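(* Let $X$ be a $0$-definable (in a structure $M$) approximate subring of a ring, let $R:=\langle X\rangle$ and $\bar R:=\langle \bar X\rangle$, and let $A\subseteq \mathfrak{C}$ be a small set of parameters. Then $$(\bar R,+)^{00}_A+\bar R\cdot(\bar R,+)^{00}_A=\bar R^{000}_A.$$ Moreover, if $R\subseteq \mathrm{dcl}(A)$, then $\bar R^{00}_A$ exists and $$\bar R^{00}_A=\bar R^{000}_A=(\bar R,+)^{00}_A+\bar X\cdot(\bar R,+)^{00}_A.$$
   Context: Rings need not be commutative or unital. For subsets $B,C$ of a ring, $B+C=\{b+c\}$ and $B\cdot C=BC=\{bc\}$ (the set of products, not of sums of products). A subset $X$ of a ring is additively symmetric if $0\in X$ and $-X=X$. $\langle X\rangle$ is the subring generated by $X$. An approximate subring is an additively symmetric subset $X$ of a ring such that $XX\cup(X+X)\subseteq F+X$ for some finite $F\subseteq\langle X\rangle$. Put $X_0:=X$ and $X_{n+1}:=X_nX_n+(X_n+X_n)$; then $\langle X\rangle=\bigcup_n X_n$. $X$ is $0$-definable in a first-order structure $M$ (in a language $\mathcal L$) if all $X_n$, and the restrictions of $+$ and $\cdot$ to each $X_n\times X_n$, are definable in $M$ without parameters. $\mathfrak C\succ M$ is a monster model: $\kappa$-saturated and strongly $\kappa$-homogeneous for a strong limit cardinal $\kappa>|\mathcal L|+|M|$, where $|\mathcal L|$ is the cardinality of the set of formulas. "Small" and "bounded" mean of cardinality $<\kappa$. $\bar X$, $\bar X_n$ are the interpretations of $X$, $X_n$ in $\mathfrak C$, and $\bar R:=\langle\bar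 X\rangle=\bigcup_n\bar X_n$ is the ring generated by $\bar X$ (with operations interpreted in $\mathfrak C$). A set is $A$-type-definable if it is the set of realizations in $\mathfrak C$ of a set of formulas over $A$; it is $A$-invariant if it is invariant under $\mathrm{Aut}(\mathfrak C/A)$. $\mathrm{dcl}(A)$ is the set of elements fixed by $\mathrm{Aut}(\mathfrak C/A)$. $(\bar R,+)^{00}_A$ is the smallest $A$-type-definable subgroup of $(\bar R,+)$ of bounded index (it is known to exist). $\bar R^{00}_A$ is the smallest $A$-type-definable two-sided ideal of $\bar R$ of bounded index (if it exists). $\bar R^{000}_A$ is the smallest $A$-invariant two-sided ideal of $\bar R$ of bounded index (it always exists). *)

theory Defs
  imports "HOL-Algebra.AbelCoset"
begin

unbundle cardinal_syntax

section \<open>First-order logic\<close>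

text \<open>A language assigns arities to its symbols; elements of the types \<open>'f\<close> and \<open>'r\<close> that are
  mapped to \<^term>\<open>None\<close> are not symbols of the language.\<close>

record ('f, 'r) language =
  fun_ar :: "'f \<rightharpoonup> nat"
  rel_ar :: "'r \<rightharpoonup> nat"

datatype 'f fo_term = Var nat | Fn 'f "'f fo_term list"

datatype ('f, 'r) fo_form =
    Eq "'f fo_term" "'f fo_term"
  | Rel 'r "'f fo_term list"
  | Neg "('f, 'r) fo_form"
  | Conj "('f, 'r) fo_form" "('f, 'r) fo_form"
  | Exi nat "('f, 'r) fo_form"

fun wf_term :: "('f, 'r) language \<Rightarrow> 'f fo_term \<Rightarrow> bool" where
  "wf_term L (Var i) \<longleftrightarrow> True"
| "wf_term L (Fn f ts) \<longleftrightarrow> fun_ar L f = Some (length ts) \<and> (\<forall>t\<in>set ts. wf_term L t)"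

fun wf_form :: "('f, 'r) language \<Rightarrow> ('f, 'r) fo_form \<Rightarrow> bool" where
  "wf_form L (Eq t u) \<longleftrightarrow> wf_term L t \<and> wf_term L u"
| "wf_form L (Rel r ts) \<longleftrightarrow> rel_ar L r = Some (length ts) \<and> (\<forall>t\<in>set ts. wf_term L t)"
| "wf_form L (Neg \<phi>) \<longleftrightarrow> wf_form L \<phi>"
| "wf_form L (Conj \<phi> \<psi>) \<longleftrightarrow> wf_form L \<phi> \<and> wf_form L \<psi>"
| "wf_form L (Exi x \<phi>) \<longleftrightarrow> wf_form L \<phi>"

fun fv_term :: "'f fo_term \<Rightarrow> nat set" where
  "fv_term (Var i) = {i}"
| "fv_term (Fn f ts) = (\<Union>t\<in>set ts. fv_term t)"

fun fv :: "('f, 'r) fo_form \<Rightarrow> nat set" where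
  "fv (Eq t u) = fv_term t \<union> fv_term u"
| "fv (Rel r ts) = (\<Union>t\<in>set ts. fv_term t)"
| "fv (Neg \<phi>) = fv \<phi>"
| "fv (Conj \<phi> \<psi>) = fv \<phi> \<union> fv \<psi>"
| "fv (Exi x \<phi>) = fv \<phi> - {x}"

record ('f, 'r, 'a) fo_struct =
  univ :: "'a set"
  fun_of :: "'f \<Rightarrow> 'a list \<Rightarrow> 'a"
  rel_of :: "'r \<Rightarrow> 'a list \<Rightarrow> bool"

definition tuples :: "'a set \<Rightarrow> nat \<Rightarrow> 'a list set" where
  "tuples U n = {xs. length xs = n \<and> set xs \<subseteq> U}"

definition is_structure :: "('f, 'r) language \<Rightarrow> ('f, 'r, 'a) fo_struct \<Rightarrow> bool" where
  "is_structure L M \<longleftrightarrow> univ M \<noteq> {} \<and>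
     (\<forall>f n. fun_ar L f = Some n \<longrightarrow> (\<forall>xs\<in>tuples (univ M) n. fun_of M f xs \<in> univ M))"

fun eval_term :: "('f, 'r, 'a) fo_struct \<Rightarrow> (nat \<Rightarrow> 'a) \<Rightarrow> 'f fo_term \<Rightarrow> 'a" where
  "eval_term M s (Var i) = s i"
| "eval_term M s (Fn f ts) = fun_of M f (map (eval_term M s) ts)"

fun sat :: "('f, 'r, 'a) fo_struct \<Rightarrow> (nat \<Rightarrow> 'a) \<Rightarrow> ('f, 'r) fo_form \<Rightarrow> bool" where
  "sat M s (Eq t u) \<longleftrightarrow> eval_term M s t = eval_term M s u"
| "sat M s (Rel r ts) \<longleftrightarrow> rel_of M r (map (eval_term M s) ts)"
| "sat M s (Neg \<phi>) \<longleftrightarrow> \<not> sat M s \<phi>"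
| "sat M s (Conj \<phi> \<psi>) \<longleftrightarrow> sat M s \<phi> \<and> sat M s \<psi>"
| "sat M s (Exi x \<phi>) \<longleftrightarrow> (\<exists>a\<in>univ M. sat M (s(x := a)) \<phi>)"

definition formulas :: "('f, 'r) language \<Rightarrow> nat \<Rightarrow> ('f, 'r) fo_form set" where
  "formulas L n = {\<phi>. wf_form L \<phi> \<and> fv \<phi> \<subseteq> {..<n}}"

text \<open>Only used for \<open>\<phi> \<in> formulas L (length xs)\<close>, so that the values \<open>xs ! i\<close> with
  \<open>i \<ge> length xs\<close> are irrelevant.\<close>

definition holds :: "('f, 'r, 'a) fo_struct \<Rightarrow> ('f, 'r) fo_form \<Rightarrow> 'a list \<Rightarrow> bool" where
  "holds M \<phi> xs \<longleftrightarrow> sat M (\<lambda>i. xs ! i) \<phi>"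

definition elem_substructure ::
  "('f, 'r) language \<Rightarrow> ('f, 'r, 'a) fo_struct \<Rightarrow> ('f, 'r, 'a) fo_struct \<Rightarrow> bool" where
  "elem_substructure L M C \<longleftrightarrow> is_structure L M \<and> is_structure L C \<and> univ M \<subseteq> univ C \<and>
     (\<forall>n. \<forall>\<phi>\<in>formulas L n. \<forall>xs\<in>tuples (univ M) n. holds M \<phi> xs \<longleftrightarrow> holds C \<phi> xs)"

text \<open>A formula over \<open>A\<close> in the variables \<open>0, \<dots>, n - 1\<close> is a formula without parameters together
  with a tuple from \<open>A\<close> to be substituted for the variables \<open>n, n + 1, \<dots>\<close>.\<close>

definition formulas_over ::
  "('f, 'r) language \<Rightarrow> 'a set \<Rightarrow> nat \<Rightarrow> (('f, 'r) fo_form \<times> 'a list) set" where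
  "formulas_over L A n = {(\<phi>, ps). set ps \<subseteq> A \<and> \<phi> \<in> formulas L (n + length ps)}"

definition realizations ::
  "('f, 'r, 'a) fo_struct \<Rightarrow> nat \<Rightarrow> (('f, 'r) fo_form \<times> 'a list) set \<Rightarrow> 'a list set" where
  "realizations M n \<Phi> = {xs \<in> tuples (univ M) n. \<forall>(\<phi>, ps)\<in>\<Phi>. holds M \<phi> (xs @ ps)}"

definition type_definable ::
  "('f, 'r) language \<Rightarrow> ('f, 'r, 'a) fo_struct \<Rightarrow> 'a set \<Rightarrow> nat \<Rightarrow> 'a list set \<Rightarrow> bool" where
  "type_definable L C A n D \<longleftrightarrow> (\<exists>\<Phi> \<subseteq> formulas_over L A n. D = realizations C n \<Phi>)"

definition defined_set ::
  "('f, 'r, 'a) fo_struct \<Rightarrow> nat \<Rightarrow> ('f, 'r) fo_form \<Rightarrow> 'a list set" where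
  "defined_set M n \<phi> = {xs \<in> tuples (univ M) n. holds M \<phi> xs}"

definition zero_definable ::
  "('f, 'r) language \<Rightarrow> ('f, 'r, 'a) fo_struct \<Rightarrow> nat \<Rightarrow> 'a list set \<Rightarrow> bool" where
  "zero_definable L M n D \<longleftrightarrow> (\<exists>\<phi>\<in>formulas L n. D = defined_set M n \<phi>)"

text \<open>The interpretation in \<open>C \<succ> M\<close> of a set that is definable in \<open>M\<close> without parameters. All
  formulas defining \<open>D\<close> in \<open>M\<close> define the same set in \<open>C\<close>, which is the union taken here.\<close>

definition interp ::
  "('f, 'r) language \<Rightarrow> ('f, 'r, 'a) fo_struct \<Rightarrow> ('f, 'r, 'a) fo_struct \<Rightarrow> nat \<Rightarrow> 'a list set \<Rightarrow>
   'a list set" where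
  "interp L M C n D = (\<Union>\<phi>\<in>{\<phi> \<in> formulas L n. defined_set M n \<phi> = D}. defined_set C n \<phi>)"


section \<open>Monster models\<close>

definition automorphisms ::
  "('f, 'r) language \<Rightarrow> ('f, 'r, 'a) fo_struct \<Rightarrow> 'a set \<Rightarrow> ('a \<Rightarrow> 'a) set" where
  "automorphisms L C A = {\<sigma>. bij_betw \<sigma> (univ C) (univ C) \<and>
     (\<forall>f n. fun_ar L f = Some n \<longrightarrow>
        (\<forall>xs\<in>tuples (univ C) n. \<sigma> (fun_of C f xs) = fun_of C f (map \<sigma> xs))) \<and>
     (\<forall>r n. rel_ar L r = Some n \<longrightarrow>
        (\<forall>xs\<in>tuples (univ C) n. rel_of C r xs \<longleftrightarrow> rel_of C r (map \<sigma> xs))) \<and>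
     (\<forall>a\<in>A. \<sigma> a = a)}"

definition invariant ::
  "('f, 'r) language \<Rightarrow> ('f, 'r, 'a) fo_struct \<Rightarrow> 'a set \<Rightarrow> 'a list set \<Rightarrow> bool" where
  "invariant L C A D \<longleftrightarrow> (\<forall>\<sigma>\<in>automorphisms L C A. map \<sigma> ` D = D)"

definition dcl :: "('f, 'r) language \<Rightarrow> ('f, 'r, 'a) fo_struct \<Rightarrow> 'a set \<Rightarrow> 'a set" where
  "dcl L C A = {a \<in> univ C. \<forall>\<sigma>\<in>automorphisms L C A. \<sigma> a = a}"

text \<open>Every cardinal below \<open>\<kappa>\<close> is the cardinality of some subset of the field of \<open>\<kappa>\<close>.\<close>

definition strong_limit :: "'k rel \<Rightarrow> bool" where
  "strong_limit \<kappa> \<longleftrightarrow> Card_order \<kappa> \<and> (\<forall>B :: 'k set. |B| <o \<kappa> \<longrightarrow> |Pow B| <o \<kappa>)"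

definition saturated ::
  "('f, 'r) language \<Rightarrow> 'k rel \<Rightarrow> ('f, 'r, 'a) fo_struct \<Rightarrow> bool" where
  "saturated L \<kappa> C \<longleftrightarrow> (\<forall>A \<subseteq> univ C. |A| <o \<kappa> \<longrightarrow>
     (\<forall>n. \<forall>\<Phi> \<subseteq> formulas_over L A n.
        (\<forall>\<Psi> \<subseteq> \<Phi>. finite \<Psi> \<longrightarrow> realizations C n \<Psi> \<noteq> {}) \<longrightarrow> realizations C n \<Phi> \<noteq> {}))"

definition partial_elementary ::
  "('f, 'r) language \<Rightarrow> ('f, 'r, 'a) fo_struct \<Rightarrow> 'a set \<Rightarrow> ('a \<Rightarrow> 'a) \<Rightarrow> bool" where
  "partial_elementary L C B g \<longleftrightarrow> B \<subseteq> univ C \<and> g ` B \<subseteq> univ C \<and>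
     (\<forall>n. \<forall>\<phi>\<in>formulas L n. \<forall>xs\<in>tuples B n. holds C \<phi> xs \<longleftrightarrow> holds C \<phi> (map g xs))"

definition strongly_homogeneous ::
  "('f, 'r) language \<Rightarrow> 'k rel \<Rightarrow> ('f, 'r, 'a) fo_struct \<Rightarrow> bool" where
  "strongly_homogeneous L \<kappa> C \<longleftrightarrow> (\<forall>B g. |B| <o \<kappa> \<longrightarrow> partial_elementary L C B g \<longrightarrow>
     (\<exists>\<sigma>\<in>automorphisms L C {}. \<forall>b\<in>B. \<sigma> b = g b))"

definition monster_model ::
  "('f, 'r) language \<Rightarrow> 'k rel \<Rightarrow> ('f, 'r, 'a) fo_struct \<Rightarrow> ('f, 'r, 'a) fo_struct \<Rightarrow> bool" where
  "monster_model L \<kappa> M C \<longleftrightarrow> elem_substructure L M C \<and> strong_limit \<kappa> \<and>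
     |{\<phi>. wf_form L \<phi>}| +c |univ M| <o \<kappa> \<and> saturated L \<kappa> C \<and> strongly_homogeneous L \<kappa> C"


section \<open>Approximate subrings\<close>

text \<open>Rings are not assumed to be commutative or unital: the field \<^const>\<open>one\<close> of the library's
  ring records is ignored. For this reason the library's \<open>ring\<close>, \<open>subring\<close> and \<open>ideal\<close> are not
  applicable, whereas its additive subgroups, cosets and the product sets
  \<open>B <+>\<^bsub>S\<^esub> D = {b + d}\<close> and \<open>B <#>\<^bsub>S\<^esub> D = {b d}\<close> are.\<close>

locale nonunital_ring = abelian_group S for S (structure) +
  assumes mult_closed: "\<lbrakk>x \<in> carrier S; y \<in> carrier S\<rbrakk> \<Longrightarrow> x \<otimes> y \<in> carrier S"
    and mult_assoc: "\<lbrakk>x \<in> carrier S; y \<in> carrier S; z \<in> carrier S\<rbrakk> \<Longrightarrow>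
      (x \<otimes> y) \<otimes> z = x \<otimes> (y \<otimes> z)"
    and distr_left: "\<lbrakk>x \<in> carrier S; y \<in> carrier S; z \<in> carrier S\<rbrakk> \<Longrightarrow>
      (x \<oplus> y) \<otimes> z = x \<otimes> z \<oplus> y \<otimes> z"
    and distr_right: "\<lbrakk>x \<in> carrier S; y \<in> carrier S; z \<in> carrier S\<rbrakk> \<Longrightarrow>
      z \<otimes> (x \<oplus> y) = z \<otimes> x \<oplus> z \<otimes> y"

definition nonunital_subring :: "'b ring \<Rightarrow> 'b set \<Rightarrow> bool" where
  "nonunital_subring S T \<longleftrightarrow> subgroup T (add_monoid S) \<and> T <#>\<^bsub>S\<^esub> T \<subseteq> T"

definition two_sided_ideal :: "'b ring \<Rightarrow> 'b set \<Rightarrow> bool" where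
  "two_sided_ideal S I \<longleftrightarrow> subgroup I (add_monoid S) \<and>
     carrier S <#>\<^bsub>S\<^esub> I \<subseteq> I \<and> I <#>\<^bsub>S\<^esub> carrier S \<subseteq> I"

definition generated_subring :: "'b ring \<Rightarrow> 'b set \<Rightarrow> 'b set" where
  "generated_subring S X = \<Inter>{T. nonunital_subring S T \<and> X \<subseteq> T}"

definition approximate_subring :: "'b ring \<Rightarrow> 'b set \<Rightarrow> bool" where
  "approximate_subring S X \<longleftrightarrow> X \<subseteq> carrier S \<and> \<zero>\<^bsub>S\<^esub> \<in> X \<and> a_set_inv\<^bsub>S\<^esub> X = X \<and>
     (\<exists>F. finite F \<and> F \<subseteq> generated_subring S X \<and>
        (X <#>\<^bsub>S\<^esub> X) \<union> (X <+>\<^bsub>S\<^esub> X) \<subseteq> F <+>\<^bsub>S\<^esub> X)"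

fun layer :: "'b ring \<Rightarrow> 'b set \<Rightarrow> nat \<Rightarrow> 'b set" where
  "layer S X 0 = X"
| "layer S X (Suc n) =
     (layer S X n <#>\<^bsub>S\<^esub> layer S X n) <+>\<^bsub>S\<^esub> (layer S X n <+>\<^bsub>S\<^esub> layer S X n)"

definition op_graph :: "('a list \<Rightarrow> 'a list \<Rightarrow> 'a list) \<Rightarrow> 'a list set \<Rightarrow> 'a list set" where
  "op_graph h D = {x @ y @ h x y | x y. x \<in> D \<and> y \<in> D}"

text \<open>\<open>X\<close> is a set of \<open>k\<close>-tuples from \<open>M\<close>; the graphs of the restricted operations are sets of
  \<open>3 k\<close>-tuples.\<close>

definition zero_definable_in ::
  "('f, 'r) language \<Rightarrow> ('f, 'r, 'a) fo_struct \<Rightarrow> nat \<Rightarrow> 'a list ring \<Rightarrow> 'a list set \<Rightarrow> bool" where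
  "zero_definable_in L M k S X \<longleftrightarrow> (\<forall>n. zero_definable L M k (layer S X n) \<and>
     zero_definable L M (3 * k) (op_graph (add S) (layer S X n)) \<and>
     zero_definable L M (3 * k) (op_graph (mult S) (layer S X n)))"

definition interp_op ::
  "('f, 'r) language \<Rightarrow> ('f, 'r, 'a) fo_struct \<Rightarrow> ('f, 'r, 'a) fo_struct \<Rightarrow> nat \<Rightarrow>
   'a list ring \<Rightarrow> 'a list set \<Rightarrow> ('a list \<Rightarrow> 'a list \<Rightarrow> 'a list) \<Rightarrow> 'a list \<Rightarrow> 'a list \<Rightarrow> 'a list"
  where
  "interp_op L M C k S X h x y =
     (THE z. \<exists>n. x @ y @ z \<in> interp L M C (3 * k) (op_graph h (layer S X n)))"

text \<open>The ring generated by the interpretation of \<open>X\<close> in \<open>C\<close>; the field \<^const>\<open>one\<close> is junk.\<close>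

definition interp_ring ::
  "('f, 'r) language \<Rightarrow> ('f, 'r, 'a) fo_struct \<Rightarrow> ('f, 'r, 'a) fo_struct \<Rightarrow> nat \<Rightarrow>
   'a list ring \<Rightarrow> 'a list set \<Rightarrow> 'a list ring" where
  "interp_ring L M C k S X =
     \<lparr>carrier = (\<Union>n. interp L M C k (layer S X n)),
      mult = interp_op L M C k S X (mult S),
      one = undefined,
      zero = \<zero>\<^bsub>S\<^esub>,
      add = interp_op L M C k S X (add S)\<rparr>"


section \<open>Connected components\<close>

definition bounded_index :: "'k rel \<Rightarrow> 'b ring \<Rightarrow> 'b set \<Rightarrow> bool" where
  "bounded_index \<kappa> R H \<longleftrightarrow> |a_rcosets\<^bsub>R\<^esub> H| <o \<kappa>"

text \<open>In the following, \<open>R\<close> is a ring of \<open>k\<close>-tuples from \<open>C\<close>, and \<^const>\<open>Least\<close> is taken with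
  respect to inclusion. The existence of the least element is not part of the definitions.\<close>

definition add_comp00 ::
  "('f, 'r) language \<Rightarrow> 'k rel \<Rightarrow> ('f, 'r, 'a) fo_struct \<Rightarrow> 'a set \<Rightarrow> nat \<Rightarrow> 'a list ring \<Rightarrow>
   'a list set" where
  "add_comp00 L \<kappa> C A k R =
     (LEAST H. subgroup H (add_monoid R) \<and> type_definable L C A k H \<and> bounded_index \<kappa> R H)"

definition bounded_td_ideal ::
  "('f, 'r) language \<Rightarrow> 'k rel \<Rightarrow> ('f, 'r, 'a) fo_struct \<Rightarrow> 'a set \<Rightarrow> nat \<Rightarrow> 'a list ring \<Rightarrow>
   'a list set \<Rightarrow> bool" where
  "bounded_td_ideal L \<kappa> C A k R I \<longleftrightarrow>
     two_sided_ideal R I \<and> type_definable L C A k I \<and> bounded_index \<kappa> R I"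

definition ring_comp00_exists ::
  "('f, 'r) language \<Rightarrow> 'k rel \<Rightarrow> ('f, 'r, 'a) fo_struct \<Rightarrow> 'a set \<Rightarrow> nat \<Rightarrow> 'a list ring \<Rightarrow> bool"
  where
  "ring_comp00_exists L \<kappa> C A k R \<longleftrightarrow>
     (\<exists>I. bounded_td_ideal L \<kappa> C A k R I \<and> (\<forall>J. bounded_td_ideal L \<kappa> C A k R J \<longrightarrow> I \<subseteq> J))"

definition ring_comp00 ::
  "('f, 'r) language \<Rightarrow> 'k rel \<Rightarrow> ('f, 'r, 'a) fo_struct \<Rightarrow> 'a set \<Rightarrow> nat \<Rightarrow> 'a list ring \<Rightarrow>
   'a list set" where
  "ring_comp00 L \<kappa> C A k R = (LEAST I. bounded_td_ideal L \<kappa> C A k R I)"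

definition ring_comp000 ::
  "('f, 'r) language \<Rightarrow> 'k rel \<Rightarrow> ('f, 'r, 'a) fo_struct \<Rightarrow> 'a set \<Rightarrow> 'a list ring \<Rightarrow>
   'a list set" where
  "ring_comp000 L \<kappa> C A R =
     (LEAST I. two_sided_ideal R I \<and> invariant L C A I \<and> bounded_index \<kappa> R I)"

end

theory Submission
 imports Defs Complex_Main "HOL-Library.Nat_Bijection"
begin

text \<open>
Let \<open>Rbar\<close> be the interpreted ring, \<open>Xbar\<close> the interpretation of \<open>X\<close>, and \<open>H\<close> the additive component $(\bar R,+)^{00}_A$. Everything rests on one fact: sums and
right multiples of elements of \<open>Rbar H\<close> stay in \<open>H + Rbar H\<close>. Given it, \<open>H + Rbar H\<close> is an
\<open>A\<close>-invariant ideal of bounded index, and it lies in every other one, because an \<open>A\<close>-invariant subgroup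
of bounded index contains \<open>H\<close>.

The engine is an ergodicity statement (\<open>ergodic\<close>). In an abelian group, the upper covering density
(\<open>upd\<close>) of a set compares averaged translates of the set with averaged translates of the base set
\<open>X\<close>; amenability enters only through polynomial growth (\<open>cov_base_length\<close>), so that no invariant mean
has to be constructed. Suppose a group of automorphisms \<open>\<Gamma>\<close> preserves \<open>H\<close>, and \<open>H\<close> is the least
\<open>\<Gamma>\<close>-invariant type-definable subgroup of bounded index. Then a \<open>\<Gamma>\<close>-invariant subset \<open>Y\<close> of \<open>H\<close> of
positive density meets every coset neighbourhood in \<open>H\<close>. The automorphisms \<open>\<sigma>\<close> with
\<open>\<sigma> x - x \<in> H\<close> for all \<open>x\<close> have the same least subgroup (\<open>ccomp_least_aut0\<close>). For them the set of \<open>h\<close>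
in \<open>H\<close> such that some \<open>l h\<close> is close to \<open>c + k\<close>, \<open>k\<close> in \<open>H\<close>, is invariant whatever \<open>c\<close> is, and so it
is dense. Hence \<open>r h + c\<close> lies, up to \<open>H\<close> and a small error, in the form \<open>r' h'\<close>, and compactness
removes the error (\<open>product_sum\<close>, \<open>product_right\<close>).

Type-definable subgroups of bounded index are produced by the Bogolyubov-type theorem \<open>bogolyubov\<close>: the
fourfold sum of a definable symmetric generic set contains one that is defined by countably many
formulas. Applied to difference sets of a definable set of positive density it also gives the second
half: for an invariant \<open>I\<close> of bounded index, a type over representatives of the cosets of \<open>I\<close> has all
its differences in \<open>I\<close>, so \<open>I\<close> contains a type-definable subgroup of bounded index
(\<open>bounded_inv_contains_cc\<close>), and ergodicity upgrades this to \<open>H\<close> (\<open>ccomp_least_invariant\<close>).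

If every element of \<open>R\<close> is fixed by the automorphisms over \<open>A\<close>, write \<open>r = f + y\<close> with \<open>f\<close> in a finite
subset of \<open>R\<close> and \<open>y\<close> in \<open>Xbar\<close>. As \<open>f\<close> is fixed, \<open>f H\<close> is contained in \<open>H\<close>; so
\<open>H + Rbar H = H + Xbar H\<close>, which is type-definable.

These arguments take place in the locale \<open>definable_ring\<close>, which isolates what the monster model
provides: an increasing family of layers, locally definable relations, compactness, and orbits of small
groups of automorphisms. The last part shows that the interpreted ring is an instance.
\<close>

section \<open>Covering densities in abelian groups\<close>

locale density = abelian_group G for G (structure) +
 fixes U X :: "'a set"
 assumes U_sub: "U \<subseteq> carrier G"
  and U_zero: "\<zero> \<in> U"
  and U_add: "\<lbrakk>x \<in> U; y \<in> U\<rbrakk> \<Longrightarrow> x \<oplus> y \<in> U"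
  and U_neg: "x \<in> U ==> \<ominus> x \<in> U"
  and X_sub: "X \<subseteq> U"
  and X_zero: "\<zero> \<in> X"
begin

lemma U_carr [simp]: "x \<in> U ==> x \<in> carrier G"
 using U_sub by blast

lemma U_minus: "\<lbrakk>x \<in> U; y \<in> U\<rbrakk> \<Longrightarrow> x \<ominus> y \<in> U"
 by (simp add: minus_eq U_add U_neg)

definition ind :: "'a set => 'a => nat" where
 "ind Z x = of_bool (x \<in> Z)"

text \<open>The sum of the translates of \<open>f\<close> along a list; the densities below
compare such sums for \<open>f\<close> with those for the indicator of the base set
\<open>X\<close>.\<close>

definition cov :: "'a list => ('a => nat) => 'a => nat" where
 "cov gs f x = (\<Sum>g\<leftarrow>gs. f (x \<ominus> g))"

definition conv :: "'a list => 'a list => 'a list" where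
 "conv gs hs = concat (map (%g. map (%h. g \<oplus> h) hs) gs)"

lemma length_conv [simp]: "length (conv gs hs) = length gs * length hs"
 by (induction gs) (auto simp: conv_def)

lemma set_conv: "set (conv gs hs) = (%(g, h). g \<oplus> h) ` (set gs \<times> set hs)"
 by (auto simp: conv_def)

lemma set_conv_U: "set gs \<subseteq> U ==> set hs \<subseteq> U ==> set (conv gs hs) \<subseteq> U"
 using U_add by (auto simp: set_conv)

lemma conv_eq_Nil [simp]: "conv gs hs = [] \<longleftrightarrow> gs = [] \<or> hs = []"
 using length_conv[of gs hs] by (metis length_0_conv mult_is_0)

lemma minus_minus_eq: "\<lbrakk>x \<in> carrier G; g \<in> carrier G; h \<in> carrier G\<rbrakk> \<Longrightarrow> x \<ominus> g \<ominus> h = x \<ominus> (g \<oplus> h)"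
 by (simp add: minus_eq minus_add a_assoc)

lemma cov_Nil [simp]: "cov [] f x = 0"
 and cov_Cons [simp]: "cov (g # gs) f x = f (x \<ominus> g) + cov gs f x"
 and cov_append: "cov (gs @ hs) f x = cov gs f x + cov hs f x"
 by (auto simp: cov_def)

lemma cov_add: "cov gs (%x. f x + h x) x = cov gs f x + cov gs h x"
 by (induction gs) auto

lemma cov_mono:
 assumes "set gs \<subseteq> U" "x \<in> U" "\<And>y. y \<in> U ==> f y \<le> h y"
 shows "cov gs f x \<le> cov gs h x"
 using assms by (induction gs) (auto simp: U_minus add_mono)

lemma cov_conv:
 assumes "set gs \<subseteq> U" "set hs \<subseteq> U" "x \<in> U"
 shows "cov (conv gs hs) f x = cov gs (cov hs f) x"
 using assms(1)
proof (induction gs)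
 case Nil
 then show ?case by (simp add: conv_def)
next
 case (Cons g gs)
 have "cov (map (%h. g \<oplus> h) hs) f x = cov hs f (x \<ominus> g)"
  using assms(2,3) Cons.prems by (induction hs) (auto simp: minus_minus_eq)
 then show ?case
  using Cons by (simp add: conv_def cov_append)
qed

lemma cov_commute:
 assumes "set gs \<subseteq> U" "set hs \<subseteq> U" "x \<in> U"
 shows "cov gs (cov hs f) x = cov hs (cov gs f) x"
 using assms(1)
proof (induction gs)
 case Nil
 have "cov hs (%x. 0) x = 0" by (induction hs) auto
 moreover have "cov [] f = (%x. 0)" by auto
 ultimately show ?case by simp
next
 case (Cons g gs)
 have *: "cov (g # gs) f = (%x. f (x \<ominus> g) + cov gs f x)" by auto
 have "cov hs (%x. f (x \<ominus> g)) x = cov hs f (x \<ominus> g)"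
  using assms(2,3) Cons.prems
 proof (induction hs)
  case (Cons h hs)
  then have "x \<ominus> h \<ominus> g = x \<ominus> g \<ominus> h"
   by (simp add: minus_minus_eq a_comm)
  then show ?case using Cons by simp
 qed simp
 then show ?case
  using Cons by (simp add: * cov_add)
qed

primrec cpow :: "'a list => nat => 'a list" where
 "cpow hs 0 = [\<zero>]"
| "cpow hs (Suc n) = conv hs (cpow hs n)"

lemma length_cpow: "length (cpow hs n) = length hs ^ n"
 by (induction n) auto

lemma set_cpow_U: "set hs \<subseteq> U ==> set (cpow hs n) \<subseteq> U"
 by (induction n) (auto simp: U_zero set_conv_U simp del: set_conv dest: set_conv_U)

primrec mulN :: "nat => 'a => 'a" where
 "mulN 0 h = \<zero>"
| "mulN (Suc j) h = h \<oplus> mulN j h"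

lemma mulN_U: "h \<in> U ==> mulN j h \<in> U"
 by (induction j) (auto simp: U_zero U_add)

text \<open>The sums in which each entry is used at most \<open>n\<close> times: at most
$(n+1)^{|hs|}$ elements, which is the polynomial growth of abelian groups.\<close>

primrec msums :: "'a list => nat => 'a set" where
 "msums [] n = {\<zero>}"
| "msums (h # hs) n = (%(j, y). mulN j h \<oplus> y) ` ({..n} \<times> msums hs n)"

lemma msums_finite: "finite (msums hs n)"
 by (induction hs) auto

lemma msums_card: "card (msums hs n) \<le> (n + 1) ^ length hs"
proof (induction hs)
 case (Cons h hs)
 have "card (msums (h # hs) n) \<le> card ({..n} \<times> msums hs n)"
  unfolding msums.simps by (intro card_image_le finite_cartesian_product msums_finite) simp
 also have "\<dots> = (n + 1) * card (msums hs n)" by (simp add: card_cartesian_product)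
 also have "\<dots> \<le> (n + 1) * (n + 1) ^ length hs"
  using Cons by (rule mult_left_mono) simp
 finally show ?case by simp
qed simp

lemma msums_U: "set hs \<subseteq> U ==> msums hs n \<subseteq> U"
 by (induction hs) (auto simp: U_zero intro!: U_add mulN_U)

lemma msums_mono: "m \<le> n ==> msums hs m \<subseteq> msums hs n"
proof (induction hs)
 case (Cons h hs)
 then have "{..m} \<times> msums hs m \<subseteq> {..n} \<times> msums hs n" by auto
 then show ?case by (simp add: image_mono)
qed simp

lemma msums_zero: "set hs \<subseteq> U ==> \<zero> \<in> msums hs n"
proof (induction hs)
 case (Cons h hs)
 then have "(0, \<zero>) \<in> {..n} \<times> msums hs n" by auto
 then have "mulN 0 h \<oplus> \<zero> \<in> msums (h # hs) n" by (auto intro!: rev_image_eqI)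
 then show ?case by simp
qed simp

lemma msums_step:
 "\<lbrakk>set hs \<subseteq> U; h \<in> set hs; y \<in> msums hs n\<rbrakk> \<Longrightarrow> h \<oplus> y \<in> msums hs (Suc n)"
proof (induction hs arbitrary: y)
 case (Cons a hs)
 from Cons.prems obtain j z where jz: "j \<le> n" "z \<in> msums hs n" "y = mulN j a \<oplus> z" by auto
 have c: "a \<in> carrier G" "mulN j a \<in> carrier G" "z \<in> carrier G" "h \<in> carrier G"
  using Cons.prems jz msums_U[of hs n] mulN_U[of a j] by auto
 show ?case
 proof (cases "h = a")
  case True
  have "h \<oplus> y = mulN (Suc j) a \<oplus> z" using True jz c by (simp add: a_assoc)
  moreover have "(Suc j, z) \<in> {..Suc n} \<times> msums hs (Suc n)"
   using jz msums_mono[of n "Suc n" hs] by auto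
  ultimately show ?thesis unfolding msums.simps by (metis (mono_tags, lifting) case_prod_conv image_eqI)
 next
  case False
  then have "h \<oplus> z \<in> msums hs (Suc n)" using Cons jz by auto
  moreover have "h \<oplus> y = mulN j a \<oplus> (h \<oplus> z)" using jz c by (simp add: a_lcomm)
  moreover have "j \<le> Suc n" using jz by simp
  ultimately show ?thesis unfolding msums.simps by (metis (mono_tags, lifting) SigmaI atMost_iff case_prod_conv image_eqI)
 qed
qed simp

lemma set_cpow: "set hs \<subseteq> U ==> set (cpow hs n) \<subseteq> msums hs n"
proof (induction n)
 case 0
 then show ?case using msums_zero by auto
next
 case (Suc n)
 then show ?case using msums_step by (auto simp: set_conv)
qed

lemma cov_cpow_mono:
 assumes "set gs \<subseteq> U" "set hs \<subseteq> U" "\<And>x. x \<in> U ==> cov hs f x \<le> cov gs f x" "x \<in> U"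
 shows "cov (cpow hs n) f x \<le> cov (cpow gs n) f x"
 using assms(4)
proof (induction n arbitrary: x)
 case (Suc n)
 have "cov (cpow hs (Suc n)) f x = cov hs (cov (cpow hs n) f) x"
  using assms Suc.prems by (simp add: cov_conv set_cpow_U)
 also have "\<dots> \<le> cov hs (cov (cpow gs n) f) x"
  using assms Suc by (intro cov_mono) auto
 also have "\<dots> = cov (cpow gs n) (cov hs f) x"
  using assms Suc.prems by (simp add: cov_commute set_cpow_U)
 also have "\<dots> \<le> cov (cpow gs n) (cov gs f) x"
  using assms Suc by (intro cov_mono) (auto simp: set_cpow_U)
 also have "\<dots> = cov (cpow gs (Suc n)) f x"
  using assms Suc.prems by (simp add: cov_conv set_cpow_U cov_commute)
 finally show ?case .
qed simp

lemma cov_ind_le: "cov gs (ind Z) x \<le> length gs"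
 by (induction gs) (auto simp: ind_def of_bool_def)

lemma count_le_cov: "set gs \<subseteq> U ==> y \<in> U ==> count_list gs y \<le> cov gs (ind X) y"
proof (induction gs)
 case (Cons g gs)
 then have "g = y ==> ind X (y \<ominus> g) = 1"
  by (simp add: ind_def X_zero minus_eq r_neg)
 then show ?case using Cons by auto
qed simp

lemma poly_less_exp:
 fixes r :: real assumes "r > 1"
 shows "EX n::nat. real (n + 1) ^ b < r ^ n"
proof (cases "b = 0")
 case True
 then show ?thesis using assms by (intro exI[of _ 1]) simp
next
 case False
 define s where "s = root b r"
 have s: "s > 1" "s ^ b = r" using assms False by (auto simp: s_def)
 have "(%n. of_nat n / s ^ n) \<longlonglongrightarrow> 0"
  using s by (intro lim_n_over_pown) auto
 moreover have "(%n. 1 / s ^ n) \<longlonglongrightarrow> 0"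
  using LIMSEQ_inverse_realpow_zero[OF s(1)] by (simp add: divide_inverse)
 ultimately have "(%n. real n / s ^ n + 1 / s ^ n) \<longlonglongrightarrow> 0 + 0"
  by (intro tendsto_add) auto
 then have "eventually (%n. real n / s ^ n + 1 / s ^ n < 1) sequentially"
  by (auto dest: order_tendstoD(2)[of _ _ _ 1])
 then obtain n where n: "real n / s ^ n + 1 / s ^ n < 1"
  by (auto simp: eventually_sequentially)
 have "real (n + 1) < s ^ n"
  using n s by (simp add: add_divide_distrib[symmetric] divide_less_eq)
 then have "real (n + 1) ^ b < (s ^ n) ^ b"
  using False by (intro power_strict_mono) auto
 also have "\<dots> = r ^ n" by (simp add: s(2)[symmetric] power_mult[symmetric] mult.commute)
 finally show ?thesis by blast
qed

text \<open>Iterating the inequality \<open>n\<close> times bounds the \<open>|hs|^n\<close> terms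
of the left side by the number of \<open>n\<close>-fold sums, polynomial in \<open>n\<close>,
times \<open>|gs|^n\<close>; so \<open>|hs| > |gs|\<close> is impossible. This is what makes the
densities nontrivial.\<close>

lemma cov_base_length:
 assumes "set gs \<subseteq> U" "set hs \<subseteq> U" "\<And>x. x \<in> U ==> cov hs (ind X) x \<le> cov gs (ind X) x"
 shows "length hs \<le> length gs"
proof (rule ccontr)
 assume "\<not> ?thesis"
 then have less: "length gs < length hs" by simp
 let ?a = "length gs" and ?b = "length hs"
 have main: "?b ^ n \<le> (n + 1) ^ ?b * ?a ^ n" for n
 proof -
  have sub: "set (cpow hs n) \<subseteq> msums hs n" "set (cpow hs n) \<subseteq> U"
   using assms set_cpow set_cpow_U by auto
  have "?b ^ n = length (cpow hs n)" by (simp add: length_cpow)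
  also have "\<dots> = (\<Sum>y\<in>set (cpow hs n). count_list (cpow hs n) y)"
   by (simp add: sum_count_set)
  also have "\<dots> \<le> (\<Sum>y\<in>set (cpow hs n). ?a ^ n)"
  proof (rule sum_mono)
   fix y assume "y \<in> set (cpow hs n)"
   then have y: "y \<in> U" using sub by auto
   have "count_list (cpow hs n) y \<le> cov (cpow hs n) (ind X) y"
    using y sub by (intro count_le_cov) auto
   also have "\<dots> \<le> cov (cpow gs n) (ind X) y"
    using assms y by (intro cov_cpow_mono) auto
   also have "\<dots> \<le> ?a ^ n" using cov_ind_le[of "cpow gs n" X y] by (simp add: length_cpow)
   finally show "count_list (cpow hs n) y \<le> ?a ^ n" .
  qed
  also have "\<dots> = card (set (cpow hs n)) * ?a ^ n" by simp
  also have "\<dots> \<le> card (msums hs n) * ?a ^ n"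
   by (intro mult_right_mono card_mono msums_finite sub) simp
  also have "\<dots> \<le> (n + 1) ^ ?b * ?a ^ n"
   by (intro mult_right_mono msums_card) simp
  finally show ?thesis .
 qed
 show False
 proof (cases "?a = 0")
  case True
  then show ?thesis using main[of 1] less by simp
 next
  case False
  let ?r = "real ?b / real ?a"
  have "?r > 1" using less False by (simp add: less_divide_eq)
  from poly_less_exp[OF this, of ?b] obtain n where "real (n + 1) ^ ?b < ?r ^ n" by blast
  then have "real (n + 1) ^ ?b * real ?a ^ n < real ?b ^ n"
   using False by (simp add: power_divide less_divide_eq)
  moreover have "real ?b ^ n \<le> real (n + 1) ^ ?b * real ?a ^ n"
   using of_nat_mono[OF main[of n], where ?'a = real] by (simp add: add.commute)
  ultimately show False by linarith
 qed
qed

definition uset :: "('a => nat) => real set" where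
 "uset f = {real (length hs) / real (length gs) | gs hs. gs \<noteq> [] \<and> set gs \<subseteq> U \<and> set hs \<subseteq> U \<and>
  (ALL x:U. cov gs f x \<le> cov hs (ind X) x)}"

text \<open>By duality, this is the largest mean of \<open>f\<close> over the invariant means that
give \<open>X\<close> the value 1.\<close>

definition upd :: "('a => nat) => real" where "upd f = Inf (uset f)"

definition lset :: "('a => nat) => real set" where
 "lset f = {real (length hs) / real (length gs) | gs hs. gs \<noteq> [] \<and> set gs \<subseteq> U \<and> set hs \<subseteq> U \<and>
  (ALL x:U. cov hs (ind X) x \<le> cov gs f x)}"

definition lod :: "('a => nat) => real" where "lod f = Sup (lset f)"

definition bdd :: "('a => nat) => bool" where
 "bdd f \<longleftrightarrow> (EX ks. set ks \<subseteq> U \<and> (ALL x:U. f x \<le> cov ks (ind X) x))"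

lemma minus_zero_U: "x \<in> U ==> x \<ominus> \<zero> = x" by (simp add: minus_eq)

lemma usetI:
 assumes "gs \<noteq> []" "set gs \<subseteq> U" "set hs \<subseteq> U" "\<And>x. x \<in> U ==> cov gs f x \<le> cov hs (ind X) x"
  "r = real (length hs) / real (length gs)"
 shows "r \<in> uset f"
 unfolding uset_def using assms by blast

lemma lsetI:
 assumes "gs \<noteq> []" "set gs \<subseteq> U" "set hs \<subseteq> U" "\<And>x. x \<in> U ==> cov hs (ind X) x \<le> cov gs f x"
  "r = real (length hs) / real (length gs)"
 shows "r \<in> lset f"
 unfolding lset_def using assms by blast

lemma bdd_uset: "bdd f ==> uset f \<noteq> {}"
proof -
 assume "bdd f"
 then obtain ks where "set ks \<subseteq> U" "ALL x:U. f x \<le> cov ks (ind X) x" by (auto simp: bdd_def)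
 then have "real (length ks) / real (length [\<zero>]) \<in> uset f"
  unfolding uset_def by (intro CollectI exI[of _ "[\<zero>]"] exI[of _ ks]) (auto simp: U_zero minus_zero_U)
 then show ?thesis by blast
qed

lemma uset_bdd_below: "bdd_below (uset f)"
 by (rule bdd_belowI[of _ 0]) (auto simp: uset_def)

lemma uset_nonneg: "r \<in> uset f ==> 0 \<le> r" by (auto simp: uset_def)

lemma upd_le: "r \<in> uset f ==> upd f \<le> r"
 unfolding upd_def by (rule cInf_lower) (auto simp: uset_bdd_below)

lemma upd_less: "bdd f ==> upd f < r ==> EX s:uset f. s < r"
 unfolding upd_def using cInf_less_iff[OF bdd_uset uset_bdd_below] by blast

lemma upd_ge: "bdd f ==> (\<And>s. s \<in> uset f ==> r \<le> s) ==> r \<le> upd f"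
 unfolding upd_def by (intro cInf_greatest bdd_uset) auto

lemma upd_nonneg: "bdd f ==> 0 \<le> upd f"
 by (rule upd_ge) (auto simp: uset_nonneg)

lemma bdd_mono: "bdd h ==> (\<And>x. x \<in> U ==> f x \<le> h x) ==> bdd f"
 unfolding bdd_def by (meson le_trans)

lemma bdd_add: "bdd f ==> bdd h ==> bdd (%x. f x + h x)"
 unfolding bdd_def
proof (elim exE conjE)
 fix ks ls assume "set ks \<subseteq> U" "ALL x:U. f x \<le> cov ks (ind X) x"
  "set ls \<subseteq> U" "ALL x:U. h x \<le> cov ls (ind X) x"
 then show "EX ks. set ks \<subseteq> U \<and> (ALL x:U. f x + h x \<le> cov ks (ind X) x)"
  by (intro exI[of _ "ks @ ls"]) (auto simp: cov_append add_mono)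
qed

lemma bdd_zero: "bdd (%x. 0)" unfolding bdd_def by (intro exI[of _ "[]"]) auto

lemma bdd_mult: "bdd f ==> bdd (%x. t * f x)"
 by (induction t) (auto simp: bdd_zero bdd_add)

lemma bdd_sum: "finite I ==> (\<And>i. i \<in> I ==> bdd (f i)) ==> bdd (%x. \<Sum>i\<in>I. f i x)"
 by (induction I rule: finite_induct) (auto simp: bdd_zero bdd_add)

lemma bdd_cov: "bdd f ==> set ks \<subseteq> U ==> bdd (cov ks f)"
proof -
 assume "bdd f" and k: "set ks \<subseteq> U"
 then obtain ls where l: "set ls \<subseteq> U" "ALL x:U. f x \<le> cov ls (ind X) x" by (auto simp: bdd_def)
 show ?thesis unfolding bdd_def
 proof (intro exI[of _ "conv ks ls"] conjI ballI)
  show "set (conv ks ls) \<subseteq> U" using k l set_conv_U by blast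
  fix x assume x: "x \<in> U"
  show "cov ks f x \<le> cov (conv ks ls) (ind X) x"
   using k l x by (auto simp: cov_conv intro!: cov_mono)
 qed
qed

lemma upd_mono: "bdd h ==> (\<And>x. x \<in> U ==> f x \<le> h x) ==> upd f \<le> upd h"
proof (rule upd_ge)
 fix s assume h: "bdd h" "\<And>x. x \<in> U ==> f x \<le> h x" and "s \<in> uset h"
 then obtain gs hs where s: "s = real (length hs) / real (length gs)" "gs \<noteq> []" "set gs \<subseteq> U"
  "set hs \<subseteq> U" "ALL x:U. cov gs h x \<le> cov hs (ind X) x" by (auto simp: uset_def)
 have "s \<in> uset f"
 proof (rule usetI)
  fix x assume x: "x \<in> U"
  have "cov gs f x \<le> cov gs h x" using s h x by (intro cov_mono) auto
  then show "cov gs f x \<le> cov hs (ind X) x" using s x by fastforce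
 qed (use s in auto)
 then show "upd f \<le> s" by (rule upd_le)
qed

lemma upd_cong: "(\<And>x. x \<in> U ==> f x = h x) ==> upd f = upd h"
proof -
 assume a: "\<And>x. x \<in> U ==> f x = h x"
 have "cov gs f x = cov gs h x" if "set gs \<subseteq> U" "x \<in> U" for gs x
  using that a by (intro antisym cov_mono) auto
 then have "uset f = uset h" unfolding uset_def by (intro Collect_cong) (metis (no_types, lifting))
 then show ?thesis by (simp add: upd_def)
qed

text \<open>Families witnessing bounds for \<open>f\<close> and for \<open>h\<close> can be
convolved to have a common denominator.\<close>

lemma upd_add:
 assumes "bdd f" "bdd h"
 shows "upd (%x. f x + h x) \<le> upd f + upd h"
proof -
 have "upd (%x. f x + h x) \<le> r + s" if "r \<in> uset f" "s \<in> uset h" for r s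
 proof -
  from that obtain gs hs gs' hs' where
   r: "r = real (length hs) / real (length gs)" "gs \<noteq> []" "set gs \<subseteq> U"
    "set hs \<subseteq> U" "ALL x:U. cov gs f x \<le> cov hs (ind X) x" and
   s: "s = real (length hs') / real (length gs')" "gs' \<noteq> []" "set gs' \<subseteq> U"
    "set hs' \<subseteq> U" "ALL x:U. cov gs' h x \<le> cov hs' (ind X) x" by (auto simp: uset_def)
  let ?g = "conv gs gs'" and ?h = "conv gs' hs @ conv gs hs'"
  have "real (length ?h) / real (length ?g) \<in> uset (%x. f x + h x)"
  proof (rule usetI)
   show "?g \<noteq> []" "set ?g \<subseteq> U" "set ?h \<subseteq> U" using r s set_conv_U by auto
   fix x assume x: "x \<in> U"
   have "cov ?g (%x. f x + h x) x = cov gs (cov gs' f) x + cov gs (cov gs' h) x"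
    using r s x by (simp add: cov_conv cov_add[abs_def])
   also have "cov gs (cov gs' f) x = cov gs' (cov gs f) x" using r s x by (intro cov_commute)
   also have "cov gs' (cov gs f) x \<le> cov gs' (cov hs (ind X)) x"
    using r s x by (intro cov_mono) auto
   also have "cov gs (cov gs' h) x \<le> cov gs (cov hs' (ind X)) x"
    using r s x by (intro cov_mono) auto
   finally show "cov ?g (%x. f x + h x) x \<le> cov ?h (ind X) x"
    using r s x by (simp add: cov_conv cov_append)
  qed (rule refl)
  moreover have "real (length ?h) / real (length ?g) = r + s"
   unfolding r(1) s(1) using r(2) s(2) by (simp add: add_frac_eq mult.commute)
  ultimately show ?thesis using upd_le by metis
 qed
 then have "upd (%x. f x + h x) - s \<le> upd f" if "s \<in> uset h" for s
  using that assms by (intro upd_ge) (auto simp: algebra_simps)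
 then have "upd (%x. f x + h x) - upd f \<le> upd h"
  using assms by (intro upd_ge) (auto simp: algebra_simps)
 then show ?thesis by simp
qed

lemma upd_zero: "upd (%x. 0) = 0"
proof (rule antisym)
 have "cov [\<zero>] (%x. 0) x = 0" for x by simp
 then have "real (length []) / real (length [\<zero>]) \<in> uset (%x. 0)"
  unfolding uset_def by (intro CollectI exI[of _ "[\<zero>]"] exI[of _ "[]"]) (auto simp: U_zero)
 then show "upd (%x. 0) \<le> 0" using upd_le by fastforce
qed (simp add: upd_nonneg bdd_zero)

lemma upd_cov_ge:
 assumes "bdd f" "set ks \<subseteq> U"
 shows "real (length ks) * upd f \<le> upd (cov ks f)"
proof (cases "ks = []")
 case True
 then show ?thesis using assms by (simp add: upd_nonneg bdd_cov)
next
 case False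
 show ?thesis
 proof (rule upd_ge[OF bdd_cov[OF assms]])
  fix s assume "s \<in> uset (cov ks f)"
  then obtain gs hs where s: "s = real (length hs) / real (length gs)" "gs \<noteq> []" "set gs \<subseteq> U"
   "set hs \<subseteq> U" "ALL x:U. cov gs (cov ks f) x \<le> cov hs (ind X) x" by (auto simp: uset_def)
  have "real (length hs) / real (length (conv gs ks)) \<in> uset f"
   unfolding uset_def
   by (intro CollectI exI[of _ "conv gs ks"] exI[of _ hs])
    (use s assms False set_conv_U in \<open>auto simp: cov_conv\<close>)
  then have "upd f \<le> real (length hs) / real (length (conv gs ks))" by (rule upd_le)
  then have "real (length ks) * upd f \<le> real (length ks) * (real (length hs) / real (length (conv gs ks)))"
   by (rule mult_left_mono) simp
  also have "\<dots> = s" using s False by simp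
  finally show "real (length ks) * upd f \<le> s" .
 qed
qed

lemma upd_shift:
 assumes "bdd f" "g \<in> U"
 shows "upd (%x. f (x \<ominus> g)) = upd f"
proof -
 have le: "upd f \<le> upd (%x. f (x \<ominus> g))" if "bdd f" "g \<in> U" for f g
  using upd_cov_ge[of f "[g]"] that by (simp add: cov_def[abs_def])
 have b: "bdd (%x. f (x \<ominus> g))" using bdd_cov[of f "[g]"] assms by (simp add: cov_def[abs_def])
 have "upd (%x. f (x \<ominus> g)) \<le> upd (%x. f ((x \<ominus> \<ominus> g) \<ominus> g))"
  using le[OF b U_neg[OF assms(2)]] .
 also have "\<dots> = upd f"
  using assms(2) by (intro upd_cong) (simp add: minus_eq a_assoc l_neg U_neg r_neg)
 finally show ?thesis using le[OF assms] by simp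
qed

lemma upd_mult_ge: "bdd f ==> real t * upd f \<le> upd (%x. t * f x)"
proof -
 assume b: "bdd f"
 have c: "cov (replicate t \<zero>) f x = t * f x" if "x \<in> U" for x
  using that by (induction t) (auto simp: minus_zero_U)
 have "real t * upd f \<le> upd (cov (replicate t \<zero>) f)"
  using upd_cov_ge[of f "replicate t \<zero>"] b U_zero by (auto simp: set_replicate_conv_if)
 also have "\<dots> = upd (%x. t * f x)" using c by (rule upd_cong)
 finally show ?thesis .
qed

lemma upd_sum_le: "finite I ==> (\<And>i. i \<in> I ==> bdd (f i)) ==> upd (%x. \<Sum>i\<in>I. f i x) \<le> (\<Sum>i\<in>I. upd (f i))"
proof (induction I rule: finite_induct)
 case (insert i I)
 then have "upd (%x. f i x + (\<Sum>i\<in>I. f i x)) \<le> upd (f i) + upd (%x. \<Sum>i\<in>I. f i x)"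
  by (intro upd_add bdd_sum) auto
 then show ?case using insert by auto
qed (simp add: upd_zero)

lemma upd_cov_le: "bdd f ==> set ks \<subseteq> U ==> upd (cov ks f) \<le> real (length ks) * upd f"
proof (induction ks)
 case (Cons k ks)
 have "upd (%x. f (x \<ominus> k) + cov ks f x) \<le> upd (%x. f (x \<ominus> k)) + upd (cov ks f)"
  using Cons bdd_cov[of f "[k]"] by (intro upd_add bdd_cov) (auto simp: cov_def[abs_def])
 also have "\<dots> \<le> upd f + real (length ks) * upd f"
  using Cons by (intro add_mono) (auto simp: upd_shift)
 finally show ?case by (simp add: algebra_simps cov_def[abs_def])
next
 case Nil
 have "cov [] f = (%x. 0)" by auto
 then show ?case by (simp add: upd_zero)
qed

text \<open>Here the growth bound enters: no covering of \<open>X\<close> by itself is cheaper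
than the trivial one.\<close>

lemma upd_base: "1 \<le> upd (ind X)"
proof (rule upd_ge)
 have "ALL x:U. ind X x \<le> cov [\<zero>] (ind X) x" by (auto simp: minus_zero_U)
 then show "bdd (ind X)" unfolding bdd_def by (intro exI[of _ "[\<zero>]"]) (auto simp: U_zero)
next
 fix s assume "s \<in> uset (ind X)"
 then obtain gs hs where s: "s = real (length hs) / real (length gs)" "gs \<noteq> []" "set gs \<subseteq> U"
  "set hs \<subseteq> U" "ALL x:U. cov gs (ind X) x \<le> cov hs (ind X) x" by (auto simp: uset_def)
 then have "length gs \<le> length hs" by (intro cov_base_length) auto
 then show "1 \<le> s" using s by (simp add: le_divide_eq)
qed

text \<open>A telescoping sum: averaging over \<open>T\<close> successive translates along
\<open>h\<close> changes the second summand only at the two ends, so the loss tends to 0 with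
\<open>1/T\<close>.\<close>

lemma upd_shift_part:
 assumes "bdd u" "bdd v" "h \<in> U"
 shows "upd (%x. u x + v x) \<le> upd (%x. u x + v (x \<ominus> h))"
proof -
 let ?w = "%x. u x + v (x \<ominus> h)"
 have bv: "bdd (%x. v (x \<ominus> h))" using bdd_cov[of v "[h]"] assms by (simp add: cov_def[abs_def])
 have bw: "bdd ?w" using assms bv by (intro bdd_add)
 define ks where "ks T = map (%j. mulN j h) [0..<T]" for T :: nat
 have ksU: "set (ks T) \<subseteq> U" for T using assms mulN_U by (auto simp: ks_def)
 have ks_Suc: "ks (Suc T) = ks T @ [mulN T h]" for T by (simp add: ks_def)
 have tele: "cov (ks T) v x + v (x \<ominus> mulN T h) = v x + cov (ks T) (%x. v (x \<ominus> h)) x" if "x \<in> U" for x T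
 proof (induction T)
  case 0
  then show ?case using that by (simp add: ks_def minus_zero_U)
 next
  case (Suc T)
  have "mulN T h \<in> U" using mulN_U assms by blast
  then have "x \<ominus> mulN (Suc T) h = x \<ominus> mulN T h \<ominus> h"
   using that assms by (simp add: minus_minus_eq a_comm)
  then show ?case using Suc by (simp add: ks_Suc cov_append)
 qed
 have T: "real T * upd (%x. u x + v x) \<le> real T * upd ?w + upd v" for T
 proof -
  have "real T * upd (%x. u x + v x) \<le> upd (cov (ks T) (%x. u x + v x))"
   using upd_cov_ge[of "%x. u x + v x" "ks T"] assms ksU by (simp add: bdd_add ks_def)
  also have "\<dots> \<le> upd (%x. cov (ks T) ?w x + v x)"
  proof (rule upd_mono)
   show "bdd (%x. cov (ks T) ?w x + v x)" by (intro bdd_add[OF bdd_cov[OF bw ksU] assms(2)])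
   fix x assume "x \<in> U"
   then show "cov (ks T) (%x. u x + v x) x \<le> cov (ks T) ?w x + v x"
    using tele[of x T] by (simp add: cov_add)
  qed
  also have "\<dots> \<le> upd (cov (ks T) ?w) + upd v"
   by (intro upd_add bdd_cov[OF bw ksU] assms(2))
  also have "upd (cov (ks T) ?w) \<le> real T * upd ?w"
   using upd_cov_le[OF bw ksU, of T] by (simp add: ks_def)
  finally show ?thesis by simp
 qed
 show ?thesis
 proof (rule ccontr)
  assume "\<not> ?thesis"
  then have d: "upd (%x. u x + v x) - upd ?w > 0" by simp
  then obtain T :: nat where "upd v < real T * (upd (%x. u x + v x) - upd ?w)"
   using reals_Archimedean3 by blast
  then show False using T[of T] by (simp add: algebra_simps)
 qed
qed

lemma lset_nonempty: "lset f \<noteq> {}"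
proof -
 have "real (length []) / real (length [\<zero>]) \<in> lset f"
  unfolding lset_def by (intro CollectI exI[of _ "[\<zero>]"] exI[of _ "[]"]) (auto simp: U_zero)
 then show ?thesis by blast
qed

lemma lset_bdd: "bdd f ==> bdd_above (lset f)"
proof -
 assume "bdd f"
 then obtain ks where k: "set ks \<subseteq> U" "ALL x:U. f x \<le> cov ks (ind X) x" by (auto simp: bdd_def)
 show ?thesis
 proof (rule bdd_aboveI)
  fix s assume "s \<in> lset f"
  then obtain gs hs where s: "s = real (length hs) / real (length gs)" "gs \<noteq> []" "set gs \<subseteq> U"
   "set hs \<subseteq> U" "ALL x:U. cov hs (ind X) x \<le> cov gs f x" by (auto simp: lset_def)
  have "length hs \<le> length (conv gs ks)"
  proof (rule cov_base_length)
   show "set (conv gs ks) \<subseteq> U" using s k set_conv_U by blast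
   fix x assume x: "x \<in> U"
   have "cov hs (ind X) x \<le> cov gs f x" using s x by blast
   also have "\<dots> \<le> cov gs (cov ks (ind X)) x" using s k x by (intro cov_mono) auto
   finally show "cov hs (ind X) x \<le> cov (conv gs ks) (ind X) x" using s k x by (simp add: cov_conv)
  qed (use s in auto)
  then have "real (length hs) \<le> real (length gs) * real (length ks)"
   by (metis length_conv of_nat_le_iff of_nat_mult)
  then show "s \<le> real (length ks)" using s by (simp add: divide_le_eq mult.commute)
 qed
qed

lemma lod_ge: "bdd f ==> r \<in> lset f ==> r \<le> lod f"
 unfolding lod_def by (intro cSup_upper lset_bdd) auto

lemma lod_le: "(\<And>s. s \<in> lset f ==> s \<le> r) ==> lod f \<le> r"
 unfolding lod_def by (intro cSup_least lset_nonempty) auto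

lemma lod_mono: "bdd h ==> (\<And>x. x \<in> U ==> f x \<le> h x) ==> lod f \<le> lod h"
proof (rule lod_le)
 fix s assume h: "bdd h" "\<And>x. x \<in> U ==> f x \<le> h x" and "s \<in> lset f"
 then obtain gs hs where s: "s = real (length hs) / real (length gs)" "gs \<noteq> []" "set gs \<subseteq> U"
  "set hs \<subseteq> U" "ALL x:U. cov hs (ind X) x \<le> cov gs f x" by (auto simp: lset_def)
 have "s \<in> lset h"
 proof (rule lsetI)
  fix x assume x: "x \<in> U"
  have "cov gs f x \<le> cov gs h x" using s h x by (intro cov_mono) auto
  then show "cov hs (ind X) x \<le> cov gs h x" using s x by fastforce
 qed (use s in auto)
 then show "s \<le> lod h" using h lod_ge by blast
qed

lemma lod_add:
 assumes "bdd f" "bdd h"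
 shows "lod f + lod h \<le> lod (%x. f x + h x)"
proof -
 have "r + s \<le> lod (%x. f x + h x)" if "r \<in> lset f" "s \<in> lset h" for r s
 proof -
  from that obtain gs hs gs' hs' where
   r: "r = real (length hs) / real (length gs)" "gs \<noteq> []" "set gs \<subseteq> U"
    "set hs \<subseteq> U" "ALL x:U. cov hs (ind X) x \<le> cov gs f x" and
   s: "s = real (length hs') / real (length gs')" "gs' \<noteq> []" "set gs' \<subseteq> U"
    "set hs' \<subseteq> U" "ALL x:U. cov hs' (ind X) x \<le> cov gs' h x" by (auto simp: lset_def)
  let ?g = "conv gs gs'" and ?h = "conv gs' hs @ conv gs hs'"
  have "real (length ?h) / real (length ?g) \<in> lset (%x. f x + h x)"
  proof (rule lsetI)
   show "?g \<noteq> []" "set ?g \<subseteq> U" "set ?h \<subseteq> U" using r s set_conv_U by auto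
   fix x assume x: "x \<in> U"
   have "cov gs' (cov hs (ind X)) x \<le> cov gs' (cov gs f) x"
    using r s x by (intro cov_mono) auto
   moreover have "cov gs (cov hs' (ind X)) x \<le> cov gs (cov gs' h) x"
    using r s x by (intro cov_mono) auto
   moreover have "cov gs (cov gs' f) x = cov gs' (cov gs f) x" using r s x by (intro cov_commute)
   moreover have "cov ?g (%x. f x + h x) x = cov gs (cov gs' f) x + cov gs (cov gs' h) x"
    using r s x by (simp add: cov_conv cov_add[abs_def])
   ultimately show "cov ?h (ind X) x \<le> cov ?g (%x. f x + h x) x"
    using r s x by (simp add: cov_conv cov_append)
  qed (rule refl)
  moreover have "real (length ?h) / real (length ?g) = r + s"
   unfolding r(1) s(1) using r(2) s(2) by (simp add: add_frac_eq mult.commute)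
  ultimately show ?thesis using lod_ge[OF bdd_add[OF assms]] by metis
 qed
 then have "lod f \<le> lod (%x. f x + h x) - s" if "s \<in> lset h" for s
  using that by (intro lod_le) (auto simp: algebra_simps)
 then have "lod h \<le> lod (%x. f x + h x) - lod f"
  by (intro lod_le) (auto simp: algebra_simps)
 then show ?thesis by simp
qed

lemma lod_zero: "0 \<le> lod f" if "bdd f"
proof -
 obtain r where "r \<in> lset f" using lset_nonempty by blast
 moreover then have "0 \<le> r" by (auto simp: lset_def)
 ultimately show ?thesis using lod_ge[OF that] by force
qed

lemma lod_cov_le:
 assumes "bdd f" "set ks \<subseteq> U" "ks \<noteq> []"
 shows "lod (cov ks f) \<le> real (length ks) * lod f"
proof (rule lod_le)
 fix s assume "s \<in> lset (cov ks f)"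
 then obtain gs hs where s: "s = real (length hs) / real (length gs)" "gs \<noteq> []" "set gs \<subseteq> U"
  "set hs \<subseteq> U" "ALL x:U. cov hs (ind X) x \<le> cov gs (cov ks f) x" by (auto simp: lset_def)
 have "real (length hs) / real (length (conv gs ks)) \<in> lset f"
  unfolding lset_def
  by (intro CollectI exI[of _ "conv gs ks"] exI[of _ hs])
   (use s assms set_conv_U in \<open>auto simp: cov_conv\<close>)
 then have "real (length hs) / real (length (conv gs ks)) \<le> lod f" using assms lod_ge by blast
 then have "real (length ks) * (real (length hs) / real (length (conv gs ks))) \<le> real (length ks) * lod f"
  by (rule mult_left_mono) simp
 moreover have "real (length ks) * (real (length hs) / real (length (conv gs ks))) = s" using s assms by simp
 ultimately show "s \<le> real (length ks) * lod f" by simp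
qed

lemma lod_shift:
 assumes "bdd f" "g \<in> U"
 shows "lod (%x. f (x \<ominus> g)) = lod f"
proof -
 have le: "lod (%x. f (x \<ominus> g)) \<le> lod f" if "bdd f" "g \<in> U" for f g
  using lod_cov_le[of f "[g]"] that by (simp add: cov_def[abs_def])
 have b: "bdd (%x. f (x \<ominus> g))" using bdd_cov[of f "[g]"] assms by (simp add: cov_def[abs_def])
 have "lod f \<le> lod (%x. f ((x \<ominus> \<ominus> g) \<ominus> g))"
  using assms(2) bdd_cov[OF b, of "[\<ominus> g]"]
  by (intro lod_mono) (auto simp: minus_eq a_assoc l_neg U_neg r_neg cov_def[abs_def])
 also have "\<dots> \<le> lod (%x. f (x \<ominus> g))"
  using le[OF b U_neg[OF assms(2)]] .
 finally show ?thesis using le[OF assms] by simp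
qed

lemma lod_sum_ge: "finite I ==> (\<And>i. i \<in> I ==> bdd (f i)) ==> (\<Sum>i\<in>I. lod (f i)) \<le> lod (%x. \<Sum>i\<in>I. f i x)"
proof (induction I rule: finite_induct)
 case (insert i I)
 then have "lod (f i) + lod (%x. \<Sum>i\<in>I. f i x) \<le> lod (%x. f i x + (\<Sum>i\<in>I. f i x))"
  by (intro lod_add bdd_sum) auto
 then show ?case using insert by auto
qed (simp add: lod_zero bdd_zero)

end

section \<open>Cardinals below a strong limit\<close>

lemma card_of_lists_le:
 fixes A :: "'a set"
 shows "|lists A| \<le>o |A| +c natLeq"
proof -
 let ?r = "|A| +c natLeq"
 have inf: "Cinfinite ?r" by (simp add: Cinfinite_csum natLeq_Cinfinite)
 have A: "|A| \<le>o ?r" by (rule ordLeq_csum1[OF card_of_Card_order])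
 have one: "|{[]} :: 'a list set| \<le>o ?r"
  by (rule ordLess_imp_ordLeq[OF Cfinite_ordLess_Cinfinite[OF _ inf]])
   (auto simp: cfinite_def Field_card_of card_of_card_order_on)
 have n: "|{xs \<in> lists A. length xs = n}| \<le>o ?r" for n
 proof (induction n)
  case 0
  have "{xs \<in> lists A. length xs = 0} = {[]}" by auto
  then show ?case using one by simp
 next
  case (Suc n)
  have "{xs \<in> lists A. length xs = Suc n} = (%(x, xs). x # xs) ` (A \<times> {xs \<in> lists A. length xs = n})"
   by (force simp: length_Suc_conv image_iff)
  then have "|{xs \<in> lists A. length xs = Suc n}| \<le>o |A \<times> {xs \<in> lists A. length xs = n}|"
   by (simp only: card_of_image)
  also have "|A \<times> {xs \<in> lists A. length xs = n}| \<le>o ?r"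
   using cprod_cinfinite_bound[OF A Suc card_of_Card_order card_of_Card_order inf]
   by (simp add: cprod_def Field_card_of)
  finally show ?case .
 qed
 have "lists A = (\<Union>n. {xs \<in> lists A. length xs = n})" by auto
 moreover have "|\<Union>n. {xs \<in> lists A. length xs = n}| \<le>o ?r"
 proof (rule UNION_Cinfinite_bound[OF _ _ inf])
  show "|UNIV :: nat set| \<le>o ?r"
   using ordIso_ordLeq_trans[OF card_of_nat ordLeq_csum2[OF natLeq_Card_order]] .
 qed (use n in auto)
 ultimately show ?thesis by simp
qed

locale big_cardinal =
 fixes \<kappa> :: "'k rel"
 assumes kappa_strong: "strong_limit \<kappa>"
  and nat_less: "|UNIV :: nat set| <o \<kappa>"
begin

lemma kCard: "Card_order \<kappa>" using kappa_strong by (simp add: strong_limit_def)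

lemma kInf: "Cinfinite \<kappa>"
proof -
 have "natLeq \<le>o \<kappa>"
  by (rule ordLess_imp_ordLeq[OF ordIso_ordLess_trans[OF ordIso_symmetric[OF card_of_nat] nat_less]])
 then have "cinfinite \<kappa>" by (rule cinfinite_mono[OF _ natLeq_cinfinite])
 then show ?thesis using kCard by simp
qed

text \<open>A strong limit is only assumed to be closed under power sets of subsets of its own
field.\<close>

lemma kPow:
 fixes A :: "'a set"
 assumes "|A| <o \<kappa>" shows "|Pow A| <o \<kappa>"
proof -
 obtain B :: "'k set" where B: "|A| =o |B|"
  using internalize_card_of_ordLess[of A \<kappa>] assms by blast
 then have "|B| <o \<kappa>" using ordIso_ordLess_trans[OF ordIso_symmetric[OF B] assms] by simp
 then have PB: "|Pow B| <o \<kappa>" using kappa_strong by (simp add: strong_limit_def)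
 obtain f where f: "bij_betw f A B" using B card_of_ordIso[of A B] by blast
 then have "bij_betw (image f) (Pow A) (Pow B)" by (rule bij_betw_Pow)
 then have "|Pow A| =o |Pow B|" using card_of_ordIso[of "Pow A" "Pow B"] by blast
 then show ?thesis using PB by (rule ordIso_ordLess_trans)
qed

lemma kTimes:
 assumes "|A| <o \<kappa>" "|B| <o \<kappa>" shows "|A \<times> B| <o \<kappa>"
proof -
 let ?C = "(A <+> B) <+> (UNIV :: nat set)"
 have fin: "\<not> finite (Field \<kappa>)" using kInf by (simp add: cinfinite_def)
 have C: "|?C| <o \<kappa>"
  by (intro card_of_Plus_ordLess_infinite_Field[OF fin kCard] assms nat_less)
 have "infinite ?C" by (simp add: finite_Plus_iff)
 then have "|?C \<times> ?C| =o |?C|" by (rule card_of_Times_same_infinite)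
 moreover have "|A \<times> B| \<le>o |?C \<times> ?C|"
 proof (rule card_of_ordLeq[THEN iffD1], intro exI conjI)
  show "inj_on (%(a, b). (Inl (Inl a) :: ('a + 'b) + nat, Inl (Inr b) :: ('a + 'b) + nat)) (A \<times> B)"
   by (auto simp: inj_on_def)
 qed auto
 ultimately show ?thesis by (rule ordLeq_ordLess_trans[OF _ ordIso_ordLess_trans[OF _ C], rotated])
qed

lemma kUn: "|A| <o \<kappa> ==> |B| <o \<kappa> ==> |A \<union> B| <o \<kappa>"
 by (rule Un_Cinfinite_bound_strict[OF _ _ kInf])

lemma kImage: "|A| <o \<kappa> ==> |f ` A| <o \<kappa>"
 by (rule ordLeq_ordLess_trans[OF card_of_image])

lemma kSubset: "|A| <o \<kappa> ==> B \<subseteq> A ==> |B| <o \<kappa>"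
 by (rule ordLeq_ordLess_trans[OF card_of_mono1])

lemma kFinite: "finite A ==> |A| <o \<kappa>"
 by (rule Cfinite_ordLess_Cinfinite[OF _ kInf]) (simp add: cfinite_def Field_card_of card_of_card_order_on)

lemma kLists: "|A| <o \<kappa> ==> |lists A| <o \<kappa>"
proof -
 assume A: "|A| <o \<kappa>"
 have fin: "\<not> finite (Field \<kappa>)" using kInf by (simp add: cinfinite_def)
 have "|A <+> (UNIV :: nat set)| <o \<kappa>"
  by (rule card_of_Plus_ordLess_infinite_Field[OF fin kCard A nat_less])
 moreover have "|A| +c natLeq =o |A <+> (UNIV :: nat set)|"
  by (rule ordIso_transitive[OF csum_cong2[OF ordIso_symmetric[OF card_of_nat]]
     ordIso_symmetric[OF Plus_csum]])
 ultimately have "|A| +c natLeq <o \<kappa>" by (rule ordIso_ordLess_trans[rotated])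
 then show ?thesis by (rule ordLeq_ordLess_trans[OF card_of_lists_le])
qed

lemma kcountable: "|range (f :: nat => _)| <o \<kappa>"
 by (rule kImage[OF nat_less])

end

section \<open>Rings with locally definable operations\<close>

context nonunital_ring
begin

lemma mult_zero_right: "x \<in> carrier S ==> x \<otimes> \<zero> = \<zero>"
 using distr_right[of \<zero> \<zero> x] mult_closed[of x \<zero>] add.l_cancel_one[of "x \<otimes> \<zero>" "x \<otimes> \<zero>"] by simp

lemma mult_zero_left: "x \<in> carrier S ==> \<zero> \<otimes> x = \<zero>"
 using distr_left[of \<zero> \<zero> x] mult_closed[of \<zero> x] add.l_cancel_one[of "\<zero> \<otimes> x" "\<zero> \<otimes> x"] by simp

lemma mult_minus_right: "x \<in> carrier S ==> y \<in> carrier S ==> x \<otimes> (\<ominus> y) = \<ominus> (x \<otimes> y)"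
 using distr_right[of "\<ominus> y" y x] mult_closed[of x "\<ominus> y"] mult_closed[of x y] mult_zero_right[of x]
  minus_equality[of "x \<otimes> (\<ominus> y)" "x \<otimes> y"] by (simp add: l_neg)

lemma mult_minus_left: "x \<in> carrier S ==> y \<in> carrier S ==> (\<ominus> x) \<otimes> y = \<ominus> (x \<otimes> y)"
 using distr_left[of "\<ominus> x" x y] mult_closed[of "\<ominus> x" y] mult_closed[of x y] mult_zero_left[of y]
  minus_equality[of "(\<ominus> x) \<otimes> y" "x \<otimes> y"] by (simp add: l_neg)

end

text \<open>Relations on the ring are predicates on environments \<open>nat => 'b\<close>, read as
tuples; only their restrictions to each layer are definable.\<close>

definition bddenv :: "(nat => 'b set) => nat => (nat => 'b) => bool" where
 "bddenv XX N e \<longleftrightarrow> (ALL i. e i \<in> XX N)"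

definition bounded_definable :: "(nat => 'b set) => ((nat => 'b) => bool) set => 'b set set" where
 "bounded_definable XX LD = {D. (EX n. D \<subseteq> XX n) \<and> (%e. e 0 \<in> D) \<in> LD}"

text \<open>\<open>XX\<close> are the layers of the ring, \<open>LD\<close> the relations whose
restriction to each layer is definable with parameters, and \<open>compact\<close> is saturation.
In \<open>orbits\<close>, the family \<open>\<B>\<close> plays the role of the bounded sets
definable over a small set \<open>S\<close>: an intersection of such sets around \<open>x\<close>
is the type of \<open>x\<close>, hence an orbit.\<close>

locale definable_ring = nonunital_ring R + big_cardinal \<kappa>
 for R :: "'b ring" (structure) and \<kappa> :: "'k rel" +
 fixes XX :: "nat => 'b set"
  and LD :: "((nat => 'b) => bool) set"
  and Aut :: "('b => 'b) set"
 assumes carrier_eq: "carrier R = (\<Union>n. XX n)"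
  and XX_Suc: "XX n \<subseteq> XX (Suc n)"
  and XX_zero: "\<zero> \<in> XX 0"
  and XX_neg: "x \<in> XX n ==> \<ominus> x \<in> XX n"
  and XX_add: "\<lbrakk>x \<in> XX n; y \<in> XX n\<rbrakk> \<Longrightarrow> x \<oplus> y \<in> XX (Suc n)"
  and XX_mult: "\<lbrakk>x \<in> XX n; y \<in> XX n\<rbrakk> \<Longrightarrow> x \<otimes> y \<in> XX (Suc n)"
  and XX_cover: "EX F. finite F \<and> F \<subseteq> carrier R \<and> (ALL x:XX n. EX f:F. EX y:XX 0. x = f \<oplus> y)"
  and LD_local: "(\<And>N. EX Q:LD. ALL e. bddenv XX N e --> P e = Q e) ==> P \<in> LD"
  and LD_not: "P \<in> LD ==> (%e. \<not> P e) \<in> LD"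
  and LD_conj: "P \<in> LD ==> Q \<in> LD ==> (%e. P e \<and> Q e) \<in> LD"
  and LD_ex: "P \<in> LD ==> (%e. EX x:XX n. P (case_nat x e)) \<in> LD"
  and LD_ren: "P \<in> LD ==> (%e. P (%i. e (f i))) \<in> LD"
  and LD_const: "c \<in> carrier R ==> P \<in> LD ==> (%e. P (case_nat c e)) \<in> LD"
  and LD_add: "P \<in> LD ==> (%e. P (case_nat (e i \<oplus> e j) e)) \<in> LD"
  and LD_mult: "P \<in> LD ==> (%e. P (case_nat (e i \<otimes> e j) e)) \<in> LD"
  and LD_XX: "(%e. e 0 \<in> XX n) \<in> LD"
  and LD_eq: "(%e. e 0 = e 1) \<in> LD"
  and compact: "\<lbrakk>\<F> \<subseteq> bounded_definable XX LD; \<F> \<noteq> {}; |\<F>| <o \<kappa>;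
   \<And>\<G>. \<G> \<subseteq> \<F> ==> finite \<G> ==> \<G> \<noteq> {} ==> \<Inter>\<G> \<noteq> {}\<rbrakk> \<Longrightarrow> \<Inter>\<F> \<noteq> {}"
  and Aut_id: "id \<in> Aut"
  and Aut_comp: "\<sigma> \<in> Aut ==> \<tau> \<in> Aut ==> \<sigma> \<circ> \<tau> \<in> Aut"
  and Aut_inv: "\<sigma> \<in> Aut ==> EX \<tau>:Aut. ALL x:carrier R. \<tau> (\<sigma> x) = x \<and> \<sigma> (\<tau> x) = x"
  and Aut_XX: "\<sigma> \<in> Aut ==> x \<in> XX n ==> \<sigma> x \<in> XX n"
  and Aut_add: "\<sigma> \<in> Aut ==> x \<in> carrier R ==> y \<in> carrier R ==> \<sigma> (x \<oplus> y) = \<sigma> x \<oplus> \<sigma> y"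
  and Aut_mult: "\<sigma> \<in> Aut ==> x \<in> carrier R ==> y \<in> carrier R ==> \<sigma> (x \<otimes> y) = \<sigma> x \<otimes> \<sigma> y"
  and Aut_DD: "\<sigma> \<in> Aut ==> D \<in> bounded_definable XX LD ==> \<sigma> ` D \<in> bounded_definable XX LD"
  and orbits: "\<lbrakk>S \<subseteq> carrier R; |S| <o \<kappa>\<rbrakk> \<Longrightarrow> \<exists>\<B>\<subseteq>bounded_definable XX LD. |\<B>| <o \<kappa> \<and>
   range XX \<subseteq> \<B> \<and> (ALL B:\<B>. ALL C:\<B>. B \<inter> C \<in> \<B> \<and> B - C \<in> \<B>) \<and>
   (ALL B:\<B>. ALL \<sigma>:Aut. (ALL x:S. \<sigma> x = x) --> \<sigma> ` B = B) \<and>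
   (ALL x:carrier R. \<Inter>{B \<in> \<B>. x \<in> B} = {\<sigma> x | \<sigma>. \<sigma> \<in> Aut \<and> (ALL y:S. \<sigma> y = y)})"
begin

abbreviation RR where "RR \<equiv> carrier R"

abbreviation DD :: "'b set set" where "DD \<equiv> bounded_definable XX LD"

lemma XX_carrier: "x \<in> XX n ==> x \<in> RR" using carrier_eq by blast

lemma XX_sub: "XX n \<subseteq> RR" using carrier_eq by blast

lemma XX_mono: "m \<le> n ==> XX m \<subseteq> XX n"
 by (rule lift_Suc_mono_le[of XX]) (auto intro: XX_Suc[THEN subsetD])

lemma XX_monoD: "x \<in> XX m ==> m \<le> n ==> x \<in> XX n" using XX_mono by blast

lemma in_carrierE: "x \<in> RR ==> (\<And>n. x \<in> XX n ==> P) ==> P" using carrier_eq by blast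

lemma XX_zero': "\<zero> \<in> XX n" using XX_zero XX_mono[of 0 n] by blast

lemma XX_minus: "x \<in> XX n ==> y \<in> XX n ==> x \<ominus> y \<in> XX (Suc n)"
 by (simp add: minus_eq XX_add XX_neg)

text \<open>Terms: functions that may be substituted into every relation in \<open>LD\<close>,
with the shift \<open>f\<close> needed for a term below further bound variables.\<close>

definition LT :: "((nat => 'b) => 'b) set" where
 "LT = {t. (ALL N. EX M. ALL e. bddenv XX N e --> t e \<in> XX M) \<and>
  (ALL P:LD. ALL f. (%e. P (case_nat (t (%i. e (f i))) e)) \<in> LD)}"

lemma LTI: "(\<And>N. EX M. ALL e. bddenv XX N e --> t e \<in> XX M) ==>
 (\<And>P f. P \<in> LD ==> (%e. P (case_nat (t (%i. e (f i))) e)) \<in> LD) ==> t \<in> LT"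
 by (auto simp: LT_def)

lemma LT_bdd: "t \<in> LT ==> EX M. ALL e. bddenv XX N e --> t e \<in> XX M" by (auto simp: LT_def)

lemma LT_subst: "t \<in> LT ==> P \<in> LD ==> (%e. P (case_nat (t (%i. e (f i))) e)) \<in> LD" by (auto simp: LT_def)

lemma LT_var: "(%e. e i) \<in> LT"
proof (rule LTI)
 fix P :: "(nat => 'b) => bool" and f :: "nat => nat" assume "P \<in> LD"
 then have "(%e. P (%j. e (case_nat (f i) (%j. j) j))) \<in> LD" by (rule LD_ren)
 moreover have "(%j. e (case_nat (f i) (%j. j) j)) = case_nat (e (f i)) e" for e :: "nat => 'b"
  by (auto split: nat.split)
 ultimately show "(%e. P (case_nat (e (f i)) e)) \<in> LD" by simp
qed (auto simp: bddenv_def)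

lemma LT_const: "c \<in> RR ==> (%e. c) \<in> LT"
 by (rule LTI) (auto intro: LD_const elim: in_carrierE)

lemma LD_subst2:
 assumes "t \<in> LT" "u \<in> LT" "P \<in> LD"
 shows "(%e. P (case_nat (t (%i. e (f i))) (case_nat (u (%i. e (f i))) e))) \<in> LD"
proof -
 have 1: "(%e. P (case_nat (t (%i. e (Suc (f i)))) e)) \<in> LD"
  by (rule LT_subst[OF assms(1,3)])
 have "(%e. P (case_nat (t (%i. (case_nat (u (%i. e (f i))) e) (Suc (f i)))) (case_nat (u (%i. e (f i))) e))) \<in> LD"
  by (rule LT_subst[OF assms(2) 1])
 then show ?thesis by simp
qed

lemma case_nat_shift2: "(%i. case_nat x (case_nat y (case_nat z e)) (case_nat 0 (%i. i + 3) i)) = case_nat x e"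
 by (auto split: nat.split simp: numeral_eq_Suc)

lemma LT_op:
 assumes t: "t \<in> LT" and u: "u \<in> LT"
  and op: "\<And>P i j. P \<in> LD ==> (%e. P (case_nat (opr (e i) (e j)) e)) \<in> LD"
  and bd: "\<And>x y n. x \<in> XX n ==> y \<in> XX n ==> opr x y \<in> XX (Suc n)"
 shows "(%e. opr (t e) (u e)) \<in> LT"
proof (rule LTI)
 fix N
 obtain M M' where M: "ALL e. bddenv XX N e --> t e \<in> XX M" "ALL e. bddenv XX N e --> u e \<in> XX M'"
  using LT_bdd[OF t] LT_bdd[OF u] by blast
 have "opr (t e) (u e) \<in> XX (Suc (max M M'))" if "bddenv XX N e" for e
  using M that XX_mono[of M "max M M'"] XX_mono[of M' "max M M'"] by (intro bd) auto
 then show "EX M. ALL e. bddenv XX N e --> opr (t e) (u e) \<in> XX M" by blast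
next
 fix P :: "(nat => 'b) => bool" and f :: "nat => nat" assume P: "P \<in> LD"
 have "(%e. P (%i. e (case_nat 0 (%i. i + 3) i))) \<in> LD" by (rule LD_ren[OF P])
 from op[OF this, of 0 1]
 have "(%e. P (%i. case_nat (opr (e 0) (e 1)) e (case_nat 0 (%i. i + 3) i))) \<in> LD" .
 from LD_subst2[OF t u this, of f]
 show "(%e. P (case_nat (opr (t (%i. e (f i))) (u (%i. e (f i)))) e)) \<in> LD"
  by (simp add: case_nat_shift2)
qed

lemma LT_add: "t \<in> LT ==> u \<in> LT ==> (%e. t e \<oplus> u e) \<in> LT"
 by (rule LT_op) (auto intro: LD_add XX_add)

lemma LT_mult: "t \<in> LT ==> u \<in> LT ==> (%e. t e \<otimes> u e) \<in> LT"
 by (rule LT_op) (auto intro: LD_mult XX_mult)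

lemma LD_eqt: "t \<in> LT ==> u \<in> LT ==> (%e. t e = u e) \<in> LD"
 using LD_subst2[OF _ _ LD_eq, of t u "%i. i"] by simp

lemma DD_I: "D \<subseteq> XX n ==> (%e. e 0 \<in> D) \<in> LD ==> D \<in> DD"
 by (auto simp: bounded_definable_def)

lemma DD_bdd: "D \<in> DD ==> EX n. D \<subseteq> XX n" by (auto simp: bounded_definable_def)

lemma DD_carrier: "D \<in> DD ==> D \<subseteq> RR" using DD_bdd XX_sub by blast

lemma LD_mem: "D \<in> DD ==> t \<in> LT ==> (%e. t e \<in> D) \<in> LD"
 using LT_subst[of t "%e. e 0 \<in> D" "%i. i"] by (simp add: bounded_definable_def)

lemma XX_DD: "XX n \<in> DD" by (rule DD_I[OF subset_refl LD_XX])

lemma LD_disj: "P \<in> LD ==> Q \<in> LD ==> (%e. P e \<or> Q e) \<in> LD"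
 using LD_not[OF LD_conj[OF LD_not[of P] LD_not[of Q]]] by simp

lemma LD_imp: "P \<in> LD ==> Q \<in> LD ==> (%e. P e --> Q e) \<in> LD"
proof -
 assume "P \<in> LD" "Q \<in> LD"
 then have "(%e. \<not> P e \<or> Q e) \<in> LD" by (intro LD_disj LD_not)
 moreover have "(%e. \<not> P e \<or> Q e) = (%e. P e --> Q e)" by auto
 ultimately show ?thesis by simp
qed

lemma LD_bex: "(%e. \<Phi> (e 0) (%i. e (Suc i))) \<in> LD ==> (%e. EX x:XX n. \<Phi> x e) \<in> LD"
 using LD_ex[of "%e. \<Phi> (e 0) (%i. e (Suc i))" n] by simp

lemma LD_ball: "(%e. \<Phi> (e 0) (%i. e (Suc i))) \<in> LD ==> (%e. ALL x:XX n. \<Phi> x e) \<in> LD"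
 using LD_not[OF LD_bex[OF LD_not, of "\<Phi>" n]] by simp

lemma LD_bexD:
 assumes "D \<in> DD" "(%e. \<Phi> (e 0) (%i. e (Suc i))) \<in> LD"
 shows "(%e. EX x:D. \<Phi> x e) \<in> LD"
proof -
 obtain n where n: "D \<subseteq> XX n" using DD_bdd assms by blast
 have "(%e. EX x:XX n. x \<in> D \<and> \<Phi> x e) \<in> LD"
  by (rule LD_bex) (intro LD_conj LD_mem assms LT_var)
 moreover have "(EX x:XX n. x \<in> D \<and> \<Phi> x e) = (EX x:D. \<Phi> x e)" for e using n by blast
 ultimately show ?thesis by simp
qed

lemma LT_neg:
 assumes t: "t \<in> LT" shows "(%e. \<ominus> t e) \<in> LT"
proof (rule LTI)
 fix N show "EX M. ALL e. bddenv XX N e --> \<ominus> t e \<in> XX M" using LT_bdd[OF t, of N] XX_neg by blast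
next
 fix P :: "(nat => 'b) => bool" and f :: "nat => nat" assume P: "P \<in> LD"
 show "(%e. P (case_nat (\<ominus> t (%i. e (f i))) e)) \<in> LD"
 proof (rule LD_local)
  fix N
  obtain M where M: "\<And>e. bddenv XX N e ==> t e \<in> XX M" using LT_bdd[OF t] by blast
  let ?Q = "%e. EX y:XX M. t (%i. e (f i)) \<oplus> y = \<zero> \<and> P (case_nat y e)"
  have "(%e. (%e. e 0 \<oplus> e 1 = \<zero>) (case_nat (t (%i. e (Suc (f i)))) e)) \<in> LD"
   by (intro LT_subst[OF t] LD_eqt LT_add LT_var LT_const zero_closed)
  then have 1: "(%e. t (%i. e (Suc (f i))) \<oplus> e 0 = \<zero>) \<in> LD" by simp
  have 2: "(%e. P (case_nat (e 0) (%i. e (Suc i)))) \<in> LD"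
   using P by (rule back_subst[of "%P. P \<in> LD"]) (auto intro!: ext arg_cong[of _ _ P] split: nat.split)
  have "?Q \<in> LD" by (rule LD_bex) (intro LD_conj 1 2)
  moreover have "P (case_nat (\<ominus> t (%i. e (f i))) e) = ?Q e" if "bddenv XX N e" for e
  proof -
   have m: "t (%i. e (f i)) \<in> XX M" using that by (intro M) (auto simp: bddenv_def)
   have "ALL y:XX M. t (%i. e (f i)) \<oplus> y = \<zero> \<longleftrightarrow> y = \<ominus> t (%i. e (f i))"
    using m XX_carrier by (metis minus_equality r_neg a_comm)
   then show ?thesis using XX_neg[OF m] by auto
  qed
  ultimately show "EX Q:LD. ALL e. bddenv XX N e --> P (case_nat (\<ominus> t (%i. e (f i))) e) = Q e"
   by (intro bexI[of _ ?Q]) auto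
 qed
qed

lemma LT_minus: "t \<in> LT ==> u \<in> LT ==> (%e. t e \<ominus> u e) \<in> LT"
 unfolding minus_eq by (intro LT_add LT_neg)

lemma LD_True: "(%e. True) \<in> LD"
 using LD_disj[OF LD_eq LD_not[OF LD_eq]] by simp

lemma LD_triv: "(%e. b) \<in> LD"
 using LD_True LD_not[OF LD_True] by (cases b) auto

text \<open>A Boolean combination, \<open>F\<close>, of finitely many conditions, used to express
counting.\<close>

lemma LD_fin:
 assumes "finite I" "\<And>i. i \<in> I ==> \<Phi> i \<in> LD"
 shows "(%e. F {i \<in> I. \<Phi> i e}) \<in> LD"
 using assms
proof (induction I arbitrary: F rule: finite_induct)
 case (insert a I)
 have "(%e. (\<Phi> a e \<and> F (insert a {i \<in> I. \<Phi> i e})) \<or> (\<not> \<Phi> a e \<and> F {i \<in> I. \<Phi> i e})) \<in> LD"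
  using insert.IH[of "%Z. F (insert a Z)"] insert.IH[of F] insert.prems
  by (intro LD_disj LD_conj LD_not) auto
 moreover have "(%e. (\<Phi> a e \<and> F (insert a {i \<in> I. \<Phi> i e})) \<or> (\<not> \<Phi> a e \<and> F {i \<in> I. \<Phi> i e}))
   = (%e. F {i \<in> insert a I. \<Phi> i e})" (is "?l = ?r")
 proof
  fix e
  have "{i \<in> insert a I. \<Phi> i e} = (if \<Phi> a e then insert a {i \<in> I. \<Phi> i e} else {i \<in> I. \<Phi> i e})" by auto
  then show "?l e = ?r e" by simp
 qed
 ultimately show ?case by simp
qed (simp add: LD_triv)

lemma LD_exlist:
 assumes "(%e. \<Phi> (map e [0..<n]) (%i. e (i + n))) \<in> LD"
 shows "(%e. EX gs. length gs = n \<and> set gs \<subseteq> XX N \<and> \<Phi> gs e) \<in> LD"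
 using assms
proof (induction n arbitrary: \<Phi>)
 case 0
 then show ?case by simp
next
 case (Suc n)
 \<comment> \<open>The first element stays in the environment while the others are quantified.\<close>
 let ?\<Psi> = "%gs e. \<Phi> (e 0 # gs) (%i. e (Suc i))"
 have a: "(%e. \<Phi> (map (%i. e (case_nat n (%i. i) i)) [0..<Suc n]) (%i. e (i + Suc n))) \<in> LD"
 proof -
  let ?g = "%i. if i = 0 then n else if i \<le> n then i - 1 else i"
  have "(%e. \<Phi> (map (%i. e (?g i)) [0..<Suc n]) (%i. e (?g (i + Suc n)))) \<in> LD"
   by (rule LD_ren[OF Suc.prems])
  moreover have m: "map (%i. e (?g i)) [0..<Suc n] = map (%i. e (case_nat n (%i. i) i)) [0..<Suc n]" for e :: "nat => 'b"
   by (rule map_cong) (auto split: nat.split)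
  moreover have m': "(%i. e (?g (i + Suc n))) = (%i. e (i + Suc n))" for e :: "nat => 'b" by auto
  ultimately show ?thesis by (simp only: m m')
 qed
 have b: "map (%i. e (case_nat n (%i. i) i)) [0..<Suc n] = e n # map e [0..<n]" for e :: "nat => 'b"
  by (simp add: upt_conv_Cons map_Suc_upt[symmetric] del: upt_Suc)
 have "(%e. ?\<Psi> (map e [0..<n]) (%i. e (i + n))) \<in> LD"
  using a by (simp add: b del: upt_Suc)
 from Suc.IH[OF this]
 have "(%e. EX gs. length gs = n \<and> set gs \<subseteq> XX N \<and> \<Phi> (e 0 # gs) (%i. e (Suc i))) \<in> LD" .
 then have "(%e. EX x:XX N. EX gs. length gs = n \<and> set gs \<subseteq> XX N \<and> \<Phi> (x # gs) e) \<in> LD"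
  by (rule LD_bex)
 moreover have "(EX x:XX N. EX gs. length gs = n \<and> set gs \<subseteq> XX N \<and> \<Phi> (x # gs) e)
  = (EX gs. length gs = Suc n \<and> set gs \<subseteq> XX N \<and> \<Phi> gs e)" for e
 proof
  assume "EX x:XX N. EX gs. length gs = n \<and> set gs \<subseteq> XX N \<and> \<Phi> (x # gs) e"
  then obtain x gs where "x \<in> XX N" "length gs = n" "set gs \<subseteq> XX N" "\<Phi> (x # gs) e" by blast
  then show "EX gs. length gs = Suc n \<and> set gs \<subseteq> XX N \<and> \<Phi> gs e" by (intro exI[of _ "x # gs"]) simp
 next
  assume "EX gs. length gs = Suc n \<and> set gs \<subseteq> XX N \<and> \<Phi> gs e"
  then obtain gs where gs: "length gs = Suc n" "set gs \<subseteq> XX N" "\<Phi> gs e" by blast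
  then obtain x gs' where "gs = x # gs'" by (cases gs) auto
  with gs show "EX x:XX N. EX gs. length gs = n \<and> set gs \<subseteq> XX N \<and> \<Phi> (x # gs) e"
   by (intro bexI[of _ x] exI[of _ gs']) auto
 qed
 ultimately show ?case by (simp only:)
qed

lemma DD_Int: "D \<in> DD ==> E \<in> DD ==> D \<inter> E \<in> DD"
proof -
 assume D: "D \<in> DD" "E \<in> DD"
 then obtain n where "D \<inter> E \<subseteq> XX n" using DD_bdd by blast
 then show ?thesis by (rule DD_I) (unfold Int_iff, intro LD_conj LD_mem LT_var D)
qed

lemma DD_Diff: "D \<in> DD ==> E \<in> DD ==> D - E \<in> DD"
proof -
 assume D: "D \<in> DD" "E \<in> DD"
 then obtain n where "D - E \<subseteq> XX n" using DD_bdd by blast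
 then show ?thesis by (rule DD_I) (unfold Diff_iff, intro LD_conj LD_not LD_mem LT_var D)
qed

lemma DD_collect: "D \<in> DD ==> (%e. \<Phi> (e 0)) \<in> LD ==> {x \<in> D. \<Phi> x} \<in> DD"
proof -
 assume D: "D \<in> DD" "(%e. \<Phi> (e 0)) \<in> LD"
 then obtain n where "{x \<in> D. \<Phi> x} \<subseteq> XX n" using DD_bdd by blast
 then show ?thesis by (rule DD_I) (unfold mem_Collect_eq, intro LD_conj LD_mem LT_var D)
qed

lemma DD_Un: "D \<in> DD ==> E \<in> DD ==> D \<union> E \<in> DD"
proof -
 assume D: "D \<in> DD" "E \<in> DD"
 then obtain m n where "D \<subseteq> XX m" "E \<subseteq> XX n" using DD_bdd by metis
 then have "D \<union> E \<subseteq> XX (max m n)" using XX_mono[of m "max m n"] XX_mono[of n "max m n"] by auto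
 then show ?thesis by (rule DD_I) (unfold Un_iff, intro LD_disj LD_mem LT_var D)
qed

lemma DD_empty: "{} \<in> DD" using DD_Diff[OF XX_DD[of 0] XX_DD[of 0]] by simp

lemma DD_sing: "c \<in> RR ==> {c} \<in> DD"
proof -
 assume c: "c \<in> RR"
 then obtain n where "{c} \<subseteq> XX n" using carrier_eq by blast
 then show ?thesis by (rule DD_I) (unfold singleton_iff, intro LD_eqt LT_var LT_const c)
qed

lemma DD_finUN: "finite I ==> (\<And>i. i \<in> I ==> D i \<in> DD) ==> (\<Union>i\<in>I. D i) \<in> DD"
 by (induction I rule: finite_induct) (auto intro: DD_empty DD_Un)

lemma DD_finite: "finite F ==> F \<subseteq> RR ==> F \<in> DD"
 using DD_finUN[of F "%c. {c}"] DD_sing by (simp add: subset_iff)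

lemma DD_finInt: "finite \<G> ==> \<G> \<noteq> {} ==> \<G> \<subseteq> DD ==> \<Inter>\<G> \<in> DD"
 by (induction \<G> rule: finite_ne_induct) (auto intro: DD_Int)

lemma set_add_iff: "z \<in> A <+> B \<longleftrightarrow> (EX x:A. EX y:B. z = x \<oplus> y)"
 by (auto simp: set_add_def')

lemma XX_set_add: "D \<subseteq> XX n ==> E \<subseteq> XX n ==> D <+> E \<subseteq> XX (Suc n)"
 by (auto simp: set_add_iff intro!: XX_add)

lemma DD_add: "D \<in> DD ==> E \<in> DD ==> D <+> E \<in> DD"
proof -
 assume D: "D \<in> DD" "E \<in> DD"
 then obtain m n where "D \<subseteq> XX m" "E \<subseteq> XX n" using DD_bdd by metis
 then have "D \<subseteq> XX (max m n)" "E \<subseteq> XX (max m n)"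
  using XX_mono[of m "max m n"] XX_mono[of n "max m n"] by auto
 from XX_set_add[OF this] show ?thesis
  by (rule DD_I) (unfold set_add_iff, intro LD_bexD D LD_eqt LT_var LT_add)
qed

definition negs :: "'b set => 'b set" where "negs D = {x \<in> RR. \<ominus> x \<in> D}"

lemma negs_DD: "D \<in> DD ==> negs D \<in> DD"
proof -
 assume D: "D \<in> DD"
 then obtain n where n: "D \<subseteq> XX n" using DD_bdd by blast
 have e: "negs D = {x \<in> XX n. \<ominus> x \<in> D}"
 proof
  show "negs D \<subseteq> {x \<in> XX n. \<ominus> x \<in> D}"
  proof
   fix x assume "x \<in> negs D"
   then have "x \<in> RR" "\<ominus> x \<in> D" by (auto simp: negs_def)
   then show "x \<in> {x \<in> XX n. \<ominus> x \<in> D}" using n XX_neg[of "\<ominus> x" n] minus_minus[of x] by auto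
  qed
 qed (auto simp: negs_def XX_carrier)
 show ?thesis unfolding e by (intro DD_collect XX_DD LD_mem D LT_neg LT_var)
qed

section \<open>Type-definable sets and subgroups\<close>

definition dirf :: "'b set set => bool" where
 "dirf \<F> \<longleftrightarrow> \<F> \<noteq> {} \<and> (ALL A:\<F>. ALL B:\<F>. EX C:\<F>. C \<subseteq> A \<inter> B)"

lemma dirf_finite:
 assumes "dirf \<F>" "finite \<G>" "\<G> \<subseteq> \<F>"
 shows "EX C:\<F>. ALL A:\<G>. C \<subseteq> A"
 using assms(2,3)
proof (induction \<G> rule: finite_induct)
 case empty
 then show ?case using assms(1) by (auto simp: dirf_def)
next
 case (insert A \<G>)
 then obtain C where C: "C \<in> \<F>" "ALL A:\<G>. C \<subseteq> A" by auto
 moreover have "A \<in> \<F>" using insert by simp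
 ultimately obtain E where "E \<in> \<F>" "E \<subseteq> A \<inter> C" using assms(1) unfolding dirf_def by meson
 with C show ?case by (intro bexI[of _ E]) auto
qed

text \<open>Compactness in the form in which it is used: a directed family of nonempty bounded
definable sets.\<close>

lemma compact_dir:
 assumes dir: "dirf \<F>" and small: "|\<F>| <o \<kappa>"
  and T: "\<And>D. D \<in> \<F> ==> T D \<in> DD" "\<And>D. D \<in> \<F> ==> T D \<noteq> {}"
  and mono: "\<And>D E. D \<in> \<F> ==> E \<in> \<F> ==> D \<subseteq> E ==> T D \<subseteq> T E"
 shows "EX x. ALL D:\<F>. x \<in> T D"
proof -
 have "\<Inter>(T ` \<F>) \<noteq> {}"
 proof (rule compact)
  show "T ` \<F> \<subseteq> DD" "T ` \<F> \<noteq> {}" using T dir by (auto simp: dirf_def)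
  show "|T ` \<F>| <o \<kappa>" by (rule kImage[OF small])
  fix \<G> assume "\<G> \<subseteq> T ` \<F>" "finite \<G>" "\<G> \<noteq> {}"
  then obtain \<F>0 where \<F>0: "\<F>0 \<subseteq> \<F>" "finite \<F>0" "\<G> = T ` \<F>0" by (metis finite_subset_image)
  obtain C where C: "C \<in> \<F>" "ALL A:\<F>0. C \<subseteq> A" using dirf_finite[OF dir \<F>0(2,1)] by blast
  have "T C \<subseteq> \<Inter>\<G>" using \<F>0 C mono by blast
  then show "\<Inter>\<G> \<noteq> {}" using T(2)[OF C(1)] by blast
 qed
 then show ?thesis by auto
qed

text \<open>Type-definable over some small set of parameters. Such a set lies in one layer;
\<open>TDw\<close> is the case of countably many formulas.\<close>

definition TD :: "'b set => bool" where
 "TD D \<longleftrightarrow> (\<exists>\<F>\<subseteq>DD. \<F> \<noteq> {} \<and> |\<F>| <o \<kappa> \<and> D = \<Inter>\<F>)"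

definition TDw :: "'b set => bool" where
 "TDw D \<longleftrightarrow> (EX Q :: nat => 'b set. (ALL i. Q i \<in> DD) \<and> D = (\<Inter>i. Q i))"

lemma TD_dir:
 assumes "TD D"
 shows "\<exists>\<F>\<subseteq>DD. dirf \<F> \<and> |\<F>| <o \<kappa> \<and> D = \<Inter>\<F>"
proof -
 obtain \<F> where F: "\<F> \<subseteq> DD" "\<F> \<noteq> {}" "|\<F>| <o \<kappa>" "D = \<Inter>\<F>" using assms by (auto simp: TD_def)
 let ?L = "{xs \<in> lists \<F>. xs \<noteq> []}"
 let ?F = "(%xs. \<Inter>(set xs)) ` ?L"
 have "?F \<subseteq> DD" using F(1) by (auto intro!: DD_finInt)
 moreover have "dirf ?F"
  unfolding dirf_def
 proof (intro conjI ballI)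
  obtain A where "A \<in> \<F>" using F(2) by blast
  then have "[A] \<in> ?L" by simp
  then show "?F \<noteq> {}" by blast
 next
  fix A B assume "A \<in> ?F" "B \<in> ?F"
  then obtain xs ys where "A = \<Inter>(set xs)" "xs \<in> ?L" "B = \<Inter>(set ys)" "ys \<in> ?L" by blast
  then have "xs @ ys \<in> ?L" "\<Inter>(set (xs @ ys)) \<subseteq> A \<inter> B" by auto
  then show "EX C:?F. C \<subseteq> A \<inter> B" by blast
 qed
 moreover have "|?F| <o \<kappa>"
  by (rule kImage, rule kSubset[OF kLists[OF F(3)]]) auto
 moreover have "D = \<Inter>?F"
 proof
  show "\<Inter>?F \<subseteq> D"
  proof
   fix x assume x: "x \<in> \<Inter>?F"
   have "x \<in> A" if "A \<in> \<F>" for A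
   proof -
    have "\<Inter>(set [A]) \<in> ?F" by (rule image_eqI[of _ _ "[A]"]) (use that in auto)
    then show ?thesis using x by auto
   qed
   then show "x \<in> D" using F(4) by blast
  qed
 qed (use F(4) in auto)
 ultimately show ?thesis by blast
qed

lemma TD_carrier: "TD D ==> D \<subseteq> RR" using DD_carrier by (fastforce simp: TD_def)

lemma TD_bdd: "TD D ==> EX n. D \<subseteq> XX n"
proof -
 assume "TD D"
 then obtain \<F> where "\<F> \<subseteq> DD" "\<F> \<noteq> {}" "D = \<Inter>\<F>" by (auto simp: TD_def)
 then obtain A where "A \<in> DD" "D \<subseteq> A" by blast
 then show ?thesis using DD_bdd by blast
qed

lemma TDw_TD: "TDw D ==> TD D"
 unfolding TDw_def TD_def using kcountable by (metis image_subsetI range_eqI empty_not_UNIV image_is_empty)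

lemma TD_family:
 assumes "I \<noteq> {}" "|I| <o \<kappa>" "J \<noteq> {}" "|J| <o \<kappa>"
  and "\<And>i. i \<in> I ==> K i = (\<Inter>j\<in>J. Q i j)" "\<And>i j. i \<in> I ==> j \<in> J ==> Q i j \<in> DD"
 shows "TD (\<Inter>i\<in>I. K i)"
 unfolding TD_def
proof (intro exI conjI)
 let ?F = "(%(i, j). Q i j) ` (I \<times> J)"
 show "?F \<subseteq> DD" "?F \<noteq> {}" "(\<Inter>i\<in>I. K i) = \<Inter>?F" using assms by auto
 show "|?F| <o \<kappa>" by (intro kImage kTimes assms)
qed

lemma TD_Int: "TD D ==> TD E ==> TD (D \<inter> E)"
 unfolding TD_def
proof (elim exE conjE)
 fix \<F> \<G> assume "\<F> \<subseteq> DD" "\<F> \<noteq> {}" "|\<F>| <o \<kappa>" "D = \<Inter>\<F>" "\<G> \<subseteq> DD" "\<G> \<noteq> {}" "|\<G>| <o \<kappa>" "E = \<Inter>\<G>"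
 then show "\<exists>\<F>\<subseteq>DD. \<F> \<noteq> {} \<and> |\<F>| <o \<kappa> \<and> D \<inter> E = \<Inter>\<F>"
  by (intro exI[of _ "\<F> \<union> \<G>"]) (auto intro: kUn)
qed

lemma TDw_decreasing:
 assumes "TDw D"
 shows "EX Q :: nat => 'b set. (ALL i. Q i \<in> DD) \<and> decseq Q \<and> D = (\<Inter>i. Q i)"
proof -
 obtain Q :: "nat => 'b set" where Q: "\<And>i. Q i \<in> DD" "D = (\<Inter>i. Q i)" using assms by (auto simp: TDw_def)
 have "(\<Inter>i\<in>{..n}. Q i) \<in> DD" for n using Q(1) by (intro DD_finInt) auto
 then show ?thesis using Q(2)
  by (intro exI[of _ "%n. \<Inter>i\<in>{..n}. Q i"]) (auto simp: decseq_def)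
qed

text \<open>For a type-definable \<open>K\<close> these definable sets form a base of
neighbourhoods of \<open>K\<close>, by compactness.\<close>

definition NB :: "'b set => 'b set set" where "NB K = {D \<in> DD. K \<subseteq> D}"

lemma NB_Int: "D \<in> NB K ==> E \<in> NB K ==> D \<inter> E \<in> NB K" by (auto simp: NB_def DD_Int)

lemma NB_DD: "D \<in> NB K ==> D \<in> DD" by (simp add: NB_def)

lemma NB_base:
 assumes "dirf \<F>" "\<F> \<subseteq> DD" "|\<F>| <o \<kappa>" "D \<in> NB (\<Inter>\<F>)"
 shows "EX E:\<F>. E \<subseteq> D"
proof (rule ccontr)
 assume *: "\<not> ?thesis"
 have "EX x. ALL E:\<F>. x \<in> E - D"
  by (rule compact_dir[OF assms(1,3)]) (use assms * in \<open>auto intro: DD_Diff simp: NB_def\<close>)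
 then show False using assms by (auto simp: NB_def dirf_def)
qed

lemma NB_compact:
 assumes K: "TD K"
  and T: "\<And>D. D \<in> NB K ==> T D \<in> DD" "\<And>D. D \<in> NB K ==> T D \<noteq> {}"
  and mono: "\<And>D E. D \<in> NB K ==> E \<in> NB K ==> D \<subseteq> E ==> T D \<subseteq> T E"
 shows "EX x. ALL D:NB K. x \<in> T D"
proof -
 obtain \<F> where F: "\<F> \<subseteq> DD" "dirf \<F>" "|\<F>| <o \<kappa>" "K = \<Inter>\<F>" using TD_dir[OF K] by blast
 have FNB: "\<F> \<subseteq> NB K" using F by (auto simp: NB_def)
 have "EX x. ALL D:\<F>. x \<in> T D"
  by (rule compact_dir[OF F(2,3)]) (use FNB T mono in blast)+
 then obtain x where x: "\<And>D. D \<in> \<F> ==> x \<in> T D" by blast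
 have "x \<in> T D" if D: "D \<in> NB K" for D
 proof -
  obtain E where "E \<in> \<F>" "E \<subseteq> D" using NB_base[OF F(2,1,3)] D F(4) by blast
  then show ?thesis using x mono[of E D] FNB D by blast
 qed
 then show ?thesis by blast
qed

lemma TD_NB: "TD K ==> \<Inter>(NB K) = K"
 unfolding TD_def NB_def by blast

lemma TD_memI: "TD K ==> (\<And>D. D \<in> NB K ==> x \<in> D) ==> x \<in> K"
 using TD_NB by blast

lemma NB_nonempty: "TD K ==> EX D. D \<in> NB K" unfolding TD_def NB_def by blast

lemma NB_two:
 assumes K: "TD K" and L: "TD L" and D: "D \<in> NB (K \<inter> L)"
 shows "EX E:NB K. EX F:NB L. E \<inter> F \<subseteq> D"
proof -
 obtain \<F> where F: "\<F> \<subseteq> DD" "dirf \<F>" "|\<F>| <o \<kappa>" "L = \<Inter>\<F>" using TD_dir[OF L] by blast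
 obtain \<G> where G: "\<G> \<subseteq> DD" "dirf \<G>" "|\<G>| <o \<kappa>" "K = \<Inter>\<G>" using TD_dir[OF K] by blast
 let ?H = "(%(A, B). A \<inter> B) ` (\<G> \<times> \<F>)"
 have "dirf ?H"
  unfolding dirf_def
 proof (intro conjI ballI)
  show "?H \<noteq> {}" using F(2) G(2) by (auto simp: dirf_def)
  fix A B assume "A \<in> ?H" "B \<in> ?H"
  then obtain a a' b b' where ab: "A = a \<inter> a'" "B = b \<inter> b'" "a \<in> \<G>" "b \<in> \<G>" "a' \<in> \<F>" "b' \<in> \<F>" by auto
  obtain c where c: "c \<in> \<G>" "c \<subseteq> a \<inter> b" using ab(3,4) G(2) unfolding dirf_def by metis
  obtain c' where c': "c' \<in> \<F>" "c' \<subseteq> a' \<inter> b'" using ab(5,6) F(2) unfolding dirf_def by metis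
  show "EX C:?H. C \<subseteq> A \<inter> B"
   using ab c c' by (intro bexI[of _ "c \<inter> c'"]) auto
 qed
 moreover have "|?H| <o \<kappa>" by (intro kImage kTimes F G)
 moreover have "?H \<subseteq> DD" using F(1) G(1) by (auto intro!: DD_Int)
 moreover have "\<Inter>?H = K \<inter> L" using F(2,4) G(2,4) by (auto simp: dirf_def)
 ultimately obtain E where "E \<in> ?H" "E \<subseteq> D" using NB_base[of ?H D] D by auto
 then show ?thesis using F G by (auto simp: NB_def)
qed

definition asub :: "'b set => bool" where "asub K \<longleftrightarrow> subgroup K (add_monoid R)"

lemma asub_carrier: "asub K ==> K \<subseteq> RR" unfolding asub_def using subgroup.subset by force

lemma asub_zero: "asub K ==> \<zero> \<in> K" unfolding asub_def using subgroup.one_closed by force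

lemma asub_add: "asub K ==> x \<in> K ==> y \<in> K ==> x \<oplus> y \<in> K" unfolding asub_def using subgroup.m_closed by force

lemma asub_neg: "asub K ==> x \<in> K ==> \<ominus> x \<in> K"
 unfolding asub_def using subgroup.m_inv_closed[of K "add_monoid R" x] by (simp add: a_inv_def)

lemma asub_minus: "asub K ==> x \<in> K ==> y \<in> K ==> x \<ominus> y \<in> K"
 by (simp add: minus_eq asub_add asub_neg)

lemma asubI:
 assumes "K \<subseteq> RR" "\<zero> \<in> K" "\<And>x y. x \<in> K ==> y \<in> K ==> x \<oplus> y \<in> K" "\<And>x. x \<in> K ==> \<ominus> x \<in> K"
 shows "asub K"
 unfolding asub_def by (rule subgroup.intro) (use assms in \<open>auto simp: a_inv_def\<close>)

lemma asubI':
 assumes "K \<subseteq> RR" "\<zero> \<in> K" "\<And>x y. x \<in> K ==> y \<in> K ==> x \<ominus> y \<in> K"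
 shows "asub K"
proof (rule asubI)
 have neg: "\<ominus> x \<in> K" if "x \<in> K" for x
 proof -
  have "\<ominus> x = \<zero> \<ominus> x" using that assms(1) by (auto simp: minus_eq)
  then show ?thesis using that assms by metis
 qed
 then show "\<ominus> x \<in> K" if "x \<in> K" for x using that .
 fix x y assume "x \<in> K" "y \<in> K"
 then have "x \<ominus> (\<ominus> y) \<in> K" using neg assms by blast
 then show "x \<oplus> y \<in> K" using \<open>y \<in> K\<close> assms(1) by (auto simp: minus_eq)
qed (use assms in auto)

lemma asub_Int: "asub K ==> asub L ==> asub (K \<inter> L)"
 using asub_carrier[of K] by (intro asubI) (auto simp: asub_zero asub_add asub_neg)

lemma asub_INT: "I \<noteq> {} ==> (\<And>i. i \<in> I ==> asub (K i)) ==> asub (\<Inter>i\<in>I. K i)"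
 using asub_carrier by (intro asubI) (auto simp: asub_zero asub_add asub_neg subset_iff)

text \<open>Continuity of subtraction at a type-definable subgroup, by compactness.\<close>

lemma NB_sub:
 assumes "TD K" "asub K" "D \<in> NB K"
 shows "EX E:NB K. ALL x:E. ALL y:E. x \<ominus> y \<in> D"
proof (rule ccontr)
 assume *: "\<not> ?thesis"
 have DDD: "D \<in> DD" using assms by (simp add: NB_def)
 have "EX x. ALL E:NB K. x \<in> {x \<in> E. EX y:E. x \<ominus> y \<notin> D}"
 proof (rule NB_compact[OF assms(1)])
  fix E assume "E \<in> NB K"
  then show "{x \<in> E. EX y:E. x \<ominus> y \<notin> D} \<in> DD"
   by (intro DD_collect LD_bexD LD_not LD_mem DDD LT_minus LT_var) (auto simp: NB_def)
 qed (use * in blast)+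
 then obtain x where x: "\<And>E. E \<in> NB K ==> x \<in> E \<and> (EX y:E. x \<ominus> y \<notin> D)" by blast
 then have xK: "x \<in> K" using TD_memI[OF assms(1)] by blast
 then have xc: "x \<in> RR" using assms asub_carrier by blast
 have "EX y. ALL E:NB K. y \<in> {y \<in> E. x \<ominus> y \<notin> D}"
 proof (rule NB_compact[OF assms(1)])
  fix E assume "E \<in> NB K"
  then show "{y \<in> E. x \<ominus> y \<notin> D} \<in> DD"
   by (intro DD_collect LD_not LD_mem DDD LT_minus LT_var LT_const xc) (auto simp: NB_def)
 qed (use x in blast)+
 then obtain y where y: "\<And>E. E \<in> NB K ==> y \<in> E \<and> x \<ominus> y \<notin> D" by blast
 then have "y \<in> K" "x \<ominus> y \<notin> D" using TD_memI[OF assms(1)] NB_nonempty[OF assms(1)] by blast+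
 then show False using xK asub_minus[OF assms(2)] assms(3) by (auto simp: NB_def)
qed

lemma minus_cancel: "x \<in> RR ==> y \<in> RR ==> y \<oplus> (x \<ominus> y) = x"
 by (simp add: minus_eq a_lcomm r_neg)

text \<open>Generic: finitely many translates cover the layer \<open>XX 0\<close>, hence, since
\<open>XX 0\<close> covers each layer up to finitely many translates, every layer.\<close>

definition gen :: "'b set => bool" where
 "gen D \<longleftrightarrow> (EX F. finite F \<and> F \<subseteq> RR \<and> (ALL x:XX 0. EX f:F. EX d:D. x = f \<oplus> d))"

lemma gen_mono: "gen D ==> D \<subseteq> E ==> gen E" unfolding gen_def by (meson subsetD)

lemma reps:
 assumes "finite (c ` Z)"
 shows "EX F. finite F \<and> F \<subseteq> Z \<and> (ALL x:Z. EX f:F. c x = c f)"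
proof -
 obtain F where "F \<subseteq> Z" "finite F" "c ` Z = c ` F" using assms by (metis finite_subset_image subset_refl)
 then show ?thesis by (intro exI[of _ F]) (metis image_iff)
qed

lemma gen_pieces:
 assumes "finite (c ` XX 0)" "\<And>x y. x \<in> XX 0 ==> y \<in> XX 0 ==> c x = c y ==> x \<ominus> y \<in> D"
 shows "gen D"
proof -
 obtain F where F: "finite F" "F \<subseteq> XX 0" "ALL x:XX 0. EX f:F. c x = c f" using reps[OF assms(1)] by blast
 show ?thesis
  unfolding gen_def
 proof (intro exI[of _ F] conjI ballI)
  show "F \<subseteq> RR" using F XX_sub by blast
  fix x assume x: "x \<in> XX 0"
  then obtain f where f: "f \<in> F" "c x = c f" using F by blast
  then have "x \<ominus> f \<in> D" using assms(2) x F by blast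
  moreover have "x = f \<oplus> (x \<ominus> f)" using x f F XX_carrier by (metis minus_cancel subsetD)
  ultimately show "EX f:F. EX d:D. x = f \<oplus> d" using f by blast
 qed (use F in auto)
qed

lemma add_minus_add: "\<lbrakk>f \<in> RR; d \<in> RR; d' \<in> RR\<rbrakk> \<Longrightarrow> (f \<oplus> d) \<ominus> (f \<oplus> d') = d \<ominus> d'"
proof -
 assume c: "f \<in> RR" "d \<in> RR" "d' \<in> RR"
 have "(f \<oplus> d) \<ominus> (f \<oplus> d') = (f \<oplus> \<ominus> f) \<oplus> (d \<oplus> \<ominus> d')"
  using c by (simp add: minus_eq minus_add a_ac)
 then show ?thesis using c by (simp add: r_neg minus_eq)
qed

text \<open>A generic set yields a finite colouring of each layer with differences of equal
colours in \<open>E - E\<close>; colourings, unlike coverings, are easily combined for several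
sets.\<close>

lemma gen_col:
 assumes "gen E" "E \<subseteq> RR"
 shows "EX c :: 'b => 'b \<times> 'b. finite (c ` XX n) \<and> (ALL x:XX n. ALL y:XX n. c x = c y --> (EX d:E. EX d':E. x \<ominus> y = d \<ominus> d'))"
proof -
 obtain F where F: "finite F" "F \<subseteq> RR" "ALL x:XX 0. EX f:F. EX d:E. x = f \<oplus> d"
  using assms(1) by (auto simp: gen_def)
 from XX_cover[of n] obtain F' where "finite F' \<and> F' \<subseteq> RR \<and> (ALL x:XX n. EX f:F'. EX y:XX 0. x = f \<oplus> y)" ..
 then have F': "finite F'" "F' \<subseteq> RR" "ALL x:XX n. EX f:F'. EX y:XX 0. x = f \<oplus> y" by auto
 have "ALL x:XX n. EX p. p \<in> F' \<times> F \<and> (EX d:E. x = (fst p \<oplus> snd p) \<oplus> d)"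
 proof
  fix x assume "x \<in> XX n"
  then obtain f' y where 1: "f' \<in> F'" "y \<in> XX 0" "x = f' \<oplus> y" using F' by blast
  then obtain f d where 2: "f \<in> F" "d \<in> E" "y = f \<oplus> d" using F by blast
  then have "x = (f' \<oplus> f) \<oplus> d" using 1 F F' assms(2) by (auto simp: a_assoc subset_iff)
  then show "EX p. p \<in> F' \<times> F \<and> (EX d:E. x = (fst p \<oplus> snd p) \<oplus> d)"
   using 1 2 by (intro exI[of _ "(f', f)"]) auto
 qed
 then obtain c where c: "\<And>x. x \<in> XX n ==> c x \<in> F' \<times> F \<and> (EX d:E. x = (fst (c x) \<oplus> snd (c x)) \<oplus> d)"
  by metis
 show ?thesis
 proof (intro exI[of _ c] conjI ballI impI)
  have "c ` XX n \<subseteq> F' \<times> F" using c by blast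
  then show "finite (c ` XX n)" by (rule finite_subset) (use F F' in simp)
  fix x y assume xy: "x \<in> XX n" "y \<in> XX n" "c x = c y"
  obtain d d' where d: "d \<in> E" "x = (fst (c x) \<oplus> snd (c x)) \<oplus> d"
   "d' \<in> E" "y = (fst (c x) \<oplus> snd (c x)) \<oplus> d'" using c[OF xy(1)] c[OF xy(2)] xy(3) by metis
  have "fst (c x) \<oplus> snd (c x) \<in> RR"
   using c[OF xy(1)] F F' by (auto simp: subset_iff mem_Times_iff)
  then have "x \<ominus> y = d \<ominus> d'" using d assms(2) add_minus_add[of "fst (c x) \<oplus> snd (c x)" d d'] by (metis subsetD)
  then show "EX d:E. EX d':E. x \<ominus> y = d \<ominus> d'" using d by blast
 qed
qed

text \<open>For a type-definable subgroup this is bounded index (\<open>cc_bidx\<close>,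
\<open>bidx_coc\<close>); \<open>cc\<close> collects these subgroups and \<open>ccw\<close> those
given by countably many formulas.\<close>

definition coc :: "'b set => bool" where "coc K \<longleftrightarrow> (ALL D:NB K. gen D)"

definition cc :: "'b set => bool" where "cc K \<longleftrightarrow> asub K \<and> TD K \<and> coc K"

definition ccw :: "'b set => bool" where "ccw K \<longleftrightarrow> asub K \<and> TDw K \<and> coc K"

lemma ccw_cc: "ccw K ==> cc K" by (simp add: ccw_def cc_def TDw_TD)

lemma cc_asub: "cc K ==> asub K" and cc_TD: "cc K ==> TD K" and cc_coc: "cc K ==> coc K"
 by (auto simp: cc_def)

lemma cc_col:
 assumes "cc K" "D \<in> NB K"
 shows "EX c :: 'b => 'b \<times> 'b. finite (c ` XX n) \<and> (ALL x:XX n. ALL y:XX n. c x = c y --> x \<ominus> y \<in> D)"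
proof -
 obtain E where E: "E \<in> NB K" "ALL x:E. ALL y:E. x \<ominus> y \<in> D"
  using NB_sub[of K D] assms by (auto simp: cc_def)
 then have "gen E" "E \<subseteq> RR" using assms by (auto simp: cc_def coc_def NB_def dest: DD_carrier)
 from gen_col[OF this, of n] obtain c :: "'b => 'b \<times> 'b" where
  "finite (c ` XX n)" "ALL x:XX n. ALL y:XX n. c x = c y --> (EX d:E. EX d':E. x \<ominus> y = d \<ominus> d')" by blast
 then show ?thesis using E(2) by (intro exI[of _ c]) metis
qed

lemma coc_Int:
 assumes "cc K" "cc L" shows "coc (K \<inter> L)"
 unfolding coc_def
proof
 fix D assume D: "D \<in> NB (K \<inter> L)"
 then obtain E F where EF: "E \<in> NB K" "F \<in> NB L" "E \<inter> F \<subseteq> D"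
  using NB_two assms cc_TD by meson
 obtain c d :: "'b => 'b \<times> 'b" where
  c: "finite (c ` XX 0)" "ALL x:XX 0. ALL y:XX 0. c x = c y --> x \<ominus> y \<in> E" and
  d: "finite (d ` XX 0)" "ALL x:XX 0. ALL y:XX 0. d x = d y --> x \<ominus> y \<in> F"
  using cc_col[OF assms(1) EF(1), of 0] cc_col[OF assms(2) EF(2), of 0] by blast
 show "gen D"
 proof (rule gen_pieces[of "%x. (c x, d x)"])
  show "finite ((%x. (c x, d x)) ` XX 0)"
   by (rule finite_subset[of _ "c ` XX 0 \<times> d ` XX 0"]) (use c d in auto)
 qed (use c d EF in auto)
qed

lemma cc_Int: "cc K ==> cc L ==> cc (K \<inter> L)"
 using coc_Int by (simp add: cc_def asub_Int TD_Int)

lemma cc_finInt: "finite I ==> I \<noteq> {} ==> (\<And>i. i \<in> I ==> cc (K i)) ==> cc (\<Inter>i\<in>I. K i)"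
 by (induction I rule: finite_ne_induct) (auto intro: cc_Int)

lemma TDw_Int: "TDw D ==> TDw E ==> TDw (D \<inter> E)"
proof -
 assume "TDw D" "TDw E"
 then obtain P Q :: "nat => 'b set" where "\<And>i. P i \<in> DD" "D = (\<Inter>i. P i)" "\<And>i. Q i \<in> DD" "E = (\<Inter>i. Q i)"
  by (auto simp: TDw_def)
 then show ?thesis unfolding TDw_def
  by (intro exI[of _ "%i. P i \<inter> Q i"]) (auto intro: DD_Int)
qed

lemma TDw_INT: "(\<And>i :: nat. TDw (D i)) ==> TDw (\<Inter>i. D i)"
proof -
 assume "\<And>i :: nat. TDw (D i)"
 then obtain Q :: "nat => nat => 'b set" where Q: "\<And>i j. Q i j \<in> DD" "\<And>i. D i = (\<Inter>j. Q i j)"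
  unfolding TDw_def by metis
 have "(\<Inter>i. D i) = (\<Inter>k. Q (fst (prod_decode k)) (snd (prod_decode k)))"
 proof -
  have "(\<Inter>i. D i) = (\<Inter>p\<in>range prod_decode. Q (fst p) (snd p))"
   using Q(2) by (auto simp: surj_prod_decode)
  then show ?thesis by (simp add: image_image)
 qed
 then show ?thesis unfolding TDw_def using Q(1)
  by (intro exI[of _ "%k. Q (fst (prod_decode k)) (snd (prod_decode k))"] conjI) auto
qed

lemma ccw_Int: "ccw K ==> ccw L ==> ccw (K \<inter> L)"
 using coc_Int[OF ccw_cc ccw_cc] by (simp add: ccw_def asub_Int TDw_Int)

lemma ccw_finInt: "finite I ==> I \<noteq> {} ==> (\<And>i. i \<in> I ==> ccw (K i)) ==> ccw (\<Inter>i\<in>I. K i)"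
 by (induction I rule: finite_ne_induct) (auto intro: ccw_Int)

text \<open>A definable neighbourhood of the intersection already contains a finite
subintersection, to which finitely many colourings apply.\<close>

lemma coc_family:
 assumes "I \<noteq> {}" "|I| <o \<kappa>" "J \<noteq> {}" "|J| <o \<kappa>"
  and K: "\<And>i. i \<in> I ==> K i = (\<Inter>j\<in>J. Q i j)" "\<And>i j. i \<in> I ==> j \<in> J ==> Q i j \<in> DD"
  and cc: "\<And>i. i \<in> I ==> cc (K i)"
 shows "cc (\<Inter>i\<in>I. K i)"
 unfolding cc_def
proof (intro conjI)
 show "asub (\<Inter>i\<in>I. K i)" using assms(1) cc cc_asub by (intro asub_INT) auto
 show "TD (\<Inter>i\<in>I. K i)" by (rule TD_family[OF assms(1-4) K])
 show "coc (\<Inter>i\<in>I. K i)"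
  unfolding coc_def
 proof
  fix D assume D: "D \<in> NB (\<Inter>i\<in>I. K i)"
  let ?F = "(%(i, j). Q i j - D) ` (I \<times> J)"
  have "EX \<G>. \<G> \<subseteq> ?F \<and> finite \<G> \<and> \<G> \<noteq> {} \<and> \<Inter>\<G> = {}"
  proof (rule ccontr)
   assume *: "\<not> ?thesis"
   have "\<Inter>?F \<noteq> {}"
   proof (rule compact)
    show "?F \<subseteq> DD" using K D by (auto simp: NB_def intro!: DD_Diff)
    show "?F \<noteq> {}" using assms by auto
    show "|?F| <o \<kappa>" by (intro kImage kTimes assms)
   qed (use * in blast)
   then obtain x where x: "ALL A:?F. x \<in> A" by blast
   then have "x \<in> Q i j - D" if "i \<in> I" "j \<in> J" for i j using that by force
   then have "x \<in> (\<Inter>i\<in>I. K i)" "x \<notin> D" using K(1) assms(1,3) by auto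
   then show False using D by (auto simp: NB_def)
  qed
  then obtain \<G> where "\<G> \<subseteq> ?F" "finite \<G>" "\<G> \<noteq> {}" "\<Inter>\<G> = {}" by blast
  then obtain Z where Z: "Z \<subseteq> I \<times> J" "finite Z" "\<G> = (%(i, j). Q i j - D) ` Z"
   by (meson finite_subset_image)
  have Zne: "fst ` Z \<noteq> {}" using Z \<open>\<G> \<noteq> {}\<close> by auto
  have "(\<Inter>i\<in>fst ` Z. K i) \<subseteq> D"
  proof
   fix x assume x: "x \<in> (\<Inter>i\<in>fst ` Z. K i)"
   show "x \<in> D"
   proof (rule ccontr)
    assume "x \<notin> D"
    have "x \<in> A" if A: "A \<in> \<G>" for A
    proof -
     obtain i j where ij: "(i, j) \<in> Z" "A = Q i j - D" using A unfolding Z(3) by auto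
     then have "x \<in> K i" using x by force
     then have "x \<in> Q i j" using ij Z(1) K(1)[of i] by auto
     then show ?thesis using ij \<open>x \<notin> D\<close> by simp
    qed
    then show False using \<open>\<Inter>\<G> = {}\<close> by blast
   qed
  qed
  moreover have "cc (\<Inter>i\<in>fst ` Z. K i)" using Z Zne cc by (intro cc_finInt) auto
  ultimately show "gen D" using D by (auto simp: cc_def coc_def NB_def)
 qed
qed

lemma ccw_INT:
 assumes "\<And>i :: nat. ccw (K i)" shows "ccw (\<Inter>i. K i)"
proof -
 from assms obtain Q :: "nat => nat => 'b set" where Q: "\<And>i j. Q i j \<in> DD" "\<And>i. K i = (\<Inter>j. Q i j)"
  unfolding TDw_def ccw_def by metis
 have "cc (\<Inter>i\<in>UNIV. K i)"
  by (rule coc_family[where J = "UNIV :: nat set" and Q = Q])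
   (use Q assms in \<open>auto simp: nat_less ccw_cc simp del: UNIV_I\<close>)
 moreover have "TDw (\<Inter>i. K i)" using assms by (intro TDw_INT) (simp add: ccw_def)
 ultimately show ?thesis by (simp add: cc_def ccw_def)
qed

text \<open>Below \<open>D\<close> choose neighbourhoods of \<open>H\<close> each of which
contains the differences of the next one, and intersect them.\<close>

lemma ccw_between:
 assumes "cc H" "D \<in> NB H"
 shows "EX K. ccw K \<and> H \<subseteq> K \<and> K \<subseteq> D"
proof -
 have "EX Q :: nat => 'b set. ALL n. (Q n \<in> NB H \<and> Q n \<subseteq> D) \<and> (ALL x:Q (Suc n). ALL y:Q (Suc n). x \<ominus> y \<in> Q n)"
 proof (rule dependent_nat_choice)
  show "EX Q. Q \<in> NB H \<and> Q \<subseteq> D" using assms by blast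
  fix Q and n :: nat assume "Q \<in> NB H \<and> Q \<subseteq> D"
  then obtain E where "E \<in> NB H" "ALL x:E. ALL y:E. x \<ominus> y \<in> Q" using NB_sub assms cc_TD cc_asub by meson
  then show "EX Q'. (Q' \<in> NB H \<and> Q' \<subseteq> D) \<and> (ALL x:Q'. ALL y:Q'. x \<ominus> y \<in> Q)"
   using assms(2) by (intro exI[of _ "E \<inter> D"]) (auto intro: NB_Int)
 qed
 then obtain Q :: "nat => 'b set" where Q: "\<And>n. Q n \<in> NB H" "\<And>n. Q n \<subseteq> D"
  "\<And>n x y. x \<in> Q (Suc n) ==> y \<in> Q (Suc n) ==> x \<ominus> y \<in> Q n" by blast
 let ?K = "\<Inter>n. Q n"
 have sub: "H \<subseteq> ?K" using Q(1) by (auto simp: NB_def)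
 have "asub ?K"
 proof (rule asubI')
  show "?K \<subseteq> RR" using Q(1)[of 0] by (auto simp: NB_def dest: DD_carrier)
  show "\<zero> \<in> ?K" using sub asub_zero assms cc_asub by blast
 qed (use Q(3) in blast)
 moreover have "TDw ?K" unfolding TDw_def using Q(1) by (intro exI[of _ Q]) (auto simp: NB_def)
 moreover have "coc ?K" using assms(1) sub by (auto simp: cc_def coc_def NB_def)
 moreover have "?K \<subseteq> D" using Q(2)[of 0] by blast
 ultimately show ?thesis using sub by (intro exI[of _ ?K]) (simp add: ccw_def)
qed

end

section \<open>Densities of definable sets\<close>

sublocale definable_ring \<subseteq> dens: density R "RR" "XX 0"
 by unfold_locales (auto simp: XX_sub XX_zero)

context definable_ring
begin

lemma add_cancel: "f \<in> RR ==> y \<in> RR ==> f \<oplus> y \<ominus> f = y"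
proof -
 assume c: "f \<in> RR" "y \<in> RR"
 then have "f \<oplus> y \<ominus> f = y \<oplus> (f \<oplus> \<ominus> f)" by (simp add: minus_eq a_ac)
 then show ?thesis using c by (simp add: r_neg)
qed

lemma neg_minus: "x \<in> RR ==> y \<in> RR ==> \<ominus> (x \<ominus> y) = y \<ominus> x"
 by (simp add: minus_eq minus_add a_comm)

lemma minus_zero_r: "x \<in> RR ==> x \<ominus> \<zero> = x" by (rule dens.minus_zero_U)

abbreviation ind :: "'b set => 'b => nat" where "ind \<equiv> dens.ind"

lemma ind_mono: "(x \<in> A ==> x \<in> B) ==> ind A x \<le> ind B x" by (auto simp: dens.ind_def)

definition tr :: "'b => 'b set => 'b set" where "tr g B = {x \<in> RR. x \<ominus> g \<in> B}"

lemma bdd_XX: "dens.bdd (ind (XX n))"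
proof -
 from XX_cover[of n] obtain F where "finite F \<and> F \<subseteq> RR \<and> (ALL x:XX n. EX f:F. EX y:XX 0. x = f \<oplus> y)" ..
 then have F: "finite F" "F \<subseteq> RR" "ALL x:XX n. EX f:F. EX y:XX 0. x = f \<oplus> y" by auto
 obtain ks where ks: "set ks = F" using finite_list[OF F(1)] by blast
 show ?thesis unfolding dens.bdd_def
 proof (intro exI[of _ ks] conjI ballI)
  fix x assume x: "x \<in> RR"
  show "ind (XX n) x \<le> dens.cov ks (ind (XX 0)) x"
  proof (cases "x \<in> XX n")
   case True
   then obtain f y where f: "f \<in> set ks" "y \<in> XX 0" "x = f \<oplus> y" using F ks by blast
   then have "f \<in> RR" "y \<in> RR" using F ks XX_carrier by auto
   then have "x \<ominus> f = y" using f by (simp add: add_cancel)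
   then have "ind (XX 0) (x \<ominus> f) = 1" using f by (simp add: dens.ind_def)
   moreover have "f \<in> set ks ==> ind (XX 0) (x \<ominus> f) \<le> dens.cov ks (ind (XX 0)) x"
    by (auto simp: dens.cov_def intro!: member_le_sum_list)
   ultimately show ?thesis using f by (simp add: dens.ind_def)
  qed (simp add: dens.ind_def)
 qed (use ks F in simp)
qed

lemma bdd_ind: "Z \<subseteq> XX n ==> dens.bdd (ind Z)"
 by (rule dens.bdd_mono[OF bdd_XX[of n]]) (auto intro: ind_mono)

lemma bdd_DD: "D \<in> DD ==> dens.bdd (ind D)" using DD_bdd bdd_ind by blast

lemma gen_cov:
 assumes "gen E" "E \<subseteq> RR"
 shows "EX ks. set ks \<subseteq> RR \<and> ks \<noteq> [] \<and> (ALL x:RR. ind (XX 0) x \<le> dens.cov ks (ind E) x)"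
proof -
 obtain F where F: "finite F" "F \<subseteq> RR" "ALL x:XX 0. EX f:F. EX d:E. x = f \<oplus> d"
  using assms(1) by (auto simp: gen_def)
 obtain ks where ks: "set ks = F" using finite_list[OF F(1)] by blast
 show ?thesis
 proof (intro exI[of _ ks] conjI ballI)
  show "ks \<noteq> []" using F(3) XX_zero ks by auto
  fix x assume x: "x \<in> RR"
  show "ind (XX 0) x \<le> dens.cov ks (ind E) x"
  proof (cases "x \<in> XX 0")
   case True
   then obtain f y where f: "f \<in> set ks" "y \<in> E" "x = f \<oplus> y" using F ks by blast
   then have "f \<in> RR" "y \<in> RR" using F ks assms(2) by auto
   then have "x \<ominus> f = y" using f by (simp add: add_cancel)
   then have "ind E (x \<ominus> f) = 1" using f by (simp add: dens.ind_def)
   moreover have "f \<in> set ks ==> ind E (x \<ominus> f) \<le> dens.cov ks (ind E) x"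
    by (auto simp: dens.cov_def intro!: member_le_sum_list)
   ultimately show ?thesis using f by (simp add: dens.ind_def)
  qed (simp add: dens.ind_def)
 qed (use ks F in simp)
qed

lemma gen_upd_pos:
 assumes "gen E" "E \<in> DD" shows "0 < dens.upd (ind E)"
proof -
 obtain ks where ks: "set ks \<subseteq> RR" "ALL x:RR. ind (XX 0) x \<le> dens.cov ks (ind E) x"
  using gen_cov[OF assms(1) DD_carrier[OF assms(2)]] by blast
 have "1 \<le> dens.upd (ind (XX 0))" by (rule dens.upd_base)
 also have "\<dots> \<le> dens.upd (dens.cov ks (ind E))"
  using ks assms by (intro dens.upd_mono dens.bdd_cov bdd_DD) auto
 also have "\<dots> \<le> real (length ks) * dens.upd (ind E)"
  using ks assms by (intro dens.upd_cov_le bdd_DD)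
 finally show ?thesis using dens.upd_nonneg[OF bdd_DD[OF assms(2)]]
  by (cases "dens.upd (ind E) = 0") auto
qed

lemma gen_lod_pos:
 assumes "gen E" "E \<in> DD" shows "0 < dens.lod (ind E)"
proof -
 obtain ks where ks: "set ks \<subseteq> RR" "ks \<noteq> []" "ALL x:RR. ind (XX 0) x \<le> dens.cov ks (ind E) x"
  using gen_cov[OF assms(1) DD_carrier[OF assms(2)]] by blast
 have "real (length [\<zero>]) / real (length ks) \<in> dens.lset (ind E)"
  by (rule dens.lsetI[OF ks(2,1), where hs = "[\<zero>]"]) (use ks in \<open>auto simp: dens.minus_zero_U\<close>)
 then have "real (length [\<zero>]) / real (length ks) \<le> dens.lod (ind E)"
  by (rule dens.lod_ge[OF bdd_DD[OF assms(2)]])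
 moreover have "real (length [\<zero>]) / real (length ks) > 0" using ks by simp
 ultimately show ?thesis by linarith
qed

text \<open>A maximal subset of \<open>XX 0\<close> with no difference in \<open>S\<close> is
finite, and its translates of \<open>S\<close> cover.\<close>

lemma gen_clique:
 assumes J: "\<And>F. F \<subseteq> XX 0 ==> finite F ==> (ALL f:F. ALL f':F. f \<noteq> f' --> f \<ominus> f' \<notin> S) ==> card F < J"
  and S: "\<zero> \<in> S" "\<And>x. x \<in> S ==> \<ominus> x \<in> S"
 shows "gen S"
proof -
 let ?P = "%F. F \<subseteq> XX 0 \<and> finite F \<and> (ALL f:F. ALL f':F. f \<noteq> f' --> f \<ominus> f' \<notin> S)"
 have "?P {}" by simp
 moreover have "ALL F. ?P F --> card F < J" using J by blast
 ultimately obtain F where F: "?P F" "\<And>F'. ?P F' ==> card F' \<le> card F"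
  using ex_has_greatest_nat[of ?P "{}" card J] by blast
 show ?thesis unfolding gen_def
 proof (intro exI[of _ F] conjI ballI)
  show "F \<subseteq> RR" using F XX_sub by blast
  fix x assume x: "x \<in> XX 0"
  have "EX f:F. x \<ominus> f \<in> S"
  proof (rule ccontr)
   assume n: "\<not> ?thesis"
   have "f \<ominus> x \<notin> S" if "f \<in> F" for f
   proof
    assume "f \<ominus> x \<in> S"
    then have "\<ominus> (f \<ominus> x) \<in> S" by (rule S)
    moreover have "\<ominus> (f \<ominus> x) = x \<ominus> f"
     using that F x XX_carrier by (intro neg_minus) auto
    ultimately show False using n that by auto
   qed
   then have "?P (insert x F)" using F x n by auto
   moreover have "x \<notin> F" using n S(1) x XX_carrier by (auto simp: minus_eq r_neg)
   ultimately have "card (insert x F) \<le> card F" "x \<notin> F" using F(2) by blast+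
   then show False using F by simp
  qed
  then obtain f where f: "f \<in> F" "x \<ominus> f \<in> S" by blast
  moreover have "x = f \<oplus> (x \<ominus> f)" using x f F XX_carrier by (metis minus_cancel subsetD)
  ultimately show "EX f:F. EX d:S. x = f \<oplus> d" by blast
 qed (use F in auto)
qed

lemma ind_shift: "x \<in> RR ==> ind (tr g B) x = ind B (x \<ominus> g)"
 by (simp add: dens.ind_def tr_def)

lemma minus_minus_swap: "\<lbrakk>x \<in> RR; g \<in> RR; h \<in> RR\<rbrakk> \<Longrightarrow> x \<ominus> g \<ominus> (h \<ominus> g) = x \<ominus> h"
 by (simp add: minus_eq minus_add a_ac r_neg1 r_neg2)

text \<open>The almost-stabiliser of \<open>B\<close> at level \<open>s\<close>.\<close>

definition stab :: "'b set => real => 'b set" where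
 "stab B s = {g \<in> XX 1. s \<le> dens.upd (ind (B \<inter> tr g B))}"

lemma upd_two_translates:
 assumes "dens.bdd (ind B)" "g \<in> RR" "h \<in> RR"
 shows "dens.upd (ind (tr g B \<inter> tr h B)) = dens.upd (ind (B \<inter> tr (h \<ominus> g) B))"
proof -
 have "dens.upd (ind (B \<inter> tr (h \<ominus> g) B)) = dens.upd (%x. ind (B \<inter> tr (h \<ominus> g) B) (x \<ominus> g))"
  by (rule dens.upd_shift[symmetric])
   (use assms in \<open>auto intro: dens.bdd_mono[OF assms(1)] ind_mono\<close>)
 also have "\<dots> = dens.upd (ind (tr g B \<inter> tr h B))"
  using assms by (intro dens.upd_cong) (auto simp: dens.ind_def tr_def minus_minus_swap)
 finally show ?thesis by simp
qed

lemma stab_sym: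
 assumes "dens.bdd (ind B)" "g \<in> stab B s" shows "\<ominus> g \<in> stab B s"
proof -
 have g: "g \<in> XX 1" "g \<in> RR" using assms XX_carrier by (auto simp: stab_def)
 have "dens.upd (ind (tr g B \<inter> tr \<zero> B)) = dens.upd (ind (B \<inter> tr (\<zero> \<ominus> g) B))"
  using g assms by (intro upd_two_translates) auto
 moreover have "dens.upd (ind (tr g B \<inter> tr \<zero> B)) = dens.upd (ind (B \<inter> tr g B))"
  by (rule dens.upd_cong) (auto simp: dens.ind_def tr_def minus_zero_r)
 moreover have "\<zero> \<ominus> g = \<ominus> g" using g by (simp add: minus_eq)
 ultimately show ?thesis using assms(2) XX_neg by (simp add: stab_def)
qed

text \<open>Among \<open>J\<close> translates of \<open>B\<close>, two overlap in density at least
\<open>s\<close>: otherwise their union would be denser than the layer \<open>XX (Suc m)\<close>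
that contains it.\<close>

lemma stab_gen:
 assumes B: "B \<subseteq> XX m" and t: "0 < t" "t \<le> dens.upd (ind B)"
  and J: "dens.upd (ind (XX (Suc m))) + t \<le> real J * t" and s: "s = t / (real J)\<^sup>2"
 shows "gen (stab B s)"
proof (rule gen_clique[where J = J])
 have bB: "dens.bdd (ind B)" using bdd_ind B by blast
 have P0: "0 \<le> dens.upd (ind (XX (Suc m)))" by (rule dens.upd_nonneg[OF bdd_XX])
 then have J0: "real J \<ge> 1" using J t by (metis add_increasing mult_le_cancel_right1 order_trans linorder_not_less order_refl)
 have s_le: "s \<le> t" using J0 t s by (simp add: divide_le_eq mult_le_cancel_left1)
 have "dens.upd (ind (B \<inter> tr \<zero> B)) = dens.upd (ind B)"
  by (rule dens.upd_cong) (auto simp: dens.ind_def tr_def minus_zero_r)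
 then show "\<zero> \<in> stab B s" using s_le t XX_zero' by (simp add: stab_def)
 show "\<And>x. x \<in> stab B s ==> \<ominus> x \<in> stab B s" by (rule stab_sym[OF bB])
 fix F assume F: "F \<subseteq> XX 0" "finite F" "ALL f:F. ALL f':F. f \<noteq> f' --> f \<ominus> f' \<notin> stab B s"
 show "card F < J"
 proof (rule ccontr)
  assume "\<not> ?thesis"
  then have "J \<le> card F" by simp
  then obtain G where G: "G \<subseteq> F" "card G = J" by (meson obtain_subset_with_card_n)
  then have Gf: "finite G" "G \<subseteq> XX 0" "G \<subseteq> RR"
   using F finite_subset XX_sub[of 0] by auto
  obtain ks where ks: "set ks = G" "distinct ks" using finite_distinct_list[OF Gf(1)] by blast
  have len: "length ks = J" using ks G distinct_card by fastforce
  let ?Q = "{p \<in> G \<times> G. fst p \<noteq> snd p}"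
  let ?h = "%p. ind (tr (fst p) B \<inter> tr (snd p) B)"
  have bh: "dens.bdd (?h p)" if "p \<in> ?Q" for p
  proof -
   have "tr (fst p) B \<subseteq> XX (Suc (Suc m))"
   proof
    fix x assume x: "x \<in> tr (fst p) B"
    have f: "fst p \<in> XX m" using that Gf XX_mono[of 0 m] by auto
    have "x = fst p \<oplus> (x \<ominus> fst p)" using x f XX_carrier by (metis (no_types, lifting) minus_cancel mem_Collect_eq tr_def)
    moreover have "x \<ominus> fst p \<in> XX m" using x B by (auto simp: tr_def)
    ultimately have "x \<in> XX (Suc m)" using XX_add[OF f] by metis
    then show "x \<in> XX (Suc (Suc m))" using XX_Suc by blast
   qed
   then show ?thesis by (intro bdd_ind[of _ "Suc (Suc m)"]) auto
  qed
  have Qf: "finite ?Q" using Gf by auto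
  have cardQ: "real (card ?Q) \<le> (real J)\<^sup>2"
  proof -
   have "card ?Q \<le> card (G \<times> G)" using Gf by (intro card_mono) auto
   then have "card ?Q \<le> J * J" using G by (simp add: card_cartesian_product)
   then show ?thesis by (metis of_nat_le_iff of_nat_mult power2_eq_square)
  qed
  have lt: "dens.upd (?h p) < s" if p: "p \<in> ?Q" for p
  proof -
   have c: "fst p \<in> RR" "snd p \<in> RR" using p Gf by auto
   have "dens.upd (?h p) = dens.upd (ind (B \<inter> tr (snd p \<ominus> fst p) B))"
    by (rule upd_two_translates[OF bB c])
   moreover have "snd p \<ominus> fst p \<notin> stab B s"
    using p G(1) by (intro F(3)[rule_format, of "snd p" "fst p"]) auto
   moreover have "snd p \<ominus> fst p \<in> XX 1"
    using p Gf XX_minus[of "snd p" 0 "fst p"] by (auto simp: subset_iff)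
   ultimately show ?thesis by (simp add: stab_def)
  qed
  have pt: "dens.cov ks (ind B) x \<le> ind (XX (Suc m)) x + (\<Sum>p\<in>?Q. ?h p x)" if x: "x \<in> RR" for x
  proof -
   let ?M = "{f \<in> G. x \<ominus> f \<in> B}"
   have c: "dens.cov ks (ind B) x = card ?M"
   proof -
    have "dens.cov ks (ind B) x = (\<Sum>f\<in>G. of_bool (x \<ominus> f \<in> B))"
     using ks by (simp add: dens.cov_def dens.ind_def sum_list_distinct_conv_sum_set)
    also have "\<dots> = card ?M" using Gf by (simp add: of_bool_def sum.If_cases Int_def)
    finally show ?thesis .
   qed
   have d: "(\<Sum>p\<in>?Q. ?h p x) = card {p \<in> ?M \<times> ?M. fst p \<noteq> snd p}"
   proof -
    have "(\<Sum>p\<in>?Q. ?h p x) = (\<Sum>p\<in>?Q. of_bool (fst p \<in> ?M \<and> snd p \<in> ?M))"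
     using x by (intro sum.cong) (auto simp: dens.ind_def tr_def)
    also have "\<dots> = card {p \<in> ?Q. fst p \<in> ?M \<and> snd p \<in> ?M}"
     using Qf by (simp add: of_bool_def sum.If_cases Int_def)
    also have "{p \<in> ?Q. fst p \<in> ?M \<and> snd p \<in> ?M} = {p \<in> ?M \<times> ?M. fst p \<noteq> snd p}" by auto
    finally show ?thesis .
   qed
   show ?thesis
   proof (cases "?M = {}")
    case False
    then obtain f where f: "f \<in> G" "x \<ominus> f \<in> B" by blast
    then have "x = f \<oplus> (x \<ominus> f)" using x Gf by (metis minus_cancel subsetD)
    moreover have "f \<in> XX m" "x \<ominus> f \<in> XX m" using f Gf B XX_mono[of 0 m] by auto
    ultimately have "x \<in> XX (Suc m)" using XX_add by metis
    then have 1: "ind (XX (Suc m)) x = 1" by (simp add: dens.ind_def)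
    have "(%f'. (f, f')) ` (?M - {f}) \<subseteq> {p \<in> ?M \<times> ?M. fst p \<noteq> snd p}" using f by auto
    then have "card ((%f'. (f, f')) ` (?M - {f})) \<le> card {p \<in> ?M \<times> ?M. fst p \<noteq> snd p}"
     using Gf by (intro card_mono) auto
    moreover have "card ((%f'. (f, f')) ` (?M - {f})) = card ?M - 1"
     using f Gf by (subst card_image) (auto simp: inj_on_def)
    ultimately show ?thesis using c d 1 by linarith
   next
    case True
    have "dens.cov ks (ind B) x = 0" unfolding c True by simp
    then show ?thesis by simp
   qed
  qed
  have "real J * t \<le> real J * dens.upd (ind B)" using t by (intro mult_left_mono) auto
  also have "\<dots> \<le> dens.upd (dens.cov ks (ind B))"
   using dens.upd_cov_ge[OF bB, of ks] ks Gf len by simp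
  also have "\<dots> \<le> dens.upd (%x. ind (XX (Suc m)) x + (\<Sum>p\<in>?Q. ?h p x))"
   using pt bdd_XX bh Qf by (intro dens.upd_mono dens.bdd_add dens.bdd_sum) auto
  also have "\<dots> \<le> dens.upd (ind (XX (Suc m))) + dens.upd (%x. \<Sum>p\<in>?Q. ?h p x)"
   using bdd_XX bh Qf by (intro dens.upd_add dens.bdd_sum) auto
  also have "dens.upd (%x. \<Sum>p\<in>?Q. ?h p x) \<le> (\<Sum>p\<in>?Q. dens.upd (?h p))"
   using bh Qf by (intro dens.upd_sum_le) auto
  also have "\<dots> < t"
  proof (cases "?Q = {}")
   case True
   have "(\<Sum>p\<in>?Q. dens.upd (?h p)) = 0" unfolding True by simp
   then show ?thesis using t by linarith
  next
   case False
   then have "(\<Sum>p\<in>?Q. dens.upd (?h p)) < (\<Sum>p\<in>?Q. s)"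
    using lt Qf by (intro sum_strict_mono) auto
   also have "\<dots> = real (card ?Q) * s" by simp
   also have "\<dots> \<le> (real J)\<^sup>2 * s" using cardQ s t by (intro mult_right_mono) auto
   also have "\<dots> = t" using s J0 by simp
   finally show ?thesis .
  qed
  finally show False using J by linarith
 qed
qed

lemma DD_TDw: "D \<in> DD ==> TDw D" unfolding TDw_def by (intro exI[of _ "%i. D"]) auto

lemma DD_tr: "B \<in> DD ==> g \<in> RR ==> tr g B \<in> DD"
proof -
 assume B: "B \<in> DD" and g: "g \<in> RR"
 obtain m where m: "B \<subseteq> XX m" using DD_bdd B by blast
 obtain n where n: "g \<in> XX n" using g in_carrierE by blast
 have "tr g B \<subseteq> XX (Suc (max m n))"
 proof
  fix x assume x: "x \<in> tr g B"
  then have "x = g \<oplus> (x \<ominus> g)" using g by (auto simp: tr_def minus_cancel)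
  moreover have "g \<in> XX (max m n)" "x \<ominus> g \<in> XX (max m n)"
   using x n m XX_mono[of m "max m n"] XX_mono[of n "max m n"] by (auto simp: tr_def)
  ultimately show "x \<in> XX (Suc (max m n))" using XX_add by metis
 qed
 then have "tr g B = {x \<in> XX (Suc (max m n)). x \<ominus> g \<in> B}" using XX_carrier by (auto simp: tr_def)
 also have "\<dots> \<in> DD" by (intro DD_collect XX_DD LD_mem B LT_minus LT_var LT_const g)
 finally show ?thesis .
qed

lemma LD_count:
 fixes n J :: nat
 assumes "\<And>i. i < n ==> P i \<in> LD" "\<And>j. j < J ==> Q j \<in> LD"
 shows "(%e. (\<Sum>i\<in>{0..<n}. of_bool (P i e) :: nat) \<le> (\<Sum>j\<in>{0..<J}. of_bool (Q j e))) \<in> LD"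
proof -
 let ?\<Phi> = "%i. if i < n then P i else Q (i - n)"
 let ?F = "%Z. card (Z \<inter> {0..<n}) \<le> card (Z \<inter> {n..<n + J})"
 have "(%e. ?F {i \<in> {0..<n + J}. ?\<Phi> i e}) \<in> LD"
  by (rule LD_fin) (use assms in auto)
 moreover have "?F {i \<in> {0..<n + J}. ?\<Phi> i e} = ((\<Sum>i\<in>{0..<n}. of_bool (P i e) :: nat) \<le> (\<Sum>j\<in>{0..<J}. of_bool (Q j e)))" for e
 proof -
  have 1: "{i \<in> {0..<n + J}. ?\<Phi> i e} \<inter> {0..<n} = {i \<in> {0..<n}. P i e}" by auto
  have 2: "{i \<in> {0..<n + J}. ?\<Phi> i e} \<inter> {n..<n + J} = (%j. j + n) ` {j \<in> {0..<J}. Q j e}"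
  proof (intro equalityI subsetI)
   fix i assume "i \<in> {i \<in> {0..<n + J}. ?\<Phi> i e} \<inter> {n..<n + J}"
   then show "i \<in> (%j. j + n) ` {j \<in> {0..<J}. Q j e}" by (intro image_eqI[of _ _ "i - n"]) auto
  qed auto
  have 3: "(\<Sum>i\<in>{0..<N}. of_bool (P i) :: nat) = card {i \<in> {0..<N}. P i}" for P :: "nat => bool" and N
   by (simp add: of_bool_def sum.If_cases Int_def)
  show ?thesis unfolding 1 2 3 by (simp add: card_image inj_on_def)
 qed
 ultimately show ?thesis by simp
qed

lemma cov_map_upt: "dens.cov (map e [0..<n]) f x = (\<Sum>i\<in>{0..<n}. f (x \<ominus> e i))"
 by (simp add: dens.cov_def interv_sum_list_conv_sum_set_nat comp_def)

text \<open>A lower bound on the upper density says that certain coverings with natural number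
lengths do not exist, and each of these countably many conditions is definable.\<close>

lemma stab_TDw:
 assumes B: "B \<in> DD"
 shows "TDw (stab B s)"
proof -
 obtain m where m: "B \<subseteq> XX m" using DD_bdd B by blast
 have bB: "dens.bdd (ind B)" using bdd_DD B by blast
 let ?M = "%N. Suc (max N m)"
 let ?\<Phi> = "%g gs hs N. ALL x:XX (?M N). dens.cov gs (%y. of_bool (y \<in> B \<and> y \<ominus> g \<in> B)) x \<le> dens.cov hs (%y. of_bool (y \<in> XX 0)) x"
 let ?S = "%n J N. {g \<in> XX 1. 0 < n --> real J < s * real n -->
  \<not> (EX gs. length gs = n \<and> set gs \<subseteq> XX N \<and> (EX hs. length hs = J \<and> set hs \<subseteq> XX N \<and> ?\<Phi> g gs hs N))}"
 have "?S n J N \<in> DD" for n J N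
  apply (rule DD_collect[OF XX_DD])
  apply (intro LD_imp LD_triv LD_not)
  apply (rule LD_exlist)
  apply (rule LD_exlist)
  apply (rule LD_ball)
  unfolding cov_map_upt
  by (intro LD_count LD_conj LD_mem B XX_DD LT_minus LT_var)
 then have "TDw (\<Inter>n. \<Inter>J. \<Inter>N. ?S n J N)" by (intro TDw_INT DD_TDw)
 moreover have "stab B s = (\<Inter>n. \<Inter>J. \<Inter>N. ?S n J N)"
 proof (intro equalityI subsetI)
  fix g assume g: "g \<in> stab B s"
  show "g \<in> (\<Inter>n. \<Inter>J. \<Inter>N. ?S n J N)"
  proof (intro INT_I CollectI conjI impI notI)
   show "g \<in> XX 1" using g by (simp add: stab_def)
   fix n J N assume n: "0 < n" "real J < s * real n"
    "EX gs. length gs = n \<and> set gs \<subseteq> XX N \<and> (EX hs. length hs = J \<and> set hs \<subseteq> XX N \<and> ?\<Phi> g gs hs N)"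
   then obtain gs hs where l: "length gs = n" "set gs \<subseteq> XX N" "length hs = J" "set hs \<subseteq> XX N" and P: "?\<Phi> g gs hs N" by blast
   have "dens.upd (ind (B \<inter> tr g B)) \<le> real J / real n"
   proof (rule dens.upd_le, rule dens.usetI)
    show "gs \<noteq> []" using l n by auto
    show "set gs \<subseteq> RR" "set hs \<subseteq> RR" using l XX_sub by blast+
    show "real J / real n = real (length hs) / real (length gs)" using l by simp
    fix x assume x: "x \<in> RR"
    show "dens.cov gs (ind (B \<inter> tr g B)) x \<le> dens.cov hs (ind (XX 0)) x"
    proof (cases "x \<in> XX (?M N)")
     case True
     have 1: "dens.cov gs (ind (B \<inter> tr g B)) x = dens.cov gs (%y. of_bool (y \<in> B \<and> y \<ominus> g \<in> B)) x"
      unfolding dens.cov_def using B DD_carrier by (intro arg_cong[of _ _ sum_list] map_cong) (auto simp: dens.ind_def tr_def)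
     have 2: "ind (XX 0) = (%y. of_bool (y \<in> XX 0))" by (auto simp: dens.ind_def)
     show ?thesis unfolding 1 2 using P True by blast
    next
     case False
     have "ind (B \<inter> tr g B) (x \<ominus> k) = 0" if "k \<in> set gs" for k
     proof (rule ccontr)
      assume "ind (B \<inter> tr g B) (x \<ominus> k) \<noteq> 0"
      then have "x \<ominus> k \<in> XX m" using m by (auto simp: dens.ind_def)
      moreover have "k \<in> XX N" using that l by auto
      ultimately have "k \<in> XX (max N m)" "x \<ominus> k \<in> XX (max N m)"
       using XX_monoD by (auto intro: XX_monoD)
      then have "k \<oplus> (x \<ominus> k) \<in> XX (?M N)" by (rule XX_add)
      then show False using False x \<open>k \<in> XX N\<close> XX_carrier by (simp add: minus_cancel)
     qed
     then have "dens.cov gs (ind (B \<inter> tr g B)) x = 0"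
      by (simp add: dens.cov_def sum_list_eq_0_iff)
     then show ?thesis by simp
    qed
   qed
   then have "s \<le> real J / real n" using g by (simp add: stab_def)
   then have "s * real n \<le> real J" using n by (simp add: le_divide_eq)
   then show False using n by simp
  qed
 next
  fix g assume g: "g \<in> (\<Inter>n. \<Inter>J. \<Inter>N. ?S n J N)"
  then have gS: "g \<in> ?S n J N" for n J N by blast
  have g1: "g \<in> XX 1" using gS[of 0 0 0] by simp
  have bd: "dens.bdd (ind (B \<inter> tr g B))" by (rule dens.bdd_mono[OF bB]) (auto intro: ind_mono)
  show "g \<in> stab B s"
  proof (rule ccontr)
   assume "g \<notin> stab B s"
   then have "dens.upd (ind (B \<inter> tr g B)) < s" using g1 by (simp add: stab_def)
   from dens.upd_less[OF bd this] obtain gs hs where u: "gs \<noteq> []" "set gs \<subseteq> RR" "set hs \<subseteq> RR"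
    "ALL x:RR. dens.cov gs (ind (B \<inter> tr g B)) x \<le> dens.cov hs (ind (XX 0)) x"
    "real (length hs) / real (length gs) < s" by (auto simp: dens.uset_def)
   have "EX N. set gs \<union> set hs \<subseteq> XX N"
   proof -
    have "finite (set gs \<union> set hs)" "set gs \<union> set hs \<subseteq> RR" using u by auto
    then show ?thesis
    proof (induction rule: finite_induct)
     case (insert a A)
     then obtain N where N: "A \<subseteq> XX N" by auto
     obtain n where n: "a \<in> XX n" using insert in_carrierE by (metis insert_subset)
     have "insert a A \<subseteq> XX (max N n)" using N n XX_mono[of N "max N n"] XX_mono[of n "max N n"] by auto
     then show ?case by blast
    qed simp
   qed
   then obtain N where N: "set gs \<subseteq> XX N" "set hs \<subseteq> XX N" by auto
   have "real (length hs) < s * real (length gs)" using u by (simp add: divide_less_eq)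
   moreover have "0 < length gs" using u by simp
   moreover have "?\<Phi> g gs hs N"
   proof
    fix x assume x: "x \<in> XX (?M N)"
    have 1: "dens.cov gs (ind (B \<inter> tr g B)) x = dens.cov gs (%y. of_bool (y \<in> B \<and> y \<ominus> g \<in> B)) x"
      unfolding dens.cov_def using B DD_carrier by (intro arg_cong[of _ _ sum_list] map_cong) (auto simp: dens.ind_def tr_def)
    have 2: "ind (XX 0) = (%y. of_bool (y \<in> XX 0))" by (auto simp: dens.ind_def)
    show "dens.cov gs (%y. of_bool (y \<in> B \<and> y \<ominus> g \<in> B)) x \<le> dens.cov hs (%y. of_bool (y \<in> XX 0)) x"
     using u(4) x XX_carrier unfolding 1[symmetric] 2[symmetric] by blast
   qed
   ultimately show False using gS[of "length gs" "length hs" N] N by blast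
  qed
 qed
 ultimately show ?thesis by simp
qed

section \<open>A Bogolyubov theorem\<close>

definition dbl :: "'b set => 'b set" where "dbl S = S <+> S"

lemma dbl_iff: "z \<in> dbl S \<longleftrightarrow> (EX x:S. EX y:S. z = x \<oplus> y)" by (simp add: dbl_def set_add_iff)

lemma dbl_DD: "S \<in> DD ==> dbl S \<in> DD" by (simp add: dbl_def DD_add)

lemma dbl_mono: "S \<subseteq> T ==> dbl S \<subseteq> dbl T" unfolding subset_iff dbl_iff by blast

lemma dbl_neg: "S \<subseteq> RR ==> (\<And>x. x \<in> S ==> \<ominus> x \<in> S) ==> x \<in> dbl S ==> \<ominus> x \<in> dbl S"
 unfolding dbl_iff by (metis minus_add subsetD)

lemma dbl_zero: "\<zero> \<in> S ==> \<zero> \<in> dbl S" unfolding dbl_iff by (metis l_zero zero_closed)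

lemma dbl_sub: "\<zero> \<in> S ==> S \<subseteq> RR ==> S \<subseteq> dbl S" unfolding dbl_iff using r_zero by (metis dbl_iff subset_iff)

lemma dbl_compact:
 assumes dir: "dirf \<F>" and small: "|\<F>| <o \<kappa>" "\<F> \<subseteq> DD"
  and T: "\<And>D. D \<in> \<F> ==> T D \<in> DD"
  and mono: "\<And>D E. D \<in> \<F> ==> E \<in> \<F> ==> D \<subseteq> E ==> T D \<subseteq> T E"
  and z: "\<And>D. D \<in> \<F> ==> z \<in> dbl (T D)"
 shows "z \<in> dbl (\<Inter>D\<in>\<F>. T D)"
proof -
 obtain D0 where D0: "D0 \<in> \<F>" using dir by (auto simp: dirf_def)
 then have "dbl (T D0) \<subseteq> RR" using T dbl_DD DD_carrier by blast
 then have zc: "z \<in> RR" using z D0 by blast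
 have "EX x. ALL D:\<F>. x \<in> {x \<in> T D. z \<ominus> x \<in> T D}"
 proof (rule compact_dir[OF dir small(1)])
  fix D assume D: "D \<in> \<F>"
  show "{x \<in> T D. z \<ominus> x \<in> T D} \<in> DD"
   by (intro DD_collect LD_mem T D LT_minus LT_const LT_var zc)
  obtain x y where xy: "x \<in> T D" "y \<in> T D" "z = x \<oplus> y" using z[OF D] by (auto simp: dbl_iff)
  then have "z \<ominus> x = y" using T[OF D] DD_carrier by (auto intro!: add_cancel)
  then show "{x \<in> T D. z \<ominus> x \<in> T D} \<noteq> {}" using xy by auto
 qed (use mono in blast)
 then obtain x where x: "\<And>D. D \<in> \<F> ==> x \<in> T D \<and> z \<ominus> x \<in> T D" by blast
 then have "x \<in> RR" using D0 T DD_carrier by blast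
 then have "z = x \<oplus> (z \<ominus> x)" using zc by (simp add: minus_cancel)
 then show ?thesis using x unfolding dbl_iff by blast
qed

definition gsym :: "'b set => bool" where
 "gsym E \<longleftrightarrow> E \<in> DD \<and> gen E \<and> \<zero> \<in> E \<and> (ALL x:E. \<ominus> x \<in> E)"

fun psum :: "(nat => 'b) => nat => 'b" where
 "psum g 0 = \<zero>"
| "psum g (Suc n) = psum g n \<oplus> g n"

lemma psum_carrier: "(\<And>i. i < n ==> g i \<in> RR) ==> psum g n \<in> RR"
 by (induction n) auto

lemma chain_count:
 fixes b :: "nat => bool"
 shows "(\<Sum>i<k. of_bool (b i \<and> b (Suc i)) :: nat) + of_bool (b 0) \<le> (\<Sum>i<k. of_bool (b i)) + of_bool (b k)"
proof (induction k)
 case (Suc k)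
 have "of_bool (b k \<and> b (Suc k)) + of_bool (b k) \<le> of_bool (b k) + (of_bool (b (Suc k)) :: nat)" by simp
 with Suc show ?case unfolding sum.lessThan_Suc by linarith
qed simp

text \<open>If each \<open>g i\<close> moves \<open>W\<close> by a small proportion of its lower
density, then the sum of the eight moves it by less than all of it, so \<open>W\<close> still
meets its translate.\<close>

lemma chain_meets:
 assumes W: "W \<in> DD" "0 < dens.lod (ind W)"
  and g: "\<And>i. i < 8 ==> g i \<in> RR"
  and large: "\<And>i. i < 8 ==> (31/32)\<^sup>2 * dens.lod (ind W) \<le> dens.lod (ind (W \<inter> tr (g i) W))"
 shows "EX w:W. EX w':W. psum g 8 = w \<ominus> w'"
proof -
 let ?s = "psum g"
 have sc: "?s i \<in> RR" if "i \<le> 8" for i using that g by (intro psum_carrier) auto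
 have bW: "dens.bdd (ind W)" using W bdd_DD by blast
 have bT: "dens.bdd (ind (tr h W \<inter> Z))" if "h \<in> RR" for h Z
 proof -
  have "dens.bdd (dens.cov [h] (ind W))" by (rule dens.bdd_cov[OF bW]) (use that in simp)
  then show ?thesis
   by (rule dens.bdd_mono) (use that in \<open>auto simp: ind_shift[symmetric] intro: ind_mono\<close>)
 qed
 have "W \<inter> tr (?s 8) W \<noteq> {}"
 proof
  assume dis: "W \<inter> tr (?s 8) W = {}"
  let ?V = "%i. tr (?s i) W"
  have pt: "ind W x + (\<Sum>i<8. ind (?V i \<inter> ?V (Suc i)) x) \<le> dens.cov (map ?s [0..<8]) (ind W) x" if x: "x \<in> RR" for x
  proof -
   have c: "dens.cov (map ?s [0..<8]) (ind W) x = (\<Sum>i<8. of_bool (x \<in> ?V i))"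
    using x unfolding cov_map_upt by (simp add: dens.ind_def tr_def lessThan_atLeast0)
   have i: "(\<Sum>i<8. ind (?V i \<inter> ?V (Suc i)) x) = (\<Sum>i<8. of_bool (x \<in> ?V i \<and> x \<in> ?V (Suc i)))"
    by (simp add: dens.ind_def)
   have V0: "x \<in> ?V 0 \<longleftrightarrow> x \<in> W" using x by (simp add: tr_def minus_zero_r)
   have "(\<Sum>i<8. of_bool (x \<in> ?V i \<and> x \<in> ?V (Suc i)) :: nat) + of_bool (x \<in> ?V 0) \<le> (\<Sum>i<8. of_bool (x \<in> ?V i)) + of_bool (x \<in> ?V 8)"
    using chain_count[of "%i. x \<in> ?V i" 8] .
   moreover have "(\<Sum>i<8. of_bool (x \<in> ?V i \<and> x \<in> ?V (Suc i)) :: nat) \<le> (\<Sum>i<8. of_bool (x \<in> ?V i))"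
    by (rule sum_mono) auto
   ultimately show ?thesis unfolding c i
    using dis V0 by (cases "x \<in> ?V 8") (auto simp: dens.ind_def)
  qed
  have step: "(31/32)\<^sup>2 * dens.lod (ind W) \<le> dens.lod (ind (?V i \<inter> ?V (Suc i)))" if i: "i < 8" for i
  proof -
   have si: "?s i \<in> RR" "g i \<in> RR" using sc[of i] g i by auto
   have "dens.lod (ind (?V i \<inter> ?V (Suc i))) = dens.lod (%x. ind (W \<inter> tr (g i) W) (x \<ominus> ?s i))"
   proof -
    have e: "ind (?V i \<inter> ?V (Suc i)) x = ind (W \<inter> tr (g i) W) (x \<ominus> ?s i)" if "x \<in> RR" for x
     using that si by (simp add: dens.ind_def tr_def dens.minus_minus_eq)
    have b: "dens.bdd (ind (?V i \<inter> ?V (Suc i)))" by (rule bT[OF si(1)])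
    then have "dens.bdd (%x. ind (W \<inter> tr (g i) W) (x \<ominus> ?s i))"
     by (rule dens.bdd_mono) (simp only: e order_refl)
    then show ?thesis using b by (intro antisym dens.lod_mono) (simp_all only: e order_refl)
   qed
   also have "\<dots> = dens.lod (ind (W \<inter> tr (g i) W))"
    by (rule dens.lod_shift) (use si bT[of "g i" W] in \<open>auto simp: Int_commute\<close>)
   finally show ?thesis using large[OF i] by simp
  qed
  have b: "dens.bdd (ind (?V i \<inter> ?V (Suc i)))" if "i < 8" for i using bT sc[of i] that by simp
  have "dens.lod (ind W) + 8 * ((31/32)\<^sup>2 * dens.lod (ind W)) = dens.lod (ind W) + (\<Sum>i<8::nat. (31/32)\<^sup>2 * dens.lod (ind W))"
   by simp
  also have "\<dots> \<le> dens.lod (ind W) + (\<Sum>i<8. dens.lod (ind (?V i \<inter> ?V (Suc i))))"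
   using step by (intro add_mono sum_mono) auto
  also have "\<dots> \<le> dens.lod (ind W) + dens.lod (%x. \<Sum>i<8. ind (?V i \<inter> ?V (Suc i)) x)"
   using b by (intro add_mono dens.lod_sum_ge) auto
  also have "\<dots> \<le> dens.lod (%x. ind W x + (\<Sum>i<8. ind (?V i \<inter> ?V (Suc i)) x))"
   using b by (intro dens.lod_add bW dens.bdd_sum) auto
  also have "\<dots> \<le> dens.lod (dens.cov (map ?s [0..<8]) (ind W))"
   using pt sc bW by (intro dens.lod_mono dens.bdd_cov) auto
  also have "\<dots> \<le> 8 * dens.lod (ind W)"
   using dens.lod_cov_le[OF bW, of "map ?s [0..<8]"] sc by (simp add: image_subset_iff)
  finally have "1 + 8 * (31/32)\<^sup>2 \<le> (8::real)"
   using W(2) by (simp add: power2_eq_square field_simps)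
  then show False by (simp add: power2_eq_square)
 qed
 then obtain w where w: "w \<in> W" "w \<ominus> ?s 8 \<in> W" by (auto simp: tr_def)
 have wc: "w \<in> RR" using w W DD_carrier by blast
 have "w \<ominus> (w \<ominus> ?s 8) = ?s 8"
 proof -
  have "w \<ominus> (w \<ominus> ?s 8) = (w \<oplus> \<ominus> w) \<oplus> ?s 8"
   using wc sc[of 8] by (simp add: minus_eq minus_add a_assoc)
  then show ?thesis using wc sc[of 8] by (simp add: r_neg)
 qed
 then show ?thesis using w by metis
qed

lemma dbl3_psum:
 assumes "S \<subseteq> RR" "z \<in> dbl (dbl (dbl S))"
 shows "EX g. (ALL i<8. g i \<in> S) \<and> z = psum g 8"
proof -
 obtain u v where u: "u \<in> dbl (dbl S)" and v: "v \<in> dbl (dbl S)" and zuv: "z = u \<oplus> v"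
  using assms(2) unfolding dbl_iff[of z] by blast
 obtain u1 u2 where u12: "u1 \<in> dbl S" "u2 \<in> dbl S" "u = u1 \<oplus> u2" using u unfolding dbl_iff[of u] by blast
 obtain v1 v2 where v12: "v1 \<in> dbl S" "v2 \<in> dbl S" "v = v1 \<oplus> v2" using v unfolding dbl_iff[of v] by blast
 obtain a b where ab: "a \<in> S" "b \<in> S" "u1 = a \<oplus> b" using u12(1) unfolding dbl_iff by blast
 obtain c d where cd: "c \<in> S" "d \<in> S" "u2 = c \<oplus> d" using u12(2) unfolding dbl_iff by blast
 obtain e f where ef: "e \<in> S" "f \<in> S" "v1 = e \<oplus> f" using v12(1) unfolding dbl_iff by blast
 obtain h k where hk: "h \<in> S" "k \<in> S" "v2 = h \<oplus> k" using v12(2) unfolding dbl_iff by blast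
 have m: "a \<in> S" "b \<in> S" "c \<in> S" "d \<in> S" "e \<in> S" "f \<in> S" "h \<in> S" "k \<in> S"
  and z: "z = ((a \<oplus> b) \<oplus> (c \<oplus> d)) \<oplus> ((e \<oplus> f) \<oplus> (h \<oplus> k))"
  using zuv u12(3) v12(3) ab cd ef hk by simp_all
 let ?g = "%i. [a, b, c, d, e, f, h, k] ! i"
 have "?g i \<in> S" if "i < 8" for i
 proof -
  have "?g i \<in> set [a, b, c, d, e, f, h, k]" using that by (intro nth_mem) simp
  then show ?thesis using m by auto
 qed
 moreover have "z = psum ?g 8"
 proof -
  have c: "a \<in> RR" "b \<in> RR" "c \<in> RR" "d \<in> RR"
   "e \<in> RR" "f \<in> RR" "h \<in> RR" "k \<in> RR" using m assms(1) by auto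
  then show ?thesis unfolding z by (simp add: numeral_eq_Suc a_assoc)
 qed
 ultimately show ?thesis by blast
qed

text \<open>Pigeonhole: a quantity bounded below cannot drop by a fixed factor at every
step.\<close>

lemma stab_chain:
 fixes t :: "nat => real" and f :: "real => real"
 assumes "0 < c" "\<And>i. c \<le> f (t i)"
 shows "EX i. 31/32 * f (t i) \<le> f (t (Suc i))"
proof (rule ccontr)
 assume "\<not> ?thesis"
 then have less: "f (t (Suc i)) < 31/32 * f (t i)" for i by (simp add: not_le)
 have "f (t n) \<le> (31/32) ^ n * f (t 0)" for n
 proof (induction n)
  case (Suc n)
  then show ?case using less[of n] by simp
 qed simp
 moreover have f0: "0 < f (t 0)" using assms(1) assms(2)[of 0] by linarith
 obtain n :: nat where "(31/32) ^ n < c / f (t 0)"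
  using real_arch_pow_inv[of "c / f (t 0)" "31/32"] assms(1) f0 by auto
 then have "(31/32) ^ n * f (t 0) < c" using f0 by (simp add: less_divide_eq)
 ultimately show False using assms(2)[of n] by (smt (verit, best))
qed

text \<open>The argument of Sanders and of Massicot and Wagner. Among the definable
\<open>B\<close> in \<open>E\<close> of density at least \<open>t\<close>, take \<open>B +
E\<close> of almost least lower density, at a level \<open>t\<close> at which this minimum hardly
changes when \<open>t\<close> is replaced by the much smaller overlap guaranteed by
\<open>stab_gen\<close>. For \<open>g\<close> in the almost-stabiliser of \<open>B\<close>, the
sum \<open>(B \<inter> (g + B)) + E\<close> is then almost all of \<open>B + E\<close>, so
\<open>g\<close> almost stabilises \<open>W = B + E\<close>, and eight such \<open>g\<close> still
sum to a difference of elements of \<open>W\<close>.\<close>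

lemma bogolyubov_step:
 assumes E: "gsym E"
 shows "EX S. gsym S \<and> dbl (dbl (dbl S)) \<subseteq> dbl (dbl E)"
proof -
 have EDD: "E \<in> DD" and Egen: "gen E" and E0: "\<zero> \<in> E" and Eneg: "\<And>x. x \<in> E ==> \<ominus> x \<in> E"
  using E by (auto simp: gsym_def)
 have Ec: "E \<subseteq> RR" by (rule DD_carrier[OF EDD])
 obtain m where m: "E \<subseteq> XX m" using DD_bdd EDD by blast
 define P where "P = dens.upd (ind (XX (Suc m)))"
 \<comment> \<open>\<open>J t\<close> translates suffice in \<open>stab_gen\<close> for sets of density \<open>t\<close>.\<close>
 define J where "J t = nat \<lceil>(P + t) / t\<rceil>" for t
 define t where "t = rec_nat (dens.upd (ind E)) (%_ t. t / (real (J t))\<^sup>2)"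
 have t0: "t 0 = dens.upd (ind E)" and tS: "t (Suc i) = t i / (real (J (t i)))\<^sup>2" for i
  by (simp_all add: t_def)
 have P0: "0 \<le> P" unfolding P_def by (rule dens.upd_nonneg[OF bdd_XX])
 have Jt: "P + u \<le> real (J u) * u" "1 \<le> real (J u)" if "0 < u" for u
 proof -
  have "(P + u) / u \<le> real (J u)" unfolding J_def by linarith
  then show "P + u \<le> real (J u) * u" using that by (simp add: divide_le_eq)
  then have "u \<le> real (J u) * u" using P0 by linarith
  then show "1 \<le> real (J u)" using that by (simp add: mult_le_cancel_right1)
 qed
 have tpos: "0 < t i" for i
 proof (induction i)
  case 0 then show ?case using gen_upd_pos[OF Egen EDD] t0 by simp
 next
  case (Suc i) then show ?case using Jt(2)[OF Suc] unfolding tS by (intro divide_pos_pos zero_less_power) auto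
 qed
 have tdec: "t (Suc i) \<le> t i" for i
 proof -
  have "1 \<le> (real (J (t i)))\<^sup>2" using Jt(2)[OF tpos[of i]] by (rule one_le_power)
  then show ?thesis unfolding tS using tpos[of i] by (simp add: divide_le_eq mult_le_cancel_left1)
 qed
 have tle: "t i \<le> dens.upd (ind E)" for i
  by (induction i) (use t0 tdec order_trans in auto)
 define \<B> where "\<B> u = {B \<in> DD. B \<subseteq> E \<and> u \<le> dens.upd (ind B)}" for u
 define f where "f u = (INF B\<in>\<B> u. dens.lod (ind (B <+> E)))" for u
 define c where "c = dens.lod (ind E)"
 have c: "0 < c" unfolding c_def by (rule gen_lod_pos[OF Egen EDD])
 have low: "c \<le> dens.lod (ind (B <+> E))" if B: "B \<in> \<B> u" "0 < u" for B u
 proof -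
  have BDD: "B \<in> DD" and "0 < dens.upd (ind B)" using B by (auto simp: \<B>_def)
  then have "B \<noteq> {}" using dens.upd_zero by (auto simp: dens.ind_def[abs_def])
  then obtain b where b: "b \<in> B" by blast
  then have bc: "b \<in> RR" using BDD DD_carrier by blast
  have "c = dens.lod (%x. ind E (x \<ominus> b))" unfolding c_def
   by (rule dens.lod_shift[symmetric, OF bdd_DD[OF EDD] bc])
  also have "\<dots> \<le> dens.lod (ind (B <+> E))"
  proof (rule dens.lod_mono[OF bdd_DD[OF DD_add[OF BDD EDD]]])
   fix x assume x: "x \<in> RR"
   have "x \<in> B <+> E" if "x \<ominus> b \<in> E"
    using that b minus_cancel[OF x bc] unfolding set_add_iff by metis
   then show "ind E (x \<ominus> b) \<le> ind (B <+> E) x" by (simp add: dens.ind_def)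
  qed
  finally show ?thesis .
 qed
 have EB: "E \<in> \<B> (t i)" for i using tle EDD by (simp add: \<B>_def)
 have bb: "bdd_below ((%B. dens.lod (ind (B <+> E))) ` \<B> (t i))" for i
  by (rule bdd_belowI2[of _ c]) (use low tpos in blast)
 have fc: "c \<le> f (t i)" for i unfolding f_def
  by (rule cINF_greatest) (use EB low tpos in blast)+
 \<comment> \<open>From this level to the next the minimum drops by a factor of at most 31/32.\<close>
 obtain i where i: "31/32 * f (t i) \<le> f (t (Suc i))" using stab_chain[where f = f and t = t, OF c fc] by blast
 have "f (t i) < 32/31 * f (t i)" using fc[of i] c by simp
 then obtain B where B: "B \<in> \<B> (t i)" "dens.lod (ind (B <+> E)) < 32/31 * f (t i)"
  using cINF_less_iff[OF _ bb[of i]] EB[of i] unfolding f_def by blast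
 have BDD: "B \<in> DD" "B \<subseteq> E" "t i \<le> dens.upd (ind B)" using B by (auto simp: \<B>_def)
 let ?W = "B <+> E :: 'b set"
 let ?S = "stab B (t (Suc i))"
 have WDD: "?W \<in> DD" by (rule DD_add[OF BDD(1) EDD])
 have W0: "0 < dens.lod (ind ?W)" using low[OF B(1) tpos] c by linarith
 have Sgen: "gen ?S"
  by (rule stab_gen[OF _ tpos BDD(3) _ tS]) (use BDD m Jt(1)[OF tpos] in \<open>auto simp: P_def\<close>)
 have Sneg: "\<And>x. x \<in> ?S ==> \<ominus> x \<in> ?S" by (rule stab_sym[OF bdd_DD[OF BDD(1)]])
 have S0: "\<zero> \<in> ?S"
 proof -
  have "dens.upd (ind (B \<inter> tr \<zero> B)) = dens.upd (ind B)"
   by (rule dens.upd_cong) (auto simp: dens.ind_def tr_def minus_zero_r)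
  then show ?thesis using BDD(3) tdec[of i] XX_zero' by (simp add: stab_def)
 qed
 have Slarge: "(31/32)\<^sup>2 * dens.lod (ind ?W) \<le> dens.lod (ind (?W \<inter> tr g ?W))" if g: "g \<in> ?S" for g
 proof -
  have gc: "g \<in> RR" using g XX_carrier by (auto simp: stab_def)
  let ?B = "B \<inter> tr g B"
  have BB: "?B \<in> \<B> (t (Suc i))"
   using g BDD DD_Int[OF BDD(1) DD_tr[OF BDD(1) gc]] by (auto simp: \<B>_def stab_def)
  have "(31/32)\<^sup>2 * dens.lod (ind ?W) \<le> (31/32)\<^sup>2 * (32/31 * f (t i))"
   using B(2) by (intro mult_left_mono) auto
  also have "\<dots> = 31/32 * f (t i)" by (simp add: power2_eq_square)
  also have "\<dots> \<le> f (t (Suc i))" by (rule i)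
  also have "\<dots> \<le> dens.lod (ind (?B <+> E))" unfolding f_def by (rule cINF_lower[OF bb BB])
  also have "\<dots> \<le> dens.lod (ind (?W \<inter> tr g ?W))"
  proof (rule dens.lod_mono)
   show "dens.bdd (ind (?W \<inter> tr g ?W))"
    by (rule bdd_DD[OF DD_Int[OF WDD DD_tr[OF WDD gc]]])
   fix x assume x: "x \<in> RR"
   show "ind (?B <+> E) x \<le> ind (?W \<inter> tr g ?W) x"
   proof (rule ind_mono)
    assume "x \<in> ?B <+> E"
    then obtain b e where be: "b \<in> B" "b \<ominus> g \<in> B" "e \<in> E" "x = b \<oplus> e" by (auto simp: set_add_iff tr_def)
    then have bc: "b \<in> RR" "e \<in> RR" using BDD Ec by auto
    then have "x \<ominus> g = (b \<ominus> g) \<oplus> e" using be gc by (simp add: minus_eq a_ac)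
    then have "x \<ominus> g \<in> ?W" using be unfolding set_add_iff by blast
    moreover have "x \<in> ?W" using be unfolding set_add_iff by blast
    ultimately show "x \<in> ?W \<inter> tr g ?W" using x by (simp add: tr_def)
   qed
  qed
  finally show ?thesis .
 qed
 have Sc: "?S \<subseteq> RR" using XX_sub by (auto simp: stab_def)
 have sub: "dbl (dbl (dbl ?S)) \<subseteq> dbl (dbl E)"
 proof
  fix z assume "z \<in> dbl (dbl (dbl ?S))"
  from dbl3_psum[OF Sc this] obtain g where g: "\<And>i. i < 8 ==> g i \<in> ?S" "z = psum g 8" by blast
  have gc: "g i \<in> RR" if "i < 8" for i using g(1)[OF that] Sc by blast
  have "EX w:?W. EX w':?W. psum g 8 = w \<ominus> w'"
   by (rule chain_meets[OF WDD W0 gc Slarge[OF g(1)]])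
  then obtain w w' where w: "w \<in> ?W" "w' \<in> ?W" "z = w \<ominus> w'" using g(2) by blast
  then obtain b e b' e' where be: "b \<in> E" "e \<in> E" "b' \<in> E" "e' \<in> E" "w = b \<oplus> e" "w' = b' \<oplus> e'"
   using BDD(2) unfolding set_add_iff by blast
  have "z = (b \<oplus> e) \<oplus> (\<ominus> b' \<oplus> \<ominus> e')" using w be Ec by (simp add: minus_eq minus_add subset_iff)
  moreover have "b \<oplus> e \<in> dbl E" using be unfolding dbl_iff by blast
  moreover have "\<ominus> b' \<oplus> \<ominus> e' \<in> dbl E" using be Eneg unfolding dbl_iff by blast
  ultimately show "z \<in> dbl (dbl E)" unfolding dbl_iff[of z] by blast
 qed
 obtain Q where Q: "\<And>i :: nat. Q i \<in> DD" "decseq Q" "?S = (\<Inter>i. Q i)"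
  using TDw_decreasing[OF stab_TDw[OF BDD(1)]] by blast
 define Q' where "Q' i = Q i \<inter> negs (Q i)" for i
 have Q': "Q' i \<in> DD" for i unfolding Q'_def by (intro DD_Int negs_DD Q)
 have Q'dec: "Q' j \<subseteq> Q' i" if "i \<le> j" for i j
  using decseqD[OF Q(2) that] by (auto simp: Q'_def negs_def)
 have SQ: "?S \<subseteq> Q' i" for i
 proof
  fix x assume "x \<in> ?S"
  then have "x \<in> Q i" "\<ominus> x \<in> Q i" "x \<in> RR" using Q(3) Sneg[of x] Sc by auto
  then show "x \<in> Q' i" by (simp add: Q'_def negs_def)
 qed
 have Q'S: "(\<Inter>i. Q' i) \<subseteq> ?S" using Q(3) by (auto simp: Q'_def)
 let ?F = "range Q'"
 have dir: "dirf ?F" unfolding dirf_def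
 proof (intro conjI ballI)
  fix A B assume "A \<in> ?F" "B \<in> ?F"
  then obtain i j where "A = Q' i" "B = Q' j" by blast
  then show "EX C:?F. C \<subseteq> A \<inter> B" using Q'dec[of i "max i j"] Q'dec[of j "max i j"] by auto
 qed simp
 have FDD: "?F \<subseteq> DD" using Q' by auto
 have small: "|?F| <o \<kappa>" by (rule kcountable)
 have "EX i. dbl (dbl (dbl (Q' i))) \<subseteq> dbl (dbl E)"
 proof (rule ccontr)
  assume "\<not> ?thesis"
  then have ne: "dbl (dbl (dbl D)) - dbl (dbl E) \<noteq> {}" if "D \<in> ?F" for D using that by auto
  have "EX z. ALL D:?F. z \<in> dbl (dbl (dbl D)) - dbl (dbl E)"
  proof (rule compact_dir[OF dir small])
   fix D assume "D \<in> ?F"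
   then show "dbl (dbl (dbl D)) - dbl (dbl E) \<in> DD" using FDD EDD by (intro DD_Diff dbl_DD) auto
  next
   fix D D' :: "'b set" assume "D \<subseteq> D'"
   then have "dbl (dbl (dbl D)) \<subseteq> dbl (dbl (dbl D'))" by (intro dbl_mono)
   then show "dbl (dbl (dbl D)) - dbl (dbl E) \<subseteq> dbl (dbl (dbl D')) - dbl (dbl E)" by blast
  qed (rule ne)
  then obtain z where z: "\<And>D. D \<in> ?F ==> z \<in> dbl (dbl (dbl D))" "z \<notin> dbl (dbl E)" using Q'dec by blast
  have FD: "D \<in> DD" if "D \<in> ?F" for D using FDD that by blast
  have "z \<in> dbl (\<Inter>D\<in>?F. dbl (dbl D))"
   by (rule dbl_compact[OF dir small FDD]) (assumption | rule FD dbl_DD dbl_mono z(1))+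
  moreover have "y \<in> dbl (\<Inter>D\<in>?F. dbl D)" if "y \<in> (\<Inter>D\<in>?F. dbl (dbl D))" for y
   by (rule dbl_compact[OF dir small FDD]) (assumption | rule FD dbl_DD dbl_mono INT_D[OF that])+
  then have "(\<Inter>D\<in>?F. dbl (dbl D)) \<subseteq> dbl (\<Inter>D\<in>?F. dbl D)" by blast
  moreover have "y \<in> dbl (\<Inter>D\<in>?F. D)" if "y \<in> (\<Inter>D\<in>?F. dbl D)" for y
   by (rule dbl_compact[OF dir small FDD]) (assumption | rule FD INT_D[OF that])+
  then have "(\<Inter>D\<in>?F. dbl D) \<subseteq> dbl (\<Inter>D\<in>?F. D)" by blast
  moreover have "(\<Inter>D\<in>?F. D) \<subseteq> ?S" using Q'S by auto
  ultimately have "z \<in> dbl (dbl (dbl ?S))" using dbl_mono by (meson subsetD)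
  then show False using sub z(2) by blast
 qed
 then obtain i where i: "dbl (dbl (dbl (Q' i))) \<subseteq> dbl (dbl E)" by blast
 have "gsym (Q' i)" unfolding gsym_def
 proof (intro conjI ballI Q')
  show "gen (Q' i)" by (rule gen_mono[OF Sgen SQ])
  show "\<zero> \<in> Q' i" using S0 SQ by blast
  fix x assume "x \<in> Q' i"
  then show "\<ominus> x \<in> Q' i" using DD_carrier[OF Q(1)[of i]] by (auto simp: Q'_def negs_def)
 qed
 then show ?thesis using i by blast
qed

text \<open>Iterating the previous step gives a sequence of definable sets each of which contains
the double of the next; their intersection is a subgroup.\<close>

theorem bogolyubov:
 assumes "gsym E" shows "EX K. ccw K \<and> K \<subseteq> dbl (dbl E)"
proof -
 have "EX e :: nat => 'b set. ALL n. (gsym (e n) \<and> dbl (dbl (e n)) \<subseteq> dbl (dbl E)) \<and> dbl (dbl (dbl (e (Suc n)))) \<subseteq> dbl (dbl (e n))"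
 proof (rule dependent_nat_choice)
  show "EX e. gsym e \<and> dbl (dbl e) \<subseteq> dbl (dbl E)" using assms by blast
  fix e and n :: nat assume e: "gsym e \<and> dbl (dbl e) \<subseteq> dbl (dbl E)"
  obtain S where S: "gsym S" "dbl (dbl (dbl S)) \<subseteq> dbl (dbl e)" using bogolyubov_step e by blast
  have Sc: "S \<subseteq> RR" using S DD_carrier by (auto simp: gsym_def)
  have dc: "dbl (dbl S) \<subseteq> RR" using S by (intro DD_carrier dbl_DD) (simp add: gsym_def)
  have "\<zero> \<in> dbl (dbl S)" using S by (intro dbl_zero) (simp add: gsym_def)
  then have "dbl (dbl S) \<subseteq> dbl (dbl (dbl S))" using dc by (rule dbl_sub)
  then show "EX S. (gsym S \<and> dbl (dbl S) \<subseteq> dbl (dbl E)) \<and> dbl (dbl (dbl S)) \<subseteq> dbl (dbl e)"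
   using S e by blast
 qed
 then obtain e :: "nat => 'b set" where e: "\<And>n. gsym (e n)" "\<And>n. dbl (dbl (e n)) \<subseteq> dbl (dbl E)"
  "\<And>n. dbl (dbl (dbl (e (Suc n)))) \<subseteq> dbl (dbl (e n))" by blast
 let ?q = "%n. dbl (dbl (e n))"
 let ?K = "\<Inter>n. ?q n"
 have eDD: "e n \<in> DD" "e n \<subseteq> RR" for n using e(1)[of n] DD_carrier by (auto simp: gsym_def)
 have qDD: "?q n \<in> DD" for n using eDD by (intro dbl_DD)
 have qc: "?q n \<subseteq> RR" "dbl (e n) \<subseteq> RR" for n using DD_carrier qDD eDD dbl_DD by blast+
 have eq: "e n \<subseteq> ?q n" for n
 proof -
  have "\<zero> \<in> e n" using e(1)[of n] by (simp add: gsym_def)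
  then show ?thesis using eDD(2)[of n] qc[of n] dbl_sub dbl_zero by (meson order_trans)
 qed
 have qdec: "?q j \<subseteq> ?q i" if "i \<le> j" for i j
  using that
 proof (induction rule: dec_induct)
  case (step j)
  have "\<zero> \<in> ?q (Suc j)" using eq[of "Suc j"] e(1)[of "Suc j"] by (auto simp: gsym_def)
  then have "?q (Suc j) \<subseteq> dbl (?q (Suc j))" using qc by (intro dbl_sub) auto
  then show ?case using e(3)[of j] step by blast
 qed simp
 have "ccw ?K" unfolding ccw_def
 proof (intro conjI)
  show "asub ?K"
  proof (rule asubI)
   show "?K \<subseteq> RR" using qc by blast
   show "\<zero> \<in> ?K" using eq e(1) by (auto simp: gsym_def subset_iff)
  next
   fix x y assume xy: "x \<in> ?K" "y \<in> ?K"
   have "x \<oplus> y \<in> ?q n" for n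
   proof -
    have "x \<oplus> y \<in> dbl (?q (Suc n))" using xy unfolding dbl_iff[of _ "?q (Suc n)"] by blast
    then show ?thesis using e(3) by blast
   qed
   then show "x \<oplus> y \<in> ?K" by blast
  next
   fix x assume x: "x \<in> ?K"
   have "\<ominus> x \<in> ?q n" for n
   proof (rule dbl_neg)
    show "dbl (e n) \<subseteq> RR" by (rule qc)
    show "\<ominus> y \<in> dbl (e n)" if "y \<in> dbl (e n)" for y
     by (rule dbl_neg[OF eDD(2) _ that]) (use e(1)[of n] in \<open>auto simp: gsym_def\<close>)
   qed (use x in blast)
   then show "\<ominus> x \<in> ?K" by blast
  qed
  show "TDw ?K" unfolding TDw_def by (intro exI[of _ ?q] conjI allI qDD refl)
  show "coc ?K" unfolding coc_def
  proof
   fix D assume D: "D \<in> NB ?K"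
   have dir: "dirf (range ?q)" unfolding dirf_def
   proof (intro conjI ballI)
    fix A B assume "A \<in> range ?q" "B \<in> range ?q"
    then obtain i j where "A = ?q i" "B = ?q j" by blast
    then show "EX C:range ?q. C \<subseteq> A \<inter> B" using qdec[of i "max i j"] qdec[of j "max i j"] by auto
   qed simp
   have "range ?q \<subseteq> DD" using qDD by blast
   from NB_base[OF dir this kcountable D] obtain n where "?q n \<subseteq> D" by blast
   then show "gen D" using eq[of n] e(1)[of n] gen_mono by (meson gsym_def order_trans)
  qed
 qed
 moreover have "?K \<subseteq> dbl (dbl E)" using e(2) by blast
 ultimately show ?thesis by blast
qed

section \<open>Automorphisms and bounded index\<close>

lemma Aut_carrier: "\<sigma> \<in> Aut ==> x \<in> RR ==> \<sigma> x \<in> RR"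
 using Aut_XX carrier_eq by blast

lemma Aut_zero: "\<sigma> \<in> Aut ==> \<sigma> \<zero> = \<zero>"
proof -
 assume s: "\<sigma> \<in> Aut"
 have c: "\<sigma> \<zero> \<in> RR" using Aut_carrier[OF s] by simp
 have "\<sigma> \<zero> \<oplus> \<sigma> \<zero> = \<sigma> \<zero>" using Aut_add[OF s, of \<zero> \<zero>] by simp
 then have "\<sigma> \<zero> = \<sigma> \<zero> \<ominus> \<sigma> \<zero>" using add_cancel[OF c c] by simp
 then show ?thesis using c by (simp add: minus_eq r_neg)
qed

lemma Aut_neg: "\<sigma> \<in> Aut ==> x \<in> RR ==> \<sigma> (\<ominus> x) = \<ominus> \<sigma> x"
proof -
 assume s: "\<sigma> \<in> Aut" and x: "x \<in> RR"
 have "\<sigma> (\<ominus> x) \<oplus> \<sigma> x = \<zero>" using Aut_add[OF s, of "\<ominus> x" x] x Aut_zero[OF s] by (simp add: l_neg)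
 then show ?thesis using Aut_carrier[OF s] x by (metis a_inv_closed minus_equality)
qed

lemma Aut_minus: "\<sigma> \<in> Aut ==> x \<in> RR ==> y \<in> RR ==> \<sigma> (x \<ominus> y) = \<sigma> x \<ominus> \<sigma> y"
 by (simp add: minus_eq Aut_add Aut_neg)

lemma Aut_inj: "\<sigma> \<in> Aut ==> inj_on \<sigma> (RR)"
 by (metis Aut_inv inj_onI)

lemma neg_zero: "\<ominus> \<zero> = \<zero>" by (rule minus_equality) simp_all

definition autg :: "('b => 'b) set => bool" where
 "autg \<Gamma> \<longleftrightarrow> \<Gamma> \<subseteq> Aut \<and> id \<in> \<Gamma> \<and> (ALL \<sigma>:\<Gamma>. ALL \<tau>:\<Gamma>. \<sigma> \<circ> \<tau> \<in> \<Gamma>) \<and>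
  (ALL \<sigma>:\<Gamma>. EX \<tau>:\<Gamma>. ALL x:RR. \<tau> (\<sigma> x) = x \<and> \<sigma> (\<tau> x) = x)"

lemma autg_Aut: "autg Aut" using Aut_id Aut_comp Aut_inv by (auto simp: autg_def)

lemma autgD: "autg \<Gamma> ==> \<sigma> \<in> \<Gamma> ==> \<sigma> \<in> Aut" by (auto simp: autg_def)

lemma autg_inv: "autg \<Gamma> ==> \<sigma> \<in> \<Gamma> ==> EX \<tau>:\<Gamma>. ALL x:RR. \<tau> (\<sigma> x) = x \<and> \<sigma> (\<tau> x) = x"
 by (auto simp: autg_def)

definition ginv :: "('b => 'b) set => 'b set => bool" where
 "ginv \<Gamma> D \<longleftrightarrow> (ALL \<sigma>:\<Gamma>. \<sigma> ` D = D)"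

lemma ginvD: "ginv \<Gamma> D ==> \<sigma> \<in> \<Gamma> ==> x \<in> D ==> \<sigma> x \<in> D" by (auto simp: ginv_def)

lemma ginvI:
 assumes "autg \<Gamma>" "D \<subseteq> RR" "\<And>\<sigma> x. \<sigma> \<in> \<Gamma> ==> x \<in> D ==> \<sigma> x \<in> D"
 shows "ginv \<Gamma> D"
 unfolding ginv_def
proof (intro ballI equalityI subsetI)
 fix \<sigma> x assume s: "\<sigma> \<in> \<Gamma>" and x: "x \<in> D"
 obtain \<tau> where t: "\<tau> \<in> \<Gamma>" "ALL x:RR. \<tau> (\<sigma> x) = x \<and> \<sigma> (\<tau> x) = x" using autg_inv[OF assms(1) s] by blast
 then have "x = \<sigma> (\<tau> x)" "\<tau> x \<in> D" using x assms(2,3) by auto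
 then show "x \<in> \<sigma> ` D" by blast
qed (use assms(3) in blast)

lemma ginv_sub: "ginv \<Gamma> D ==> \<Gamma>' \<subseteq> \<Gamma> ==> ginv \<Gamma>' D" by (auto simp: ginv_def)

lemma image_INT_carrier:
 assumes "\<sigma> \<in> Aut" "\<F> \<noteq> {}" "\<And>D. D \<in> \<F> ==> D \<subseteq> RR"
 shows "\<sigma> ` (\<Inter>\<F>) = (\<Inter>D\<in>\<F>. \<sigma> ` D)"
 using image_INT[OF Aut_inj[OF assms(1)], of \<F> "%D. D"] assms(2,3) by auto

lemma TD_image: "\<sigma> \<in> Aut ==> TD K ==> TD (\<sigma> ` K)"
proof -
 assume s: "\<sigma> \<in> Aut" and "TD K"
 then obtain \<F> where F: "\<F> \<subseteq> DD" "\<F> \<noteq> {}" "|\<F>| <o \<kappa>" "K = \<Inter>\<F>" by (auto simp: TD_def)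
 then show ?thesis unfolding TD_def
  by (intro exI[of _ "image \<sigma> ` \<F>"]) (use image_INT_carrier[OF s F(2)] DD_carrier Aut_DD[OF s] kImage in auto)
qed

lemma TDw_image: "\<sigma> \<in> Aut ==> TDw K ==> TDw (\<sigma> ` K)"
proof -
 assume s: "\<sigma> \<in> Aut" and "TDw K"
 then obtain Q :: "nat => 'b set" where Q: "\<And>i. Q i \<in> DD" "K = (\<Inter>i. Q i)" by (auto simp: TDw_def)
 have "\<sigma> ` K = (\<Inter>i. \<sigma> ` Q i)"
  unfolding Q(2) by (rule image_INT[OF Aut_inj[OF s]]) (use Q(1) DD_carrier in auto)
 then show ?thesis unfolding TDw_def using Q(1) Aut_DD[OF s] by (intro exI[of _ "%i. \<sigma> ` Q i"]) auto
qed

lemma asub_image: "\<sigma> \<in> Aut ==> asub K ==> asub (\<sigma> ` K)"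
proof -
 assume s: "\<sigma> \<in> Aut" and K: "asub K"
 note c = asub_carrier[OF K, THEN subsetD]
 show ?thesis
 proof (rule asubI')
  show "\<sigma> ` K \<subseteq> RR" using c Aut_carrier[OF s] by blast
  show "\<zero> \<in> \<sigma> ` K" using asub_zero[OF K] Aut_zero[OF s] by force
  fix x y assume "x \<in> \<sigma> ` K" "y \<in> \<sigma> ` K"
  then obtain x' y' where "x' \<in> K" "y' \<in> K" "x = \<sigma> x'" "y = \<sigma> y'" by blast
  then show "x \<ominus> y \<in> \<sigma> ` K" using Aut_minus[OF s c c] asub_minus[OF K] by (metis imageI)
 qed
qed

lemma gen_image:
 assumes s: "\<sigma> \<in> Aut" and g: "gen D" "D \<subseteq> RR"
 shows "gen (\<sigma> ` D)"
proof -
 obtain F where F: "finite F" "F \<subseteq> RR" "ALL x:XX 0. EX f:F. EX d:D. x = f \<oplus> d"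
  using g by (auto simp: gen_def)
 obtain \<tau> where t: "\<tau> \<in> Aut" "ALL x:RR. \<tau> (\<sigma> x) = x \<and> \<sigma> (\<tau> x) = x" using Aut_inv[OF s] by blast
 show ?thesis unfolding gen_def
 proof (intro exI[of _ "\<sigma> ` F"] conjI ballI)
  show "\<sigma> ` F \<subseteq> RR" using F Aut_carrier[OF s] by blast
  fix x assume x: "x \<in> XX 0"
  then obtain f d where f: "f \<in> F" "d \<in> D" "\<tau> x = f \<oplus> d" using F Aut_XX[OF t(1) x] by blast
  then have "x = \<sigma> f \<oplus> \<sigma> d" using t x XX_carrier Aut_add[OF s, of f d] F g by (metis subsetD)
  then show "EX f:\<sigma> ` F. EX d:\<sigma> ` D. x = f \<oplus> d" using f by blast
 qed (use F in simp)
qed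

lemma coc_image: "\<sigma> \<in> Aut ==> K \<subseteq> RR ==> coc K ==> coc (\<sigma> ` K)"
 unfolding coc_def
proof
 fix D assume s: "\<sigma> \<in> Aut" and K: "K \<subseteq> RR" "ALL D:NB K. gen D" and D: "D \<in> NB (\<sigma> ` K)"
 obtain \<tau> where t: "\<tau> \<in> Aut" "ALL x:RR. \<tau> (\<sigma> x) = x \<and> \<sigma> (\<tau> x) = x" using Aut_inv[OF s] by blast
 have Dc: "D \<subseteq> RR" using D NB_DD DD_carrier by blast
 have "K \<subseteq> \<tau> ` D"
 proof
  fix x assume x: "x \<in> K"
  then have "\<sigma> x \<in> D" using D by (auto simp: NB_def)
  moreover have "x = \<tau> (\<sigma> x)" using t x K by auto
  ultimately show "x \<in> \<tau> ` D" by blast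
 qed
 then have "\<tau> ` D \<in> NB K" using D Aut_DD[OF t(1)] by (auto simp: NB_def)
 then have "gen (\<tau> ` D)" using K by blast
 then have "gen (\<sigma> ` \<tau> ` D)" using gen_image[OF s] Aut_carrier[OF t(1)] Dc by (metis image_subset_iff subsetD)
 moreover have "\<sigma> ` \<tau> ` D = D" using t Dc by (force simp: image_image)
 ultimately show "gen D" by simp
qed

lemma cc_image: "\<sigma> \<in> Aut ==> cc K ==> cc (\<sigma> ` K)"
 using TD_image asub_image coc_image asub_carrier by (simp add: cc_def)

lemma ccw_image: "\<sigma> \<in> Aut ==> ccw K ==> ccw (\<sigma> ` K)"
 using TDw_image asub_image coc_image asub_carrier by (simp add: ccw_def)

definition bidx :: "'b set => bool" where "bidx K \<longleftrightarrow> |a_rcosets K| <o \<kappa>"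

lemma coset_eq:
 assumes K: "asub K" and xy: "x \<in> RR" "y \<in> RR" "x \<ominus> y \<in> K"
 shows "K +> x = K +> y"
proof -
 have 1: "K +> x \<subseteq> K +> y" if "x \<in> RR" "y \<in> RR" "x \<ominus> y \<in> K" for x y
 proof
  fix z assume "z \<in> K +> x"
  then obtain h where h: "h \<in> K" "z = h \<oplus> x" by (auto simp: a_r_coset_def')
  then have hc: "h \<in> RR" using asub_carrier[OF K] by blast
  then have "z = (h \<oplus> (x \<ominus> y)) \<oplus> y" using h that by (simp add: minus_eq a_assoc l_neg)
  moreover have "h \<oplus> (x \<ominus> y) \<in> K" using h that asub_add[OF K] by blast
  ultimately show "z \<in> K +> y" by (auto simp: a_r_coset_def')
 qed
 have "y \<ominus> x \<in> K" using asub_neg[OF K xy(3)] neg_minus[OF xy(1,2)] by simp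
 then show ?thesis using 1[OF xy] 1[OF xy(2,1)] by blast
qed

lemma coset_eqD:
 assumes K: "asub K" and xy: "x \<in> RR" "y \<in> RR" "K +> x = K +> y"
 shows "x \<ominus> y \<in> K"
proof -
 have "\<zero> \<oplus> x \<in> K +> x" using asub_zero[OF K] by (auto simp: a_r_coset_def')
 then obtain h where h: "h \<in> K" "x = h \<oplus> y" using xy by (auto simp: a_r_coset_def')
 then have "h \<in> RR" using asub_carrier[OF K] by blast
 then have "x \<ominus> y = h" using h xy by (simp add: minus_eq a_assoc r_neg)
 then show ?thesis using h by simp
qed

text \<open>Bounded index follows from any map with few values that separates cosets.\<close>

lemma bidx_code:
 assumes K: "asub K" and c: "|c ` RR| <o \<kappa>" "\<And>x y. x \<in> RR ==> y \<in> RR ==> c x = c y ==> x \<ominus> y \<in> K"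
 shows "bidx K"
proof -
 let ?r = "%z. SOME x. x \<in> RR \<and> c x = z"
 have "a_rcosets K \<subseteq> (%z. K +> ?r z) ` c ` RR"
 proof
  fix C assume "C \<in> a_rcosets K"
  then obtain a where a: "a \<in> RR" "C = K +> a" by (auto simp: A_RCOSETS_def')
  have "?r (c a) \<in> RR \<and> c (?r (c a)) = c a" by (rule someI[of _ a]) (use a in simp)
  then have "a \<ominus> ?r (c a) \<in> K" "?r (c a) \<in> RR" using c(2) a by auto
  then have "C = K +> ?r (c a)" using coset_eq[OF K] a by blast
  then show "C \<in> (%z. K +> ?r z) ` c ` RR" using a by blast
 qed
 then show ?thesis unfolding bidx_def using kSubset[OF kImage[OF c(1)]] by blast
qed

lemma bidx_reps:
 assumes K: "asub K" and b: "bidx K"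
 shows "\<exists>P\<subseteq>RR. |P| <o \<kappa> \<and> (ALL x:RR. EX p:P. x \<ominus> p \<in> K)"
proof (intro exI conjI ballI)
 let ?r = "%C. SOME x. x \<in> RR \<and> C = K +> x"
 have r: "?r C \<in> RR \<and> C = K +> ?r C" if "C \<in> a_rcosets K" for C
  by (rule someI_ex) (use that in \<open>auto simp: A_RCOSETS_def'\<close>)
 show "?r ` (a_rcosets K) \<subseteq> RR" using r by blast
 show "|?r ` (a_rcosets K)| <o \<kappa>" using b unfolding bidx_def by (rule kImage)
 fix x assume x: "x \<in> RR"
 then have "K +> x \<in> a_rcosets K" by (auto simp: A_RCOSETS_def')
 then show "EX p:?r ` (a_rcosets K). x \<ominus> p \<in> K" using r coset_eqD[OF K x] by blast
qed

lemma cc_bidx: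
 assumes K: "cc K" shows "bidx K"
proof -
 obtain \<F> where F: "\<F> \<subseteq> DD" "dirf \<F>" "|\<F>| <o \<kappa>" "K = \<Inter>\<F>" using TD_dir[OF cc_TD[OF K]] by blast
 have "EX c :: 'b => nat. ALL x:XX n. ALL y:XX n. c x = c y --> x \<ominus> y \<in> D" if "D \<in> \<F>" for D n
 proof -
  have "D \<in> NB K" using that F by (auto simp: NB_def)
  from cc_col[OF K this, of n] obtain c :: "'b => 'b \<times> 'b" where
   c: "finite (c ` XX n)" "ALL x:XX n. ALL y:XX n. c x = c y --> x \<ominus> y \<in> D" by blast
  obtain h :: "'b \<times> 'b => nat" where "inj_on h (c ` XX n)"
   using finite_imp_inj_to_nat_seg[OF c(1)] by blast
  then show ?thesis using c(2) by (intro exI[of _ "h \<circ> c"]) (auto dest: inj_onD)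
 qed
 then obtain c :: "'b set => nat => 'b => nat" where
  c: "\<And>D n x y. D \<in> \<F> ==> x \<in> XX n ==> y \<in> XX n ==> c D n x = c D n y ==> x \<ominus> y \<in> D" by metis
 let ?code = "%x. {(D, n, c D n x) | D n. D \<in> \<F> \<and> x \<in> XX n}"
 show ?thesis
 proof (rule bidx_code[OF cc_asub[OF K], of ?code])
  have "|Pow (\<F> \<times> (UNIV :: nat set) \<times> (UNIV :: nat set))| <o \<kappa>"
   by (intro kPow kTimes F nat_less)
  moreover have "?code ` RR \<subseteq> Pow (\<F> \<times> UNIV \<times> UNIV)"
   by (intro image_subsetI PowI subsetI) auto
  ultimately show "|?code ` RR| <o \<kappa>" by (rule kSubset)
  fix x y assume xy: "x \<in> RR" "y \<in> RR" "?code x = ?code y"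
  obtain n where n: "x \<in> XX n" using in_carrierE[OF xy(1)] by blast
  have "x \<ominus> y \<in> D" if D: "D \<in> \<F>" for D
  proof -
   have "(D, n, c D n x) \<in> ?code x" using D n by blast
   then have "(D, n, c D n x) \<in> ?code y" using xy(3) by simp
   then show ?thesis using c[OF D n] by auto
  qed
  then show "x \<ominus> y \<in> K" using F by blast
 qed
qed

text \<open>If finitely many translates of \<open>D\<close> by representatives of the cosets did
not cover, compactness would give an element outside all of them, hence outside all
cosets.\<close>

lemma bidx_coc:
 assumes K: "asub K" "bidx K" shows "coc K"
 unfolding coc_def
proof
 fix D assume D: "D \<in> NB K"
 obtain P where P: "P \<subseteq> RR" "|P| <o \<kappa>" "ALL x:RR. EX p:P. x \<ominus> p \<in> K" using bidx_reps[OF K] by blast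
 let ?A = "%p. {x \<in> XX 0. x \<ominus> p \<notin> D}"
 have "EX \<G>. \<G> \<subseteq> ?A ` P \<and> finite \<G> \<and> \<G> \<noteq> {} \<and> \<Inter>\<G> = {}"
 proof (rule ccontr)
  assume *: "\<not> ?thesis"
  have "\<Inter>(?A ` P) \<noteq> {}"
  proof (rule compact)
   show "?A ` P \<subseteq> DD"
   proof
    fix A assume "A \<in> ?A ` P"
    then obtain p where p: "p \<in> P" "A = ?A p" by blast
    show "A \<in> DD" unfolding p(2)
     by (intro DD_collect XX_DD LD_not LD_mem LT_minus LT_var LT_const) (use p P D in \<open>auto simp: NB_def\<close>)
   qed
   show "?A ` P \<noteq> {}" using P(3) zero_closed by blast
   show "|?A ` P| <o \<kappa>" by (rule kImage[OF P(2)])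
  qed (use * in blast)
  then obtain x where x: "ALL p:P. x \<in> ?A p" by blast
  moreover have "P \<noteq> {}" using P(3) zero_closed by blast
  ultimately have "x \<in> RR" using XX_carrier by blast
  then obtain p where "p \<in> P" "x \<ominus> p \<in> K" using P(3) by blast
  then show False using x D by (auto simp: NB_def)
 qed
 then obtain \<G> where "\<G> \<subseteq> ?A ` P" "finite \<G>" "\<Inter>\<G> = {}" by blast
 then obtain F where F: "F \<subseteq> P" "finite F" "\<G> = ?A ` F" by (meson finite_subset_image)
 then have F3: "(\<Inter>p\<in>F. ?A p) = {}" using \<open>\<Inter>\<G> = {}\<close> by simp
 show "gen D" unfolding gen_def
 proof (intro exI[of _ F] conjI ballI)
  show "F \<subseteq> RR" using F P by blast
  fix x assume x: "x \<in> XX 0"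
  then obtain p where p: "p \<in> F" "x \<ominus> p \<in> D" using F3 by blast
  then have "p \<in> RR" "x \<in> RR" using x F P XX_carrier by blast+
  then have "x = p \<oplus> (x \<ominus> p)" by (simp add: minus_cancel)
  then show "EX f:F. EX d:D. x = f \<oplus> d" using p by blast
 qed (use F in simp)
qed

lemma bidx_mono:
 assumes "asub H" "bidx H" "asub J" "H \<subseteq> J" shows "bidx J"
proof (rule bidx_code[OF assms(3), of "%x. H +> x"])
 have "(%x. H +> x) ` RR = a_rcosets H" by (auto simp: A_RCOSETS_def')
 then show "|(%x. H +> x) ` RR| <o \<kappa>" using assms(2) by (simp add: bidx_def)
qed (use coset_eqD[OF assms(1)] assms(4) in blast)

inductive_set asums :: "'b set => 'b set" for Z where
 asums_zero: "\<zero> \<in> asums Z"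
| asums_step: "x \<in> asums Z ==> z \<in> Z ==> x \<oplus> z \<in> asums Z"

lemma asums_carrier: "Z \<subseteq> RR ==> x \<in> asums Z ==> x \<in> RR"
 by (rotate_tac 1, induction rule: asums.induct) auto

lemma asums_base: "Z \<subseteq> RR ==> Z \<subseteq> asums Z"
 using asums_step[OF asums_zero] by fastforce

lemma asums_add:
 assumes "Z \<subseteq> RR" "x \<in> asums Z" "y \<in> asums Z" shows "x \<oplus> y \<in> asums Z"
 using assms(3)
proof induction
 case asums_zero
 then show ?case using assms asums_carrier by simp
next
 case (asums_step y z)
 then have "(x \<oplus> y) \<oplus> z \<in> asums Z" using asums.asums_step by blast
 moreover have "x \<in> RR" "y \<in> RR" "z \<in> RR" using assms asums_step asums_carrier by auto
 ultimately show ?case by (simp add: a_assoc)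
qed

lemma asums_asub:
 assumes "Z \<subseteq> RR" "\<And>z. z \<in> Z ==> \<ominus> z \<in> Z" shows "asub (asums Z)"
proof (rule asubI)
 fix x assume "x \<in> asums Z"
 then show "\<ominus> x \<in> asums Z"
 proof induction
  case (asums_step x z)
  then have "\<ominus> x \<oplus> \<ominus> z \<in> asums Z" using assms asums.asums_step by blast
  moreover have "x \<in> RR" "z \<in> RR" using asums_carrier assms asums_step by auto
  ultimately show ?case by (simp add: minus_add)
 qed (simp add: asums.asums_zero neg_zero)
qed (use assms asums_carrier asums_add asums.asums_zero in auto)

lemma asums_mono: "Z \<subseteq> Z' ==> asums Z \<subseteq> asums Z'"
proof
 fix x assume z: "Z \<subseteq> Z'" and "x \<in> asums Z"
 from this(2) show "x \<in> asums Z'" by induction (use z in \<open>auto intro: asums.intros\<close>)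
qed

lemma asums_sub: "asub H ==> Z \<subseteq> H ==> asums Z \<subseteq> H"
proof
 fix x assume h: "asub H" "Z \<subseteq> H" and "x \<in> asums Z"
 from this(3) show "x \<in> H" by induction (use h in \<open>auto intro: asub_zero asub_add\<close>)
qed

definition conjs :: "('b => 'b) set => 'b set => 'b set" where "conjs \<Gamma> K = (\<Union>\<sigma>\<in>\<Gamma>. \<sigma> ` K)"

lemma asums_finite_support:
 assumes "x \<in> asums (conjs \<Gamma> K)" shows "EX \<Sigma>. finite \<Sigma> \<and> \<Sigma> \<subseteq> \<Gamma> \<and> x \<in> asums (conjs \<Sigma> K)"
 using assms
proof induction
 case asums_zero
 then show ?case by (intro exI[of _ "{}"]) (auto intro: asums.asums_zero)
next
 case (asums_step x z)
 then obtain \<Sigma> \<sigma> where S: "finite \<Sigma>" "\<Sigma> \<subseteq> \<Gamma>" "x \<in> asums (conjs \<Sigma> K)" "\<sigma> \<in> \<Gamma>" "z \<in> \<sigma> ` K"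
  by (auto simp: conjs_def)
 have "x \<in> asums (conjs (insert \<sigma> \<Sigma>) K)" using S(3) asums_mono[of "conjs \<Sigma> K" "conjs (insert \<sigma> \<Sigma>) K"] by (auto simp: conjs_def)
 then have "x \<oplus> z \<in> asums (conjs (insert \<sigma> \<Sigma>) K)" using S by (intro asums.asums_step) (auto simp: conjs_def)
 then show ?case using S by (intro exI[of _ "insert \<sigma> \<Sigma>"]) auto
qed

lemma conjs_asub:
 assumes "\<Gamma> \<subseteq> Aut" "asub K"
 shows "conjs \<Gamma> K \<subseteq> RR" "asub (asums (conjs \<Gamma> K))"
proof -
 show c: "conjs \<Gamma> K \<subseteq> RR"
 proof
  fix z assume "z \<in> conjs \<Gamma> K"
  then obtain \<sigma> k where "\<sigma> \<in> \<Gamma>" "k \<in> K" "z = \<sigma> k" by (auto simp: conjs_def)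
  then show "z \<in> RR" using Aut_carrier[of \<sigma> k] assms(1) asub_carrier[OF assms(2)] by blast
 qed
 show "asub (asums (conjs \<Gamma> K))"
 proof (rule asums_asub[OF c])
  fix z assume "z \<in> conjs \<Gamma> K"
  then obtain \<sigma> where s: "\<sigma> \<in> \<Gamma>" "z \<in> \<sigma> ` K" unfolding conjs_def by blast
  then have "\<ominus> z \<in> \<sigma> ` K" using assms by (intro asub_neg[OF asub_image]) blast+
  then show "\<ominus> z \<in> conjs \<Gamma> K" using s(1) unfolding conjs_def by blast
 qed
qed

lemma conjs_sums_inv:
 assumes G: "autg \<Gamma>" and K: "asub K" and s: "\<sigma> \<in> \<Gamma>" and x: "x \<in> asums (conjs \<Gamma> K)"
 shows "\<sigma> x \<in> asums (conjs \<Gamma> K)"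
 using x
proof induction
 case asums_zero
 then show ?case using Aut_zero[OF autgD[OF G s]] by (simp add: asums.asums_zero)
next
 case (asums_step x z)
 have GA: "\<Gamma> \<subseteq> Aut" using G by (simp add: autg_def)
 obtain \<tau> k where t: "\<tau> \<in> \<Gamma>" "z = \<tau> k" "k \<in> K" using asums_step by (auto simp: conjs_def)
 then have "\<sigma> z = (\<sigma> \<circ> \<tau>) k" "\<sigma> \<circ> \<tau> \<in> \<Gamma>" using G s by (auto simp: autg_def)
 then have "\<sigma> z \<in> conjs \<Gamma> K" using t unfolding conjs_def by blast
 moreover have "\<sigma> (x \<oplus> z) = \<sigma> x \<oplus> \<sigma> z"
  using asums_step asums_carrier[OF conjs_asub(1)[OF GA K]] conjs_asub(1)[OF GA K] by (intro Aut_add autgD[OF G s]) blast+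
 ultimately show ?case using asums_step by (simp add: asums.asums_step)
qed

lemma NB_dbl:
 assumes "TD K" "asub K" "D \<in> NB K"
 shows "EX E:NB K. (ALL x:E. \<ominus> x \<in> E) \<and> dbl E \<subseteq> D \<and> E \<subseteq> D \<and> (ALL x:E. ALL y:E. x \<ominus> y \<in> D)"
proof -
 obtain E where E: "E \<in> NB K" "ALL x:E. ALL y:E. x \<ominus> y \<in> D" using NB_sub[OF assms] by blast
 let ?E = "E \<inter> negs E"
 have Ec: "E \<subseteq> RR" using E NB_DD DD_carrier by blast
 have 0: "\<zero> \<in> E" using E asub_zero[OF assms(2)] by (auto simp: NB_def)
 show ?thesis
 proof (intro bexI[of _ ?E] conjI ballI subsetI)
  have "K \<subseteq> negs E" using E asub_neg[OF assms(2)] asub_carrier[OF assms(2)] by (auto simp: NB_def negs_def)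
  then show "?E \<in> NB K" using E by (auto simp: NB_def intro!: DD_Int negs_DD)
  show "\<ominus> x \<in> ?E" if "x \<in> ?E" for x using that by (auto simp: negs_def)
  show "x \<ominus> y \<in> D" if "x \<in> ?E" "y \<in> ?E" for x y using that E by blast
  show "x \<in> D" if "x \<in> ?E" for x
  proof -
   have "x \<ominus> \<zero> \<in> D" using that E 0 by blast
   then show ?thesis using that Ec minus_zero_r by auto
  qed
  fix z assume "z \<in> dbl ?E"
  then obtain x y where xy: "x \<in> ?E" "y \<in> ?E" "z = x \<oplus> y" unfolding dbl_iff by blast
  then have "x \<ominus> (\<ominus> y) \<in> D" using E(2) by (auto simp: negs_def)
  then show "z \<in> D" using xy Ec by (auto simp: minus_eq)
 qed
qed

lemma cc_reps:
 assumes "cc K" "D \<in> NB K" "Z \<subseteq> XX n"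
 shows "EX F. finite F \<and> F \<subseteq> Z \<and> (ALL x:Z. EX f:F. x \<ominus> f \<in> D)"
proof -
 obtain c :: "'b => 'b \<times> 'b" where
  c: "finite (c ` XX n)" "ALL x:XX n. ALL y:XX n. c x = c y --> x \<ominus> y \<in> D" using cc_col[OF assms(1,2)] by blast
 have "finite (c ` Z)" by (rule finite_subset[OF _ c(1)]) (use assms(3) in blast)
 from reps[OF this] obtain F where "finite F" "F \<subseteq> Z" "ALL x:Z. EX f:F. c x = c f" by blast
 then show ?thesis using c(2) assms(3) by (intro exI[of _ F]) blast
qed

text \<open>The topological closure of the subgroup generated by the conjugates of
\<open>K\<close>, in the topology given by \<open>NB K\<close>. It is type-definable because, up
to a neighbourhood of \<open>K\<close>, the group generated is finite. The last clause is used in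
the proof of ergodicity, where sums of conjugates are needed as approximations.\<close>

lemma conjs_closure:
 assumes G: "autg \<Gamma>" and K: "cc K" and bd: "asums (conjs \<Gamma> K) \<subseteq> XX n"
 shows "EX C. cc C \<and> ginv \<Gamma> C \<and> K \<subseteq> C \<and> (ALL D:NB K. ALL x:C. EX g:asums (conjs \<Gamma> K). x \<ominus> g \<in> D)"
proof -
 define S where "S = asums (conjs \<Gamma> K)"
 have GA: "\<Gamma> \<subseteq> Aut" using G by (simp add: autg_def)
 note KT = cc_TD[OF K] and Ka = cc_asub[OF K]
 have Sa: "asub S" unfolding S_def by (rule conjs_asub[OF GA Ka])
 have Sc: "S \<subseteq> RR" by (rule asub_carrier[OF Sa])
 have KS: "K \<subseteq> S"
 proof -
  have "id ` K \<subseteq> conjs \<Gamma> K" using G unfolding conjs_def autg_def by blast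
  then have "K \<subseteq> conjs \<Gamma> K" by simp
  then show ?thesis using asums_base[OF conjs_asub(1)[OF GA Ka]] unfolding S_def by blast
 qed
 define C where "C = {x \<in> RR. ALL D:NB K. EX g:S. x \<ominus> g \<in> D}"
 have SC: "S \<subseteq> C"
 proof
  fix x assume x: "x \<in> S"
  have "x \<ominus> x \<in> D" if "D \<in> NB K" for D
   using that asub_zero[OF Ka] x Sc by (auto simp: NB_def minus_eq r_neg subset_iff)
  then show "x \<in> C" using x Sc by (auto simp: C_def)
 qed
 have Ca: "asub C"
 proof (rule asubI')
  show "C \<subseteq> RR" by (auto simp: C_def)
  show "\<zero> \<in> C" using SC asub_zero[OF Sa] by blast
  fix x y assume xy: "x \<in> C" "y \<in> C"
  have c: "x \<in> RR" "y \<in> RR" using xy by (auto simp: C_def)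
  show "x \<ominus> y \<in> C" unfolding C_def
  proof (intro CollectI conjI ballI)
   show "x \<ominus> y \<in> RR" using c by simp
   fix D assume D: "D \<in> NB K"
   obtain E where E: "E \<in> NB K" "ALL x:E. ALL y:E. x \<ominus> y \<in> D" using NB_sub[OF KT Ka D] by blast
   obtain g h where g: "g \<in> S" "x \<ominus> g \<in> E" "h \<in> S" "y \<ominus> h \<in> E" using xy E(1) unfolding C_def by blast
   have gc: "g \<in> RR" "h \<in> RR" using g Sc by auto
   have "(x \<ominus> y) \<ominus> (g \<ominus> h) = (x \<ominus> g) \<ominus> (y \<ominus> h)" using c gc by (simp add: minus_eq minus_add a_ac)
   then have "(x \<ominus> y) \<ominus> (g \<ominus> h) \<in> D" using g E(2) by simp
   then show "EX g:S. x \<ominus> y \<ominus> g \<in> D" using asub_minus[OF Sa g(1,3)] by blast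
  qed
 qed
 have Fex: "EX F. finite F \<and> F \<subseteq> S \<and> (ALL x:S. EX f:F. x \<ominus> f \<in> D)" if "cc K'" "D \<in> NB K'" for D K'
  using cc_reps[OF that] bd unfolding S_def by blast
 have CT: "TD C"
 proof -
  obtain \<F> where F: "\<F> \<subseteq> DD" "dirf \<F>" "|\<F>| <o \<kappa>" "K = \<Inter>\<F>" using TD_dir[OF KT] by blast
  have FNB: "\<F> \<subseteq> NB K" using F by (auto simp: NB_def)
  have "ALL D:NB K. EX F. finite F \<and> F \<subseteq> S \<and> (ALL x:S. EX f:F. x \<ominus> f \<in> D)" using Fex[OF K] by blast
  then obtain f where f: "\<And>D. D \<in> NB K ==> finite (f D) \<and> f D \<subseteq> S \<and> (ALL x:S. EX y:f D. x \<ominus> y \<in> D)"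
   by metis
  let ?T = "%D. f D <+> dbl D :: 'b set"
  have TDD: "?T D \<in> DD" if "D \<in> \<F>" for D
  proof -
   have "finite (f D)" "f D \<subseteq> RR" "D \<in> DD" using f[of D] FNB that F(1) Sc by blast+
   then show ?thesis using DD_add[OF DD_finite dbl_DD] by blast
  qed
  have "C = \<Inter>(?T ` \<F>)"
  proof (intro equalityI subsetI)
   fix x assume x: "x \<in> C"
   have xc: "x \<in> RR" using x by (simp add: C_def)
   have "x \<in> ?T D" if D: "D \<in> \<F>" for D
   proof -
    have Dc: "D \<subseteq> RR" using D F DD_carrier by blast
    have DN: "D \<in> NB K" using D FNB by blast
    obtain g where g: "g \<in> S" "x \<ominus> g \<in> D" using x DN unfolding C_def by blast
    obtain y where y: "y \<in> f D" "g \<ominus> y \<in> D" using f[OF DN] g by blast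
    have c: "g \<in> RR" "y \<in> RR" using g y f[OF DN] Sc by auto
    have "x = y \<oplus> ((g \<ominus> y) \<oplus> (x \<ominus> g))"
     using c xc minus_cancel[of g y] minus_cancel[of x g] by (simp add: a_assoc[symmetric])
    moreover have "(g \<ominus> y) \<oplus> (x \<ominus> g) \<in> dbl D" using y g unfolding dbl_iff by blast
    ultimately show ?thesis using y unfolding set_add_iff by blast
   qed
   then show "x \<in> \<Inter>(?T ` \<F>)" by blast
  next
   fix x assume x: "x \<in> \<Inter>(?T ` \<F>)"
   show "x \<in> C" unfolding C_def
   proof (intro CollectI conjI ballI)
    obtain D where D: "D \<in> \<F>" using F by (auto simp: dirf_def)
    then show xc: "x \<in> RR" using x TDD DD_carrier by blast
    fix D assume "D \<in> NB K"
    then obtain E where E: "E \<in> NB K" "dbl E \<subseteq> D" using NB_dbl[OF KT Ka] by meson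
    obtain E' where E': "E' \<in> \<F>" "E' \<subseteq> E" using NB_base[OF F(2,1,3)] E F(4) by blast
    have "x \<in> ?T E'" using x E' by blast
    then obtain y d where y: "y \<in> f E'" "d \<in> dbl E'" "x = y \<oplus> d" unfolding set_add_iff by blast
    have dc: "d \<in> RR" using y dbl_DD E' F DD_carrier by blast
    have yS: "y \<in> S" using f[of E'] y E' FNB by blast
    have "x \<ominus> y = d" using y dc yS Sc add_cancel by blast
    moreover have "d \<in> D" using y(2) dbl_mono[OF E'(2)] E(2) by blast
    ultimately show "EX g:S. x \<ominus> g \<in> D" using yS by blast
   qed
  qed
  then show ?thesis unfolding TD_def
   using TDD F by (intro exI[of _ "?T ` \<F>"]) (auto simp: dirf_def intro: kImage)
 qed
 have Cc: "coc C" using cc_coc[OF K] KS SC unfolding coc_def NB_def by blast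
 have "ginv \<Gamma> C"
 proof (rule ginvI[OF G])
  show "C \<subseteq> RR" by (auto simp: C_def)
  fix \<sigma> x assume s: "\<sigma> \<in> \<Gamma>" and x: "x \<in> C"
  have sA: "\<sigma> \<in> Aut" by (rule autgD[OF G s])
  have xc: "x \<in> RR" using x by (simp add: C_def)
  obtain \<tau> where t: "\<tau> \<in> \<Gamma>" "ALL x:RR. \<tau> (\<sigma> x) = x \<and> \<sigma> (\<tau> x) = x" using autg_inv[OF G s] by blast
  have tA: "\<tau> \<in> Aut" by (rule autgD[OF G t(1)])
  show "\<sigma> x \<in> C" unfolding C_def
  proof (intro CollectI conjI ballI)
   show "\<sigma> x \<in> RR" by (rule Aut_carrier[OF sA xc])
   fix D assume D: "D \<in> NB K"
   have Dc: "D \<subseteq> RR" using D NB_DD DD_carrier by blast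
   have "\<tau> ` D \<in> NB (\<tau> ` K)" using D Aut_DD[OF tA] by (auto simp: NB_def)
   from Fex[OF cc_image[OF tA K] this] obtain F where
    F: "finite F" "F \<subseteq> S" "ALL x:S. EX f:F. x \<ominus> f \<in> \<tau> ` D" by blast
   let ?D0 = "F <+> \<tau> ` D :: 'b set"
   have "S \<subseteq> ?D0"
   proof
    fix y assume y: "y \<in> S"
    then obtain f where f: "f \<in> F" "y \<ominus> f \<in> \<tau> ` D" using F by blast
    then have "y = f \<oplus> (y \<ominus> f)" using y F Sc minus_cancel by (metis subsetD)
    then show "y \<in> ?D0" using f unfolding set_add_iff by blast
   qed
   moreover have "?D0 \<in> DD" using F Sc D by (intro DD_add[OF DD_finite Aut_DD[OF tA]]) (auto simp: NB_def)
   ultimately have "?D0 \<in> NB K" using KS by (auto simp: NB_def)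
   then obtain g where g: "g \<in> S" "x \<ominus> g \<in> ?D0" using x unfolding C_def by blast
   then obtain f d where f: "f \<in> F" "d \<in> D" "x \<ominus> g = f \<oplus> \<tau> d" unfolding set_add_iff by blast
   have c: "g \<in> RR" "f \<in> RR" "d \<in> RR" "\<tau> d \<in> RR"
    using g f F Sc Dc Aut_carrier[OF tA] by auto
   have "x = (g \<oplus> f) \<oplus> \<tau> d" using f(3) minus_cancel[OF xc c(1)] c by (simp add: a_assoc)
   then have "\<sigma> x = \<sigma> (g \<oplus> f) \<oplus> d" using Aut_add[OF sA, of "g \<oplus> f" "\<tau> d"] c t by simp
   then have "\<sigma> x \<ominus> \<sigma> (g \<oplus> f) = d" using c Aut_carrier[OF sA] by (simp add: add_cancel)
   moreover have "\<sigma> (g \<oplus> f) \<in> S"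
    unfolding S_def by (rule conjs_sums_inv[OF G Ka s]) (use asub_add[OF Sa] g f F in \<open>auto simp: S_def subset_iff\<close>)
   ultimately show "EX g:S. \<sigma> x \<ominus> g \<in> D" using f by blast
  qed
 qed
 moreover have "cc C" using Ca CT Cc by (simp add: cc_def)
 moreover have "ALL D:NB K. ALL x:C. EX g:S. x \<ominus> g \<in> D" by (auto simp: C_def)
 ultimately show ?thesis using KS SC unfolding S_def by blast
qed

section \<open>Orbits\<close>

definition fixg :: "'b set => ('b => 'b) set" where
 "fixg P = {\<sigma> \<in> Aut. ALL x:P. \<sigma> x = x}"

lemma fixg_empty: "fixg {} = Aut" by (simp add: fixg_def)

lemma autg_fixg: "P \<subseteq> RR ==> autg (fixg P)"
 unfolding autg_def
proof (intro conjI ballI)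
 fix \<sigma> assume P: "P \<subseteq> RR" and s: "\<sigma> \<in> fixg P"
 then obtain \<tau> where t: "\<tau> \<in> Aut" "ALL x:RR. \<tau> (\<sigma> x) = x \<and> \<sigma> (\<tau> x) = x"
  using Aut_inv unfolding fixg_def by blast
 have "\<tau> x = x" if "x \<in> P" for x
 proof -
  have "\<sigma> x = x" "x \<in> RR" using s that P by (auto simp: fixg_def)
  then show ?thesis using t(2) by metis
 qed
 then have "\<tau> \<in> fixg P" using t(1) by (simp add: fixg_def)
 then show "EX \<tau>:fixg P. ALL x:RR. \<tau> (\<sigma> x) = x \<and> \<sigma> (\<tau> x) = x" using t(2) by blast
qed (auto simp: fixg_def Aut_id Aut_comp)

text \<open>The families of the axiom on orbits.\<close>

definition isBB :: "'b set => 'b set set => bool" where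
 "isBB P \<B> \<longleftrightarrow> \<B> \<subseteq> DD \<and> |\<B>| <o \<kappa> \<and> range XX \<subseteq> \<B> \<and> (ALL B:\<B>. ALL C:\<B>. B \<inter> C \<in> \<B> \<and> B - C \<in> \<B>) \<and>
   (ALL B:\<B>. ginv (fixg P) B) \<and> (ALL x:RR. \<Inter>{B \<in> \<B>. x \<in> B} = {\<sigma> x | \<sigma>. \<sigma> \<in> fixg P})"

lemma isBB_ex: "P \<subseteq> RR ==> |P| <o \<kappa> ==> EX \<B>. isBB P \<B>"
proof -
 assume P: "P \<subseteq> RR" "|P| <o \<kappa>"
 from orbits[OF P] obtain \<B> where B: "\<B> \<subseteq> DD" "|\<B>| <o \<kappa>" "range XX \<subseteq> \<B>"
   "ALL B:\<B>. ALL C:\<B>. B \<inter> C \<in> \<B> \<and> B - C \<in> \<B>"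
   "ALL B:\<B>. ALL \<sigma>:Aut. (ALL x:P. \<sigma> x = x) --> \<sigma> ` B = B"
   "ALL x:RR. \<Inter>{B \<in> \<B>. x \<in> B} = {\<sigma> x | \<sigma>. \<sigma> \<in> Aut \<and> (ALL y:P. \<sigma> y = y)}" by auto
 have "isBB P \<B>" unfolding isBB_def ginv_def fixg_def mem_Collect_eq
  using B by (intro conjI) (assumption | simp)+
 then show ?thesis ..
qed

lemma BB_dir:
 assumes B: "isBB P \<B>" and K: "K \<subseteq> XX n"
 shows "dirf {B \<in> \<B>. K \<subseteq> B}"
 unfolding dirf_def
proof (intro conjI ballI)
 have "XX n \<in> \<B>" using B by (auto simp: isBB_def)
 then show "{B \<in> \<B>. K \<subseteq> B} \<noteq> {}" using K by blast
next
 fix A C assume "A \<in> {B \<in> \<B>. K \<subseteq> B}" "C \<in> {B \<in> \<B>. K \<subseteq> B}"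
 then have "A \<inter> C \<in> {B \<in> \<B>. K \<subseteq> B}" using B by (auto simp: isBB_def)
 then show "EX D:{B \<in> \<B>. K \<subseteq> B}. D \<subseteq> A \<inter> C" by blast
qed

lemma BB_small: "isBB P \<B> ==> |{B \<in> \<B>. Q B}| <o \<kappa>"
 by (rule kSubset[of \<B>]) (auto simp: isBB_def)

lemma BB_DD: "isBB P \<B> ==> {B \<in> \<B>. Q B} \<subseteq> DD" by (auto simp: isBB_def)

lemma orbit_dir:
 assumes B: "isBB P \<B>" and x: "x \<in> RR"
 shows "dirf {B \<in> \<B>. x \<in> B}"
proof -
 obtain n where "{x} \<subseteq> XX n" using x in_carrierE by blast
 from BB_dir[OF B this] show ?thesis by simp
qed

text \<open>Otherwise each point of the orbit of \<open>x\<close> is separated from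
\<open>K\<close>; as the orbit is the intersection of the sets around \<open>x\<close>,
compactness separates it from \<open>K\<close> by a member of \<open>\<B>\<close>, whose
complement contains \<open>K\<close> but not \<open>x\<close>.\<close>

lemma BB_saturation:
 assumes B: "isBB P \<B>" and K: "TD K" and x: "x \<in> \<Inter>{B \<in> \<B>. K \<subseteq> B}" "x \<in> RR"
 shows "EX \<sigma>:fixg P. \<sigma> x \<in> K"
proof (rule ccontr)
 assume no: "\<not> ?thesis"
 let ?O = "\<Inter>{B \<in> \<B>. x \<in> B}"
 have O: "?O = {\<sigma> x | \<sigma>. \<sigma> \<in> fixg P}" using B x(2) by (auto simp: isBB_def)
 have dir: "dirf {B \<in> \<B>. x \<in> B}" by (rule orbit_dir[OF B x(2)])
 have OT: "TD ?O" unfolding TD_def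
  by (intro exI[of _ "{B \<in> \<B>. x \<in> B}"] conjI BB_DD[OF B] BB_small[OF B] refl) (use dir in \<open>simp add: dirf_def\<close>)
 have "K \<inter> ?O = {}" unfolding O using no by blast
 then have "{} \<in> NB (K \<inter> ?O)" by (simp add: NB_def DD_empty)
 from NB_two[OF K OT this] obtain E F where EF: "E \<in> NB K" "F \<in> NB ?O" "E \<inter> F \<subseteq> {}" by blast
 obtain B' where B': "B' \<in> \<B>" "x \<in> B'" "B' \<subseteq> F"
  using NB_base[OF dir BB_DD[OF B] BB_small[OF B] EF(2)] by blast
 obtain n where n: "K \<subseteq> XX n" using TD_bdd[OF K] by blast
 have "XX n \<in> \<B>" using B by (auto simp: isBB_def)
 then have "XX n - B' \<in> \<B>" using B B'(1) by (simp add: isBB_def)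
 moreover have "K \<subseteq> XX n - B'" using n EF B' by (auto simp: NB_def)
 ultimately have "x \<in> XX n - B'" using x(1) by blast
 then show False using B' by blast
qed

lemma BB_inv_TD:
 assumes B: "isBB P \<B>" and P: "P \<subseteq> RR" and K: "TD K" "ginv (fixg P) K"
 shows "K = \<Inter>{B \<in> \<B>. K \<subseteq> B}"
proof (intro equalityI subsetI)
 fix x assume x: "x \<in> \<Inter>{B \<in> \<B>. K \<subseteq> B}"
 obtain n where n: "K \<subseteq> XX n" using TD_bdd[OF K(1)] by blast
 then have "XX n \<in> {B \<in> \<B>. K \<subseteq> B}" using B by (auto simp: isBB_def)
 then have xc: "x \<in> RR" using x XX_carrier by blast
 obtain \<sigma> where s: "\<sigma> \<in> fixg P" "\<sigma> x \<in> K" using BB_saturation[OF B K(1) x xc] by blast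
 obtain \<tau> where t: "\<tau> \<in> fixg P" "ALL x:RR. \<tau> (\<sigma> x) = x \<and> \<sigma> (\<tau> x) = x"
  using autg_inv[OF autg_fixg[OF P] s(1)] by blast
 have "\<tau> (\<sigma> x) \<in> K" by (rule ginvD[OF K(2) t(1) s(2)])
 then show "x \<in> K" using t xc by simp
qed blast

section \<open>The additive component\<close>

lemma XX0_gsym: "gsym (XX 0)"
proof -
 have "ALL x:XX 0. EX f:{\<zero>}. EX d:XX 0. x = f \<oplus> d" using XX_carrier by auto
 then have "gen (XX 0)" unfolding gen_def by (intro exI[of _ "{\<zero>}"]) auto
 then show ?thesis by (simp add: gsym_def XX_DD XX_zero XX_neg)
qed

lemma finite_reps_XX1:
 assumes "Z \<subseteq> XX n"
 shows "EX F. finite F \<and> F \<subseteq> Z \<and> (ALL x:Z. EX f:F. x \<ominus> f \<in> XX 1)"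
proof -
 have g: "gen (XX 0)" using XX0_gsym by (simp add: gsym_def)
 from gen_col[OF g XX_sub, of n] obtain c :: "'b => 'b \<times> 'b" where
  c: "finite (c ` XX n)" "ALL x:XX n. ALL y:XX n. c x = c y --> (EX d:XX 0. EX d':XX 0. x \<ominus> y = d \<ominus> d')" by blast
 have "finite (c ` Z)" by (rule finite_subset[OF _ c(1)]) (use assms in blast)
 from reps[OF this] obtain F where F: "finite F" "F \<subseteq> Z" "ALL x:Z. EX f:F. c x = c f" by blast
 show ?thesis
 proof (intro exI[of _ F] conjI ballI F)
  fix x assume x: "x \<in> Z"
  then obtain f where f: "f \<in> F" "c x = c f" using F by blast
  then obtain d d' where "d \<in> XX 0" "d' \<in> XX 0" "x \<ominus> f = d \<ominus> d'" using c(2) x F assms by blast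
  then show "EX f:F. x \<ominus> f \<in> XX 1" using f XX_minus[of d 0 d'] by (intro bexI[of _ f]) auto
 qed
qed

lemma asub_setadd: "asub P ==> asub Q ==> asub (P <+> Q)"
proof (rule asubI)
 assume P: "asub P" "asub Q"
 note c = asub_carrier[OF P(1), THEN subsetD] asub_carrier[OF P(2), THEN subsetD]
 show "P <+> Q \<subseteq> RR" using c by (auto simp: set_add_iff)
 have "\<zero> = \<zero> \<oplus> \<zero>" by simp
 then show "\<zero> \<in> P <+> Q" using asub_zero P unfolding set_add_iff by blast
 fix x :: 'b assume "x \<in> P <+> Q"
 then obtain a b where ab: "a \<in> P" "b \<in> Q" "x = a \<oplus> b" unfolding set_add_iff by blast
 then have "\<ominus> x = \<ominus> a \<oplus> \<ominus> b" using c by (simp add: minus_add)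
 then show "\<ominus> x \<in> P <+> Q" using asub_neg P ab unfolding set_add_iff by blast
 fix y :: 'b assume "y \<in> P <+> Q"
 then obtain a' b' where ab': "a' \<in> P" "b' \<in> Q" "y = a' \<oplus> b'" unfolding set_add_iff by blast
 then have "x \<oplus> y = (a \<oplus> a') \<oplus> (b \<oplus> b')" using ab c by (simp add: a_ac)
 then show "x \<oplus> y \<in> P <+> Q" using asub_add P ab ab' unfolding set_add_iff by blast
qed

text \<open>Finitely many elements \<open>F\<close> represent the sums in the next layer up to
\<open>XX 1\<close>, and \<open>F\<close> lies in a finite sum \<open>P\<close> of conjugates,
which is a bounded subgroup. By induction on the number of summands, each sum of conjugates is in
\<open>P + XX n\<close>: the error is renormalised after each step and never accumulates.\<close>

lemma bounded_conjs:
 assumes G: "autg \<Gamma>" and K: "asub K" "K \<subseteq> XX n" and n: "1 \<le> n"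
 shows "EX m. asums (conjs \<Gamma> K) \<subseteq> XX m"
proof -
 define S where "S = asums (conjs \<Gamma> K)"
 have GA: "\<Gamma> \<subseteq> Aut" using G by (simp add: autg_def)
 have Sa: "asub S" unfolding S_def by (rule conjs_asub[OF GA K(1)])
 have Sc: "S \<subseteq> RR" by (rule asub_carrier[OF Sa])
 have cS: "conjs \<Gamma> K \<subseteq> S" unfolding S_def by (rule asums_base[OF conjs_asub(1)[OF GA K(1)]])
 have cX: "conjs \<Gamma> K \<subseteq> XX n"
  unfolding conjs_def using GA K(2) Aut_XX by blast
 let ?bs = "%P. asub P \<and> P \<subseteq> S \<and> (EX m. P \<subseteq> XX m)"
 have bs_add: "?bs (P <+> Q)" if PQ: "?bs P" "?bs Q" for P Q
 proof (intro conjI)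
  show "asub (P <+> Q)" using asub_setadd PQ by blast
  show "P <+> Q \<subseteq> S"
  proof
   fix z :: 'b assume "z \<in> P <+> Q"
   then obtain x y where "x \<in> P" "y \<in> Q" "z = x \<oplus> y" unfolding set_add_iff by blast
   then show "z \<in> S" using PQ asub_add[OF Sa, of x y] by blast
  qed
  obtain a b where "P \<subseteq> XX a" "Q \<subseteq> XX b" using PQ by blast
  then have "P \<subseteq> XX (max a b)" "Q \<subseteq> XX (max a b)" using XX_mono[of a "max a b"] XX_mono[of b "max a b"] by auto
  then show "EX m. P <+> Q \<subseteq> XX m" using XX_set_add by blast
 qed
 have zero_bs: "?bs {\<zero>}"
 proof (intro conjI)
  show "asub {\<zero>}" by (rule asubI) (auto simp: neg_zero)
  show "EX m. {\<zero>} \<subseteq> XX m" using XX_zero by blast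
 qed (use asub_zero[OF Sa] in simp)
 have one': "x \<in> asums (conjs \<Gamma> K) ==> EX P. ?bs P \<and> x \<in> P" for x
 proof (induction rule: asums.induct)
  case asums_zero
  have "?bs {\<zero>}" using zero_bs .
  then show ?case by blast
 next
  case (asums_step x z)
  then obtain P where P: "?bs P" "x \<in> P" by blast
  obtain \<sigma> where s: "\<sigma> \<in> \<Gamma>" "z \<in> \<sigma> ` K" using asums_step by (auto simp: conjs_def)
  have "\<sigma> ` K \<subseteq> conjs \<Gamma> K" using s by (auto simp: conjs_def)
  then have "?bs (\<sigma> ` K)" using asub_image[OF autgD[OF G s(1)] K(1)] cS cX by blast
  then have "?bs (P <+> \<sigma> ` K)" by (rule bs_add[OF P(1)])
  moreover have "x \<oplus> z \<in> P <+> \<sigma> ` K" using P(2) s(2) unfolding set_add_iff by blast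
  ultimately show ?case by blast
 qed
 then have one: "EX P. ?bs P \<and> x \<in> P" if "x \<in> S" for x using that unfolding S_def by blast
 have fin: "EX P. ?bs P \<and> F \<subseteq> P" if "finite F" "F \<subseteq> S" for F
  using that
 proof (induction F rule: finite_induct)
  case empty
  have "?bs {\<zero>}" using zero_bs .
  then show ?case by blast
 next
  case (insert x F)
  have "x \<in> S" "F \<subseteq> S" using insert.prems by auto
  from insert.IH[OF this(2)] obtain P where P12: "?bs P \<and> F \<subseteq> P" ..
  from one[OF \<open>x \<in> S\<close>] obtain Q where P34: "?bs Q \<and> x \<in> Q" ..
  note P = conjunct1[OF P12] conjunct2[OF P12] conjunct1[OF P34] conjunct2[OF P34]
  have PQ: "asub P" "asub Q" using P(1,3) by auto
  have "y \<in> P <+> Q" if "y \<in> P \<or> y \<in> Q" for y :: 'b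
  proof -
   have "y \<in> RR" using that PQ[THEN asub_carrier] by blast
   then have "y = y \<oplus> \<zero>" "y = \<zero> \<oplus> y" by simp_all
   then show ?thesis using that PQ[THEN asub_zero] unfolding set_add_iff by blast
  qed
  then have "insert x F \<subseteq> P <+> Q" using P(2,4) by blast
  then show ?case using bs_add[OF P(1,3)] by (intro exI[of _ "P <+> Q :: 'b set"]) simp
 qed
 have ZX: "XX (Suc n) \<inter> S \<subseteq> XX (Suc n)" by blast
 from finite_reps_XX1[OF this] obtain F where
  F: "finite F" "F \<subseteq> XX (Suc n) \<inter> S" "ALL x:XX (Suc n) \<inter> S. EX f:F. x \<ominus> f \<in> XX 1" by blast
 have FS: "F \<subseteq> S" using F(2) by blast
 from fin[OF F(1) FS] obtain P where P12: "?bs P \<and> F \<subseteq> P" ..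
 note P = conjunct1[OF P12] conjunct2[OF P12]
 have Pc: "P \<subseteq> RR" using P asub_carrier by blast
 have "x \<in> asums (conjs \<Gamma> K) ==> EX p:P. EX q:XX n \<inter> S. x = p \<oplus> q" for x
 proof (induction rule: asums.induct)
  case asums_zero
  have "\<zero> = \<zero> \<oplus> \<zero>" by simp
  then show ?case using P asub_zero XX_zero'[of n] asub_zero[OF Sa] by blast
 next
  case (asums_step x z)
  then obtain p q where pq: "p \<in> P" "q \<in> XX n" "q \<in> S" "x = p \<oplus> q" by blast
  have z: "z \<in> XX n" "z \<in> S" using asums_step cS cX by auto
  have "q \<oplus> z \<in> XX (Suc n) \<inter> S" using pq z XX_add asub_add[OF Sa] by blast
  then obtain f where f: "f \<in> F" "q \<oplus> z \<ominus> f \<in> XX 1" using F(3) by blast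
  have fP: "f \<in> P" "f \<in> S" using f F P by auto
  have c: "p \<in> RR" "q \<in> RR" "z \<in> RR" "f \<in> RR" using pq z fP Pc Sc by auto
  have "x \<oplus> z = (p \<oplus> f) \<oplus> (q \<oplus> z \<ominus> f)"
   using c pq(4) minus_cancel[of "q \<oplus> z" f] by (simp add: a_assoc)
  moreover have "p \<oplus> f \<in> P" using asub_add P pq fP by blast
  moreover have "q \<oplus> z \<ominus> f \<in> XX n" using f(2) XX_mono[OF n] by blast
  moreover have "q \<oplus> z \<ominus> f \<in> S" using asub_minus[OF Sa] asub_add[OF Sa] pq z fP by blast
  ultimately show ?case by blast
 qed
 then have "EX p:P. EX q:XX n. x = p \<oplus> q" if "x \<in> S" for x using that unfolding S_def by blast
 moreover obtain a where "P \<subseteq> XX a" using P by blast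
 ultimately have "S \<subseteq> XX a <+> XX n" unfolding subset_iff set_add_iff by blast
 moreover have "XX a <+> XX n \<subseteq> XX (Suc (max a n))"
  by (rule XX_set_add) (use XX_mono in auto)
 ultimately show ?thesis unfolding S_def by blast
qed

lemma inv_cc_exists: "EX K. cc K \<and> ginv Aut K"
proof -
 obtain K where K: "ccw K" "K \<subseteq> dbl (dbl (XX 0))" using bogolyubov[OF XX0_gsym] by blast
 have "dbl (XX 0) \<subseteq> XX 1" using XX_set_add[of "XX 0" 0 "XX 0"] by (simp add: dbl_def)
 then have "dbl (dbl (XX 0)) \<subseteq> XX 2" using XX_set_add[of "dbl (XX 0)" 1 "dbl (XX 0)"] by (simp add: dbl_def numeral_2_eq_2)
 then have KX: "K \<subseteq> XX 2" using K by blast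
 have cK: "cc K" using K ccw_cc by blast
 obtain m where "asums (conjs Aut K) \<subseteq> XX m" using bounded_conjs[OF autg_Aut cc_asub[OF cK] KX] by auto
 from conjs_closure[OF autg_Aut cK this] show ?thesis by blast
qed

text \<open>For \<open>Aut\<close> the automorphisms over \<open>A\<close>, this is $(\bar
R,+)^{00}_A$.\<close>

definition ccomp :: "'b set" where "ccomp = \<Inter>{K. cc K \<and> ginv Aut K}"

lemma ccomp_least: "cc K ==> ginv Aut K ==> ccomp \<subseteq> K" by (auto simp: ccomp_def)

lemma ccomp_cc: "cc ccomp" and ccomp_inv: "ginv Aut ccomp"
proof -
 let ?K = "{K. cc K \<and> ginv Aut K}"
 obtain \<B> where B: "isBB {} \<B>" using isBB_ex[of "{}"] kFinite[of "{}"] by auto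
 let ?F = "{B \<in> \<B>. EX K:?K. K \<subseteq> B}"
 have "K = \<Inter>{B \<in> \<B>. K \<subseteq> B}" if "K \<in> ?K" for K
  using BB_inv_TD[OF B] that cc_TD by (simp add: fixg_empty)
 then have eq: "ccomp = \<Inter>?F" unfolding ccomp_def by blast
 obtain K0 where K0: "K0 \<in> ?K" using inv_cc_exists by blast
 have dir: "dirf ?F" unfolding dirf_def
 proof (intro conjI ballI)
  obtain n where "K0 \<subseteq> XX n" using K0 cc_TD TD_bdd by blast
  moreover have "XX n \<in> \<B>" using B by (auto simp: isBB_def)
  ultimately show "?F \<noteq> {}" using K0 by blast
  fix A C assume "A \<in> ?F" "C \<in> ?F"
  then obtain K L where KL: "K \<in> ?K" "K \<subseteq> A" "L \<in> ?K" "L \<subseteq> C" "A \<in> \<B>" "C \<in> \<B>" by blast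
  have "ginv Aut (K \<inter> L)"
   by (rule ginvI[OF autg_Aut]) (use KL ginvD cc_asub asub_carrier in blast)+
  then have "K \<inter> L \<in> ?K" using KL cc_Int by blast
  moreover have "A \<inter> C \<in> \<B>" using B KL by (auto simp: isBB_def)
  ultimately show "EX D:?F. D \<subseteq> A \<inter> C" using KL by (intro bexI[of _ "A \<inter> C"]) blast+
 qed
 have small: "|?F| <o \<kappa>" and FDD: "?F \<subseteq> DD" by (rule BB_small[OF B], rule BB_DD[OF B])
 have T: "TD ccomp" unfolding TD_def eq using small FDD dir by (intro exI[of _ ?F]) (auto simp: dirf_def)
 have "asub (\<Inter>K\<in>?K. K)" using K0 cc_asub by (intro asub_INT) auto
 then have a: "asub ccomp" by (simp add: ccomp_def)
 have "coc ccomp" unfolding coc_def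
 proof
  fix D assume D: "D \<in> NB ccomp"
  then obtain A where "A \<in> ?F" "A \<subseteq> D" using NB_base[OF dir FDD small, of D] D[unfolded eq] by blast
  then obtain K where "K \<in> ?K" "K \<subseteq> D" by blast
  then show "gen D" using D by (auto simp: cc_def coc_def NB_def)
 qed
 then show "cc ccomp" using T a by (simp add: cc_def)
 show "ginv Aut ccomp"
  by (rule ginvI[OF autg_Aut]) (use asub_carrier[OF a] ginvD in \<open>auto simp: ccomp_def\<close>)
qed

text \<open>The automorphisms that act trivially modulo the component. They fix \<open>c\<close>
up to \<open>ccomp\<close> for every \<open>c\<close>, so sets defined from \<open>c\<close>
modulo \<open>ccomp\<close> are invariant under them without adding \<open>c\<close> to the
parameters.\<close>

definition aut0 :: "('b => 'b) set" where
 "aut0 = {\<sigma> \<in> Aut. ALL x:RR. \<sigma> x \<ominus> x \<in> ccomp}"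

lemma aut0D: "\<sigma> \<in> aut0 ==> x \<in> RR ==> \<sigma> x \<ominus> x \<in> ccomp" by (simp add: aut0_def)

lemma ccomp_asub: "asub ccomp" by (rule cc_asub[OF ccomp_cc])

lemma minus_trans:
 "x \<in> RR ==> y \<in> RR ==> z \<in> RR ==> (x \<ominus> y) \<oplus> (y \<ominus> z) = x \<ominus> z"
proof -
 assume c: "x \<in> RR" "y \<in> RR" "z \<in> RR"
 have "(x \<ominus> y) \<oplus> (y \<ominus> z) = (\<ominus> y \<oplus> y) \<oplus> (x \<oplus> \<ominus> z)" using c by (simp add: minus_eq a_ac)
 then show ?thesis using c by (simp add: l_neg minus_eq)
qed

lemma autg_aut0: "autg aut0"
 unfolding autg_def
proof (intro conjI ballI)
 show "id \<in> aut0" using Aut_id asub_zero[OF ccomp_asub] by (auto simp: aut0_def minus_eq r_neg)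
 fix \<sigma> assume s: "\<sigma> \<in> aut0"
 then have sA: "\<sigma> \<in> Aut" by (simp add: aut0_def)
 {
  fix \<tau> assume t: "\<tau> \<in> aut0"
  then have tA: "\<tau> \<in> Aut" by (simp add: aut0_def)
  have "\<sigma> (\<tau> x) \<ominus> x \<in> ccomp" if x: "x \<in> RR" for x
  proof -
   have c: "\<tau> x \<in> RR" "\<sigma> (\<tau> x) \<in> RR" using x tA sA Aut_carrier by auto
   show ?thesis using asub_add[OF ccomp_asub aut0D[OF s c(1)] aut0D[OF t x]] minus_trans[OF c(2,1) x] by simp
  qed
  then show "\<sigma> \<circ> \<tau> \<in> aut0" using Aut_comp[OF sA tA] by (simp add: aut0_def)
 }
 obtain \<tau> where t: "\<tau> \<in> Aut" "ALL x:RR. \<tau> (\<sigma> x) = x \<and> \<sigma> (\<tau> x) = x" using Aut_inv[OF sA] by blast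
 have "\<tau> x \<ominus> x \<in> ccomp" if x: "x \<in> RR" for x
 proof -
  have c: "\<tau> x \<in> RR" using Aut_carrier[OF t(1) x] .
  have "x \<ominus> \<tau> x \<in> ccomp" using aut0D[OF s c] t x by simp
  then show ?thesis using asub_neg[OF ccomp_asub] neg_minus[OF x c] by metis
 qed
 then have "\<tau> \<in> aut0" using t by (simp add: aut0_def)
 then show "EX \<tau>:aut0. ALL x:RR. \<tau> (\<sigma> x) = x \<and> \<sigma> (\<tau> x) = x" using t by blast
qed (auto simp: aut0_def)

text \<open>The conjugate \<open>\<tau> K\<close> depends only on the action of
\<open>\<tau>\<close> on the cosets of the component. There are fewer than \<open>\<kappa>\<close>
such actions, so the intersection of all conjugates is again type-definable of bounded index, and
it is invariant.\<close>

lemma ccomp_least_aut0: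
 assumes K: "cc K" "ginv aut0 K"
 shows "ccomp \<subseteq> K"
proof -
 let ?cos = "a_rcosets ccomp"
 let ?act = "%\<tau>. {(ccomp +> x, ccomp +> \<tau> x) | x. x \<in> RR}"
 have Kc: "K \<subseteq> RR" using asub_carrier cc_asub K by blast
 have key: "\<tau> ` K \<subseteq> \<tau>' ` K" if tt: "\<tau> \<in> Aut" "\<tau>' \<in> Aut" "?act \<tau> = ?act \<tau>'" for \<tau> \<tau>'
 proof -
  obtain \<rho> where r: "\<rho> \<in> Aut" "ALL x:RR. \<rho> (\<tau>' x) = x \<and> \<tau>' (\<rho> x) = x" using Aut_inv[OF tt(2)] by blast
  have "\<rho> (\<tau> x) \<ominus> x \<in> ccomp" if x: "x \<in> RR" for x
  proof -
   have "(ccomp +> x, ccomp +> \<tau> x) \<in> ?act \<tau>'" using x tt(3) by blast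
   then obtain y where y: "y \<in> RR" "ccomp +> x = ccomp +> y" "ccomp +> \<tau> x = ccomp +> \<tau>' y" by blast
   have c: "\<tau> x \<in> RR" "\<tau>' y \<in> RR" "\<tau>' x \<in> RR" using x y tt Aut_carrier by auto
   have "y \<ominus> x \<in> ccomp" by (rule coset_eqD[OF ccomp_asub y(1) x y(2)[symmetric]])
   then have "\<tau>' (y \<ominus> x) \<in> ccomp" by (rule ginvD[OF ccomp_inv tt(2)])
   then have "\<tau>' y \<ominus> \<tau>' x \<in> ccomp" using Aut_minus[OF tt(2) y(1) x] by simp
   moreover have "\<tau> x \<ominus> \<tau>' y \<in> ccomp" by (rule coset_eqD[OF ccomp_asub c(1,2) y(3)])
   ultimately have "\<tau> x \<ominus> \<tau>' x \<in> ccomp" using asub_add[OF ccomp_asub] minus_trans[OF c] by metis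
   then have "\<rho> (\<tau> x \<ominus> \<tau>' x) \<in> ccomp" by (rule ginvD[OF ccomp_inv r(1)])
   then show ?thesis using Aut_minus[OF r(1) c(1,3)] r(2) x by simp
  qed
  then have ra: "\<rho> \<circ> \<tau> \<in> aut0" using Aut_comp[OF r(1) tt(1)] by (simp add: aut0_def)
  show ?thesis
  proof
   fix z assume "z \<in> \<tau> ` K"
   then obtain k where k: "k \<in> K" "z = \<tau> k" by blast
   have "\<rho> z \<in> K" using ginvD[OF K(2) ra k(1)] k by simp
   moreover have "z = \<tau>' (\<rho> z)" using k Kc r(2) Aut_carrier[OF tt(1)] by auto
   ultimately show "z \<in> \<tau>' ` K" by blast
  qed
 qed
 let ?I = "(%\<tau>. \<tau> ` K) ` Aut"
 have IP: "?I \<subseteq> (%Z. (SOME \<tau>. \<tau> \<in> Aut \<and> ?act \<tau> = Z) ` K) ` Pow (?cos \<times> ?cos)"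
 proof
  fix Z assume "Z \<in> ?I"
  then obtain \<tau> where t: "\<tau> \<in> Aut" "Z = \<tau> ` K" by blast
  let ?t = "SOME \<tau>'. \<tau>' \<in> Aut \<and> ?act \<tau>' = ?act \<tau>"
  have s: "?t \<in> Aut \<and> ?act ?t = ?act \<tau>" by (rule someI[of _ \<tau>]) (use t in simp)
  then have "\<tau> ` K = ?t ` K" using key[of \<tau> ?t] key[of ?t \<tau>] t by (intro equalityI) simp_all
  moreover have "?act \<tau> \<subseteq> ?cos \<times> ?cos" using Aut_carrier[OF t(1)] by (auto simp: A_RCOSETS_def')
  ultimately show "Z \<in> (%Z. (SOME \<tau>. \<tau> \<in> Aut \<and> ?act \<tau> = Z) ` K) ` Pow (?cos \<times> ?cos)"
   using t(2) by (intro image_eqI[of _ _ "?act \<tau>"]) simp_all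
 qed
 have "|?cos| <o \<kappa>" using cc_bidx[OF ccomp_cc] by (simp add: bidx_def)
 then have "|Pow (?cos \<times> ?cos)| <o \<kappa>" by (intro kPow kTimes)
 then have Ismall: "|?I| <o \<kappa>" by (rule kSubset[OF kImage IP])
 obtain \<F> where F: "\<F> \<subseteq> DD" "\<F> \<noteq> {}" "|\<F>| <o \<kappa>" "K = \<Inter>\<F>" using cc_TD[OF K(1)] by (auto simp: TD_def)
 define tt where "tt Z = (SOME \<tau>. \<tau> \<in> Aut \<and> Z = \<tau> ` K)" for Z
 have tt: "tt Z \<in> Aut \<and> Z = tt Z ` K" if "Z \<in> ?I" for Z
 proof -
  have "EX \<tau>. \<tau> \<in> Aut \<and> Z = \<tau> ` K" using that by blast
  then show ?thesis unfolding tt_def by (rule someI_ex)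
 qed
 have "cc (\<Inter>Z\<in>?I. Z)"
 proof (rule coc_family[OF _ Ismall F(2,3)])
  show "?I \<noteq> {}" using Aut_id by blast
  fix Z assume Z: "Z \<in> ?I"
  have "Z = tt Z ` (\<Inter>\<F>)" using tt[OF Z] F(4) by simp
  also have "\<dots> = (\<Inter>D\<in>\<F>. tt Z ` D)"
   by (rule image_INT_carrier[OF _ F(2)]) (use tt[OF Z] F DD_carrier in auto)
  finally show "Z = (\<Inter>D\<in>\<F>. tt Z ` D)" .
  show "tt Z ` D \<in> DD" if "D \<in> \<F>" for D using tt[OF Z] Aut_DD F that by blast
  show "cc Z" using Z cc_image K by blast
 qed
 moreover have "ginv Aut (\<Inter>Z\<in>?I. Z)"
 proof (rule ginvI[OF autg_Aut])
  show "(\<Inter>Z\<in>?I. Z) \<subseteq> RR" using Aut_id Kc by force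
  fix \<sigma> x assume s: "\<sigma> \<in> Aut" and x: "x \<in> (\<Inter>Z\<in>?I. Z)"
  obtain \<rho> where r: "\<rho> \<in> Aut" "ALL x:RR. \<rho> (\<sigma> x) = x \<and> \<sigma> (\<rho> x) = x" using Aut_inv[OF s] by blast
  have "\<sigma> x \<in> \<tau> ` K" if t: "\<tau> \<in> Aut" for \<tau>
  proof -
   have "x \<in> (\<rho> \<circ> \<tau>) ` K" using x Aut_comp[OF r(1) t] by blast
   then obtain k where k: "k \<in> K" "x = \<rho> (\<tau> k)" by auto
   then have "\<sigma> x = \<tau> k" using r(2) Kc Aut_carrier[OF t] by auto
   then show ?thesis using k by blast
  qed
  then show "\<sigma> x \<in> (\<Inter>Z\<in>?I. Z)" by blast
 qed
 ultimately have "ccomp \<subseteq> (\<Inter>Z\<in>?I. Z)" by (rule ccomp_least)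
 also have "\<dots> \<subseteq> id ` K" using Aut_id by blast
 finally show ?thesis by simp
qed

end

section \<open>Ergodicity\<close>

lemma (in density) upd_endo:
 assumes s: "\<And>x. x \<in> U ==> \<sigma> x \<in> U" "\<And>x y. x \<in> U ==> y \<in> U ==> \<sigma> (x \<ominus> y) = \<sigma> x \<ominus> \<sigma> y"
  and t: "\<And>x. x \<in> U ==> \<tau> x \<in> U" "\<And>x. x \<in> U ==> \<sigma> (\<tau> x) = x"
  and X: "\<And>x. x \<in> U ==> \<sigma> x \<in> X \<longleftrightarrow> x \<in> X" and b: "bdd (%x. f (\<sigma> x))"
 shows "upd f \<le> upd (%x. f (\<sigma> x))"
proof (rule upd_ge[OF b])
 fix r assume "r \<in> uset (%x. f (\<sigma> x))"
 then obtain gs hs where g: "r = real (length hs) / real (length gs)" "gs \<noteq> []" "set gs \<subseteq> U" "set hs \<subseteq> U"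
  "ALL x:U. cov gs (%x. f (\<sigma> x)) x \<le> cov hs (ind X) x" by (auto simp: uset_def)
 have c: "cov (map \<sigma> ks) h x = cov ks (%x. h (\<sigma> x)) (\<tau> x)" if "set ks \<subseteq> U" "x \<in> U" for ks h x
  using that(1)
 proof (induction ks)
  case (Cons k ks)
  then have "\<sigma> (\<tau> x \<ominus> k) = x \<ominus> \<sigma> k" using s(2) t that(2) by simp
  then show ?case using Cons by simp
 qed simp
 have "r \<in> uset f"
 proof (rule usetI)
  show "map \<sigma> gs \<noteq> []" "set (map \<sigma> gs) \<subseteq> U" "set (map \<sigma> hs) \<subseteq> U" using g s(1) by auto
  show "r = real (length (map \<sigma> hs)) / real (length (map \<sigma> gs))" using g by simp
  fix x assume x: "x \<in> U"
  have "cov (map \<sigma> gs) f x = cov gs (%x. f (\<sigma> x)) (\<tau> x)" by (rule c[OF g(3) x])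
  also have "\<dots> \<le> cov hs (ind X) (\<tau> x)" using g t x by blast
  also have "\<dots> \<le> cov hs (%x. ind X (\<sigma> x)) (\<tau> x)"
   by (rule cov_mono) (use g t x X in \<open>auto simp: ind_def\<close>)
  also have "\<dots> = cov (map \<sigma> hs) (ind X) x" using c[OF g(4) x] by simp
  finally show "cov (map \<sigma> gs) f x \<le> cov (map \<sigma> hs) (ind X) x" .
 qed
 then show "upd f \<le> r" by (rule upd_le)
qed

context definable_ring
begin

lemma density_asub: "asub H ==> density R H H"
 by unfold_locales (auto simp: asub_zero asub_add asub_neg dest: asub_carrier[THEN subsetD])

text \<open>Finitely many translates of a neighbourhood of \<open>K\<close> cover
\<open>H\<close>, so one of them, hence each, has positive density.\<close>

lemma upd_nbhd_pos:
 assumes H: "asub H" "H \<subseteq> XX n" and K: "cc K" "E \<in> NB K" and h: "h \<in> H" and Y: "\<And>x. x \<in> H ==> x \<ominus> h \<in> E ==> x \<in> Y"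
  and YH: "Y \<subseteq> H"
 shows "0 < density.upd R H H (ind Y)"
proof -
 interpret h: density R H H by (rule density_asub[OF H(1)])
 have b1: "h.bdd (ind Z)" for Z unfolding h.bdd_def
  by (intro exI[of _ "[\<zero>]"]) (auto simp: h.ind_def asub_zero[OF H(1)] h.minus_zero_U)
 obtain F where F: "finite F" "F \<subseteq> H" "ALL x:H. EX f:F. x \<ominus> f \<in> E" using cc_reps[OF K H(2)] by blast
 obtain fs where fs: "set fs = F" using finite_list[OF F(1)] by blast
 have hc: "h \<in> RR" using h H asub_carrier by blast
 let ?ks = "map (%f. f \<ominus> h) fs"
 have ks: "set ?ks \<subseteq> H" using fs F h asub_minus[OF H(1)] by auto
 have "1 \<le> h.upd (ind H)" by (rule h.upd_base)
 also have "\<dots> \<le> h.upd (h.cov ?ks (ind Y))"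
 proof (rule h.upd_mono[OF h.bdd_cov[OF b1 ks]])
  fix x assume x: "x \<in> H"
  then obtain f where f: "f \<in> set fs" "x \<ominus> f \<in> E" using F fs by blast
  have c: "x \<in> RR" "f \<in> RR" using x f fs F H asub_carrier by blast+
  have "x \<ominus> (f \<ominus> h) \<in> H" using x f fs F h asub_minus[OF H(1)] by blast
  moreover have "(x \<ominus> (f \<ominus> h)) \<ominus> h = x \<ominus> f"
  proof -
   have "(x \<ominus> (f \<ominus> h)) \<ominus> h = x \<ominus> ((f \<ominus> h) \<oplus> h)" using c hc by (intro h.minus_minus_eq) auto
   also have "(f \<ominus> h) \<oplus> h = f" using minus_cancel[OF c(2) hc] c hc by (simp add: a_comm)
   finally show ?thesis .
  qed
  ultimately have "x \<ominus> (f \<ominus> h) \<in> Y" using Y f by simp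
  then have "ind Y (x \<ominus> (f \<ominus> h)) = 1" by (simp add: h.ind_def)
  moreover have "ind Y (x \<ominus> (f \<ominus> h)) \<le> h.cov ?ks (ind Y) x"
   using f(1) by (auto simp: h.cov_def comp_def intro!: member_le_sum_list)
  ultimately show "ind H x \<le> h.cov ?ks (ind Y) x" by (simp add: h.ind_def)
 qed
 also have "\<dots> \<le> real (length ?ks) * h.upd (ind Y)" by (rule h.upd_cov_le[OF b1 ks])
 finally show ?thesis using h.upd_nonneg[OF b1, of Y] by (cases "h.upd (ind Y) = 0") auto
qed

text \<open>Minimise the density of \<open>Y + L\<close> over the subgroups \<open>L\<close> in
\<open>ccw\<close>; a countable intersection \<open>M\<close> attains the minimum
\<open>a\<close>. Conjugating \<open>M\<close> does not change \<open>Y + M\<close> in density as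
\<open>Y\<close> is invariant, so for finitely many conjugates \<open>Y + \<sigma> M\<close>
exceeds \<open>Z = Y + N\<close>, \<open>N\<close> in the intersection of these conjugates, by a
negligible set, and \<open>Z\<close> is invariant up to negligible sets under sums of elements of
the \<open>\<sigma> M\<close>. Since \<open>H\<close> is least, such sums are dense in
\<open>H\<close>. If the neighbourhood of \<open>g\<close> missed \<open>Y\<close>, its translates
by finitely many such sums would cover \<open>Z\<close> while meeting \<open>Z\<close> in
negligible sets, and \<open>a\<close> would be 0.\<close>

theorem ergodic:
 assumes G: "autg \<Gamma>" and H: "cc H" "ginv \<Gamma> H"
  and least: "\<And>K. cc K ==> ginv \<Gamma> K ==> H \<subseteq> K"
  and Y: "Y \<subseteq> H" "ginv \<Gamma> Y" and pos: "0 < density.upd R H H (ind Y)"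
  and K: "ccw K" "K \<subseteq> Q" "Q \<in> DD" and g: "g \<in> H"
 shows "EX y:Y. g \<ominus> y \<in> Q"
proof (rule ccontr)
 assume no: "\<not> ?thesis"
 note Ha = cc_asub[OF H(1)]
 have Hc: "H \<subseteq> RR" by (rule asub_carrier[OF Ha])
 interpret h: density R H H by (rule density_asub[OF Ha])
 obtain n where n: "H \<subseteq> XX n" using TD_bdd[OF cc_TD[OF H(1)]] by blast
 have b1: "h.bdd (ind Z)" for Z unfolding h.bdd_def
  by (intro exI[of _ "[\<zero>]"]) (auto simp: h.ind_def asub_zero[OF Ha] h.minus_zero_U)
 \<comment> \<open>\<open>YK L = Y + L\<close>\<close>
 define YK where "YK L = {x \<in> H. EX y:Y. x \<ominus> y \<in> L}" for L
 define pw where "pw L = h.upd (ind (YK L))" for L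
 have pw_mono: "L \<subseteq> L' ==> pw L \<le> pw L'" for L L' unfolding pw_def
  by (rule h.upd_mono[OF b1]) (auto simp: h.ind_def YK_def)
 define a where "a = (INF L\<in>{L. ccw L}. pw L)"
 have bb: "bdd_below (pw ` {L. ccw L})"
  by (rule bdd_belowI2[of _ 0]) (simp add: pw_def h.upd_nonneg[OF b1])
 have a_le: "ccw L ==> a \<le> pw L" for L unfolding a_def by (rule cINF_lower[OF bb]) simp
 have "EX L. ccw L \<and> pw L < a + 1 / real (Suc i)" for i
 proof -
  have "a < a + 1 / real (Suc i)" by simp
  then show ?thesis using cINF_less_iff[OF _ bb] K(1) unfolding a_def by blast
 qed
 then obtain L where L: "\<And>i. ccw (L i)" "\<And>i. pw (L i) < a + 1 / real (Suc i)" by metis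
 define M where "M = (\<Inter>i. L i) \<inter> K"
 have M: "ccw M" unfolding M_def by (intro ccw_Int ccw_INT L K)
 have pwM: "pw M = a"
 proof (rule antisym)
  have "pw M \<le> a + 1 / real (Suc i)" for i
  proof -
   have "M \<subseteq> L i" by (auto simp: M_def)
   then show ?thesis using pw_mono[of M "L i"] L(2)[of i] by linarith
  qed
  then have "pw M - a \<le> 1 / real (Suc i)" for i by (simp add: algebra_simps)
  then show "pw M \<le> a"
   by (metis diff_gt_0_iff_gt inverse_eq_divide linorder_not_le reals_Archimedean)
 qed (rule a_le[OF M])
 note Ma = cc_asub[OF ccw_cc[OF M]] and MT = cc_TD[OF ccw_cc[OF M]]
 have Mc: "M \<subseteq> RR" by (rule asub_carrier[OF Ma])
 have "Q \<in> NB M" using K by (auto simp: NB_def M_def)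
 then obtain E where E: "E \<in> NB M" "ALL x:E. ALL y:E. x \<ominus> y \<in> Q" using NB_sub[OF MT Ma] by blast
 have gc: "g \<in> RR" using g Hc by blast
 have Yc: "Y \<subseteq> RR" using Y Hc by blast
 define V0 where "V0 = {x \<in> H. x \<ominus> g \<in> E}"
 have V0: "V0 \<inter> YK M = {}"
 proof (rule ccontr)
  assume "V0 \<inter> YK M \<noteq> {}"
  then obtain x y where x: "x \<in> H" "x \<ominus> g \<in> E" "y \<in> Y" "x \<ominus> y \<in> M" by (auto simp: V0_def YK_def)
  have c: "x \<in> RR" "y \<in> RR" using x Hc Yc by auto
  have "x \<ominus> y \<in> E" using x E(1) by (auto simp: NB_def)
  then have "(x \<ominus> y) \<ominus> (x \<ominus> g) \<in> Q" using E(2) x by blast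
  moreover have "(x \<ominus> y) \<ominus> (x \<ominus> g) = g \<ominus> y"
  proof -
   have "(x \<ominus> y) \<ominus> (x \<ominus> g) = (x \<ominus> y) \<oplus> (g \<ominus> x)" using c gc neg_minus[of x g] by (simp add: minus_eq)
   then show ?thesis using minus_trans[OF gc c] c gc by (simp add: a_comm)
  qed
  ultimately show False using no x by auto
 qed
 define K' where "K' = M \<inter> H"
 have K'cc: "cc K'" unfolding K'_def by (intro cc_Int ccw_cc M H)
 note K'a = cc_asub[OF K'cc]
 define S where "S = asums (conjs \<Gamma> K')"
 have GA: "\<Gamma> \<subseteq> Aut" using G by (simp add: autg_def)
 have conjH: "conjs \<Gamma> K' \<subseteq> H" unfolding conjs_def K'_def using ginvD[OF H(2)] by blast
 have SH: "S \<subseteq> H" unfolding S_def by (rule asums_sub[OF Ha conjH])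
 have "asums (conjs \<Gamma> K') \<subseteq> XX n" using SH n unfolding S_def by blast
 from conjs_closure[OF G K'cc this] obtain C where
  C: "cc C" "ginv \<Gamma> C" "ALL D:NB K'. ALL x:C. EX g:S. x \<ominus> g \<in> D" unfolding S_def by blast
 have HC: "H \<subseteq> C" by (rule least[OF C(1,2)])
 have "E \<in> NB K'" using E by (auto simp: NB_def K'_def)
 then obtain E1 where E1: "E1 \<in> NB K'" "dbl E1 \<subseteq> E" using NB_dbl[OF cc_TD[OF K'cc] K'a] by meson
 obtain F where F: "finite F" "F \<subseteq> H" "ALL x:H. EX f:F. x \<ominus> f \<in> E1" using cc_reps[OF K'cc E1(1) n] by blast
 have "ALL f:F. EX p:S. f \<ominus> p \<in> E1" using C(3) E1(1) HC F(2) by blast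
 then obtain p where p: "\<And>f. f \<in> F ==> p f \<in> S \<and> f \<ominus> p f \<in> E1" by metis
 have cover: "EX f:F. x \<ominus> p f \<in> E" if x: "x \<in> H" for x
 proof -
  obtain f where f: "f \<in> F" "x \<ominus> f \<in> E1" using F x by blast
  have c: "x \<in> RR" "f \<in> RR" "p f \<in> RR" using x f F p[OF f(1)] SH Hc by auto
  have "(x \<ominus> f) \<oplus> (f \<ominus> p f) \<in> dbl E1" using f p[OF f(1)] unfolding dbl_iff by blast
  then show ?thesis using minus_trans[OF c] E1(2) f by auto
 qed
 have "ALL f:F. EX \<Sigma>. finite \<Sigma> \<and> \<Sigma> \<subseteq> \<Gamma> \<and> p f \<in> asums (conjs \<Sigma> K')"
  using p asums_finite_support unfolding S_def by blast
 then obtain sg where sg: "\<And>f. f \<in> F ==> finite (sg f) \<and> sg f \<subseteq> \<Gamma> \<and> p f \<in> asums (conjs (sg f) K')" by metis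
 define \<Sigma> where "\<Sigma> = (\<Union>f\<in>F. sg f)"
 have Sig: "finite \<Sigma>" "\<Sigma> \<subseteq> \<Gamma>" using F sg by (auto simp: \<Sigma>_def)
 have pS: "p f \<in> asums (conjs \<Sigma> K')" if "f \<in> F" for f
  using sg[OF that] asums_mono[of "conjs (sg f) K'" "conjs \<Sigma> K'"] that by (auto simp: \<Sigma>_def conjs_def)
 define N where "N = (\<Inter>\<sigma>\<in>insert id \<Sigma>. \<sigma> ` M)"
 have idA: "insert id \<Sigma> \<subseteq> Aut" using Sig GA Aut_id by auto
 have N: "ccw N" unfolding N_def using Sig idA M ccw_image by (intro ccw_finInt) auto
 have NM: "N \<subseteq> \<sigma> ` M" if "\<sigma> \<in> insert id \<Sigma>" for \<sigma> using that unfolding N_def by blast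
 have NM': "N \<subseteq> M" using NM[of id] by simp
 define Z where "Z = YK N"
 have pwN: "h.upd (ind Z) = a"
  using pw_mono[OF NM'] pwM a_le[OF N] by (simp add: pw_def Z_def)
 have Za: "0 < a"
 proof -
  have "h.upd (ind Y) \<le> h.upd (ind Z)"
  proof (rule h.upd_mono[OF b1])
   fix x assume "x \<in> H"
   show "ind Y x \<le> ind Z x"
   proof (rule ind_mono)
    assume x: "x \<in> Y"
    then have "x \<ominus> x = \<zero>" using Yc by (auto simp: minus_eq r_neg)
    then show "x \<in> Z" using x Y asub_zero[OF cc_asub[OF ccw_cc[OF N]]] by (auto simp: Z_def YK_def intro!: bexI[of _ x])
   qed
  qed
  then show ?thesis using pos pwN by linarith
 qed
 \<comment> \<open>\<open>V\<close> is negligible if adding it to some multiple of \<open>Z\<close> does not raise the density.\<close>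
 define neg where "neg V \<longleftrightarrow> (EX t::nat. h.upd (%x. t * ind Z x + ind V x) \<le> real t * a)" for V
 have bt: "h.bdd (%x. t * ind V x)" for t V by (rule h.bdd_mult[OF b1])
 have neg_empty: "neg {}" unfolding neg_def
  by (intro exI[of _ 0]) (simp add: h.ind_def[abs_def] h.upd_zero)
 have neg_mono: "neg V" if "neg W" "V \<inter> H \<subseteq> W" for V W
 proof -
  obtain t :: nat where t: "h.upd (%x. t * ind Z x + ind W x) \<le> real t * a" using \<open>neg W\<close> neg_def by blast
  have "h.upd (%x. t * ind Z x + ind V x) \<le> h.upd (%x. t * ind Z x + ind W x)"
   by (rule h.upd_mono[OF h.bdd_add[OF bt b1]]) (use that(2) in \<open>auto simp: h.ind_def\<close>)
  then show ?thesis using t unfolding neg_def by (intro exI[of _ t]) linarith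
 qed
 have neg_un: "neg (V \<union> W)" if VW: "neg V" "neg W" for V W
 proof -
  obtain t u :: nat where t: "h.upd (%x. t * ind Z x + ind V x) \<le> real t * a"
   "h.upd (%x. u * ind Z x + ind W x) \<le> real u * a" using VW neg_def by blast
  have "h.upd (%x. (t + u) * ind Z x + ind (V \<union> W) x)
    \<le> h.upd (%x. (t * ind Z x + ind V x) + (u * ind Z x + ind W x))"
   by (rule h.upd_mono[OF h.bdd_add[OF h.bdd_add[OF bt b1] h.bdd_add[OF bt b1]]]) (auto simp: h.ind_def)
  also have "\<dots> \<le> h.upd (%x. t * ind Z x + ind V x) + h.upd (%x. u * ind Z x + ind W x)"
   by (rule h.upd_add[OF h.bdd_add[OF bt b1] h.bdd_add[OF bt b1]])
  finally have "h.upd (%x. (t + u) * ind Z x + ind (V \<union> W) x) \<le> real (t + u) * a"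
   using t by (simp add: algebra_simps)
  then show ?thesis unfolding neg_def by blast
 qed
 define trH where "trH q V = {x \<in> H. x \<ominus> q \<in> V}" for q V
 have neg_tr: "neg (trH q V)" if V: "neg V" and q: "q \<in> H" for q V
 proof -
  obtain t :: nat where t: "h.upd (%x. t * ind Z x + ind V x) \<le> real t * a" using V neg_def by blast
  have "h.upd (%x. t * ind Z x + ind (trH q V) x) \<le> h.upd (%x. t * ind Z x + ind (trH q V) (x \<ominus> \<ominus> q))"
   by (rule h.upd_shift_part[OF bt b1]) (rule asub_neg[OF Ha q])
  also have "\<dots> \<le> h.upd (%x. t * ind Z x + ind V x)"
  proof (rule h.upd_mono[OF h.bdd_add[OF bt b1]])
   fix x assume x: "x \<in> H"
   have c: "x \<in> RR" "q \<in> RR" using x q Hc by auto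
   then have "x \<ominus> \<ominus> q \<ominus> q = x" by (simp add: minus_eq a_assoc r_neg)
   then show "t * ind Z x + ind (trH q V) (x \<ominus> \<ominus> q) \<le> t * ind Z x + ind V x"
    by (auto simp: trH_def h.ind_def)
  qed
  finally show ?thesis using t unfolding neg_def by (intro exI[of _ t]) linarith
 qed
 have diff: "neg (YK (\<sigma> ` M) - Z)" if s: "\<sigma> \<in> \<Sigma>" for \<sigma>
 proof -
  have sG: "\<sigma> \<in> \<Gamma>" using s Sig by blast
  have sA: "\<sigma> \<in> Aut" using sG GA by blast
  obtain \<tau> where t: "\<tau> \<in> \<Gamma>" "ALL x:RR. \<tau> (\<sigma> x) = x \<and> \<sigma> (\<tau> x) = x" using autg_inv[OF G sG] by blast
  have ZY: "Z \<subseteq> YK (\<sigma> ` M)" unfolding Z_def YK_def using NM[of \<sigma>] s by blast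
  have tr: "\<sigma> x \<in> YK (\<sigma> ` M) ==> x \<in> YK M" if x: "x \<in> H" for x
  proof -
   assume "\<sigma> x \<in> YK (\<sigma> ` M)"
   then obtain y m where y: "y \<in> Y" "m \<in> M" "\<sigma> x \<ominus> y = \<sigma> m" by (auto simp: YK_def)
   have c: "y \<in> RR" "m \<in> RR" "x \<in> RR" "\<sigma> x \<in> RR"
    using y Yc Mc x Hc Aut_carrier[OF sA] by auto
   have "\<tau> (\<sigma> x \<ominus> y) = m" using y(3) t(2) c by simp
   then have "x \<ominus> \<tau> y = m" using Aut_minus[OF autgD[OF G t(1)] c(4,1)] t(2) c by simp
   moreover have "\<tau> y \<in> Y" by (rule ginvD[OF Y(2) t(1) y(1)])
   ultimately show "x \<in> YK M" using x y(2) by (auto simp: YK_def)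
  qed
  have "h.upd (ind (YK (\<sigma> ` M))) \<le> h.upd (%x. ind (YK (\<sigma> ` M)) (\<sigma> x))"
  proof (rule h.upd_endo[where \<tau> = \<tau>])
   show "h.bdd (%x. ind (YK (\<sigma> ` M)) (\<sigma> x))"
    by (rule h.bdd_mono[OF b1[of UNIV]]) (auto simp: h.ind_def)
   show "\<sigma> x \<in> H" if "x \<in> H" for x by (rule ginvD[OF H(2) sG that])
   then show "\<sigma> x \<in> H \<longleftrightarrow> x \<in> H" if "x \<in> H" for x using that by blast
  qed (use Hc t(2) ginvD[OF H(2) t(1)] Aut_minus[OF sA] in auto)
  also have "\<dots> \<le> h.upd (ind (YK M))"
   by (rule h.upd_mono[OF b1]) (use tr in \<open>auto simp: h.ind_def\<close>)
  also have "\<dots> = a" using pwM by (simp add: pw_def)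
  finally have "h.upd (ind (YK (\<sigma> ` M))) \<le> a" .
  moreover have "(%x. 1 * ind Z x + ind (YK (\<sigma> ` M) - Z) x) = ind (YK (\<sigma> ` M))"
   using ZY by (intro ext) (auto simp: h.ind_def)
  ultimately have "h.upd (%x. 1 * ind Z x + ind (YK (\<sigma> ` M) - Z) x) \<le> real 1 * a" by simp
  then show ?thesis unfolding neg_def by blast
 qed
 have step: "neg (trH q V \<inter> Z)" if V: "neg (V \<inter> Z)" and q: "\<sigma> \<in> \<Sigma>" "q \<in> \<sigma> ` K'" for \<sigma> q V
 proof -
  have sA: "\<sigma> \<in> Aut" and sG: "\<sigma> \<in> \<Gamma>" using q Sig GA by auto
  have qH: "q \<in> H" "q \<in> \<sigma> ` M" using q ginvD[OF H(2) sG] by (auto simp: K'_def)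
  have qc: "q \<in> RR" using qH Hc by blast
  have "neg (trH q ((V \<inter> Z) \<union> (YK (\<sigma> ` M) - Z)))" by (intro neg_tr neg_un V diff q qH)
  moreover have "trH q V \<inter> Z \<subseteq> trH q ((V \<inter> Z) \<union> (YK (\<sigma> ` M) - Z))"
  proof
   fix x assume x: "x \<in> trH q V \<inter> Z"
   then have xH: "x \<in> H" "x \<ominus> q \<in> V" by (auto simp: trH_def)
   obtain y where y: "y \<in> Y" "x \<ominus> y \<in> N" using x by (auto simp: Z_def YK_def)
   have c: "x \<in> RR" "y \<in> RR" using xH y Hc Yc by auto
   have "x \<ominus> y \<in> \<sigma> ` M" using y NM[of \<sigma>] q by blast
   then have "(x \<ominus> y) \<ominus> q \<in> \<sigma> ` M" using asub_minus[OF asub_image[OF sA Ma]] qH by blast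
   moreover have "(x \<ominus> y) \<ominus> q = (x \<ominus> q) \<ominus> y" using c qc by (simp add: minus_eq a_ac)
   ultimately have "x \<ominus> q \<in> YK (\<sigma> ` M)" using y(1) asub_minus[OF Ha xH(1) qH(1)] by (auto simp: YK_def)
   then show "x \<in> trH q ((V \<inter> Z) \<union> (YK (\<sigma> ` M) - Z))" using xH by (auto simp: trH_def)
  qed
  ultimately show ?thesis using neg_mono by blast
 qed
 have conjSH: "conjs \<Sigma> K' \<subseteq> H" using conjH Sig by (auto simp: conjs_def)
 have multi: "q \<in> asums (conjs \<Sigma> K') ==> ALL V. neg (V \<inter> Z) --> neg (trH q V \<inter> Z)" for q
 proof (induction rule: asums.induct)
  case asums_zero
  have "trH \<zero> V \<inter> Z \<inter> H \<subseteq> V \<inter> Z" for V using Hc by (auto simp: trH_def minus_zero_r subset_iff)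
  then show ?case using neg_mono by blast
 next
  case (asums_step q z)
  show ?case
  proof (intro allI impI)
   fix V assume V: "neg (V \<inter> Z)"
   obtain \<sigma> where s: "\<sigma> \<in> \<Sigma>" "z \<in> \<sigma> ` K'" using asums_step by (auto simp: conjs_def)
   have qH: "q \<in> H" "z \<in> H" using asums_sub[OF Ha conjSH] asums_step conjSH by auto
   have "neg (trH z V \<inter> Z)" by (rule step[OF V s])
   then have "neg (trH q (trH z V) \<inter> Z)" using asums_step by blast
   moreover have "trH (q \<oplus> z) V \<subseteq> trH q (trH z V)"
   proof
    fix x assume x: "x \<in> trH (q \<oplus> z) V"
    then have "x \<in> H" by (simp add: trH_def)
    moreover then have "x \<ominus> q \<in> H" using asub_minus[OF Ha _ qH(1)] by blast
    moreover have "x \<ominus> q \<ominus> z = x \<ominus> (q \<oplus> z)" using \<open>x \<in> H\<close> qH Hc by (intro dens.minus_minus_eq) auto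
    ultimately show "x \<in> trH q (trH z V)" using x by (simp add: trH_def)
   qed
   then have "trH (q \<oplus> z) V \<inter> Z \<inter> H \<subseteq> trH q (trH z V) \<inter> Z" by blast
   ultimately show "neg (trH (q \<oplus> z) V \<inter> Z)" using neg_mono by blast
  qed
 qed
 have "V0 \<inter> Z = {}" using V0 NM' by (auto simp: Z_def YK_def)
 then have "neg (V0 \<inter> Z)" using neg_empty by simp
 then have each: "neg (trH (p f) V0 \<inter> Z)" if "f \<in> F" for f using multi[OF pS[OF that]] by blast
 have "neg (\<Union>f\<in>F'. trH (p f) V0 \<inter> Z)" if "finite F'" "F' \<subseteq> F" for F'
  using that by (induction F' rule: finite_induct) (auto simp: neg_empty intro!: neg_un each)
 then have "neg (\<Union>f\<in>F. trH (p f) V0 \<inter> Z)" using F(1) by blast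
 moreover have "Z \<inter> H \<subseteq> (\<Union>f\<in>F. trH (p f) V0 \<inter> Z)"
 proof
  fix x assume x: "x \<in> Z \<inter> H"
  then have "x \<ominus> g \<in> H" using asub_minus[OF Ha _ g] by blast
  then obtain f where f: "f \<in> F" "x \<ominus> g \<ominus> p f \<in> E" using cover by blast
  have pH: "p f \<in> H" using p[OF f(1)] SH by blast
  have "x \<ominus> g \<ominus> p f = x \<ominus> p f \<ominus> g" using x pH gc Hc by (simp add: minus_eq a_ac subset_iff)
  then have "x \<ominus> p f \<in> V0" using f asub_minus[OF Ha _ pH] x by (simp add: V0_def)
  then show "x \<in> (\<Union>f\<in>F. trH (p f) V0 \<inter> Z)" using x f by (auto simp: trH_def)
 qed
 ultimately have "neg Z" using neg_mono by blast
 then obtain t :: nat where t: "h.upd (%x. t * ind Z x + ind Z x) \<le> real t * a" using neg_def by blast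
 have "real (t + 1) * a \<le> h.upd (%x. (t + 1) * ind Z x)" using h.upd_mult_ge[OF b1[of Z], of "t + 1"] pwN by simp
 also have "(%x. (t + 1) * ind Z x) = (%x. t * ind Z x + ind Z x)" by auto
 finally show False using t Za by (simp add: algebra_simps)
qed

section \<open>The ideal generated by the component\<close>

lemma distr_left_minus: "\<lbrakk>x \<in> RR; y \<in> RR; z \<in> RR\<rbrakk> \<Longrightarrow> (x \<ominus> y) \<otimes> z = x \<otimes> z \<ominus> y \<otimes> z"
 by (simp add: minus_eq distr_left mult_minus_left)

lemma distr_right_minus: "\<lbrakk>x \<in> RR; y \<in> RR; z \<in> RR\<rbrakk> \<Longrightarrow> z \<otimes> (x \<ominus> y) = z \<otimes> x \<ominus> z \<otimes> y"
 by (simp add: minus_eq distr_right mult_minus_right)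

text \<open>Both multiplications by a fixed element are treated at once.\<close>

definition additive_map :: "('b => 'b) => bool" where
 "additive_map f \<longleftrightarrow> (ALL t:LT. (%e. f (t e)) \<in> LT) \<and>
  (ALL x:RR. ALL y:RR. f (x \<ominus> y) = f x \<ominus> f y)"

lemma additive_mapI:
 assumes "\<And>t. t \<in> LT ==> (%e. f (t e)) \<in> LT"
  "\<And>x y. x \<in> RR ==> y \<in> RR ==> f (x \<ominus> y) = f x \<ominus> f y"
 shows "additive_map f"
 using assms by (simp add: additive_map_def)

lemma additive_left: "r \<in> RR ==> additive_map (%x. r \<otimes> x)"
 by (rule additive_mapI) (auto intro: LT_mult LT_const distr_right_minus)

lemma additive_right: "r \<in> RR ==> additive_map (%x. x \<otimes> r)"
 by (rule additive_mapI) (auto intro: LT_mult LT_const distr_left_minus)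

lemma additive_map_LT: "additive_map f ==> t \<in> LT ==> (%e. f (t e)) \<in> LT"
 by (simp add: additive_map_def)

lemma additive_map_minus: "additive_map f ==> x \<in> RR ==> y \<in> RR ==> f (x \<ominus> y) = f x \<ominus> f y"
 by (simp add: additive_map_def)

lemma additive_map_bdd: "additive_map f ==> EX m. ALL x:XX n. f x \<in> XX m"
proof -
 assume f: "additive_map f"
 obtain m where m: "ALL e. bddenv XX n e --> f (e 0) \<in> XX m"
  using LT_bdd[OF additive_map_LT[OF f LT_var[of 0]], of n] by blast
 have "f x \<in> XX m" if "x \<in> XX n" for x
  using m[rule_format, of "%i. x"] that by (simp add: bddenv_def)
 then show ?thesis by blast
qed

lemma additive_map_carrier: "additive_map f ==> x \<in> RR ==> f x \<in> RR"
 using additive_map_bdd in_carrierE XX_carrier by metis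

lemma additive_map_zero: "additive_map f ==> f \<zero> = \<zero>"
proof -
 assume f: "additive_map f"
 have "f (\<zero> \<ominus> \<zero>) = f \<zero> \<ominus> f \<zero>" by (rule additive_map_minus[OF f]) simp_all
 then show ?thesis using additive_map_carrier[OF f, of \<zero>] by (simp add: minus_eq r_neg neg_zero)
qed

lemma cc_pullback:
 assumes f: "additive_map f" and K: "cc K" and L: "cc L"
 shows "cc {x \<in> K. f x \<in> L}"
proof -
 let ?M = "{x \<in> K. f x \<in> L}"
 obtain \<F> where F: "\<F> \<subseteq> DD" "dirf \<F>" "|\<F>| <o \<kappa>" "K = \<Inter>\<F>" using TD_dir[OF cc_TD[OF K]] by blast
 obtain \<G> where G: "\<G> \<subseteq> DD" "dirf \<G>" "|\<G>| <o \<kappa>" "L = \<Inter>\<G>" using TD_dir[OF cc_TD[OF L]] by blast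
 let ?H = "(%(A, B). {x \<in> A. f x \<in> B}) ` (\<F> \<times> \<G>)"
 have dir: "dirf ?H" unfolding dirf_def
 proof (intro conjI ballI)
  show "?H \<noteq> {}" using F(2) G(2) by (auto simp: dirf_def)
  fix A B assume "A \<in> ?H" "B \<in> ?H"
  then obtain a a' b b' where ab: "A = {x \<in> a. f x \<in> a'}" "B = {x \<in> b. f x \<in> b'}" "a \<in> \<F>" "b \<in> \<F>" "a' \<in> \<G>" "b' \<in> \<G>" by auto
  obtain c where c: "c \<in> \<F>" "c \<subseteq> a \<inter> b" using ab(3,4) F(2) unfolding dirf_def by metis
  obtain c' where c': "c' \<in> \<G>" "c' \<subseteq> a' \<inter> b'" using ab(5,6) G(2) unfolding dirf_def by metis
  show "EX C:?H. C \<subseteq> A \<inter> B"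
   using ab c c' by (intro bexI[of _ "{x \<in> c. f x \<in> c'}"]) auto
 qed
 have small: "|?H| <o \<kappa>" by (intro kImage kTimes F G)
 have HDD: "?H \<subseteq> DD"
 proof
  fix A assume "A \<in> ?H"
  then obtain a b where ab: "A = {x \<in> a. f x \<in> b}" "a \<in> DD" "b \<in> DD" using F G by auto
  show "A \<in> DD" unfolding ab(1) by (intro DD_collect LD_mem ab additive_map_LT[OF f] LT_var)
 qed
 have eq: "\<Inter>?H = ?M" using F(2,4) G(2,4) by (auto simp: dirf_def)
 have T: "TD ?M" unfolding TD_def using HDD small dir eq by (intro exI[of _ ?H]) (auto simp: dirf_def)
 have Kc: "K \<subseteq> RR" using asub_carrier cc_asub K by blast
 have a: "asub ?M"
 proof (rule asubI')
  show "?M \<subseteq> RR" using Kc by blast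
  show "\<zero> \<in> ?M" using asub_zero cc_asub K L additive_map_zero[OF f] by auto
  show "x \<ominus> y \<in> ?M" if xy: "x \<in> ?M" "y \<in> ?M" for x y
  proof -
   have c: "x \<in> RR" "y \<in> RR" using xy Kc by blast+
   show ?thesis
    using xy asub_minus[OF cc_asub[OF K]] asub_minus[OF cc_asub[OF L]] additive_map_minus[OF f c] by simp
  qed
 qed
 have "coc ?M" unfolding coc_def
 proof
  fix D assume "D \<in> NB ?M"
  then have "D \<in> NB (\<Inter>?H)" unfolding eq .
  from NB_base[OF dir HDD small this] obtain A where "A \<in> ?H" "A \<subseteq> D" by blast
  then obtain a b where ab: "{x \<in> a. f x \<in> b} \<subseteq> D" "a \<in> \<F>" "b \<in> \<G>" by auto
  have aN: "a \<in> NB K" "b \<in> NB L" using ab F G by (auto simp: NB_def)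
  obtain m where m: "ALL x:XX 0. f x \<in> XX m" using additive_map_bdd[OF f] by blast
  obtain c d :: "'b => 'b \<times> 'b" where
   c: "finite (c ` XX 0)" "ALL x:XX 0. ALL y:XX 0. c x = c y --> x \<ominus> y \<in> a" and
   d: "finite (d ` XX m)" "ALL x:XX m. ALL y:XX m. d x = d y --> x \<ominus> y \<in> b"
   using cc_col[OF K aN(1), of 0] cc_col[OF L aN(2), of m] by blast
  show "gen D"
  proof (rule gen_pieces[of "%x. (c x, d (f x))"])
   show "finite ((%x. (c x, d (f x))) ` XX 0)"
    by (rule finite_subset[of _ "c ` XX 0 \<times> d ` XX m"]) (use c d m in auto)
   fix x y assume xy: "x \<in> XX 0" "y \<in> XX 0" "(c x, d (f x)) = (c y, d (f y))"
   then have "x \<ominus> y \<in> a" "f x \<ominus> f y \<in> b" using c d m by auto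
   then show "x \<ominus> y \<in> D" using ab(1) additive_map_minus[OF f, of x y] xy XX_carrier by auto
  qed
 qed
 then show ?thesis using T a by (simp add: cc_def)
qed

lemma ccw_exists: "EX K. ccw K" using bogolyubov[OF XX0_gsym] by blast

lemma pullback_nbhd:
 assumes f: "additive_map f" and L: "cc L" "D \<in> NB L"
 shows "EX K n. ccw K \<and> K \<subseteq> {x \<in> XX n. f x \<in> D} \<and> {x \<in> XX n. f x \<in> D} \<in> DD"
proof -
 obtain K0 where K0: "ccw K0" using ccw_exists by blast
 have M: "cc {x \<in> K0. f x \<in> L}" by (rule cc_pullback[OF f ccw_cc[OF K0] L(1)])
 obtain n where n: "K0 \<subseteq> XX n" using K0 ccw_cc cc_TD TD_bdd by blast
 have Q: "{x \<in> XX n. f x \<in> D} \<in> DD"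
  by (intro DD_collect XX_DD LD_mem additive_map_LT[OF f] LT_var) (use L in \<open>simp add: NB_def\<close>)
 then have "{x \<in> XX n. f x \<in> D} \<in> NB {x \<in> K0. f x \<in> L}" using n L by (auto simp: NB_def)
 from ccw_between[OF M this] Q show ?thesis by blast
qed

lemma ccomp_BB: "EX \<B>. isBB {} \<B>" using isBB_ex[of "{}"] kFinite[of "{}"] by auto

lemma NB_inv_base:
 assumes "D \<in> NB ccomp"
 shows "EX B:NB ccomp. ginv Aut B \<and> B \<subseteq> D"
proof -
 obtain \<B> where B: "isBB {} \<B>" using ccomp_BB by blast
 obtain n where n: "ccomp \<subseteq> XX n" using TD_bdd[OF cc_TD[OF ccomp_cc]] by blast
 have eq: "ccomp = \<Inter>{B \<in> \<B>. ccomp \<subseteq> B}"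
  using BB_inv_TD[OF B _ cc_TD[OF ccomp_cc]] ccomp_inv by (simp add: fixg_empty)
 then have "D \<in> NB (\<Inter>{B \<in> \<B>. ccomp \<subseteq> B})" using assms by simp
 from NB_base[OF BB_dir[OF B n] BB_DD[OF B] BB_small[OF B] this]
 obtain E where "E \<in> \<B>" "ccomp \<subseteq> E" "E \<subseteq> D" by blast
 then show ?thesis using B by (intro bexI[of _ E]) (auto simp: isBB_def NB_def fixg_empty)
qed

text \<open>Compactness, once for \<open>r\<close> and then for \<open>h\<close>.\<close>

lemma product_closed:
 assumes K: "TD K" and c: "c \<in> RR"
  and near: "\<And>D. D \<in> NB K ==> EX r:XX m. EX h:D. c \<ominus> r \<otimes> h \<in> D"
 shows "EX r:XX m. EX h:K. c \<ominus> r \<otimes> h \<in> K"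
proof -
 have "EX r. ALL D:NB K. r \<in> {r \<in> XX m. EX h:D. c \<ominus> r \<otimes> h \<in> D}"
 proof (rule NB_compact[OF K])
  fix D assume D: "D \<in> NB K"
  show "{r \<in> XX m. EX h:D. c \<ominus> r \<otimes> h \<in> D} \<in> DD"
   by (intro DD_collect XX_DD LD_bexD LD_mem LT_minus LT_mult LT_var LT_const c) (use D in \<open>auto simp: NB_def\<close>)
  show "{r \<in> XX m. EX h:D. c \<ominus> r \<otimes> h \<in> D} \<noteq> {}" using near[OF D] by blast
 qed blast
 then obtain r where r: "\<And>D. D \<in> NB K ==> r \<in> XX m \<and> (EX h:D. c \<ominus> r \<otimes> h \<in> D)" by blast
 have rX: "r \<in> XX m" using r NB_nonempty[OF K] by blast
 then have rc: "r \<in> RR" using XX_carrier by blast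
 have "EX h. ALL D:NB K. h \<in> {h \<in> D. c \<ominus> r \<otimes> h \<in> D}"
 proof (rule NB_compact[OF K])
  fix D assume D: "D \<in> NB K"
  show "{h \<in> D. c \<ominus> r \<otimes> h \<in> D} \<in> DD"
   by (intro DD_collect LD_mem LT_minus LT_mult LT_var LT_const c rc) (use D in \<open>auto simp: NB_def\<close>)
  show "{h \<in> D. c \<ominus> r \<otimes> h \<in> D} \<noteq> {}" using r[OF D] by blast
 qed blast
 then obtain h where h: "\<And>D. D \<in> NB K ==> h \<in> D \<and> c \<ominus> r \<otimes> h \<in> D" by blast
 then have "h \<in> K" "c \<ominus> r \<otimes> h \<in> K" using TD_memI[OF K] by blast+
 then show ?thesis using rX by blast
qed

lemma ccomp_carrier: "ccomp \<subseteq> RR" by (rule asub_carrier[OF ccomp_asub])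

lemma aut0_Aut: "\<sigma> \<in> aut0 ==> \<sigma> \<in> Aut" by (simp add: aut0_def)

lemma ccomp_inv0: "ginv aut0 ccomp" by (rule ginv_sub[OF ccomp_inv]) (auto simp: aut0_def)

lemma NB_quarter:
 assumes "D \<in> NB ccomp"
 shows "EX B:NB ccomp. ginv Aut B \<and> dbl (dbl B) \<subseteq> D \<and> (EX E. B \<subseteq> E \<and> dbl (dbl E) \<subseteq> D \<and> E \<subseteq> RR \<and> (ALL x:E. \<ominus> x \<in> E))"
proof -
 note T = cc_TD[OF ccomp_cc]
 obtain E1 where E1: "E1 \<in> NB ccomp" "dbl E1 \<subseteq> D" using NB_dbl[OF T ccomp_asub assms] by meson
 obtain E where E: "E \<in> NB ccomp" "dbl E \<subseteq> E1" "ALL x:E. \<ominus> x \<in> E" using NB_dbl[OF T ccomp_asub E1(1)] by meson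
 obtain B where B: "B \<in> NB ccomp" "ginv Aut B" "B \<subseteq> E" using NB_inv_base[OF E(1)] by blast
 have "dbl (dbl E) \<subseteq> D" using dbl_mono[OF E(2)] E1(2) by blast
 moreover have "dbl (dbl B) \<subseteq> dbl (dbl E)" by (intro dbl_mono B)
 moreover have "E \<subseteq> RR" using E(1) NB_DD DD_carrier by blast
 ultimately show ?thesis using B E by blast
qed

text \<open>Let \<open>c = r2 h2\<close>. The set \<open>Y\<close> of \<open>h\<close> in the
component such that \<open>l h\<close> is near \<open>c + k\<close> for some \<open>l\<close> and
\<open>k\<close> contains a neighbourhood of \<open>h2\<close>, hence has positive density, and it
is invariant under \<open>aut0\<close>. By ergodicity some \<open>y\<close> in \<open>Y\<close> is
so near to \<open>h1\<close> that \<open>r1 h1\<close> is near \<open>r1 y\<close>; so the sum is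
near \<open>(r1 + l) y\<close> modulo the component.\<close>

lemma product_sum:
 assumes r: "r1 \<in> RR" "r2 \<in> RR" and h: "h1 \<in> ccomp" "h2 \<in> ccomp"
 shows "EX r:RR. EX k:ccomp. (r1 \<otimes> h1 \<oplus> r2 \<otimes> h2) \<ominus> r \<otimes> k \<in> ccomp"
proof -
 note T = cc_TD[OF ccomp_cc]
 obtain n where n: "ccomp \<subseteq> XX n" using TD_bdd[OF T] by blast
 obtain a b where ab: "r1 \<in> XX a" "r2 \<in> XX b" using r in_carrierE by metis
 have hc: "h1 \<in> RR" "h2 \<in> RR" using h ccomp_carrier by auto
 let ?c = "r2 \<otimes> h2" and ?m = "Suc (max a b)"
 have cc: "?c \<in> RR" "r1 \<otimes> h1 \<in> RR" using r hc by (auto intro: mult_closed)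
 have "EX r:XX ?m. EX k:ccomp. (r1 \<otimes> h1 \<oplus> ?c) \<ominus> r \<otimes> k \<in> ccomp"
 proof (rule product_closed[OF T])
  show "r1 \<otimes> h1 \<oplus> ?c \<in> RR" using cc by simp
  fix D assume D: "D \<in> NB ccomp"
  from NB_quarter[OF D] obtain B E where B: "B \<in> NB ccomp" "ginv Aut B"
   and E: "B \<subseteq> E" "dbl (dbl E) \<subseteq> D" "E \<subseteq> RR" "ALL x:E. \<ominus> x \<in> E" by blast
  have BDD: "B \<in> DD" and Bc: "B \<subseteq> RR" and HB: "ccomp \<subseteq> B" using B(1) DD_carrier by (auto simp: NB_def)
  define Y where "Y = {h \<in> ccomp. EX l:XX b. EX k:ccomp. (l \<otimes> h \<ominus> ?c) \<ominus> k \<in> B}"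
  have Yinv: "ginv aut0 Y"
  proof (rule ginvI[OF autg_aut0])
   show "Y \<subseteq> RR" using ccomp_carrier by (auto simp: Y_def)
   fix \<sigma> x assume s: "\<sigma> \<in> aut0" and x: "x \<in> Y"
   have sA: "\<sigma> \<in> Aut" by (rule aut0_Aut[OF s])
   obtain l k where lk: "l \<in> XX b" "k \<in> ccomp" "(l \<otimes> x \<ominus> ?c) \<ominus> k \<in> B" and xH: "x \<in> ccomp" using x by (auto simp: Y_def)
   have c: "l \<in> RR" "k \<in> RR" "x \<in> RR" "l \<otimes> x \<in> RR"
    using lk xH XX_carrier ccomp_carrier by (auto intro: mult_closed)
   have sc: "\<sigma> l \<in> RR" "\<sigma> k \<in> RR" "\<sigma> x \<in> RR" "\<sigma> ?c \<in> RR" "\<sigma> l \<otimes> \<sigma> x \<in> RR"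
    using c cc Aut_carrier[OF sA] by (auto intro: mult_closed)
   have "\<sigma> ((l \<otimes> x \<ominus> ?c) \<ominus> k) \<in> B" by (rule ginvD[OF B(2) sA lk(3)])
   moreover have "\<sigma> ((l \<otimes> x \<ominus> ?c) \<ominus> k) = (\<sigma> l \<otimes> \<sigma> x \<ominus> \<sigma> ?c) \<ominus> \<sigma> k"
    using c cc by (simp add: Aut_minus[OF sA] Aut_mult[OF sA])
   moreover have "(\<sigma> l \<otimes> \<sigma> x \<ominus> ?c) \<ominus> ((\<sigma> ?c \<ominus> ?c) \<oplus> \<sigma> k) = (\<sigma> l \<otimes> \<sigma> x \<ominus> \<sigma> ?c) \<ominus> \<sigma> k"
   proof -
    have "(\<sigma> l \<otimes> \<sigma> x \<ominus> ?c) \<ominus> ((\<sigma> ?c \<ominus> ?c) \<oplus> \<sigma> k) = (\<sigma> l \<otimes> \<sigma> x \<ominus> ?c) \<ominus> (\<sigma> ?c \<ominus> ?c) \<ominus> \<sigma> k"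
     using sc cc by (intro dens.minus_minus_eq[symmetric]) auto
    also have "(\<sigma> l \<otimes> \<sigma> x \<ominus> ?c) \<ominus> (\<sigma> ?c \<ominus> ?c) = \<sigma> l \<otimes> \<sigma> x \<ominus> \<sigma> ?c"
     using sc cc by (intro minus_minus_swap) auto
    finally show ?thesis .
   qed
   moreover have "(\<sigma> ?c \<ominus> ?c) \<oplus> \<sigma> k \<in> ccomp"
    by (rule asub_add[OF ccomp_asub aut0D[OF s cc(1)] ginvD[OF ccomp_inv sA lk(2)]])
   moreover have sl: "\<sigma> l \<in> XX b" and sx: "\<sigma> x \<in> ccomp" using Aut_XX[OF sA lk(1)] ginvD[OF ccomp_inv sA xH] by auto
   ultimately have "EX k:ccomp. (\<sigma> l \<otimes> \<sigma> x \<ominus> ?c) \<ominus> k \<in> B"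
    by (intro bexI[where x = "(\<sigma> ?c \<ominus> ?c) \<oplus> \<sigma> k"]) simp_all
   then show "\<sigma> x \<in> Y" using sl sx unfolding Y_def by blast
  qed
  have YH: "Y \<subseteq> ccomp" by (auto simp: Y_def)
  from pullback_nbhd[OF additive_left[OF r(2)] ccomp_cc B(1)] obtain K2 n2 where
   K2: "ccw K2" "K2 \<subseteq> {x \<in> XX n2. r2 \<otimes> x \<in> B}" "{x \<in> XX n2. r2 \<otimes> x \<in> B} \<in> DD" by blast
  have pos: "0 < density.upd R ccomp ccomp (ind Y)"
  proof (rule upd_nbhd_pos[OF ccomp_asub n ccw_cc[OF K2(1)] _ h(2) _ YH])
   show "{x \<in> XX n2. r2 \<otimes> x \<in> B} \<in> NB K2" using K2 by (auto simp: NB_def)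
   fix x assume x: "x \<in> ccomp" "x \<ominus> h2 \<in> {x \<in> XX n2. r2 \<otimes> x \<in> B}"
   then have xc: "x \<in> RR" using ccomp_carrier by blast
   have "r2 \<otimes> x \<ominus> ?c \<in> B" using x(2) distr_right_minus[OF xc hc(2) r(2)] by simp
   then have "(r2 \<otimes> x \<ominus> ?c) \<ominus> \<zero> \<in> B" using minus_zero_r Bc by (metis subsetD)
   then show "x \<in> Y" using x ab(2) asub_zero[OF ccomp_asub] unfolding Y_def by blast
  qed
  from pullback_nbhd[OF additive_left[OF r(1)] ccomp_cc B(1)] obtain K1 n1 where
   K1: "ccw K1" "K1 \<subseteq> {x \<in> XX n1. r1 \<otimes> x \<in> B}" "{x \<in> XX n1. r1 \<otimes> x \<in> B} \<in> DD" by blast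
  obtain y where y: "y \<in> Y" "r1 \<otimes> (h1 \<ominus> y) \<in> B"
   using ergodic[OF autg_aut0 ccomp_cc ccomp_inv0 ccomp_least_aut0 YH Yinv pos K1 h(1)] by blast
  obtain l k where lk: "l \<in> XX b" "k \<in> ccomp" "(l \<otimes> y \<ominus> ?c) \<ominus> k \<in> B" and yH: "y \<in> ccomp" using y by (auto simp: Y_def)
  have c: "l \<in> RR" "k \<in> RR" "y \<in> RR" "l \<otimes> y \<in> RR" "r1 \<otimes> y \<in> RR"
   using lk yH XX_carrier ccomp_carrier r by (auto intro: mult_closed)
  let ?b1 = "r1 \<otimes> (h1 \<ominus> y)" and ?b2 = "(l \<otimes> y \<ominus> ?c) \<ominus> k"
  have b1: "?b1 = r1 \<otimes> h1 \<ominus> r1 \<otimes> y" by (rule distr_right_minus[OF hc(1) c(3) r(1)])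
  have "?b1 \<in> E" "?b2 \<in> E" "k \<in> E" using y lk E(1) HB by auto
  then have bE: "?b1 \<in> E" "\<ominus> ?b2 \<in> E" "\<ominus> k \<in> E" "\<zero> \<in> E" using E(1,4) HB asub_zero[OF ccomp_asub] by auto
  have "(?b1 \<oplus> \<zero>) \<oplus> (\<ominus> ?b2 \<oplus> \<ominus> k) \<in> dbl (dbl E)"
  proof -
   have "?b1 \<oplus> \<zero> \<in> dbl E" "\<ominus> ?b2 \<oplus> \<ominus> k \<in> dbl E" using bE unfolding dbl_iff by blast+
   then show ?thesis unfolding dbl_iff[of _ "dbl E"] by blast
  qed
  moreover have "(?b1 \<oplus> \<zero>) \<oplus> (\<ominus> ?b2 \<oplus> \<ominus> k) = (r1 \<otimes> h1 \<oplus> ?c) \<ominus> (r1 \<oplus> l) \<otimes> y"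
  proof -
   have "\<ominus> ?b2 \<oplus> \<ominus> k = ?c \<ominus> l \<otimes> y"
   proof -
    have "\<ominus> ?b2 = k \<ominus> (l \<otimes> y \<ominus> ?c)" using c cc by (intro neg_minus) auto
    also have "\<dots> = k \<oplus> (?c \<ominus> l \<otimes> y)" using c cc neg_minus[of "l \<otimes> y" ?c] by (simp add: minus_eq)
    finally show ?thesis using add_cancel[of k "?c \<ominus> l \<otimes> y"] c cc by (simp add: minus_eq)
   qed
   moreover have "(r1 \<oplus> l) \<otimes> y = r1 \<otimes> y \<oplus> l \<otimes> y" by (rule distr_left[OF r(1) c(1,3)])
   ultimately show ?thesis unfolding b1 using c cc by (simp add: minus_eq minus_add a_ac)
  qed
  ultimately have "(r1 \<otimes> h1 \<oplus> ?c) \<ominus> (r1 \<oplus> l) \<otimes> y \<in> D" using E(2) by auto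
  moreover have "r1 \<oplus> l \<in> XX ?m" using ab(1) lk(1) XX_monoD[of _ _ "max a b"] by (intro XX_add) auto
  moreover have "y \<in> D" using yH D by (auto simp: NB_def)
  ultimately show "EX r:XX ?m. EX k:D. (r1 \<otimes> h1 \<oplus> ?c) \<ominus> r \<otimes> k \<in> D" by blast
 qed
 then show ?thesis using XX_carrier by blast
qed

text \<open>As for sums, with \<open>Y\<close> the set of \<open>x\<close> such that \<open>x
s'\<close> is small for some \<open>s'\<close> congruent to \<open>s\<close>. For \<open>y\<close>
in \<open>Y\<close> near \<open>h\<close>, the product \<open>h s\<close> is near \<open>y
s\<close>, which is near \<open>y (s - s')\<close>, and \<open>s - s'\<close> is in the
component.\<close>

lemma product_right:
 assumes h: "h \<in> ccomp" and s: "s \<in> RR"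
 shows "EX r:RR. EX k:ccomp. h \<otimes> s \<ominus> r \<otimes> k \<in> ccomp"
proof -
 note T = cc_TD[OF ccomp_cc]
 obtain n where n: "ccomp \<subseteq> XX n" using TD_bdd[OF T] by blast
 have hc: "h \<in> RR" using h ccomp_carrier by auto
 have "EX r:XX n. EX k:ccomp. h \<otimes> s \<ominus> r \<otimes> k \<in> ccomp"
 proof (rule product_closed[OF T])
  show "h \<otimes> s \<in> RR" using hc s by (rule mult_closed)
  fix D assume D: "D \<in> NB ccomp"
  from NB_dbl[OF T ccomp_asub D] obtain E where E: "E \<in> NB ccomp" "dbl E \<subseteq> D" by blast
  obtain B where B: "B \<in> NB ccomp" "ginv Aut B" "B \<subseteq> E" using NB_inv_base[OF E(1)] by blast
  define Y where "Y = {x \<in> ccomp. EX s':RR. s' \<ominus> s \<in> ccomp \<and> x \<otimes> s' \<in> B}"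
  have YH: "Y \<subseteq> ccomp" by (auto simp: Y_def)
  have Yinv: "ginv aut0 Y"
  proof (rule ginvI[OF autg_aut0])
   show "Y \<subseteq> RR" using ccomp_carrier by (auto simp: Y_def)
   fix \<sigma> x assume sg: "\<sigma> \<in> aut0" and x: "x \<in> Y"
   have sA: "\<sigma> \<in> Aut" by (rule aut0_Aut[OF sg])
   obtain s' where s': "s' \<in> RR" "s' \<ominus> s \<in> ccomp" "x \<otimes> s' \<in> B" and xH: "x \<in> ccomp" using x by (auto simp: Y_def)
   have xc: "x \<in> RR" using xH ccomp_carrier by blast
   have c: "\<sigma> s' \<in> RR" "\<sigma> s \<in> RR" using s s' Aut_carrier[OF sA] by auto
   have "\<sigma> s' \<ominus> \<sigma> s \<in> ccomp" using ginvD[OF ccomp_inv sA s'(2)] Aut_minus[OF sA s'(1) s] by simp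
   then have "(\<sigma> s' \<ominus> \<sigma> s) \<oplus> (\<sigma> s \<ominus> s) \<in> ccomp" by (rule asub_add[OF ccomp_asub _ aut0D[OF sg s]])
   then have "\<sigma> s' \<ominus> s \<in> ccomp" using minus_trans[OF c s] by simp
   moreover have "\<sigma> x \<otimes> \<sigma> s' \<in> B" using ginvD[OF B(2) sA s'(3)] Aut_mult[OF sA xc s'(1)] by simp
   ultimately show "\<sigma> x \<in> Y" using c ginvD[OF ccomp_inv sA xH] by (auto simp: Y_def)
  qed
  from pullback_nbhd[OF additive_right[OF s] ccomp_cc B(1)] obtain K m where
   K: "ccw K" "K \<subseteq> {x \<in> XX m. x \<otimes> s \<in> B}" "{x \<in> XX m. x \<otimes> s \<in> B} \<in> DD" by blast
  have pos: "0 < density.upd R ccomp ccomp (ind Y)"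
  proof (rule upd_nbhd_pos[OF ccomp_asub n ccw_cc[OF K(1)] _ asub_zero[OF ccomp_asub] _ YH])
   show "{x \<in> XX m. x \<otimes> s \<in> B} \<in> NB K" using K by (auto simp: NB_def)
   fix x assume x: "x \<in> ccomp" "x \<ominus> \<zero> \<in> {x \<in> XX m. x \<otimes> s \<in> B}"
   then have "x \<in> RR" using ccomp_carrier by blast
   then have "x \<otimes> s \<in> B" using x minus_zero_r by auto
   moreover have "s \<ominus> s \<in> ccomp" using s asub_zero[OF ccomp_asub] by (simp add: minus_eq r_neg)
   ultimately show "x \<in> Y" using x s by (auto simp: Y_def)
  qed
  obtain y where y: "y \<in> Y" "(h \<ominus> y) \<otimes> s \<in> B"
   using ergodic[OF autg_aut0 ccomp_cc ccomp_inv0 ccomp_least_aut0 YH Yinv pos K h] by blast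
  obtain s' where s': "s' \<in> RR" "s' \<ominus> s \<in> ccomp" "y \<otimes> s' \<in> B" and yH: "y \<in> ccomp" using y by (auto simp: Y_def)
  have yc: "y \<in> RR" using yH ccomp_carrier by blast
  have "\<ominus> (s' \<ominus> s) \<in> ccomp" by (rule asub_neg[OF ccomp_asub s'(2)])
  then have k: "s \<ominus> s' \<in> ccomp" using neg_minus[OF s'(1) s] by simp
  have "(h \<ominus> y) \<otimes> s \<oplus> y \<otimes> s' \<in> dbl E" using y(2) s'(3) B(3) unfolding dbl_iff by blast
  moreover have "(h \<ominus> y) \<otimes> s \<oplus> y \<otimes> s' = h \<otimes> s \<ominus> y \<otimes> (s \<ominus> s')"
   using hc yc s s' distr_left_minus[OF hc yc s] distr_right_minus[OF s s'(1) yc]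
   by (simp add: minus_eq minus_add mult_closed a_ac)
  ultimately have "h \<otimes> s \<ominus> y \<otimes> (s \<ominus> s') \<in> D" using E(2) by auto
  moreover have "y \<in> XX n" "s \<ominus> s' \<in> D" using yH n k D by (auto simp: NB_def)
  ultimately show "EX r:XX n. EX k:D. h \<otimes> s \<ominus> r \<otimes> k \<in> D" by blast
 qed
 then show ?thesis using XX_carrier by blast
qed

definition cideal :: "'b set" where
 "cideal = {x. EX h:ccomp. EX r:RR. EX k:ccomp. x = h \<oplus> r \<otimes> k}"

lemma cidealI: "h \<in> ccomp ==> r \<in> RR ==> k \<in> ccomp ==> h \<oplus> r \<otimes> k \<in> cideal"
 by (auto simp: cideal_def)

lemma cidealI': "x \<in> RR ==> r \<in> RR ==> k \<in> ccomp ==> x \<ominus> r \<otimes> k \<in> ccomp ==> x \<in> cideal"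
proof -
 assume a: "x \<in> RR" "r \<in> RR" "k \<in> ccomp" "x \<ominus> r \<otimes> k \<in> ccomp"
 then have c: "r \<otimes> k \<in> RR" using ccomp_carrier by (auto intro: mult_closed)
 have "x = (x \<ominus> r \<otimes> k) \<oplus> r \<otimes> k" using minus_cancel[OF a(1) c] a(1) c by (simp add: a_comm)
 then show ?thesis using cidealI[OF a(4,2,3)] by simp
qed

lemma ccomp_cideal: "ccomp \<subseteq> cideal"
proof
 fix x assume x: "x \<in> ccomp"
 then have "x = x \<oplus> \<zero> \<otimes> \<zero>" using ccomp_carrier by (auto simp: mult_zero_right)
 then show "x \<in> cideal" using cidealI[OF x zero_closed asub_zero[OF ccomp_asub]] by simp
qed

lemma cideal_carrier: "cideal \<subseteq> RR"
 using ccomp_carrier by (auto simp: cideal_def intro!: mult_closed)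

lemma cideal_asub: "asub cideal"
proof (rule asubI)
 show "\<zero> \<in> cideal" using ccomp_cideal asub_zero[OF ccomp_asub] by blast
 fix x assume "x \<in> cideal"
 then obtain h r k where x: "h \<in> ccomp" "r \<in> RR" "k \<in> ccomp" "x = h \<oplus> r \<otimes> k" by (auto simp: cideal_def)
 have c: "h \<in> RR" "k \<in> RR" "r \<otimes> k \<in> RR" using x ccomp_carrier by (auto intro: mult_closed)
 have "\<ominus> x = \<ominus> h \<oplus> r \<otimes> (\<ominus> k)" using x c by (simp add: minus_add mult_minus_right)
 then show "\<ominus> x \<in> cideal" using x asub_neg[OF ccomp_asub] cidealI by simp
 fix y assume "y \<in> cideal"
 then obtain h' r' k' where y: "h' \<in> ccomp" "r' \<in> RR" "k' \<in> ccomp" "y = h' \<oplus> r' \<otimes> k'" by (auto simp: cideal_def)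
 have c': "h' \<in> RR" "k' \<in> RR" "r' \<otimes> k' \<in> RR" using y ccomp_carrier by (auto intro: mult_closed)
 obtain s l where sl: "s \<in> RR" "l \<in> ccomp" "(r \<otimes> k \<oplus> r' \<otimes> k') \<ominus> s \<otimes> l \<in> ccomp"
  using product_sum[OF x(2) y(2) x(3) y(3)] by blast
 let ?d = "(r \<otimes> k \<oplus> r' \<otimes> k') \<ominus> s \<otimes> l"
 have slc: "s \<otimes> l \<in> RR" using sl ccomp_carrier by (auto intro: mult_closed)
 have "x \<oplus> y = (h \<oplus> h') \<oplus> (r \<otimes> k \<oplus> r' \<otimes> k')" using x y c c' by (simp add: a_ac)
 also have "r \<otimes> k \<oplus> r' \<otimes> k' = ?d \<oplus> s \<otimes> l"
  using minus_cancel[of "r \<otimes> k \<oplus> r' \<otimes> k'" "s \<otimes> l"] c c' slc by (simp add: a_comm)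
 also have "(h \<oplus> h') \<oplus> (?d \<oplus> s \<otimes> l) = (h \<oplus> h' \<oplus> ?d) \<oplus> s \<otimes> l" using c c' slc by (simp add: a_assoc)
 finally show "x \<oplus> y \<in> cideal"
  using cidealI[OF asub_add[OF ccomp_asub asub_add[OF ccomp_asub x(1) y(1)] sl(3)] sl(1,2)] by simp
qed (rule cideal_carrier)

lemma cideal_left: "s \<in> RR ==> x \<in> cideal ==> s \<otimes> x \<in> cideal"
proof -
 assume s: "s \<in> RR" and "x \<in> cideal"
 then obtain h r k where x: "h \<in> ccomp" "r \<in> RR" "k \<in> ccomp" "x = h \<oplus> r \<otimes> k" by (auto simp: cideal_def)
 have c: "h \<in> RR" "k \<in> RR" "r \<otimes> k \<in> RR" using x ccomp_carrier by (auto intro: mult_closed)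
 have 1: "t \<otimes> u \<in> cideal" if "t \<in> RR" "u \<in> ccomp" for t u
  using cidealI[OF asub_zero[OF ccomp_asub] that] mult_closed[of t u] that ccomp_carrier by auto
 have "s \<otimes> x = s \<otimes> h \<oplus> (s \<otimes> r) \<otimes> k" using x c s by (simp add: distr_right mult_assoc)
 then show ?thesis using 1[OF s x(1)] 1[OF mult_closed[OF s x(2)] x(3)] asub_add[OF cideal_asub] by simp
qed

lemma cideal_right: "s \<in> RR ==> x \<in> cideal ==> x \<otimes> s \<in> cideal"
proof -
 assume s: "s \<in> RR" and "x \<in> cideal"
 then obtain h r k where x: "h \<in> ccomp" "r \<in> RR" "k \<in> ccomp" "x = h \<oplus> r \<otimes> k" by (auto simp: cideal_def)
 have c: "h \<in> RR" "k \<in> RR" "r \<otimes> k \<in> RR" using x ccomp_carrier by (auto intro: mult_closed)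
 have 1: "u \<otimes> s \<in> cideal" if u: "u \<in> ccomp" for u
  using product_right[OF u s] cidealI' mult_closed[OF _ s, of u] u ccomp_carrier by blast
 have "x \<otimes> s = h \<otimes> s \<oplus> r \<otimes> (k \<otimes> s)" using x c s by (simp add: distr_left mult_assoc)
 then show ?thesis using 1[OF x(1)] cideal_left[OF x(2) 1[OF x(3)]] asub_add[OF cideal_asub] by simp
qed

lemma cideal_inv: "ginv Aut cideal"
proof (rule ginvI[OF autg_Aut cideal_carrier])
 fix \<sigma> x assume s: "\<sigma> \<in> Aut" and "x \<in> cideal"
 then obtain h r k where x: "h \<in> ccomp" "r \<in> RR" "k \<in> ccomp" "x = h \<oplus> r \<otimes> k" by (auto simp: cideal_def)
 have c: "h \<in> RR" "k \<in> RR" "r \<otimes> k \<in> RR" using x ccomp_carrier by (auto intro: mult_closed)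
 have "\<sigma> x = \<sigma> h \<oplus> \<sigma> r \<otimes> \<sigma> k" using x c by (simp add: Aut_add[OF s] Aut_mult[OF s])
 then show "\<sigma> x \<in> cideal" using cidealI ginvD[OF ccomp_inv s] x Aut_carrier[OF s] by simp
qed

lemma cideal_bidx: "bidx cideal"
 by (rule bidx_mono[OF ccomp_asub cc_bidx[OF ccomp_cc] cideal_asub ccomp_cideal])

section \<open>Invariant subgroups of bounded index\<close>

lemma bdd_finite_sum: "finite F ==> (\<And>Z. Z \<in> F ==> Z \<subseteq> XX n) ==> dens.upd (ind (\<Union>F)) \<le> (\<Sum>Z\<in>F. dens.upd (ind Z))"
proof -
 assume F: "finite F" "\<And>Z. Z \<in> F ==> Z \<subseteq> XX n"
 have b: "dens.bdd (ind Z)" if "Z \<in> F" for Z using bdd_ind F that by blast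
 have "dens.upd (ind (\<Union>F)) \<le> dens.upd (%x. \<Sum>Z\<in>F. ind Z x)"
 proof (rule dens.upd_mono[OF dens.bdd_sum[OF F(1) b]])
  fix x show "ind (\<Union>F) x \<le> (\<Sum>Z\<in>F. ind Z x)"
  proof (cases "x \<in> \<Union>F")
   case True
   then obtain Z where "Z \<in> F" "x \<in> Z" by blast
   then have "ind (\<Union>F) x = ind Z x" using True by (simp add: dens.ind_def)
   then show ?thesis using member_le_sum[of Z F "%Z. ind Z x"] \<open>Z \<in> F\<close> F(1) by simp
  qed (simp add: dens.ind_def)
 qed auto
 also have "\<dots> \<le> (\<Sum>Z\<in>F. dens.upd (ind Z))" by (rule dens.upd_sum_le[OF F(1) b])
 finally show ?thesis .
qed

text \<open>A maximal family of disjoint translates of a set of positive density is finite, so its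
difference set is generic.\<close>

lemma differences_gsym:
 assumes B: "B \<in> DD" "B \<subseteq> XX 0" and pos: "0 < dens.upd (ind B)"
 shows "gsym {u \<in> XX 1. EX a:B. a \<ominus> u \<in> B}"
proof -
 let ?E = "{u \<in> XX 1. EX a:B. a \<ominus> u \<in> B}"
 have bB: "dens.bdd (ind B)" by (rule bdd_DD[OF B(1)])
 have Bc: "B \<subseteq> RR" by (rule DD_carrier[OF B(1)])
 have EDD: "?E \<in> DD" by (intro DD_collect XX_DD LD_bexD LD_mem B LT_minus LT_var)
 have diff: "a \<ominus> (a \<ominus> b) = b" if "a \<in> RR" "b \<in> RR" for a b
  using that neg_minus[of a b] minus_cancel[of b a] by (simp add: minus_eq)
 have E0: "\<zero> \<in> ?E"
 proof -
  have "B \<noteq> {}" using pos dens.upd_zero by (auto simp: dens.ind_def[abs_def])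
  then obtain b where "b \<in> B" by blast
  then show ?thesis using XX_zero' Bc by (auto intro!: bexI[of _ b] simp: minus_zero_r)
 qed
 have Eneg: "\<ominus> u \<in> ?E" if u: "u \<in> ?E" for u
 proof -
  obtain a where a: "a \<in> B" "a \<ominus> u \<in> B" "u \<in> XX 1" using u by blast
  have c: "a \<in> RR" "u \<in> RR" using a Bc XX_carrier by auto
  have "(a \<ominus> u) \<ominus> (\<ominus> u) = a" using c by (simp add: minus_eq a_assoc l_neg)
  then show ?thesis using a XX_neg[OF a(3)] by (intro CollectI conjI bexI[where x = "a \<ominus> u"]) simp_all
 qed
 obtain J :: nat where J: "dens.upd (ind (XX 1)) < real J * dens.upd (ind B)"
  using reals_Archimedean3[OF pos] by blast
 have "gen ?E"
 proof (rule gen_clique[where J = J, OF _ E0 Eneg])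
  fix F assume F: "F \<subseteq> XX 0" "finite F" "ALL f:F. ALL f':F. f \<noteq> f' --> f \<ominus> f' \<notin> ?E"
  obtain ks where ks: "set ks = F" "distinct ks" using finite_distinct_list[OF F(2)] by blast
  have Fc: "F \<subseteq> RR" using F XX_sub by blast
  have "real (card F) * dens.upd (ind B) = real (length ks) * dens.upd (ind B)"
   using ks distinct_card by fastforce
  also have "\<dots> \<le> dens.upd (dens.cov ks (ind B))" by (rule dens.upd_cov_ge[OF bB]) (use ks Fc in simp)
  also have "\<dots> \<le> dens.upd (ind (XX 1))"
  proof (rule dens.upd_mono[OF bdd_XX])
   fix x assume x: "x \<in> RR"
   let ?M = "{f \<in> F. x \<ominus> f \<in> B}"
   have "dens.cov ks (ind B) x = (\<Sum>f\<in>F. of_bool (x \<ominus> f \<in> B))"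
    using ks by (simp add: dens.cov_def dens.ind_def sum_list_distinct_conv_sum_set)
   also have "\<dots> = card ?M" using F(2) by (simp add: of_bool_def sum.If_cases Int_def)
   finally have c: "dens.cov ks (ind B) x = card ?M" .
   have sub1: "f = f'" if f: "f \<in> ?M" "f' \<in> ?M" for f f'
   proof (rule ccontr)
    assume ne: "f \<noteq> f'"
    have fc: "f \<in> RR" "f' \<in> RR" using f Fc by auto
    have "(x \<ominus> f') \<ominus> (f \<ominus> f') = x \<ominus> f" by (rule minus_minus_swap[OF x fc(2,1)])
    moreover have "f \<ominus> f' \<in> XX 1" using XX_minus[of f 0 f'] f F by auto
    ultimately have "f \<ominus> f' \<in> ?E" using f by (auto intro!: bexI[of _ "x \<ominus> f'"])
    then show False using F(3) f ne by blast
   qed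
   show "dens.cov ks (ind B) x \<le> ind (XX 1) x"
   proof (cases "?M = {}")
    case False
    then obtain f where f: "f \<in> ?M" by blast
    then have "?M = {f}" using sub1 by blast
    then have "card ?M = 1" by simp
    moreover have "x \<in> XX 1"
    proof -
     have "f \<in> XX 0" "x \<ominus> f \<in> XX 0" using f F B by auto
     then have "f \<oplus> (x \<ominus> f) \<in> XX 1" using XX_add by fastforce
     then show ?thesis using minus_cancel[OF x, of f] f Fc by auto
    qed
    ultimately show ?thesis using c by (simp add: dens.ind_def)
   qed (simp only: c, simp)
  qed
  finally have "real (card F) * dens.upd (ind B) < real J * dens.upd (ind B)" using J by linarith
  then show "card F < J" using pos by simp
 qed
 then show ?thesis using EDD E0 Eneg by (simp add: gsym_def)
qed

text \<open>Fix representatives \<open>P\<close> of the cosets of \<open>I\<close>. By compactness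
there is an \<open>x\<close> none of whose neighbourhoods over \<open>P\<close> has density 0.
Bogolyubov gives a subgroup inside the fourfold difference sets of each of these neighbourhoods;
in the limit these are sums of differences of conjugates of \<open>x\<close> over
\<open>P\<close>. An automorphism that fixes \<open>P\<close> fixes each coset of
\<open>I\<close>, so these differences are in \<open>I\<close>.\<close>

lemma bounded_inv_contains_cc:
 assumes I: "asub I" "ginv Aut I" "bidx I"
 shows "EX K. cc K \<and> K \<subseteq> I"
proof -
 have Ic: "I \<subseteq> RR" by (rule asub_carrier[OF I(1)])
 obtain P where P: "P \<subseteq> RR" "|P| <o \<kappa>" "ALL x:RR. EX p:P. x \<ominus> p \<in> I" using bidx_reps[OF I(1,3)] by blast
 obtain \<B> where B: "isBB P \<B>" using isBB_ex[OF P(1,2)] by blast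
 have BDD: "\<B> \<subseteq> DD" and Bs: "|\<B>| <o \<kappa>" and BX: "XX n \<in> \<B>" for n using B by (auto simp: isBB_def)
 have BI: "A \<inter> C \<in> \<B>" "A - C \<in> \<B>" if "A \<in> \<B>" "C \<in> \<B>" for A C using B that by (auto simp: isBB_def)
 have orb: "\<sigma> x \<ominus> x \<in> I" if s: "\<sigma> \<in> fixg P" and x: "x \<in> RR" for \<sigma> x
 proof -
  obtain p where p: "p \<in> P" "x \<ominus> p \<in> I" using P(3) x by blast
  have sA: "\<sigma> \<in> Aut" "\<sigma> p = p" using s p by (auto simp: fixg_def)
  have c: "p \<in> RR" "\<sigma> x \<in> RR" using p P(1) Aut_carrier[OF sA(1) x] by auto
  have "\<sigma> (x \<ominus> p) \<in> I" by (rule ginvD[OF I(2) sA(1) p(2)])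
  then have "\<sigma> x \<ominus> p \<in> I" using Aut_minus[OF sA(1) x c(1)] sA by simp
  then have "(\<sigma> x \<ominus> p) \<ominus> (x \<ominus> p) \<in> I" using asub_minus[OF I(1)] p by blast
  then show ?thesis using minus_minus_swap[OF c(2,1) x] by simp
 qed
 let ?N = "{\<phi> \<in> \<B>. dens.upd (ind (\<phi> \<inter> XX 0)) = 0}"
 have "\<Inter>((%\<phi>. XX 0 - \<phi>) ` ?N) \<noteq> {}"
 proof (rule compact)
  show "(%\<phi>. XX 0 - \<phi>) ` ?N \<subseteq> DD" using BDD XX_DD DD_Diff by blast
  have "XX 0 - XX 0 \<in> \<B>" by (intro BI BX)
  moreover have "dens.upd (ind ((XX 0 - XX 0) \<inter> XX 0)) = 0" using dens.upd_zero by (simp add: dens.ind_def[abs_def])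
  ultimately show "(%\<phi>. XX 0 - \<phi>) ` ?N \<noteq> {}" by blast
  show "|(%\<phi>. XX 0 - \<phi>) ` ?N| <o \<kappa>" by (intro kImage kSubset[OF Bs]) auto
  fix \<G> assume "\<G> \<subseteq> (%\<phi>. XX 0 - \<phi>) ` ?N" "finite \<G>" "\<G> \<noteq> {}"
  then obtain F where F: "F \<subseteq> ?N" "finite F" "\<G> = (%\<phi>. XX 0 - \<phi>) ` F" by (meson finite_subset_image)
  show "\<Inter>\<G> \<noteq> {}"
  proof
   assume e: "\<Inter>\<G> = {}"
   have "XX 0 \<subseteq> \<Union>((%\<phi>. \<phi> \<inter> XX 0) ` F)"
   proof
    fix x assume x: "x \<in> XX 0"
    have "x \<notin> \<Inter>\<G>" using e by blast
    then have "EX \<phi>:F. x \<in> \<phi>" using F(3) x by blast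
    then obtain \<phi> where "\<phi> \<in> F" "x \<in> \<phi>" ..
    then show "x \<in> \<Union>((%\<phi>. \<phi> \<inter> XX 0) ` F)" using x by blast
   qed
   then have "dens.upd (ind (XX 0)) \<le> dens.upd (ind (\<Union>((%\<phi>. \<phi> \<inter> XX 0) ` F)))"
    by (intro dens.upd_mono bdd_ind[of _ 0]) (auto intro!: ind_mono)
   also have "\<dots> \<le> (\<Sum>Z\<in>(%\<phi>. \<phi> \<inter> XX 0) ` F. dens.upd (ind Z))"
    by (rule bdd_finite_sum[of _ 0]) (use F in auto)
   also have "\<dots> = 0" by (rule sum.neutral) (use F in auto)
   finally show False using dens.upd_base by linarith
  qed
 qed
 then obtain x where x: "ALL \<phi>:?N. x \<in> XX 0 - \<phi>" by blast
 have xX: "x \<in> XX 0"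
 proof -
  have "XX 0 - XX 0 \<in> \<B>" by (intro BI BX)
  then have "XX 0 - XX 0 \<in> ?N" using dens.upd_zero by (simp add: dens.ind_def[abs_def])
  then show ?thesis using x by blast
 qed
 then have xc: "x \<in> RR" using XX_carrier by blast
 let ?F = "{\<phi> \<in> \<B>. x \<in> \<phi>}"
 let ?E = "%\<phi>. {u \<in> XX 1. EX a:\<phi> \<inter> XX 0. a \<ominus> u \<in> \<phi> \<inter> XX 0}"
 have E: "gsym (?E \<phi>)" if p: "\<phi> \<in> ?F" for \<phi>
 proof (rule differences_gsym)
  show "\<phi> \<inter> XX 0 \<in> DD" using p BDD XX_DD DD_Int by blast
  then have "0 \<le> dens.upd (ind (\<phi> \<inter> XX 0))" by (intro dens.upd_nonneg bdd_DD)
  moreover have "dens.upd (ind (\<phi> \<inter> XX 0)) \<noteq> 0" using x p by blast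
  ultimately show "0 < dens.upd (ind (\<phi> \<inter> XX 0))" by linarith
 qed simp
 have "ALL \<phi>:?F. EX K. ccw K \<and> K \<subseteq> dbl (dbl (?E \<phi>))" using bogolyubov[OF E] by blast
 from bchoice[OF this] obtain K where "ALL \<phi>:?F. ccw (K \<phi>) \<and> K \<phi> \<subseteq> dbl (dbl (?E \<phi>))" ..
 note K = bspec[OF this]
 have "ALL \<phi>:?F. EX Q :: nat => 'b set. (ALL i. Q i \<in> DD) \<and> K \<phi> = (\<Inter>i. Q i)"
  using K unfolding ccw_def TDw_def by blast
 from bchoice[OF this] obtain Q :: "'b set => nat => 'b set"
  where "ALL \<phi>:?F. (ALL i. Q \<phi> i \<in> DD) \<and> K \<phi> = (\<Inter>i. Q \<phi> i)" ..
 note Q = bspec[OF this]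
 have dir: "dirf ?F" by (rule orbit_dir[OF B xc])
 have Fs: "|?F| <o \<kappa>" by (rule BB_small[OF B])
 have FDD: "?F \<subseteq> DD" by (rule BB_DD[OF B])
 have Kcc: "cc (\<Inter>\<phi>\<in>?F. K \<phi>)"
 proof (rule coc_family[OF _ Fs _ nat_less])
  show "?F \<noteq> {}" using dir by (simp add: dirf_def)
  show "K \<phi> = (\<Inter>i\<in>UNIV. Q \<phi> i)" if "\<phi> \<in> ?F" for \<phi> using Q[OF that] by simp
  show "Q \<phi> i \<in> DD" if "\<phi> \<in> ?F" for \<phi> i using Q[OF that] by blast
  show "cc (K \<phi>)" if "\<phi> \<in> ?F" for \<phi> using K[OF that] ccw_cc by blast
 qed simp
 have EDD: "?E \<phi> \<in> DD" if "\<phi> \<in> ?F" for \<phi> using E[OF that] by (simp add: gsym_def)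
 have Emono: "?E \<phi> \<subseteq> ?E \<psi>" if "\<phi> \<subseteq> \<psi>" for \<phi> \<psi> using that by blast
 have "(\<Inter>\<phi>\<in>?F. K \<phi>) \<subseteq> I"
 proof
  fix z assume z: "z \<in> (\<Inter>\<phi>\<in>?F. K \<phi>)"
  have z1: "z \<in> dbl (dbl (?E \<phi>))" if "\<phi> \<in> ?F" for \<phi> using z K that by blast
  have zd: "z \<in> dbl (\<Inter>\<phi>\<in>?F. dbl (?E \<phi>))"
   by (rule dbl_compact[OF dir Fs FDD]) (assumption | rule dbl_DD EDD dbl_mono Emono z1)+
  have yd: "y \<in> dbl (\<Inter>\<phi>\<in>?F. ?E \<phi>)" if y: "y \<in> (\<Inter>\<phi>\<in>?F. dbl (?E \<phi>))" for y
   by (rule dbl_compact[OF dir Fs FDD]) (assumption | rule EDD Emono INT_D[OF y])+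
  have EI: "(\<Inter>\<phi>\<in>?F. ?E \<phi>) \<subseteq> I"
  proof
   fix u assume u: "u \<in> (\<Inter>\<phi>\<in>?F. ?E \<phi>)"
   have uX: "u \<in> XX 1" using u dir by (auto simp: dirf_def)
   then have uc: "u \<in> RR" using XX_carrier by blast
   have "EX a. ALL \<phi>:?F. a \<in> {a \<in> \<phi> \<inter> XX 0. a \<ominus> u \<in> \<phi> \<inter> XX 0}"
   proof (rule compact_dir[OF dir Fs])
    fix \<phi> assume p: "\<phi> \<in> ?F"
    then have "\<phi> \<inter> XX 0 \<in> DD" using BDD XX_DD DD_Int by blast
    then show "{a \<in> \<phi> \<inter> XX 0. a \<ominus> u \<in> \<phi> \<inter> XX 0} \<in> DD"
     by (intro DD_collect LD_mem LT_minus LT_var LT_const uc)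
    show "{a \<in> \<phi> \<inter> XX 0. a \<ominus> u \<in> \<phi> \<inter> XX 0} \<noteq> {}" using u p by blast
   qed blast
   then obtain a where a: "\<And>\<phi>. \<phi> \<in> ?F ==> a \<in> \<phi> \<and> a \<ominus> u \<in> \<phi>" by blast
   have orbx: "\<Inter>?F = {\<sigma> x | \<sigma>. \<sigma> \<in> fixg P}" using B xc by (simp add: isBB_def)
   have "a \<in> \<Inter>?F" "a \<ominus> u \<in> \<Inter>?F" using a by blast+
   then obtain \<sigma> \<tau> where st: "\<sigma> \<in> fixg P" "a = \<sigma> x" "\<tau> \<in> fixg P" "a \<ominus> u = \<tau> x" unfolding orbx by blast
   have sA: "\<sigma> \<in> Aut" "\<tau> \<in> Aut" using st by (auto simp: fixg_def)
   have c: "a \<in> RR" "a \<ominus> u \<in> RR" using st Aut_carrier sA xc by auto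
   have "(a \<ominus> x) \<ominus> ((a \<ominus> u) \<ominus> x) \<in> I" using asub_minus[OF I(1) orb[OF st(1) xc] orb[OF st(3) xc]] st by simp
   moreover have "(a \<ominus> x) \<ominus> ((a \<ominus> u) \<ominus> x) = a \<ominus> (a \<ominus> u)" by (rule minus_minus_swap[OF c(1) xc c(2)])
   moreover have "a \<ominus> (a \<ominus> u) = u" using c uc neg_minus[of a u] minus_cancel[of u a] by (simp add: minus_eq)
   ultimately show "u \<in> I" by simp
  qed
  have dI: "dbl I \<subseteq> I" using asub_add[OF I(1)] unfolding dbl_iff subset_iff by blast
  have "(\<Inter>\<phi>\<in>?F. dbl (?E \<phi>)) \<subseteq> I"
  proof
   fix y assume "y \<in> (\<Inter>\<phi>\<in>?F. dbl (?E \<phi>))"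
   from yd[OF this] have "y \<in> dbl I" by (rule dbl_mono[OF EI, THEN subsetD])
   then show "y \<in> I" by (rule dI[THEN subsetD])
  qed
  from dbl_mono[OF this, THEN subsetD, OF zd] show "z \<in> I" by (rule dI[THEN subsetD])
 qed
 then show ?thesis using Kcc by blast
qed

text \<open>With \<open>K\<close> in \<open>I\<close> type-definable of bounded index and
\<open>h\<close> in the component, ergodicity approximates \<open>h\<close> modulo neighbourhoods
of \<open>K\<close> by elements of invariant neighbourhoods of \<open>K\<close>. In the limit
\<open>h\<close> is congruent modulo \<open>K\<close> to a conjugate of an element of
\<open>K\<close>.\<close>

theorem ccomp_least_invariant:
 assumes I: "asub I" "ginv Aut I" "bidx I"
 shows "ccomp \<subseteq> I"
proof
 fix h assume h: "h \<in> ccomp"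
 have hc: "h \<in> RR" using h ccomp_carrier by blast
 have Ic: "I \<subseteq> RR" by (rule asub_carrier[OF I(1)])
 obtain K where K: "cc K" "K \<subseteq> I" using bounded_inv_contains_cc[OF I] by blast
 obtain \<B> where B: "isBB {} \<B>" using ccomp_BB by blast
 obtain n where n: "ccomp \<subseteq> XX n" using TD_bdd[OF cc_TD[OF ccomp_cc]] by blast
 obtain m where m: "K \<subseteq> XX m" using TD_bdd[OF cc_TD[OF K(1)]] by blast
 obtain \<F> where F: "\<F> \<subseteq> DD" "dirf \<F>" "|\<F>| <o \<kappa>" "K = \<Inter>\<F>" using TD_dir[OF cc_TD[OF K(1)]] by blast
 let ?G = "{A \<in> \<B>. K \<subseteq> A}"
 have Gd: "dirf ?G" and Gs: "|?G| <o \<kappa>" and GD: "?G \<subseteq> DD" by (rule BB_dir[OF B m], rule BB_small[OF B], rule BB_DD[OF B])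
 let ?H = "(%(A, D). {y \<in> A. h \<ominus> y \<in> D}) ` (?G \<times> \<F>)"
 have dir: "dirf ?H" unfolding dirf_def
 proof (intro conjI ballI)
  show "?H \<noteq> {}" using F(2) Gd by (auto simp: dirf_def)
  fix A B assume "A \<in> ?H" "B \<in> ?H"
  then obtain a a' b b' where ab: "A = {x \<in> a. h \<ominus> x \<in> a'}" "B = {x \<in> b. h \<ominus> x \<in> b'}" "a \<in> ?G" "b \<in> ?G" "a' \<in> \<F>" "b' \<in> \<F>" by auto
  have "EX c:?G. c \<subseteq> a \<inter> b" by (rule Gd[unfolded dirf_def, THEN conjunct2, rule_format, OF ab(3,4)])
  then obtain c where c: "c \<in> ?G" "c \<subseteq> a \<inter> b" ..
  have "EX c:\<F>. c \<subseteq> a' \<inter> b'" by (rule F(2)[unfolded dirf_def, THEN conjunct2, rule_format, OF ab(5,6)])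
  then obtain c' where c': "c' \<in> \<F>" "c' \<subseteq> a' \<inter> b'" ..
  have "{x \<in> c. h \<ominus> x \<in> c'} \<in> ?H" using c(1) c'(1) by (intro image_eqI[of _ _ "(c, c')"]) auto
  moreover have "{x \<in> c. h \<ominus> x \<in> c'} \<subseteq> A \<inter> B" using ab(1,2) c c' by blast
  ultimately show "EX C:?H. C \<subseteq> A \<inter> B" by (rule bexI[rotated])
 qed
 have "EX y. ALL Z:?H. y \<in> Z"
 proof (rule compact_dir[OF dir])
  show "|?H| <o \<kappa>" by (intro kImage kTimes F Gs)
  fix Z assume "Z \<in> ?H"
  then obtain A D where Z: "Z = {y \<in> A. h \<ominus> y \<in> D}" "A \<in> \<B>" "K \<subseteq> A" "D \<in> \<F>" by auto
  have AD: "A \<in> DD" "D \<in> DD" using Z B F by (auto simp: isBB_def)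
  show "Z \<in> DD" unfolding Z(1) by (intro DD_collect LD_mem LT_minus LT_const LT_var hc AD)
  have DN: "D \<in> NB K" "A \<in> NB K" using Z F AD by (auto simp: NB_def)
  obtain K1 where K1: "ccw K1" "K1 \<subseteq> D" using ccw_between[OF K(1) DN(1)] by blast
  have Ainv: "ginv Aut A" using B Z by (auto simp: isBB_def fixg_empty)
  have YA: "A \<inter> ccomp \<subseteq> ccomp" by blast
  have "ginv Aut (A \<inter> ccomp)"
   by (rule ginvI[OF autg_Aut]) (use ccomp_carrier ginvD[OF Ainv] ginvD[OF ccomp_inv] in blast)+
  note Ainv' = this
  have pos: "0 < density.upd R ccomp ccomp (ind (A \<inter> ccomp))"
   by (rule upd_nbhd_pos[OF ccomp_asub n K(1) DN(2) asub_zero[OF ccomp_asub]])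
    (use ccomp_carrier minus_zero_r in auto)
  have "EX y:A \<inter> ccomp. h \<ominus> y \<in> D"
   by (rule ergodic[OF autg_Aut ccomp_cc ccomp_inv ccomp_least YA Ainv' pos K1 AD(2) h])
  then show "Z \<noteq> {}" using Z(1) by blast
 qed
 then obtain y where y': "ALL Z:?H. y \<in> Z" ..
 note y = bspec[OF y']
 have yAD: "y \<in> A \<and> h \<ominus> y \<in> D" if "A \<in> ?G" "D \<in> \<F>" for A D
  using y[of "{y \<in> A. h \<ominus> y \<in> D}"] that by force
 obtain A0 D0 where AD0: "A0 \<in> ?G" "D0 \<in> \<F>" using Gd F(2) by (auto simp: dirf_def)
 have yG: "y \<in> \<Inter>?G" using yAD AD0(2) by blast
 have "h \<ominus> y \<in> K" using yAD AD0(1) F(4) by blast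
 then have hy: "h \<ominus> y \<in> I" using K by blast
 have yc: "y \<in> RR" using yG AD0(1) GD DD_carrier by blast
 obtain \<sigma> where s: "\<sigma> \<in> Aut" "\<sigma> y \<in> K" using BB_saturation[OF B cc_TD[OF K(1)] yG yc] by (auto simp: fixg_empty)
 obtain \<tau> where t: "\<tau> \<in> Aut" "ALL x:RR. \<tau> (\<sigma> x) = x \<and> \<sigma> (\<tau> x) = x" using Aut_inv[OF s(1)] by blast
 have "\<tau> (\<sigma> y) \<in> I" using ginvD[OF I(2) t(1)] s K by blast
 then have "y \<in> I" using t yc by simp
 then have "y \<oplus> (h \<ominus> y) \<in> I" using asub_add[OF I(1)] hy by blast
 then show "h \<in> I" using minus_cancel[OF hc yc] by simp
qed

lemma cideal_least:
 assumes I: "asub I" "ginv Aut I" "bidx I" and left: "\<And>r x. r \<in> RR ==> x \<in> I ==> r \<otimes> x \<in> I"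
 shows "cideal \<subseteq> I"
proof
 fix x assume "x \<in> cideal"
 then obtain h r k where x: "h \<in> ccomp" "r \<in> RR" "k \<in> ccomp" "x = h \<oplus> r \<otimes> k" by (auto simp: cideal_def)
 have "h \<in> I" "k \<in> I" using ccomp_least_invariant[OF I] x by auto
 then show "x \<in> I" using asub_add[OF I(1)] left x by simp
qed

lemma fixed_mult_ccomp:
 assumes r: "r \<in> RR" "\<And>\<sigma>. \<sigma> \<in> Aut ==> \<sigma> r = r" and h: "h \<in> ccomp"
 shows "r \<otimes> h \<in> ccomp"
proof -
 let ?L = "{x \<in> ccomp. r \<otimes> x \<in> ccomp}"
 have "cc ?L" by (rule cc_pullback[OF additive_left[OF r(1)] ccomp_cc ccomp_cc])
 moreover have "ginv Aut ?L"
 proof (rule ginvI[OF autg_Aut])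
  show "?L \<subseteq> RR" using ccomp_carrier by blast
  fix \<sigma> x assume s: "\<sigma> \<in> Aut" and x: "x \<in> ?L"
  then have "\<sigma> (r \<otimes> x) = r \<otimes> \<sigma> x" using Aut_mult[OF s r(1), of x] r(2)[OF s] ccomp_carrier by auto
  then show "\<sigma> x \<in> ?L" using x ginvD[OF ccomp_inv s] by (metis (mono_tags, lifting) mem_Collect_eq)
 qed
 ultimately show ?thesis using ccomp_least h by blast
qed

text \<open>For \<open>f\<close> fixed by all automorphisms the pullback of the component under
multiplication by \<open>f\<close> is again invariant, so \<open>f\<close> maps the component to
itself and can be absorbed.\<close>

lemma cideal_fixed:
 assumes cov: "\<And>n. \<exists>F\<subseteq>RR. (ALL f:F. ALL \<sigma>:Aut. \<sigma> f = f) \<and> (ALL x:XX n. EX f:F. EX y:XX 0. x = f \<oplus> y)"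
 shows "cideal = {x. EX h:ccomp. EX r:XX 0. EX k:ccomp. x = h \<oplus> r \<otimes> k}" and "TD cideal"
proof -
 note T = cc_TD[OF ccomp_cc]
 show eq: "cideal = {x. EX h:ccomp. EX r:XX 0. EX k:ccomp. x = h \<oplus> r \<otimes> k}"
 proof (intro equalityI subsetI)
  fix x assume "x \<in> cideal"
  then obtain h r k where x: "h \<in> ccomp" "r \<in> RR" "k \<in> ccomp" "x = h \<oplus> r \<otimes> k" by (auto simp: cideal_def)
  obtain n where "r \<in> XX n" using x in_carrierE by blast
  moreover from cov[of n] obtain F where F: "F \<subseteq> RR" "ALL f:F. ALL \<sigma>:Aut. \<sigma> f = f" "ALL x:XX n. EX f:F. EX y:XX 0. x = f \<oplus> y" by blast
  ultimately obtain f y where f: "f \<in> F" "y \<in> XX 0" "r = f \<oplus> y" by blast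
  have c: "h \<in> RR" "k \<in> RR" "f \<in> RR" "y \<in> RR" using x f F ccomp_carrier XX_carrier by auto
  have fk: "f \<otimes> k \<in> ccomp" by (rule fixed_mult_ccomp) (use f F x c in auto)
  have "x = (h \<oplus> f \<otimes> k) \<oplus> y \<otimes> k" using x f c by (simp add: distr_left mult_closed a_assoc)
  then show "x \<in> {x. EX h:ccomp. EX r:XX 0. EX k:ccomp. x = h \<oplus> r \<otimes> k}"
   using asub_add[OF ccomp_asub x(1) fk] f x by blast
 qed (use XX_carrier cidealI in blast)
 obtain \<F> where F: "\<F> \<subseteq> DD" "dirf \<F>" "|\<F>| <o \<kappa>" "ccomp = \<Inter>\<F>" using TD_dir[OF T] by blast
 obtain n where n: "ccomp \<subseteq> XX n" using TD_bdd[OF T] by blast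
 let ?m = "Suc (Suc n)"
 let ?T = "%D. {c \<in> XX ?m. EX r:XX 0. EX h:D. c \<ominus> r \<otimes> h \<in> D}"
 have TDD: "?T D \<in> DD" if "D \<in> \<F>" for D
  by (intro DD_collect XX_DD LD_bexD LD_mem LT_minus LT_mult LT_var) (use that F in auto)
 have "cideal = \<Inter>(?T ` \<F>)"
 proof (intro equalityI subsetI)
  fix x assume "x \<in> cideal"
  then obtain h r k where x: "h \<in> ccomp" "r \<in> XX 0" "k \<in> ccomp" "x = h \<oplus> r \<otimes> k" unfolding eq by blast
  have c: "h \<in> RR" "k \<in> RR" "r \<in> RR" "r \<otimes> k \<in> RR" using x ccomp_carrier XX_carrier by (auto intro: mult_closed)
  have "r \<in> XX n" "k \<in> XX n" "h \<in> XX (Suc n)" using x n XX_monoD[of r 0 n] XX_Suc by auto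
  then have "x \<in> XX ?m" unfolding x(4) by (intro XX_add XX_mult)
  moreover have "x \<ominus> r \<otimes> k = h" using x c add_cancel[of "r \<otimes> k" h] by (simp add: a_comm)
  moreover have "h \<in> D" "k \<in> D" if "D \<in> \<F>" for D using x(1,3) F(4) that by auto
  ultimately have "x \<in> ?T D" if "D \<in> \<F>" for D
   using x(2) that by (auto intro!: bexI[where x = r and A = "XX 0"])
  then show "x \<in> \<Inter>(?T ` \<F>)" by blast
 next
  fix x assume x: "x \<in> \<Inter>(?T ` \<F>)"
  have xT: "x \<in> ?T D" if "D \<in> \<F>" for D using x that by blast
  obtain D0 where "D0 \<in> \<F>" using F(2) by (auto simp: dirf_def)
  then have xc: "x \<in> RR" using xT XX_carrier by blast
  have "EX r:XX 0. EX h:ccomp. x \<ominus> r \<otimes> h \<in> ccomp"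
  proof (rule product_closed[OF T xc])
   fix D assume "D \<in> NB ccomp"
   then have "D \<in> NB (\<Inter>\<F>)" using F(4) by simp
   from NB_base[OF F(2,1,3) this] obtain E where "E \<in> \<F>" "E \<subseteq> D" by blast
   then show "EX r:XX 0. EX h:D. x \<ominus> r \<otimes> h \<in> D" using xT by blast
  qed
  then show "x \<in> cideal" using cidealI'[OF xc] XX_carrier by blast
 qed
 then show "TD cideal" unfolding TD_def
  using TDD F by (intro exI[of _ "?T ` \<F>"]) (auto simp: dirf_def intro: kImage)
qed

end

section \<open>First-order formulas\<close>

lemma finite_fv_term: "finite (fv_term t)" by (induction t) auto

lemma finite_fv: "finite (fv \<phi>)" by (induction \<phi>) (auto simp: finite_fv_term)

lemma eval_term_cong: "(\<And>i. i \<in> fv_term t ==> s i = s' i) ==> eval_term M s t = eval_term M s' t"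
proof (induction t)
 case (Fn f ts)
 have "map (eval_term M s) ts = map (eval_term M s') ts" using Fn by (intro map_cong) auto
 then show ?case by (simp del: map_eq_conv)
qed auto

lemma sat_cong: "(\<And>i. i \<in> fv \<phi> ==> s i = s' i) ==> sat M s \<phi> = sat M s' \<phi>"
proof (induction \<phi> arbitrary: s s')
 case (Eq t u)
 have "eval_term M s t = eval_term M s' t" "eval_term M s u = eval_term M s' u"
  by (rule eval_term_cong, use Eq in auto)+
 then show ?case by simp
next
 case (Rel r ts)
 have "eval_term M s t = eval_term M s' t" if t: "t \<in> set ts" for t
 proof (rule eval_term_cong)
  fix i assume "i \<in> fv_term t"
  then have "i \<in> fv (Rel r ts)" using t by auto
  then show "s i = s' i" by (rule Rel)
 qed
 then have "map (eval_term M s) ts = map (eval_term M s') ts" by simp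
 then show ?case by (simp only: sat.simps)
next
 case (Neg \<phi>)
 have "sat M s \<phi> = sat M s' \<phi>" by (rule Neg.IH) (use Neg.prems in auto)
 then show ?case by simp
next
 case (Conj \<phi> \<psi>)
 have "sat M s \<phi> = sat M s' \<phi>" "sat M s \<psi> = sat M s' \<psi>" 
  by (rule Conj.IH(1), use Conj.prems in force) (rule Conj.IH(2), use Conj.prems in force)
 then show ?case by simp
next
 case (Exi x \<phi>)
 have "sat M (s(x := a)) \<phi> = sat M (s'(x := a)) \<phi>" for a by (rule Exi.IH) (use Exi.prems in auto)
 then show ?case by simp
qed

fun rename_term :: "(nat => nat) => 'f fo_term => 'f fo_term" where
 "rename_term f (Var i) = Var (f i)"
| "rename_term f (Fn g ts) = Fn g (map (rename_term f) ts)"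

definition fresh :: "nat set => nat" where "fresh V = Suc (Max (insert 0 V))"

lemma fresh_gt: "finite V ==> i \<in> V ==> i < fresh V" by (simp add: fresh_def less_Suc_eq_le)

text \<open>Bound variables are renamed to variables outside the range of the free ones, so that
no capture occurs for any renaming, injective or not.\<close>

fun rename :: "(nat => nat) => ('f, 'r) fo_form => ('f, 'r) fo_form" where
 "rename f (Eq t u) = Eq (rename_term f t) (rename_term f u)"
| "rename f (Rel r ts) = Rel r (map (rename_term f) ts)"
| "rename f (Neg \<phi>) = Neg (rename f \<phi>)"
| "rename f (Conj \<phi> \<psi>) = Conj (rename f \<phi>) (rename f \<psi>)"
| "rename f (Exi x \<phi>) =
  (let y = fresh (f ` fv \<phi>) in Exi y (rename (f(x := y)) \<phi>))"

lemma eval_rename_term: "eval_term M s (rename_term f t) = eval_term M (%i. s (f i)) t"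
proof (induction t)
 case (Fn g ts)
 have "map (eval_term M s \<circ> rename_term f) ts = map (eval_term M (%i. s (f i))) ts"
  using Fn by (intro map_cong) auto
 then show ?case by (simp del: map_eq_conv)
qed auto

lemma fv_rename_term: "fv_term (rename_term f t) = f ` fv_term t"
 by (induction t) auto

lemma wf_rename_term: "wf_term L (rename_term f t) = wf_term L t"
 by (induction t) auto

lemma wf_rename: "wf_form L (rename f \<phi>) = wf_form L \<phi>"
 by (induction \<phi> arbitrary: f) (auto simp: wf_rename_term Let_def)

lemma fv_rename: "fv (rename f \<phi>) = f ` fv \<phi>"
proof (induction \<phi> arbitrary: f)
 case (Exi x \<phi>)
 let ?y = "fresh (f ` fv \<phi>)"
 have "f i \<noteq> ?y" if "i \<in> fv \<phi>" for i
  using fresh_gt[OF finite_imageI[OF finite_fv] imageI[OF that], of f] by simp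
 then show ?case by (auto simp: Let_def Exi.IH)
qed (auto simp: fv_rename_term)

lemma sat_rename: "sat M s (rename f \<phi>) = sat M (%i. s (f i)) \<phi>"
proof (induction \<phi> arbitrary: f s)
 case (Rel r ts)
 have "map (eval_term M s \<circ> rename_term f) ts = map (eval_term M (%i. s (f i))) ts"
  by (intro map_cong) (auto simp: eval_rename_term)
 then show ?case by (simp del: map_eq_conv)
next
 case (Exi x \<phi>)
 let ?y = "fresh (f ` fv \<phi>)"
 have y: "f i \<noteq> ?y" if "i \<in> fv \<phi>" for i
  using fresh_gt[OF finite_imageI[OF finite_fv] imageI[OF that], of f] by simp
 have "sat M (s(?y := a)) (rename (f(x := ?y)) \<phi>) = sat M ((%i. s (f i))(x := a)) \<phi>" for a
  unfolding Exi.IH by (rule sat_cong) (use y in \<open>auto simp: fun_upd_def\<close>)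
 then show ?case by (simp add: Let_def)
qed (auto simp: eval_rename_term)

text \<open>Quantification over de Bruijn index 0.\<close>

lemma exists_formula:
 fixes \<phi> :: "('f, 'r) fo_form"
 assumes "wf_form L \<phi>"
 shows "EX \<psi>. wf_form L \<psi> \<and> (ALL (M :: ('f, 'r, 'a) fo_struct) s.
  sat M s \<psi> = (EX a:univ M. sat M (case_nat a s) \<phi>))"
proof (intro exI conjI allI)
 let ?m = "fresh (fv \<phi>)"
 let ?\<psi> = "Exi ?m (rename (case_nat ?m (%i. i)) \<phi>)"
 show "wf_form L ?\<psi>" using assms by (simp add: wf_rename)
 fix M :: "('f, 'r, 'a) fo_struct" and s
 have m: "Suc i < ?m" if "Suc i \<in> fv \<phi>" for i using fresh_gt[OF finite_fv that] .
 have "sat M (s(?m := a)) (rename (case_nat ?m (%i. i)) \<phi>) = sat M (case_nat a s) \<phi>" for a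
  unfolding sat_rename
 proof (rule sat_cong)
  fix i assume i: "i \<in> fv \<phi>"
  show "(s(?m := a)) (case i of 0 => ?m | Suc i => i) = (case i of 0 => a | Suc i => s i)"
   using i by (cases i) (auto dest: m)
 qed
 then show "sat M s ?\<psi> = (EX a:univ M. sat M (case_nat a s) \<phi>)" by simp
qed

definition prep :: "'a list => (nat => 'a) => nat => 'a" where
 "prep xs s i = (if i < length xs then xs ! i else s (i - length xs))"

lemma prep_Cons: "prep (x # xs) s = case_nat x (prep xs s)"
 by (auto simp: prep_def split: nat.split)

lemma tuples_Suc: "xs \<in> tuples U (Suc n) \<longleftrightarrow> (EX y ys. xs = y # ys \<and> y \<in> U \<and> ys \<in> tuples U n)"
 by (cases xs) (auto simp: tuples_def)

lemma exists_tuple_formula: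
 fixes \<phi> :: "('f, 'r) fo_form"
 assumes "wf_form L \<phi>"
 shows "EX \<psi>. wf_form L \<psi> \<and> (ALL (M :: ('f, 'r, 'a) fo_struct) s.
  sat M s \<psi> = (EX xs:tuples (univ M) n. sat M (prep xs s) \<phi>))"
 using assms
proof (induction n arbitrary: \<phi>)
 case 0
 have "prep [] s = s" for s :: "nat => 'a" by (auto simp: prep_def)
 then show ?case by (intro exI[of _ \<phi>]) (use 0 in \<open>auto simp: tuples_def\<close>)
next
 case (Suc n)
 obtain \<chi> where c: "wf_form L \<chi>" "ALL (M :: ('f, 'r, 'a) fo_struct) s. sat M s \<chi> = (EX a:univ M. sat M (case_nat a s) \<phi>)"
  using exists_formula[OF Suc.prems] by fast
 obtain \<psi> where p: "wf_form L \<psi>" "ALL (M :: ('f, 'r, 'a) fo_struct) s. sat M s \<psi> = (EX xs:tuples (univ M) n. sat M (prep xs s) \<chi>)"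
  using Suc.IH[OF c(1)] by fast
 have "sat M s \<psi> = (EX xs:tuples (univ M) (Suc n). sat M (prep xs s) \<phi>)" for M :: "('f, 'r, 'a) fo_struct" and s
 proof -
  have "(EX xs:tuples (univ M) (Suc n). sat M (prep xs s) \<phi>) =
    (EX y ys. y \<in> univ M \<and> ys \<in> tuples (univ M) n \<and> sat M (case_nat y (prep ys s)) \<phi>)"
   by (force simp: tuples_Suc prep_Cons[symmetric])
  then show ?thesis using p(2) c(2) by blast
 qed
 then show ?case using p(1) by (intro exI[of _ \<psi>]) simp
qed

text \<open>An environment \<open>e\<close> of \<open>k\<close>-tuples and a sequence
\<open>c\<close> of parameters are coded as one valuation: the pair \<open>(0, j)\<close> is the
parameter \<open>c j\<close>, and \<open>(Suc p, q)\<close> is entry \<open>q\<close> of the tuple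
\<open>e p\<close>. The value at the unused positions \<open>q \<ge> k\<close> is an arbitrary
element of the universe.\<close>

definition val :: "nat => (nat => 'a list) => (nat => 'a) => nat => 'a" where
 "val k e c i = (case prod_decode i of (0, j) => c j
  | (Suc p, q) => if q < k then e p ! q else c 0)"

abbreviation cpos :: "nat => nat" where "cpos j \<equiv> prod_encode (0, j)"
abbreviation vpos :: "nat => nat => nat" where "vpos p q \<equiv> prod_encode (Suc p, q)"

lemma val_cpos: "val k e c (cpos j) = c j" by (simp add: val_def)

lemma val_vpos: "q < k ==> val k e c (vpos p q) = e p ! q" by (simp add: val_def)

definition envs :: "'a set => nat => (nat => 'a list) set" where
 "envs U k = {e. ALL i. e i \<in> tuples U k}"

definition vals :: "'a set => (nat => 'a) set" where
 "vals U = {c. ALL i. c i \<in> U}"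

lemma val_vals: "e \<in> envs U k ==> c \<in> vals U ==> val k e c \<in> vals U"
 by (auto simp: val_def envs_def vals_def tuples_def split: prod.split nat.split) (metis nth_mem subsetD)

lemma envs_case: "x \<in> tuples U k ==> e \<in> envs U k ==> case_nat x e \<in> envs U k"
 by (auto simp: envs_def split: nat.split)

lemma elem_sat:
 assumes el: "elem_substructure L M C" and w: "wf_form L \<phi>" and s: "s \<in> vals (univ M)"
 shows "sat M s \<phi> = sat C s \<phi>"
proof -
 let ?n = "fresh (fv \<phi>)" let ?xs = "map s [0..<?n]"
 have f: "i < ?n" if "i \<in> fv \<phi>" for i by (rule fresh_gt[OF finite_fv that])
 have 1: "\<phi> \<in> formulas L ?n" using w f by (auto simp: formulas_def)
 have 2: "?xs \<in> tuples (univ M) ?n" using s by (auto simp: tuples_def vals_def)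
 have 3: "holds N \<phi> ?xs = sat N s \<phi>" for N :: "('a, 'b, 'c) fo_struct"
  unfolding holds_def by (rule sat_cong) (use f in auto)
 show ?thesis using el 1 2 unfolding elem_substructure_def 3[symmetric] by blast
qed

locale two_structures =
 fixes L :: "('f, 'r) language" and M C :: "('f, 'r, 'a) fo_struct" and k :: nat
begin

text \<open>The same formula defines \<open>P\<close> in \<open>M\<close> and \<open>Q\<close> in
\<open>C\<close>. The closure properties of this relation replace explicit formulas in transfer
arguments; for \<open>M = C\<close> it expresses definability with parameters.\<close>

definition tdef :: "((nat => 'a list) => (nat => 'a) => bool) => ((nat => 'a list) => (nat => 'a) => bool) => bool" where
 "tdef P Q \<longleftrightarrow> (EX \<phi>. wf_form L \<phi> \<and>
  (ALL e:envs (univ M) k. ALL c:vals (univ M). P e c = sat M (val k e c) \<phi>) \<and>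
  (ALL e:envs (univ C) k. ALL c:vals (univ C). Q e c = sat C (val k e c) \<phi>))"

lemma tdef_not: "tdef P Q ==> tdef (%e c. \<not> P e c) (%e c. \<not> Q e c)"
 unfolding tdef_def
proof (elim exE conjE)
 fix \<phi> assume "wf_form L \<phi>" "ALL e:envs (univ M) k. ALL c:vals (univ M). P e c = sat M (val k e c) \<phi>"
  "ALL e:envs (univ C) k. ALL c:vals (univ C). Q e c = sat C (val k e c) \<phi>"
 then show "EX \<phi>. wf_form L \<phi> \<and>
  (ALL e:envs (univ M) k. ALL c:vals (univ M). (\<not> P e c) = sat M (val k e c) \<phi>) \<and>
  (ALL e:envs (univ C) k. ALL c:vals (univ C). (\<not> Q e c) = sat C (val k e c) \<phi>)"
  by (intro exI[of _ "Neg \<phi>"]) simp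
qed

lemma tdefE:
 assumes "tdef P Q"
 obtains \<phi> where "wf_form L \<phi>"
  "\<And>e c. e \<in> envs (univ M) k ==> c \<in> vals (univ M) ==> P e c = sat M (val k e c) \<phi>"
  "\<And>e c. e \<in> envs (univ C) k ==> c \<in> vals (univ C) ==> Q e c = sat C (val k e c) \<phi>"
 using assms unfolding tdef_def by auto

lemma tdefI:
 assumes "wf_form L \<phi>"
  "\<And>e c. e \<in> envs (univ M) k ==> c \<in> vals (univ M) ==> P e c = sat M (val k e c) \<phi>"
  "\<And>e c. e \<in> envs (univ C) k ==> c \<in> vals (univ C) ==> Q e c = sat C (val k e c) \<phi>"
 shows "tdef P Q"
 using assms unfolding tdef_def by auto

lemma tdef_conj:
 assumes "tdef P Q" "tdef P' Q'"
 shows "tdef (%e c. P e c \<and> P' e c) (%e c. Q e c \<and> Q' e c)"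
 using assms(1)
proof (rule tdefE)
 fix \<phi> assume p: "wf_form L \<phi>"
  "\<And>e c. e \<in> envs (univ M) k ==> c \<in> vals (univ M) ==> P e c = sat M (val k e c) \<phi>"
  "\<And>e c. e \<in> envs (univ C) k ==> c \<in> vals (univ C) ==> Q e c = sat C (val k e c) \<phi>"
 from assms(2) show ?thesis
 proof (rule tdefE)
  fix \<psi> assume q: "wf_form L \<psi>"
   "\<And>e c. e \<in> envs (univ M) k ==> c \<in> vals (univ M) ==> P' e c = sat M (val k e c) \<psi>"
   "\<And>e c. e \<in> envs (univ C) k ==> c \<in> vals (univ C) ==> Q' e c = sat C (val k e c) \<psi>"
  show ?thesis by (rule tdefI[of "Conj \<phi> \<psi>"]) (use p q in auto)
 qed
qed

lemma tdef_imp: "tdef P Q ==> tdef P' Q' ==> tdef (%e c. P e c --> P' e c) (%e c. Q e c --> Q' e c)"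
 using tdef_not[OF tdef_conj[OF _ tdef_not]] by simp

lemma tdef_disj: "tdef P Q ==> tdef P' Q' ==> tdef (%e c. P e c \<or> P' e c) (%e c. Q e c \<or> Q' e c)"
 using tdef_imp[OF tdef_not] by (simp add: disj_imp)

lemma tdef_subst:
 assumes "tdef P Q"
  and M: "\<And>e c. e \<in> envs (univ M) k ==> c \<in> vals (univ M) ==>
   E e c \<in> envs (univ M) k \<and> D e c \<in> vals (univ M)"
  and C: "\<And>e c. e \<in> envs (univ C) k ==> c \<in> vals (univ C) ==>
   E e c \<in> envs (univ C) k \<and> D e c \<in> vals (univ C)"
  and g: "\<And>U e c i. e \<in> envs U k ==> c \<in> vals U ==> val k (E e c) (D e c) i = val k e c (g i)"
 shows "tdef (%e c. P (E e c) (D e c)) (%e c. Q (E e c) (D e c))"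
 using assms(1)
proof (rule tdefE)
 fix \<phi> assume p: "wf_form L \<phi>"
  "\<And>e c. e \<in> envs (univ M) k ==> c \<in> vals (univ M) ==> P e c = sat M (val k e c) \<phi>"
  "\<And>e c. e \<in> envs (univ C) k ==> c \<in> vals (univ C) ==> Q e c = sat C (val k e c) \<phi>"
 show ?thesis
 proof (rule tdefI[of "rename g \<phi>"])
  fix e c assume ec: "e \<in> envs (univ M) k" "c \<in> vals (univ M)"
  show "P (E e c) (D e c) = sat M (val k e c) (rename g \<phi>)"
   using M[OF ec] p(2)[of "E e c" "D e c"] by (simp add: sat_rename g[OF ec, symmetric])
 next
  fix e c assume ec: "e \<in> envs (univ C) k" "c \<in> vals (univ C)"
  show "Q (E e c) (D e c) = sat C (val k e c) (rename g \<phi>)"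
   using C[OF ec] p(3)[of "E e c" "D e c"] by (simp add: sat_rename g[OF ec, symmetric])
 qed (use p(1) in \<open>simp add: wf_rename\<close>)
qed

lemma tdef_rename:
 assumes "tdef P Q"
 shows "tdef (%e c. P (%i. e (f i)) (%i. c (g i))) (%e c. Q (%i. e (f i)) (%i. c (g i)))"
proof (rule tdef_subst[OF assms, where E = "%e c i. e (f i)" and D = "%e c i. c (g i)"
  and g = "%i. case prod_decode i of (0, j) => cpos (g j) | (Suc p, q) => if q < k then vpos (f p) q else cpos (g 0)"])
qed (auto simp: envs_def vals_def val_def split: prod.split nat.split)

lemma tdef_param:
 assumes "tdef P Q"
 shows "tdef (%e c. P (case_nat (map c [0..<k]) e) (%i. c (i + k))) (%e c. Q (case_nat (map c [0..<k]) e) (%i. c (i + k)))"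
proof (rule tdef_subst[OF assms, where E = "%e c. case_nat (map c [0..<k]) e" and D = "%e c i. c (i + k)"
  and g = "%i. case prod_decode i of (0, j) => cpos (j + k)
   | (Suc p, q) => if q < k then (case p of 0 => cpos q | Suc p => vpos p q) else cpos k"])
qed (auto simp: envs_def vals_def val_def tuples_def split: prod.split nat.split)

lemma tdef_exists:
 assumes "tdef P Q"
 shows "tdef (%e c. EX x:tuples (univ M) k. P (case_nat x e) c) (%e c. EX x:tuples (univ C) k. Q (case_nat x e) c)"
 using assms
proof (rule tdefE)
 fix \<phi> assume p: "wf_form L \<phi>"
  "\<And>e c. e \<in> envs (univ M) k ==> c \<in> vals (univ M) ==> P e c = sat M (val k e c) \<phi>"
  "\<And>e c. e \<in> envs (univ C) k ==> c \<in> vals (univ C) ==> Q e c = sat C (val k e c) \<phi>"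
 let ?g = "%i. case prod_decode i of (0, j) => cpos j + k
  | (Suc p, q) => if q < k then (case p of 0 => q | Suc p => vpos p q + k) else cpos 0 + k"
 obtain \<psi> where q: "wf_form L \<psi>" "ALL (N :: ('f, 'r, 'a) fo_struct) s. sat N s \<psi> = (EX xs:tuples (univ N) k. sat N (prep xs s) (rename ?g \<phi>))"
  using exists_tuple_formula[of L "rename ?g \<phi>" k] p(1) wf_rename by blast
 have v: "val k (case_nat x e) c = (%i. prep x (val k e c) (?g i))" if "length x = k" for x e and c :: "nat => 'a"
  by (rule ext) (use that in \<open>auto simp: val_def prep_def split: prod.split nat.split\<close>)
 have t: "sat N (val k (case_nat x e) c) \<phi> = sat N (prep x (val k e c)) (rename ?g \<phi>)"
  if "x \<in> tuples (univ N) k" for N :: "('f, 'r, 'a) fo_struct" and x e c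
  using v that by (simp add: sat_rename tuples_def)
 show ?thesis by (rule tdefI[OF q(1)]) (simp_all add: q(2) t[symmetric] p(2,3) envs_case cong: bex_cong)
qed

lemma tdef_ex:
 assumes "tdef (%e. P (e 0) (%i. e (Suc i))) (%e. Q (e 0) (%i. e (Suc i)))"
 shows "tdef (%e c. EX x:tuples (univ M) k. P x e c) (%e c. EX x:tuples (univ C) k. Q x e c)"
 using tdef_exists[OF assms] by simp

lemma tdef_all:
 assumes "tdef (%e. P (e 0) (%i. e (Suc i))) (%e. Q (e 0) (%i. e (Suc i)))"
 shows "tdef (%e c. ALL x:tuples (univ M) k. P x e c) (%e c. ALL x:tuples (univ C) k. Q x e c)"
 using tdef_not[OF tdef_exists[OF tdef_not[OF assms]]] by simp

lemma tdef_mem: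
 assumes "\<phi> \<in> formulas L k"
 shows "tdef (%e c. e i \<in> defined_set M k \<phi>) (%e c. e i \<in> defined_set C k \<phi>)"
proof (rule tdefI[of "rename (vpos i) \<phi>"])
 have v: "holds N \<phi> (e i) = sat N (val k e c) (rename (vpos i) \<phi>)" for N :: "('f, 'r, 'a) fo_struct" and e c
  unfolding holds_def sat_rename
  by (rule sat_cong) (use assms in \<open>auto simp: formulas_def val_vpos\<close>)
 show "(e i \<in> defined_set M k \<phi>) = sat M (val k e c) (rename (vpos i) \<phi>)" if "e \<in> envs (univ M) k" for e c
  using that v by (auto simp: defined_set_def envs_def)
 show "(e i \<in> defined_set C k \<phi>) = sat C (val k e c) (rename (vpos i) \<phi>)" if "e \<in> envs (univ C) k" for e c
  using that v by (auto simp: defined_set_def envs_def)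
qed (use assms in \<open>simp add: wf_rename formulas_def\<close>)

lemma tdef_mem3:
 assumes "\<phi> \<in> formulas L (3 * k)"
 shows "tdef (%e c. e i @ e j @ e l \<in> defined_set M (3 * k) \<phi>) (%e c. e i @ e j @ e l \<in> defined_set C (3 * k) \<phi>)"
proof -
 let ?g = "%n. if n < k then vpos i n else if n < 2 * k then vpos j (n - k) else vpos l (n - 2 * k)"
 have v: "holds N \<phi> (e i @ e j @ e l) = sat N (val k e c) (rename ?g \<phi>)"
  if "e \<in> envs (univ N) k" for N :: "('f, 'r, 'a) fo_struct" and e c
  unfolding holds_def sat_rename
 proof (rule sat_cong)
  fix n assume "n \<in> fv \<phi>"
  then have n: "n < 3 * k" using assms by (auto simp: formulas_def)
  have len: "length (e m) = k" for m using that by (auto simp: envs_def tuples_def)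
  show "(e i @ e j @ e l) ! n = val k e c (?g n)"
   using n len by (auto simp: nth_append val_vpos mult_2)
 qed
 have t: "e i @ e j @ e l \<in> tuples (univ N) (3 * k)" if "e \<in> envs (univ N) k" for N :: "('f, 'r, 'a) fo_struct" and e
  using that by (auto simp: envs_def tuples_def)
 show ?thesis
 proof (rule tdefI[of "rename ?g \<phi>"])
  show "wf_form L (rename ?g \<phi>)" using assms by (simp add: wf_rename formulas_def)
 qed (simp_all only: defined_set_def mem_Collect_eq t v simp_thms)
qed

lemma tdef_eq: "tdef (%e c. e i = e j) (%e c. e i = e j)"
proof -
 have "EX \<phi>. wf_form L \<phi> \<and> (ALL (N :: ('f, 'r, 'a) fo_struct) e c. sat N (val k e c) \<phi> = (ALL q<m. e i ! q = e j ! q))" if "m \<le> k" for m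
  using that
 proof (induction m)
  case 0
  show ?case by (intro exI[of _ "Eq (Var 0) (Var 0)"]) simp
 next
  case (Suc m)
  then obtain \<phi> where p: "wf_form L \<phi>" "ALL (N :: ('f, 'r, 'a) fo_struct) e c. sat N (val k e c) \<phi> = (ALL q<m. e i ! q = e j ! q)" by auto
  show ?case
   by (intro exI[of _ "Conj \<phi> (Eq (Var (vpos i m)) (Var (vpos j m)))"])
    (use p Suc.prems in \<open>auto simp: val_vpos less_Suc_eq\<close>)
 qed
 from this[of k] obtain \<phi> where p: "wf_form L \<phi>" "ALL (N :: ('f, 'r, 'a) fo_struct) e c. sat N (val k e c) \<phi> = (ALL q<k. e i ! q = e j ! q)" by auto
 have "(e i = e j) = (ALL q<k. e i ! q = e j ! q)" if "e \<in> envs U k" for U and e :: "nat => 'a list"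
  using that by (auto simp: envs_def tuples_def list_eq_iff_nth_eq)
 then show ?thesis by (intro tdefI[OF p(1)]) (auto simp: p(2))
qed

lemma tdef_const: "tdef (%e c. b) (%e c. b)"
 by (rule tdefI[of "if b then Eq (Var 0) (Var 0) else Neg (Eq (Var 0) (Var 0))"]) auto

lemma tdef_ex_less:
 fixes n :: nat
 assumes "\<And>i. i < n ==> tdef (P i) (Q i)"
 shows "tdef (%e c. EX i<n. P i e c) (%e c. EX i<n. Q i e c)"
proof -
 have "m \<le> n --> tdef (%e c. EX i<m. P i e c) (%e c. EX i<m. Q i e c)" for m
 proof (induction m)
  case 0
  show ?case using tdef_const[of False] by simp
 next
  case (Suc m)
  have "tdef (%e c. (EX i<m. P i e c) \<or> P m e c) (%e c. (EX i<m. Q i e c) \<or> Q m e c)" if "Suc m \<le> n"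
   by (rule tdef_disj) (use Suc assms that in auto)
  then show ?case by (simp add: less_Suc_eq ex_disj_distrib conj_disj_distribR)
 qed
 then show ?thesis by simp
qed

lemma transfer:
 assumes el: "elem_substructure L M C" and "tdef P Q" "e \<in> envs (univ M) k" "c \<in> vals (univ M)"
 shows "P e c = Q e c"
proof -
 have s: "univ M \<subseteq> univ C" using el by (simp add: elem_substructure_def)
 have ec: "e \<in> envs (univ C) k" "c \<in> vals (univ C)" using assms s by (auto simp: envs_def tuples_def vals_def subset_iff)
 from assms(2) show ?thesis
  by (rule tdefE) (simp add: assms(3,4) ec elem_sat[OF el _ val_vals[OF assms(3,4)]])
qed

lemma transfer_closed:
 assumes el: "elem_substructure L M C" and "tdef (%e c. P) (%e c. Q)" and P
 shows Q
proof -
 obtain u where u: "u \<in> univ M" using el by (auto simp: elem_substructure_def is_structure_def)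
 have "(%_. replicate k u) \<in> envs (univ M) k" "(%_. u) \<in> vals (univ M)"
  using u by (auto simp: envs_def vals_def tuples_def)
 from transfer[OF el assms(2) this] assms(3) show Q by simp
qed

end

text \<open>The equivalence of two formulas that define the same set in \<open>M\<close> transfers
to \<open>C\<close>.\<close>

lemma interp_defined:
 assumes el: "elem_substructure L M C" and p: "\<phi> \<in> formulas L n"
 shows "interp L M C n (defined_set M n \<phi>) = defined_set C n \<phi>"
proof -
 interpret two_structures L M C n .
 have "defined_set C n \<psi> = defined_set C n \<phi>" if "\<psi> \<in> formulas L n" "defined_set M n \<psi> = defined_set M n \<phi>" for \<psi>
 proof -
  have mem: "tdef (%e c. ALL x:tuples (univ M) n. x \<in> defined_set M n \<alpha> --> x \<in> defined_set M n \<beta>)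
    (%e c. ALL x:tuples (univ C) n. x \<in> defined_set C n \<alpha> --> x \<in> defined_set C n \<beta>)"
   if "\<alpha> \<in> formulas L n" "\<beta> \<in> formulas L n" for \<alpha> \<beta>
   by (rule tdef_all) (rule tdef_imp tdef_mem that)+
  have "ALL x:tuples (univ C) n. x \<in> defined_set C n \<psi> --> x \<in> defined_set C n \<phi>"
   by (rule transfer_closed[OF el mem[OF that(1) p]]) (simp add: that(2))
  moreover have "ALL x:tuples (univ C) n. x \<in> defined_set C n \<phi> --> x \<in> defined_set C n \<psi>"
   by (rule transfer_closed[OF el mem[OF p that(1)]]) (simp add: that(2))
  ultimately show ?thesis by (auto simp: defined_set_def)
 qed
 note eq = this
 let ?I = "{\<psi> \<in> formulas L n. defined_set M n \<psi> = defined_set M n \<phi>}"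
 have "(\<Union>\<psi>\<in>?I. defined_set C n \<psi>) = (\<Union>\<psi>\<in>?I. defined_set C n \<phi>)" by (rule SUP_cong[OF refl], rule eq) simp_all
 also have "\<dots> = defined_set C n \<phi>" using p by blast
 finally show ?thesis by (simp only: interp_def)
qed

section \<open>Layers of an approximate subring\<close>

lemma nonunital_subring_iff:
 assumes "nonunital_ring S"
 shows "nonunital_subring S T \<longleftrightarrow> T \<subseteq> carrier S \<and> \<zero>\<^bsub>S\<^esub> \<in> T \<and> (ALL x:T. \<ominus>\<^bsub>S\<^esub> x \<in> T) \<and>
  (ALL x:T. ALL y:T. x \<oplus>\<^bsub>S\<^esub> y \<in> T \<and> x \<otimes>\<^bsub>S\<^esub> y \<in> T)"
proof -
 interpret nonunital_ring S by fact
 have sg: "subgroup T (add_monoid S) \<longleftrightarrow> T \<subseteq> carrier S \<and> \<zero>\<^bsub>S\<^esub> \<in> T \<and> (ALL x:T. \<ominus>\<^bsub>S\<^esub> x \<in> T) \<and>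
  (ALL x:T. ALL y:T. x \<oplus>\<^bsub>S\<^esub> y \<in> T)"
  by (auto simp: subgroup_def a_inv_def)
 show ?thesis unfolding nonunital_subring_def sg set_mult_def by blast
qed

locale approx_subring = nonunital_ring S for S :: "'b ring" (structure) +
 fixes X
 assumes approx: "approximate_subring S X"
begin

abbreviation "lay n \<equiv> layer S X n"
abbreviation "gr \<equiv> generated_subring S X"

lemma X_carrier: "x \<in> X ==> x \<in> carrier S" and X_zero: "\<zero> \<in> X"
 using approx by (auto simp: approximate_subring_def)

lemma X_neg: "x \<in> X ==> \<ominus> x \<in> X"
proof -
 assume x: "x \<in> X"
 have "a_set_inv X = X" using approx by (simp add: approximate_subring_def)
 moreover have "\<ominus> x \<in> a_set_inv X" using x by (auto simp: A_SET_INV_def')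
 ultimately show ?thesis by simp
qed

lemma lay_Suc_iff: "z \<in> lay (Suc n) \<longleftrightarrow>
 (EX a:lay n. EX b:lay n. EX c:lay n. EX d:lay n. z = a \<otimes> b \<oplus> (c \<oplus> d))"
 by (auto simp: set_add_def' set_mult_def)

declare layer.simps(2) [simp del]

lemma lay_carrier: "x \<in> lay n ==> x \<in> carrier S"
proof (induction n arbitrary: x)
 case (Suc n)
 then show ?case by (fastforce simp: lay_Suc_iff intro!: mult_closed)
qed (simp add: X_carrier)

lemma lay_zero: "\<zero> \<in> lay n"
proof (induction n)
 case (Suc n)
 then show ?case unfolding lay_Suc_iff
  by (intro bexI[of _ "\<zero>"]) (simp_all add: mult_zero_left)
qed (simp add: X_zero)

lemma lay_add: "x \<in> lay n ==> y \<in> lay n ==> x \<oplus> y \<in> lay (Suc n)"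
 unfolding lay_Suc_iff
 by (intro bexI[where x = \<zero>] bexI[where x = x] bexI[where x = y]) (simp_all add: mult_zero_left lay_zero lay_carrier)

lemma lay_mult: "x \<in> lay n ==> y \<in> lay n ==> x \<otimes> y \<in> lay (Suc n)"
 unfolding lay_Suc_iff
 by (rule bexI[where x = x], rule bexI[where x = y], rule bexI[where x = \<zero>], rule bexI[where x = \<zero>])
  (simp_all add: lay_zero lay_carrier mult_closed)

lemma lay_Suc: "x \<in> lay n ==> x \<in> lay (Suc n)"
 using lay_add[OF _ lay_zero, of x n] lay_carrier by simp

lemma lay_mono: "m \<le> n ==> x \<in> lay m ==> x \<in> lay n"
 by (induction n rule: dec_induct) (auto intro: lay_Suc)

lemma lay_neg: "x \<in> lay n ==> \<ominus> x \<in> lay n"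
proof (induction n arbitrary: x)
 case (Suc n)
 then obtain a b c d where x: "a \<in> lay n" "b \<in> lay n" "c \<in> lay n" "d \<in> lay n" "x = a \<otimes> b \<oplus> (c \<oplus> d)"
  by (auto simp: lay_Suc_iff)
 then have "\<ominus> x = (\<ominus> a) \<otimes> b \<oplus> (\<ominus> c \<oplus> \<ominus> d)"
  by (simp add: lay_carrier minus_add mult_closed mult_minus_left)
 then show ?case using Suc.IH x unfolding lay_Suc_iff by blast
qed (simp add: X_neg)

lemma gr_least: "nonunital_subring S T ==> X \<subseteq> T ==> gr \<subseteq> T"
 by (auto simp: generated_subring_def)

lemma gr_subset_layers: "gr \<subseteq> (\<Union>n. lay n)"
proof (rule gr_least)
 show "X \<subseteq> (\<Union>n. lay n)" using layer.simps(1)[of S X] by blast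
 have max: "EX n. x \<in> lay n \<and> y \<in> lay n" if "x \<in> lay i" "y \<in> lay j" for x y i j
  using lay_mono[OF max.cobounded1 that(1)] lay_mono[OF max.cobounded2 that(2)] by blast
 show "nonunital_subring S (\<Union>n. lay n)"
  unfolding nonunital_subring_iff[OF nonunital_ring_axioms]
 proof (intro conjI ballI)
  fix x y assume "x \<in> (\<Union>n. lay n)" "y \<in> (\<Union>n. lay n)"
  then obtain n where "x \<in> lay n" "y \<in> lay n" using max by blast
  from UN_I[where B = lay, OF UNIV_I lay_add[OF this]] UN_I[where B = lay, OF UNIV_I lay_mult[OF this]]
  show "x \<oplus> y \<in> (\<Union>n. lay n)" "x \<otimes> y \<in> (\<Union>n. lay n)" .
 qed (use lay_carrier lay_zero lay_neg in blast)+
qed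

lemma gr_subring: "nonunital_subring S gr"
proof -
 have "nonunital_subring S (carrier S)" "X \<subseteq> carrier S"
  using X_carrier by (auto simp: nonunital_subring_iff[OF nonunital_ring_axioms] mult_closed)
 then have "gr \<subseteq> carrier S" by (rule gr_least)
 then show ?thesis
  unfolding nonunital_subring_iff[OF nonunital_ring_axioms] generated_subring_def by blast
qed

lemma X_gr: "X \<subseteq> gr" by (auto simp: generated_subring_def)

lemma gr_carrier: "x \<in> gr ==> x \<in> carrier S"
 and gr_zero: "\<zero> \<in> gr"
 and gr_neg: "x \<in> gr ==> \<ominus> x \<in> gr"
 and gr_add: "x \<in> gr ==> y \<in> gr ==> x \<oplus> y \<in> gr"
 and gr_mult: "x \<in> gr ==> y \<in> gr ==> x \<otimes> y \<in> gr"
 using gr_subring unfolding nonunital_subring_iff[OF nonunital_ring_axioms] by auto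

text \<open>Contained in finitely many translates of \<open>X\<close>, by elements of the subring
generated by \<open>X\<close>.\<close>

definition fcov :: "'b set => bool" where
 "fcov Y \<longleftrightarrow> (EX F. finite F \<and> F \<subseteq> gr \<and> (ALL y:Y. EX f:F. EX x:X. y = f \<oplus> x))"

lemma fcov_XX: "fcov {x \<oplus> y | x y. x \<in> X \<and> y \<in> X}" "fcov {x \<otimes> y | x y. x \<in> X \<and> y \<in> X}"
proof -
 obtain F where F: "finite F" "F \<subseteq> gr" "(X <#> X) \<union> (X <+> X) \<subseteq> F <+> X"
  using approx by (auto simp: approximate_subring_def)
 have add: "z \<in> P <+> Q \<longleftrightarrow> (EX p:P. EX q:Q. z = p \<oplus> q)" for z :: 'b and P Q by (auto simp: set_add_def')
 have mult: "z \<in> P <#> Q \<longleftrightarrow> (EX p:P. EX q:Q. z = p \<otimes> q)" for z :: 'b and P Q by (auto simp: set_mult_def)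
 have "x \<oplus> y \<in> F <+> X" "x \<otimes> y \<in> F <+> X" if "x \<in> X" "y \<in> X" for x y
  using F(3) that unfolding subset_iff Un_iff add mult by blast+
 then have "EX f:F. EX z:X. x \<oplus> y = f \<oplus> z" "EX f:F. EX z:X. x \<otimes> y = f \<oplus> z" if "x \<in> X" "y \<in> X" for x y
  using that unfolding add by blast+
 then show "fcov {x \<oplus> y | x y. x \<in> X \<and> y \<in> X}" "fcov {x \<otimes> y | x y. x \<in> X \<and> y \<in> X}"
  unfolding fcov_def by (auto intro!: exI[of _ F] F(1) F(2)[THEN subsetD])
qed

lemma fcov_subset: "fcov Y ==> Z \<subseteq> Y ==> fcov Z"
 unfolding fcov_def by (elim exE) (intro exI, blast)

lemma fcov_X: "fcov X"
 unfolding fcov_def by (intro exI[of _ "{\<zero>}"]) (use gr_zero X_carrier in auto)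

lemma fcov_finite: "finite Y ==> Y \<subseteq> gr ==> fcov Y"
 unfolding fcov_def by (intro exI[of _ Y]) (use X_zero gr_carrier in force)

lemma fcov_add:
 assumes Y: "fcov Y" and Z: "fcov Z"
 shows "fcov {y \<oplus> z | y z. y \<in> Y \<and> z \<in> Z}"
proof -
 obtain F where F: "finite F" "F \<subseteq> gr" "ALL y:Y. EX f:F. EX x:X. y = f \<oplus> x" using Y by (auto simp: fcov_def)
 obtain G where G: "finite G" "G \<subseteq> gr" "ALL y:Z. EX f:G. EX x:X. y = f \<oplus> x" using Z by (auto simp: fcov_def)
 obtain H where H: "finite H" "H \<subseteq> gr" "ALL y:{x \<oplus> y | x y. x \<in> X \<and> y \<in> X}. EX f:H. EX x:X. y = f \<oplus> x"
  using fcov_XX(1) unfolding fcov_def by auto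
 let ?K = "(%(f, g, h). (f \<oplus> g) \<oplus> h) ` (F \<times> G \<times> H)"
 show ?thesis unfolding fcov_def
 proof (intro exI[of _ ?K] conjI ballI)
  show "finite ?K" using F(1) G(1) H(1) by simp
  show "?K \<subseteq> gr" using F(2) G(2) H(2) gr_add by (auto simp: subset_iff)
  fix w assume "w \<in> {y \<oplus> z | y z. y \<in> Y \<and> z \<in> Z}"
  then obtain y z where yz: "y \<in> Y" "z \<in> Z" "w = y \<oplus> z" by blast
  obtain f x where f: "f \<in> F" "x \<in> X" "y = f \<oplus> x" using F(3) yz(1) by blast
  obtain g x' where g: "g \<in> G" "x' \<in> X" "z = g \<oplus> x'" using G(3) yz(2) by blast
  obtain h u where h: "h \<in> H" "u \<in> X" "x \<oplus> x' = h \<oplus> u" using H(3) f(2) g(2) by blast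
  have c: "f \<in> carrier S" "g \<in> carrier S" "h \<in> carrier S" "x \<in> carrier S" "x' \<in> carrier S" "u \<in> carrier S"
   using f g h F(2) G(2) H(2) gr_carrier X_carrier by auto
  have "w = (f \<oplus> g) \<oplus> (x \<oplus> x')" unfolding yz(3) f(3) g(3) using c by (simp add: a_ac)
  also have "\<dots> = (f \<oplus> g \<oplus> h) \<oplus> u" unfolding h(3) using c by (simp add: a_ac)
  finally show "EX f:?K. EX x:X. w = f \<oplus> x" using f(1) g(1) h(1,2) by (intro bexI[of _ "f \<oplus> g \<oplus> h"] bexI[of _ u]) force+
 qed
qed

lemma fcov_UN:
 assumes "finite I" "\<And>i. i \<in> I ==> fcov (Y i)"
 shows "fcov (\<Union>i\<in>I. Y i)"
proof -
 have "ALL i:I. EX F. finite F \<and> F \<subseteq> gr \<and> (ALL y:Y i. EX f:F. EX x:X. y = f \<oplus> x)" using assms(2) by (simp add: fcov_def)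
 from bchoice[OF this] obtain F where F: "ALL i:I. finite (F i) \<and> F i \<subseteq> gr \<and> (ALL y:Y i. EX f:F i. EX x:X. y = f \<oplus> x)" ..
 show ?thesis unfolding fcov_def
 proof (intro exI[of _ "\<Union>i\<in>I. F i"] conjI ballI)
  fix y assume "y \<in> (\<Union>i\<in>I. Y i)"
  then obtain i where i: "i \<in> I" "y \<in> Y i" by blast
  then obtain f x where "f \<in> F i" "x \<in> X" "y = f \<oplus> x" using F by blast
  then show "EX f:\<Union>i\<in>I. F i. EX x:X. y = f \<oplus> x" using i by blast
 qed (use F assms(1) in blast)+
qed

lemma fcov_image:
 assumes Y: "fcov Y" and h: "fcov (h ` X)" and hR: "\<And>x. x \<in> gr ==> h x \<in> gr"
  and add: "\<And>x y. x \<in> carrier S ==> y \<in> carrier S ==> h (x \<oplus> y) = h x \<oplus> h y"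
 shows "fcov (h ` Y)"
proof -
 obtain F where F: "finite F" "F \<subseteq> gr" "ALL y:Y. EX f:F. EX x:X. y = f \<oplus> x" using Y by (auto simp: fcov_def)
 have "fcov (h ` F)" using F hR by (intro fcov_finite) auto
 from fcov_add[OF this h] show ?thesis
 proof (rule fcov_subset, intro subsetI)
  fix z assume "z \<in> h ` Y"
  then obtain y where y: "y \<in> Y" "z = h y" ..
  then obtain f x where "f \<in> F" "x \<in> X" "y = f \<oplus> x" using F(3) by blast
  then have "z = h f \<oplus> h x" using y F(2) gr_carrier X_carrier by (simp add: add subset_iff)
  then show "z \<in> {y \<oplus> z | y z. y \<in> h ` F \<and> z \<in> h ` X}" using \<open>f \<in> F\<close> \<open>x \<in> X\<close> by blast
 qed
qed

lemma fcov_neg: "fcov Y ==> fcov ((%y. \<ominus> y) ` Y)"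
proof (erule fcov_image)
 show "fcov ((%y. \<ominus> y) ` X)" by (rule fcov_subset[OF fcov_X]) (auto intro: X_neg)
qed (auto intro: gr_neg simp: minus_add)

text \<open>The elements with this property form a subring that contains \<open>X\<close>.\<close>

lemma fcov_mult_gr:
 assumes "r \<in> gr"
 shows "fcov ((%x. r \<otimes> x) ` X)" and "fcov ((%x. x \<otimes> r) ` X)"
proof -
 let ?T = "{r \<in> gr. fcov ((%x. r \<otimes> x) ` X) \<and> fcov ((%x. x \<otimes> r) ` X)}"
 have "nonunital_subring S ?T"
  unfolding nonunital_subring_iff[OF nonunital_ring_axioms]
 proof (intro conjI ballI)
  show "?T \<subseteq> carrier S" using gr_carrier by blast
  have "(%x. \<zero> \<otimes> x) ` X \<subseteq> X" "(%x. x \<otimes> \<zero>) ` X \<subseteq> X"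
   using X_carrier X_zero by (auto simp: mult_zero_left mult_zero_right)
  then show "\<zero> \<in> ?T" using fcov_subset[OF fcov_X] gr_zero by blast
 next
  fix r assume r: "r \<in> ?T"
  then have c: "r \<in> carrier S" by (simp add: gr_carrier)
  have "(%x. (\<ominus> r) \<otimes> x) ` X = (%y. \<ominus> y) ` (%x. r \<otimes> x) ` X"
   unfolding image_image by (rule image_cong) (use c X_carrier mult_minus_left in auto)
  moreover have "(%x. x \<otimes> (\<ominus> r)) ` X = (%y. \<ominus> y) ` (%x. x \<otimes> r) ` X"
   unfolding image_image by (rule image_cong) (use c X_carrier mult_minus_right in auto)
  ultimately show "\<ominus> r \<in> ?T" using r fcov_neg gr_neg by simp
 next
  fix r s assume rs: "r \<in> ?T" "s \<in> ?T"
  then have c: "r \<in> carrier S" "s \<in> carrier S" by (simp_all add: gr_carrier)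
  have "(%x. (r \<oplus> s) \<otimes> x) ` X \<subseteq> {y \<oplus> z | y z. y \<in> (%x. r \<otimes> x) ` X \<and> z \<in> (%x. s \<otimes> x) ` X}"
   using c X_carrier distr_left by auto
  moreover have "(%x. x \<otimes> (r \<oplus> s)) ` X \<subseteq> {y \<oplus> z | y z. y \<in> (%x. x \<otimes> r) ` X \<and> z \<in> (%x. x \<otimes> s) ` X}"
   using c X_carrier distr_right by auto
  ultimately have "fcov ((%x. (r \<oplus> s) \<otimes> x) ` X)" "fcov ((%x. x \<otimes> (r \<oplus> s)) ` X)"
   using rs by (auto intro: fcov_add[THEN fcov_subset])
  then show "r \<oplus> s \<in> ?T" using rs gr_add by simp
  have "(%x. (r \<otimes> s) \<otimes> x) ` X = (%y. r \<otimes> y) ` (%x. s \<otimes> x) ` X"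
   unfolding image_image by (rule image_cong) (use c X_carrier mult_assoc in auto)
  moreover have "fcov ((%y. r \<otimes> y) ` (%x. s \<otimes> x) ` X)"
   by (rule fcov_image) (use rs c gr_mult distr_right in auto)
  moreover have "(%x. x \<otimes> (r \<otimes> s)) ` X = (%y. y \<otimes> s) ` (%x. x \<otimes> r) ` X"
   unfolding image_image by (rule image_cong) (use c X_carrier mult_assoc in auto)
  moreover have "fcov ((%y. y \<otimes> s) ` (%x. x \<otimes> r) ` X)"
   by (rule fcov_image) (use rs c gr_mult distr_left in auto)
  ultimately show "r \<otimes> s \<in> ?T" using rs gr_mult by simp
 qed
 moreover have "X \<subseteq> ?T"
 proof
  fix x assume x: "x \<in> X"
  have "(%y. x \<otimes> y) ` X \<subseteq> {x \<otimes> y | x y. x \<in> X \<and> y \<in> X}" "(%y. y \<otimes> x) ` X \<subseteq> {x \<otimes> y | x y. x \<in> X \<and> y \<in> X}"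
   using x by blast+
  then show "x \<in> ?T" using fcov_subset[OF fcov_XX(2)] x X_gr by blast
 qed
 ultimately have "r \<in> ?T" using gr_least assms by blast
 then show "fcov ((%x. r \<otimes> x) ` X)" "fcov ((%x. x \<otimes> r) ` X)" by simp_all
qed

lemma fcov_lay: "fcov (lay n)"
proof (induction n)
 case 0
 show ?case by (simp add: fcov_X)
next
 case (Suc n)
 obtain F where F: "finite F" "F \<subseteq> gr" "ALL y:lay n. EX f:F. EX x:X. y = f \<oplus> x" using Suc by (auto simp: fcov_def)
 let ?A = "\<Union>g\<in>F. (%y. y \<otimes> g) ` lay n" and ?B = "\<Union>f\<in>F. (%x. f \<otimes> x) ` X" and ?XX = "{x \<otimes> y | x y. x \<in> X \<and> y \<in> X}"
 have "fcov ((%y. y \<otimes> g) ` lay n)" if "g \<in> F" for g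
  by (rule fcov_image[OF Suc fcov_mult_gr(2)]) (use that F(2) gr_mult gr_carrier distr_left in auto)
 then have A: "fcov ?A" by (intro fcov_UN F(1))
 have B: "fcov ?B" by (intro fcov_UN F(1) fcov_mult_gr) (use F(2) in blast)
 let ?P = "{y \<oplus> z | y z. y \<in> ?A \<and> z \<in> {y \<oplus> z | y z. y \<in> ?B \<and> z \<in> ?XX}}"
 have P: "fcov ?P" by (rule fcov_add[OF A fcov_add[OF B fcov_XX(2)]])
 have prod: "a \<otimes> b \<in> ?P" if ab: "a \<in> lay n" "b \<in> lay n" for a b
 proof -
  obtain f x where f: "f \<in> F" "x \<in> X" "a = f \<oplus> x" using F(3) ab(1) by blast
  obtain g y where g: "g \<in> F" "y \<in> X" "b = g \<oplus> y" using F(3) ab(2) by blast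
  have c: "a \<in> carrier S" "f \<in> carrier S" "x \<in> carrier S" "g \<in> carrier S" "y \<in> carrier S"
   using ab f(1,2) g(1,2) F(2) gr_carrier X_carrier lay_carrier by auto
  have "a \<otimes> b = a \<otimes> g \<oplus> a \<otimes> y" unfolding g(3) using c by (simp add: distr_right)
  also have "a \<otimes> y = f \<otimes> y \<oplus> x \<otimes> y" unfolding f(3) using c by (simp add: distr_left)
  finally have e: "a \<otimes> b = a \<otimes> g \<oplus> (f \<otimes> y \<oplus> x \<otimes> y)" .
  have "a \<otimes> g \<in> ?A" "f \<otimes> y \<in> ?B" "x \<otimes> y \<in> ?XX" using ab f(1,2) g(1,2) by blast+
  then show ?thesis using e by blast
 qed
 let ?Q = "{y \<oplus> z | y z. y \<in> ?P \<and> z \<in> {y \<oplus> z | y z. y \<in> lay n \<and> z \<in> lay n}}"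
 have "fcov ?Q" by (rule fcov_add[OF P fcov_add[OF Suc Suc]])
 then show ?case
 proof (rule fcov_subset, intro subsetI)
  fix z assume "z \<in> lay (Suc n)"
  then obtain a b c d where "a \<in> lay n" "b \<in> lay n" "c \<in> lay n" "d \<in> lay n" "z = a \<otimes> b \<oplus> (c \<oplus> d)"
   by (auto simp: lay_Suc_iff)
  moreover then have "a \<otimes> b \<in> ?P" by (intro prod)
  ultimately show "z \<in> ?Q" by blast
 qed
qed

end

section \<open>The interpreted ring\<close>

locale interpreted_ring = approx_subring S X + two_structures L M C k
 for S :: "'a list ring" (structure) and X and L :: "('f, 'r) language" and M C :: "('f, 'r, 'a) fo_struct" and k +
 assumes el: "elem_substructure L M C" and zdef: "zero_definable_in L M k S X"
begin

abbreviation "TM \<equiv> tuples (univ M) k"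
abbreviation "TC \<equiv> tuples (univ C) k"
abbreviation "ga n \<equiv> op_graph (add S) (lay n)"
abbreviation "gm n \<equiv> op_graph (mult S) (lay n)"
abbreviation "ilay n \<equiv> interp L M C k (lay n)"
abbreviation "iga n \<equiv> interp L M C (3 * k) (ga n)"
abbreviation "igm n \<equiv> interp L M C (3 * k) (gm n)"

lemma univ_sub: "univ M \<subseteq> univ C" using el by (simp add: elem_substructure_def)

lemma lay_def_ex: "EX \<phi>:formulas L k. lay n = defined_set M k \<phi> \<and> ilay n = defined_set C k \<phi>"
proof -
 obtain \<phi> where p: "\<phi> \<in> formulas L k" "lay n = defined_set M k \<phi>"
  using zdef unfolding zero_definable_in_def zero_definable_def by metis
 then show ?thesis using interp_defined[OF el p(1)] by auto
qed

lemma graph_def_ex: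
 assumes "G = ga n \<or> G = gm n"
 shows "EX \<phi>:formulas L (3 * k). G = defined_set M (3 * k) \<phi> \<and> interp L M C (3 * k) G = defined_set C (3 * k) \<phi>"
proof -
 have "zero_definable L M (3 * k) G" using zdef assms unfolding zero_definable_in_def by auto
 then obtain \<phi> where p: "\<phi> \<in> formulas L (3 * k)" "G = defined_set M (3 * k) \<phi>"
  unfolding zero_definable_def by blast
 then show ?thesis using interp_defined[OF el p(1)] by auto
qed

lemma tdef_lay: "tdef (%e c. e i \<in> lay n) (%e c. e i \<in> ilay n)"
proof -
 obtain \<phi> where "\<phi> \<in> formulas L k" "lay n = defined_set M k \<phi>" "ilay n = defined_set C k \<phi>"
  using lay_def_ex by blast
 then show ?thesis using tdef_mem[of \<phi> i] by simp
qed

lemma tdef_graph: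
 assumes "G = ga n \<or> G = gm n"
 shows "tdef (%e c. e i @ e j @ e l \<in> G) (%e c. e i @ e j @ e l \<in> interp L M C (3 * k) G)"
proof -
 obtain \<phi> where "\<phi> \<in> formulas L (3 * k)" "G = defined_set M (3 * k) \<phi>" "interp L M C (3 * k) G = defined_set C (3 * k) \<phi>"
  using graph_def_ex[OF assms] by blast
 then show ?thesis using tdef_mem3[of \<phi> i j l] by simp
qed

lemmas tdef_ga = tdef_graph[OF disjI1[OF refl]]
lemmas tdef_gm = tdef_graph[OF disjI2[OF refl]]

lemma lay_TM: "x \<in> lay n ==> x \<in> TM" using lay_def_ex[of n] by (auto simp: defined_set_def)
lemma ilay_TC: "x \<in> ilay n ==> x \<in> TC" using lay_def_ex[of n] by (auto simp: defined_set_def)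

lemma graph_tuples:
 assumes "G = ga n \<or> G = gm n" "x @ y @ z \<in> interp L M C (3 * k) G" "x \<in> TC" "y \<in> TC"
 shows "z \<in> TC"
 using graph_def_ex[OF assms(1)] assms(2-4) by (auto simp: defined_set_def tuples_def)

lemma graph_iff: "x \<in> TM ==> y \<in> TM ==> z \<in> TM ==>
 x @ y @ z \<in> op_graph h (lay n) \<longleftrightarrow> x \<in> lay n \<and> y \<in> lay n \<and> z = h x y"
proof -
 assume a: "x \<in> TM" "y \<in> TM" "z \<in> TM"
 have "x = x' \<and> y = y' \<and> z = z'" if "x @ y @ z = x' @ y' @ z'" "x' \<in> lay n" "y' \<in> lay n" for x' y' z'
 proof -
  have "length x' = length x" "length y' = length y" using a lay_TM[OF that(2)] lay_TM[OF that(3)] by (auto simp: tuples_def)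
  then show ?thesis using that(1) by auto
 qed
 then show ?thesis unfolding op_graph_def by blast
qed

lemmas tdef_rules = tdef_all tdef_imp tdef_conj tdef_ex tdef_lay tdef_ga tdef_gm tdef_eq

lemma TM_nonempty: "\<zero> \<in> TM" using lay_TM[OF lay_zero] .

lemma const_env: "x \<in> TM ==> (%_. x) \<in> envs (univ M) k" by (auto simp: envs_def)

lemma vals_ex: "EX c. c \<in> vals (univ M)"
 using el by (force simp: elem_substructure_def is_structure_def vals_def)

lemma lay_ilay: "x \<in> TM ==> x \<in> ilay n \<longleftrightarrow> x \<in> lay n"
proof -
 assume x: "x \<in> TM"
 obtain c where "c \<in> vals (univ M)" using vals_ex ..
 from transfer[OF el tdef_lay[of 0 n] const_env[OF x] this] show ?thesis by simp
qed

lemma transfer_law: "tdef (%e c. P) (%e c. Q) ==> P ==> Q"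
 by (rule transfer_closed[OF el])

lemma ilay_Suc: "x \<in> ilay n ==> x \<in> ilay (Suc n)"
proof -
 let ?law = "%T D. ALL x:T. x \<in> D n --> x \<in> D (Suc n)"
 have "?law TC ilay"
  by (rule transfer_law[where P = "?law TM lay"], (rule tdef_rules)+) (use lay_Suc in blast)
 then show "x \<in> ilay n ==> x \<in> ilay (Suc n)" using ilay_TC by blast
qed

lemma ilay_mono: "m \<le> n ==> x \<in> ilay m ==> x \<in> ilay n"
 by (induction n rule: dec_induct) (auto intro: ilay_Suc)

definition isop :: "('a list => 'a list => 'a list) => bool" where
 "isop h \<longleftrightarrow> h = add S \<or> h = mult S"

lemma isop_closed: "isop h ==> x \<in> lay n ==> y \<in> lay n ==> h x y \<in> lay (Suc n)"
 unfolding isop_def using lay_add lay_mult by blast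

lemma tdef_op:
 "isop h ==> tdef (%e c. e i @ e j @ e l \<in> op_graph h (lay n)) (%e c. e i @ e j @ e l \<in> interp L M C (3 * k) (op_graph h (lay n)))"
 unfolding isop_def using tdef_ga tdef_gm by blast

abbreviation "iop h \<equiv> interp_op L M C k S X h"
abbreviation "ig h n \<equiv> interp L M C (3 * k) (op_graph h (lay n))"

lemma ig_facts:
 assumes h: "isop h"
 shows "ALL x:TC. ALL y:TC. ALL z:TC. x @ y @ z \<in> ig h n --> x \<in> ilay n \<and> y \<in> ilay n \<and> z \<in> ilay (Suc n) \<and> x @ y @ z \<in> ig h (Suc n)"
   (is "?dom TC ilay (ig h)")
  and "ALL x:TC. ALL y:TC. x \<in> ilay n \<and> y \<in> ilay n --> (EX z:TC. x @ y @ z \<in> ig h n)"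
   (is "?total TC ilay (ig h)")
  and "ALL x:TC. ALL y:TC. ALL z:TC. ALL w:TC. x @ y @ z \<in> ig h n \<and> x @ y @ w \<in> ig h n --> z = w"
   (is "?single TC (ig h)")
proof -
 let ?g = "%n. op_graph h (lay n)"
 note rules = tdef_all tdef_imp tdef_conj tdef_ex tdef_lay tdef_op[OF h] tdef_eq
 show "?dom TC ilay (ig h)"
  by (rule transfer_law[where P = "?dom TM lay ?g"], (rule rules)+) (use isop_closed[OF h] lay_Suc graph_iff in auto)
 have "?total TM lay ?g"
 proof (intro ballI impI)
  fix x y assume xy: "x \<in> TM" "y \<in> TM" "x \<in> lay n \<and> y \<in> lay n"
  then have "h x y \<in> TM" using isop_closed[OF h] lay_TM by blast
  then show "EX z:TM. x @ y @ z \<in> ?g n" using graph_iff[of x y "h x y" h n] xy by blast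
 qed
 then show "?total TC ilay (ig h)" by (rule transfer_law[rotated]) (rule rules)+
 show "?single TC (ig h)"
  by (rule transfer_law[where P = "?single TM ?g"], (rule rules)+) (use graph_iff in auto)
qed

lemma ig_TC: "isop h ==> x @ y @ z \<in> ig h n ==> x \<in> TC ==> y \<in> TC ==> z \<in> TC"
 using graph_tuples[of "op_graph h (lay n)" n x y z] by (auto simp: isop_def)

lemma ig_mono:
 assumes "isop h" "m \<le> n" "x \<in> TC" "y \<in> TC" "z \<in> TC" "x @ y @ z \<in> ig h m"
 shows "x @ y @ z \<in> ig h n"
 using assms(2)
proof (induction n rule: dec_induct)
 case (step n)
 then show ?case using ig_facts(1)[OF assms(1)] assms(3-5) by blast
qed (rule assms(6))

lemma ig_unique:
 assumes h: "isop h" and t: "x \<in> TC" "y \<in> TC" and z: "x @ y @ z \<in> ig h m" "x @ y @ w \<in> ig h n"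
 shows "z = w"
proof -
 have zw: "z \<in> TC" "w \<in> TC" using ig_TC[OF h] z t by blast+
 have "x @ y @ z \<in> ig h (max m n)" "x @ y @ w \<in> ig h (max m n)"
  by (rule ig_mono[OF h _ t zw(1) z(1)], simp) (rule ig_mono[OF h _ t zw(2) z(2)], simp)
 then show ?thesis using ig_facts(3)[OF h] t zw by blast
qed

lemma iop_eqI:
 assumes h: "isop h" and t: "x \<in> TC" "y \<in> TC" and z: "x @ y @ z \<in> ig h n"
 shows "iop h x y = z"
 unfolding interp_op_def
 by (rule the_equality) (use z ig_unique[OF h t] in blast)+

lemma iop_graph:
 assumes h: "isop h" and xy: "x \<in> ilay n" "y \<in> ilay n"
 shows "x @ y @ iop h x y \<in> ig h n" and "iop h x y \<in> ilay (Suc n)"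
proof -
 have t: "x \<in> TC" "y \<in> TC" using xy ilay_TC by blast+
 obtain z where z: "z \<in> TC" "x @ y @ z \<in> ig h n" using ig_facts(2)[OF h] xy t by blast
 have "iop h x y = z" by (rule iop_eqI[OF h t z(2)])
 then show "x @ y @ iop h x y \<in> ig h n" "iop h x y \<in> ilay (Suc n)"
  using z ig_facts(1)[OF h] t by blast+
qed

abbreviation "IR \<equiv> interp_ring L M C k S X"

lemma isop_add: "isop (add S)" and isop_mult: "isop (mult S)" by (auto simp: isop_def)

lemma carrier_IR: "carrier IR = (\<Union>n. ilay n)" and add_IR: "add IR = iop (add S)"
 and mult_IR: "mult IR = iop (mult S)" and zero_IR: "\<zero>\<^bsub>IR\<^esub> = \<zero>\<^bsub>S\<^esub>"
 by (simp_all add: interp_ring_def)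

abbreviation iplus (infixl "+\<^sub>i" 65) where "x +\<^sub>i y \<equiv> iop (add S) x y"
abbreviation itimes (infixl "*\<^sub>i" 70) where "x *\<^sub>i y \<equiv> iop (mult S) x y"

lemma two_layers: "x \<in> carrier IR ==> y \<in> carrier IR ==> EX n. x \<in> ilay n \<and> y \<in> ilay n"
proof -
 assume "x \<in> carrier IR" "y \<in> carrier IR"
 then obtain i j where "x \<in> ilay i" "y \<in> ilay j" by (auto simp: carrier_IR)
 then have "x \<in> ilay (max i j)" "y \<in> ilay (max i j)" using ilay_mono[of i "max i j"] ilay_mono[of j "max i j"] by auto
 then show ?thesis by blast
qed

lemma three_layers: "x \<in> carrier IR ==> y \<in> carrier IR ==> z \<in> carrier IR ==> EX n. x \<in> ilay n \<and> y \<in> ilay n \<and> z \<in> ilay n"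
proof -
 assume "x \<in> carrier IR" "y \<in> carrier IR" "z \<in> carrier IR"
 then obtain i j where "x \<in> ilay i \<and> y \<in> ilay i" "z \<in> ilay j" using two_layers[of x y] unfolding carrier_IR by blast
 then have "x \<in> ilay (max i j)" "y \<in> ilay (max i j)" "z \<in> ilay (max i j)" using ilay_mono[of i "max i j"] ilay_mono[of j "max i j"] by auto
 then show ?thesis by blast
qed

lemma iop_facts:
 "x \<in> ilay n ==> y \<in> ilay n ==> x @ y @ (x +\<^sub>i y) \<in> iga n"
 "x \<in> ilay n ==> y \<in> ilay n ==> x @ y @ (x *\<^sub>i y) \<in> igm n"
 "x \<in> ilay n ==> y \<in> ilay n ==> x +\<^sub>i y \<in> ilay (Suc n)"
 "x \<in> ilay n ==> y \<in> ilay n ==> x *\<^sub>i y \<in> ilay (Suc n)"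
 using iop_graph isop_add isop_mult by auto

lemma iadd_comm:
 assumes x: "x \<in> ilay n" and y: "y \<in> ilay n" shows "x +\<^sub>i y = y +\<^sub>i x"
proof -
 let ?law = "%T G. ALL x:T. ALL y:T. ALL z:T. x @ y @ z \<in> G n --> y @ x @ z \<in> G n"
 have "?law TC iga"
  by (rule transfer_law[where P = "?law TM ga"], (rule tdef_rules)+) (use graph_iff lay_carrier a_comm in auto)
 then have "y @ x @ (x +\<^sub>i y) \<in> iga n"
  using iop_facts(1)[OF x y] ilay_TC[OF x] ilay_TC[OF y] ilay_TC[OF iop_facts(3)[OF x y]] by blast
 from iop_eqI[OF isop_add ilay_TC[OF y] ilay_TC[OF x] this] show ?thesis by simp
qed

text \<open>One law covers associativity of both operations.\<close>

lemma iassoc: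
 assumes h: "isop f" "isop g" "isop f'" "isop g'"
  and law: "\<And>x y z. x \<in> carrier S ==> y \<in> carrier S ==> z \<in> carrier S ==> g (f x y) z = g' x (f' y z)"
  and x: "x \<in> ilay n" "y \<in> ilay n" "z \<in> ilay n"
 shows "iop g (iop f x y) z = iop g' x (iop f' y z)"
proof -
 let ?law = "%T G. ALL x:T. ALL y:T. ALL z:T. ALL u:T. ALL v:T. ALL w:T.
   x @ y @ u \<in> G f n \<and> u @ z @ w \<in> G g (Suc n) \<and> y @ z @ v \<in> G f' n --> x @ v @ w \<in> G g' (Suc n)"
 have r: "?law TC ig"
  by (rule transfer_law[where P = "?law TM (%h n. op_graph h (lay n))"], (rule tdef_all tdef_imp tdef_conj tdef_op h)+)
   (auto simp: graph_iff lay_Suc law lay_carrier isop_closed[OF h(3)])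
 note t = x[THEN ilay_TC]
 note g1 = iop_graph[OF h(1) x(1,2)] and g3 = iop_graph[OF h(3) x(2,3)]
 note g2 = iop_graph[OF h(2) g1(2) ilay_Suc[OF x(3)]]
 have "x @ iop f' y z @ iop g (iop f x y) z \<in> ig g' (Suc n)"
  using r t ilay_TC[OF g1(2)] ilay_TC[OF g2(2)] ilay_TC[OF g3(2)] g1(1) g2(1) g3(1) by blast
 from iop_eqI[OF h(4) t(1) ilay_TC[OF g3(2)] this] show ?thesis by simp
qed

lemma idistr:
 assumes x: "x \<in> ilay n" "y \<in> ilay n" "z \<in> ilay n"
 shows "(x +\<^sub>i y) *\<^sub>i z = x *\<^sub>i z +\<^sub>i y *\<^sub>i z" and "z *\<^sub>i (x +\<^sub>i y) = z *\<^sub>i x +\<^sub>i z *\<^sub>i y"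
proof -
 note t = x[THEN ilay_TC]
 let ?law = "%T A M. ALL x:T. ALL y:T. ALL z:T. ALL u:T. ALL v:T. ALL w:T. ALL a:T.
   x @ y @ u \<in> A n \<and> u @ z @ a \<in> M (Suc n) \<and> x @ z @ v \<in> M n \<and> y @ z @ w \<in> M n --> v @ w @ a \<in> A (Suc n)"
 have r: "?law TC iga igm"
  by (rule transfer_law[where P = "?law TM ga gm"], (rule tdef_rules)+)
   (auto simp: graph_iff distr_left lay_carrier lay_mult)
 have sum: "x +\<^sub>i y \<in> ilay (Suc n)" by (rule iop_facts(3)[OF x(1,2)])
 note z1 = ilay_Suc[OF x(3)]
 have "(x *\<^sub>i z) @ (y *\<^sub>i z) @ ((x +\<^sub>i y) *\<^sub>i z) \<in> iga (Suc n)"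
  using r t iop_facts(1)[OF x(1,2)] iop_facts(2)[OF sum z1] iop_facts(2)[OF x(1,3)] iop_facts(2)[OF x(2,3)]
   ilay_TC[OF sum] ilay_TC[OF iop_facts(4)[OF sum z1]] ilay_TC[OF iop_facts(4)[OF x(1,3)]] ilay_TC[OF iop_facts(4)[OF x(2,3)]]
  by blast
 from iop_eqI[OF isop_add ilay_TC[OF iop_facts(4)[OF x(1,3)]] ilay_TC[OF iop_facts(4)[OF x(2,3)]] this]
 show "(x +\<^sub>i y) *\<^sub>i z = x *\<^sub>i z +\<^sub>i y *\<^sub>i z" by simp
 let ?law = "%T A M. ALL x:T. ALL y:T. ALL z:T. ALL u:T. ALL v:T. ALL w:T. ALL a:T.
   x @ y @ u \<in> A n \<and> z @ u @ a \<in> M (Suc n) \<and> z @ x @ v \<in> M n \<and> z @ y @ w \<in> M n --> v @ w @ a \<in> A (Suc n)"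
 have r: "?law TC iga igm"
  by (rule transfer_law[where P = "?law TM ga gm"], (rule tdef_rules)+)
   (auto simp: graph_iff distr_right lay_carrier lay_mult)
 have "(z *\<^sub>i x) @ (z *\<^sub>i y) @ (z *\<^sub>i (x +\<^sub>i y)) \<in> iga (Suc n)"
  using r t iop_facts(1)[OF x(1,2)] iop_facts(2)[OF z1 sum] iop_facts(2)[OF x(3,1)] iop_facts(2)[OF x(3,2)]
   ilay_TC[OF sum] ilay_TC[OF iop_facts(4)[OF z1 sum]] ilay_TC[OF iop_facts(4)[OF x(3,1)]] ilay_TC[OF iop_facts(4)[OF x(3,2)]]
  by blast
 from iop_eqI[OF isop_add ilay_TC[OF iop_facts(4)[OF x(3,1)]] ilay_TC[OF iop_facts(4)[OF x(3,2)]] this]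
 show "z *\<^sub>i (x +\<^sub>i y) = z *\<^sub>i x +\<^sub>i z *\<^sub>i y" by simp
qed

lemma zero_ilay: "\<zero> \<in> ilay n" using lay_ilay[OF TM_nonempty] lay_zero by simp

lemma izero:
 assumes x: "x \<in> ilay n"
 shows "\<zero> +\<^sub>i x = x" and "EX y:ilay n. y +\<^sub>i x = \<zero>"
proof -
 obtain c where c: "c \<in> vals (univ M)" using vals_ex ..
 let ?law = "%T D G z. ALL x:T. x \<in> D n --> z @ x @ x \<in> G n \<and> (EX y:T. y \<in> D n \<and> y @ x @ z \<in> G n)"
 have t: "tdef (%e c. ?law TM lay ga (e 0)) (%e c. ?law TC ilay iga (e 0))" by (rule tdef_rules)+
 have "?law TM lay ga \<zero>"
 proof (intro ballI impI conjI)
  fix x assume x: "x \<in> TM" "x \<in> lay n"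
  show "\<zero> @ x @ x \<in> ga n" using x by (simp add: graph_iff TM_nonempty lay_zero lay_carrier)
  have "\<ominus> x \<in> lay n" "\<ominus> x \<in> TM" using lay_neg[OF x(2)] lay_TM by blast+
  moreover then have "(\<ominus> x) @ x @ \<zero> \<in> ga n" using x by (simp add: graph_iff TM_nonempty lay_carrier l_neg)
  ultimately show "EX y:TM. y \<in> lay n \<and> y @ x @ \<zero> \<in> ga n" by blast
 qed
 with transfer[OF el t const_env[OF TM_nonempty] c]
 have r: "?law TC ilay iga \<zero>" by simp
 note xt = ilay_TC[OF x]
 have "\<zero> @ x @ x \<in> iga n" using r xt x by blast
 from iop_eqI[OF isop_add ilay_TC[OF zero_ilay] xt this] show "\<zero> +\<^sub>i x = x" .
 obtain y where y: "y \<in> TC" "y \<in> ilay n" "y @ x @ \<zero> \<in> iga n" using r xt x by blast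
 from iop_eqI[OF isop_add y(1) xt y(3)] show "EX y:ilay n. y +\<^sub>i x = \<zero>" using y(2) by blast
qed

lemma interp_nonunital_ring: "nonunital_ring IR"
proof (intro nonunital_ring.intro nonunital_ring_axioms.intro abelian_groupI, unfold add_IR mult_IR zero_IR)
 show "\<zero> \<in> carrier IR" using zero_ilay carrier_IR by blast
 fix x y assume xy: "x \<in> carrier IR" "y \<in> carrier IR"
 then obtain n where n: "x \<in> ilay n" "y \<in> ilay n" using two_layers by blast
 show "x +\<^sub>i y \<in> carrier IR" "x *\<^sub>i y \<in> carrier IR" using iop_facts(3,4)[OF n] carrier_IR by blast+
 show "x +\<^sub>i y = y +\<^sub>i x" by (rule iadd_comm[OF n])
 show "\<zero> +\<^sub>i x = x" by (rule izero[OF n(1)])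
 show "EX y:carrier IR. y +\<^sub>i x = \<zero>" using izero(2)[OF n(1)] carrier_IR by blast
next
 fix x y z assume "x \<in> carrier IR" "y \<in> carrier IR" "z \<in> carrier IR"
 then obtain n where n: "x \<in> ilay n" "y \<in> ilay n" "z \<in> ilay n" using three_layers by blast
 show "(x +\<^sub>i y) +\<^sub>i z = x +\<^sub>i (y +\<^sub>i z)" by (rule iassoc[OF isop_add isop_add isop_add isop_add a_assoc n])
 show "(x *\<^sub>i y) *\<^sub>i z = x *\<^sub>i (y *\<^sub>i z)" by (rule iassoc[OF isop_mult isop_mult isop_mult isop_mult mult_assoc n])
 show "(x +\<^sub>i y) *\<^sub>i z = x *\<^sub>i z +\<^sub>i y *\<^sub>i z" "z *\<^sub>i (x +\<^sub>i y) = z *\<^sub>i x +\<^sub>i z *\<^sub>i y"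
  by (rule idistr(1)[OF n], rule idistr(2)[OF n])
qed

text \<open>The finite set of translates for \<open>X\<^sub>n\<close> consists of tuples in
\<open>M\<close>, which serve as parameters of a transfer.\<close>

lemma icover: "EX F. finite F \<and> F \<subseteq> gr \<and> F \<subseteq> carrier IR \<and> (ALL x:ilay n. EX f:F. EX y:ilay 0. x = f +\<^sub>i y)"
proof -
 obtain F where F: "finite F" "F \<subseteq> gr" "ALL x:lay n. EX f:F. EX y:X. x = f \<oplus> y"
  using fcov_lay[of n] unfolding fcov_def by auto
 obtain fs where fs: "set fs = F" using finite_list[OF F(1)] by blast
 have "EX p. F \<subseteq> lay p"
  using F(1,2)
 proof (induction F rule: finite_induct)
  case (insert f F)
  then obtain p q where "F \<subseteq> lay p" "f \<in> lay q" using gr_subset_layers by blast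
  then have "insert f F \<subseteq> lay (max p q)" using lay_mono[of p "max p q"] lay_mono[of q "max p q"] by (auto simp: subset_iff)
  then show ?case by blast
 qed simp
 then obtain p where p: "F \<subseteq> lay p" ..
 define e where "e i = (if i < length fs then fs ! i else \<zero>)" for i
 have eF: "e i \<in> F" if "i < length fs" for i using that fs by (auto simp: e_def)
 have eT: "e i \<in> TM" for i using eF[of i] p lay_TM TM_nonempty by (cases "i < length fs") (auto simp: e_def subset_iff)
 then have env: "e \<in> envs (univ M) k" by (simp add: envs_def)
 obtain c where c: "c \<in> vals (univ M)" using vals_ex ..
 let ?law = "%T D G e. ALL x:T. x \<in> D n --> (EX i<length fs. EX y:T. y \<in> D 0 \<and> e i @ y @ x \<in> G p)"
 have t: "tdef (%e c. ?law TM lay ga e) (%e c. ?law TC ilay iga e)" by (rule tdef_rules tdef_ex_less)+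
 have "?law TM lay ga e"
 proof (intro ballI impI)
  fix x assume x: "x \<in> TM" "x \<in> lay n"
  obtain f y where f: "f \<in> F" "y \<in> X" "x = f \<oplus> y" using F(3) x(2) by blast
  then obtain i where i: "i < length fs" "f = fs ! i" using fs by (auto simp: in_set_conv_nth)
  have y: "y \<in> lay 0" "y \<in> TM" "y \<in> lay p" using f(2) lay_TM[of y 0] lay_mono[of 0 p y] by auto
  have "e i = f" using i by (simp add: e_def)
  then have "e i @ y @ x \<in> ga p" using graph_iff[OF eT[of i] y(2) x(1)] p y(3) f by auto
  then show "EX i<length fs. EX y:TM. y \<in> lay 0 \<and> e i @ y @ x \<in> ga p" using i(1) y by blast
 qed
 with transfer[OF el t env c]
 have r: "?law TC ilay iga e" by simp
 have "ALL x:ilay n. EX f:F. EX y:ilay 0. x = f +\<^sub>i y"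
 proof
  fix x assume x: "x \<in> ilay n"
  then obtain i y where iy: "i < length fs" "y \<in> TC" "y \<in> ilay 0" "e i @ y @ x \<in> iga p" using r ilay_TC[OF x] by blast
  have "e i \<in> TC" using eT[of i] univ_sub by (auto simp: tuples_def)
  from iop_eqI[OF isop_add this iy(2,4)] show "EX f:F. EX y:ilay 0. x = f +\<^sub>i y" using eF[OF iy(1)] iy(3) by blast
 qed
 moreover have "F \<subseteq> carrier IR" using p lay_ilay lay_TM carrier_IR by blast
 ultimately show ?thesis using F(1,2) by blast
qed

end

section \<open>Automorphisms of the monster model\<close>

lemma eval_in_univ:
 assumes "is_structure L C" "s \<in> vals (univ C)"
 shows "wf_term L t ==> eval_term C s t \<in> univ C"
proof (induction t)
 case (Var i)
 then show ?case using assms(2) by (simp add: vals_def)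
next
 case (Fn f ts)
 have "map (eval_term C s) ts \<in> tuples (univ C) (length ts)" using Fn by (auto simp: tuples_def)
 then show ?case using assms(1) Fn.prems by (simp add: is_structure_def)
qed

lemma aut_eval:
 assumes st: "is_structure L C" and \<sigma>: "\<sigma> \<in> automorphisms L C A" and s: "s \<in> vals (univ C)"
 shows "wf_term L t ==> eval_term C (%i. \<sigma> (s i)) t = \<sigma> (eval_term C s t)"
proof (induction t)
 case (Fn f ts)
 have "map (eval_term C s) ts \<in> tuples (univ C) (length ts)"
  using Fn.prems eval_in_univ[OF st s] by (auto simp: tuples_def)
 then have "\<sigma> (fun_of C f (map (eval_term C s) ts)) = fun_of C f (map \<sigma> (map (eval_term C s) ts))"
  using \<sigma> Fn.prems by (simp add: automorphisms_def)
 moreover have "map (eval_term C (%i. \<sigma> (s i))) ts = map \<sigma> (map (eval_term C s) ts)"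
  using Fn by simp
 ultimately show ?case by (simp del: map_eq_conv map_map)
qed simp

lemma aut_bij: "\<sigma> \<in> automorphisms L C A ==> bij_betw \<sigma> (univ C) (univ C)" by (simp add: automorphisms_def)

lemma aut_univ: "\<sigma> \<in> automorphisms L C A ==> a \<in> univ C ==> \<sigma> a \<in> univ C"
 using aut_bij bij_betw_apply by fast

lemma aut_sat:
 assumes st: "is_structure L C" and \<sigma>: "\<sigma> \<in> automorphisms L C A"
 shows "wf_form L \<phi> ==> s \<in> vals (univ C) ==> sat C (%i. \<sigma> (s i)) \<phi> = sat C s \<phi>"
proof (induction \<phi> arbitrary: s)
 case (Eq t u)
 have "inj_on \<sigma> (univ C)" using aut_bij[OF \<sigma>] by (simp add: bij_betw_def)
 then show ?case using Eq eval_in_univ[OF st Eq.prems(2)]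
  by (auto simp: aut_eval[OF st \<sigma> Eq.prems(2)] dest: inj_onD)
next
 case (Rel r ts)
 have "map (eval_term C s) ts \<in> tuples (univ C) (length ts)"
  using Rel.prems eval_in_univ[OF st Rel.prems(2)] by (auto simp: tuples_def)
 then have "rel_of C r (map (eval_term C s) ts) = rel_of C r (map \<sigma> (map (eval_term C s) ts))"
  using \<sigma> Rel.prems by (simp add: automorphisms_def)
 moreover have "map (eval_term C (%i. \<sigma> (s i))) ts = map \<sigma> (map (eval_term C s) ts)"
  using Rel by (simp add: aut_eval[OF st \<sigma> Rel.prems(2)])
 ultimately show ?case by (simp del: map_eq_conv map_map)
next
 case (Exi x \<phi>)
 have eq: "sat C ((%i. \<sigma> (s i))(x := \<sigma> a)) \<phi> = sat C (s(x := a)) \<phi>" if "a \<in> univ C" for a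
 proof -
  have "(%i. \<sigma> (s i))(x := \<sigma> a) = (%i. \<sigma> ((s(x := a)) i))" by auto
  moreover have "s(x := a) \<in> vals (univ C)" using Exi.prems that by (auto simp: vals_def)
  ultimately show ?thesis using Exi.IH[of "s(x := a)"] Exi.prems by (simp del: fun_upd_apply)
 qed
 have "(EX a:univ C. sat C ((%i. \<sigma> (s i))(x := a)) \<phi>) = (EX a:\<sigma> ` univ C. sat C ((%i. \<sigma> (s i))(x := a)) \<phi>)"
  using aut_bij[OF \<sigma>] by (simp add: bij_betw_def)
 also have "\<dots> = (EX a:univ C. sat C (s(x := a)) \<phi>)" using eq by auto
 finally show ?case by simp
qed auto

lemma aut_holds:
 assumes st: "is_structure L C" and \<sigma>: "\<sigma> \<in> automorphisms L C A"
  and \<phi>: "\<phi> \<in> formulas L n" and xs: "xs \<in> tuples (univ C) n"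
 shows "holds C \<phi> (map \<sigma> xs) = holds C \<phi> xs"
proof -
 obtain u where u: "u \<in> univ C" using st by (auto simp: is_structure_def)
 define s where "s i = (if i < n then xs ! i else u)" for i
 have s: "s \<in> vals (univ C)" using xs u by (auto simp: s_def vals_def tuples_def)
 have lt: "i < n" if "i \<in> fv \<phi>" for i using \<phi> that by (auto simp: formulas_def)
 have "sat C (%i. map \<sigma> xs ! i) \<phi> = sat C (%i. \<sigma> (s i)) \<phi>"
  by (rule sat_cong) (use lt xs in \<open>auto simp: s_def tuples_def\<close>)
 also have "\<dots> = sat C s \<phi>" using aut_sat[OF st \<sigma> _ s] \<phi> by (simp add: formulas_def)
 also have "\<dots> = sat C (%i. xs ! i) \<phi>" by (rule sat_cong) (use lt in \<open>auto simp: s_def\<close>)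
 finally show ?thesis by (simp add: holds_def)
qed

lemma aut_id: "id \<in> automorphisms L C A" by (simp add: automorphisms_def)

lemma aut_comp: "\<sigma> \<in> automorphisms L C A ==> \<tau> \<in> automorphisms L C A ==> \<sigma> \<circ> \<tau> \<in> automorphisms L C A"
proof -
 assume s: "\<sigma> \<in> automorphisms L C A" and t: "\<tau> \<in> automorphisms L C A"
 have m: "map \<tau> xs \<in> tuples (univ C) n" if "xs \<in> tuples (univ C) n" for xs n
  using that aut_univ[OF t] by (auto simp: tuples_def)
 show ?thesis unfolding automorphisms_def mem_Collect_eq
 proof (intro conjI allI impI ballI)
  show "bij_betw (\<sigma> \<circ> \<tau>) (univ C) (univ C)" using aut_bij[OF s] aut_bij[OF t] by (rule bij_betw_trans[rotated])
  fix f n xs assume "fun_ar L f = Some n" "xs \<in> tuples (univ C) n"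
  then show "(\<sigma> \<circ> \<tau>) (fun_of C f xs) = fun_of C f (map (\<sigma> \<circ> \<tau>) xs)"
   using s t m[of xs n] by (simp add: automorphisms_def)
 next
  fix r n xs assume "rel_ar L r = Some n" "xs \<in> tuples (univ C) n"
  then have "rel_of C r xs = rel_of C r (map \<tau> xs)" "rel_of C r (map \<tau> xs) = rel_of C r (map \<sigma> (map \<tau> xs))"
   using s t m[of xs n] unfolding automorphisms_def by blast+
  then show "rel_of C r xs = rel_of C r (map (\<sigma> \<circ> \<tau>) xs)" by simp
 next
  fix a assume "a \<in> A"
  then show "(\<sigma> \<circ> \<tau>) a = a" using s t by (simp add: automorphisms_def)
 qed
qed

lemma aut_inv:
 assumes st: "is_structure L C" and A: "A \<subseteq> univ C" and s: "\<sigma> \<in> automorphisms L C A"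
 shows "EX \<tau>:automorphisms L C A. ALL a:univ C. \<tau> (\<sigma> a) = a \<and> \<sigma> (\<tau> a) = a"
proof -
 let ?t = "inv_into (univ C) \<sigma>"
 have b: "bij_betw \<sigma> (univ C) (univ C)" by (rule aut_bij[OF s])
 have ts: "?t (\<sigma> a) = a" if "a \<in> univ C" for a using b that by (simp add: bij_betw_def inv_into_f_f)
 have sttt: "\<sigma> (?t a) = a" if "a \<in> univ C" for a using b that by (simp add: bij_betw_def f_inv_into_f)
 have bt: "bij_betw ?t (univ C) (univ C)" using b by (rule bij_betw_inv_into)
 have tu: "?t a \<in> univ C" if "a \<in> univ C" for a using bt that bij_betw_apply by fast
 have m: "map ?t xs \<in> tuples (univ C) n" "map \<sigma> (map ?t xs) = xs" if "xs \<in> tuples (univ C) n" for xs n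
  using that tu sttt by (auto simp: tuples_def intro!: map_idI)
 have "?t \<in> automorphisms L C A" unfolding automorphisms_def mem_Collect_eq
 proof (intro conjI allI impI ballI)
  fix f n xs assume f: "fun_ar L f = Some n" and xs: "xs \<in> tuples (univ C) n"
  have "\<sigma> (fun_of C f (map ?t xs)) = fun_of C f (map \<sigma> (map ?t xs))"
   using s f m(1)[OF xs] unfolding automorphisms_def by blast
  then have "\<sigma> (fun_of C f (map ?t xs)) = fun_of C f xs" by (simp only: m(2)[OF xs])
  moreover have "fun_of C f (map ?t xs) \<in> univ C" using st f m(1)[OF xs] by (simp add: is_structure_def)
  ultimately show "?t (fun_of C f xs) = fun_of C f (map ?t xs)" using ts by metis
 next
  fix r n xs assume r: "rel_ar L r = Some n" and xs: "xs \<in> tuples (univ C) n"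
  have "rel_of C r (map ?t xs) = rel_of C r (map \<sigma> (map ?t xs))"
   using s r m(1)[OF xs] unfolding automorphisms_def by blast
  then show "rel_of C r xs = rel_of C r (map ?t xs)" by (simp only: m(2)[OF xs])
 next
  fix a assume "a \<in> A"
  then have "\<sigma> a = a" "a \<in> univ C" using s A by (auto simp: automorphisms_def)
  then show "?t a = a" using ts by metis
 qed (rule bt)
 then show ?thesis using ts sttt by blast
qed

lemma aut_mono: "A \<subseteq> B ==> automorphisms L C B \<subseteq> automorphisms L C A"
 by (auto simp: automorphisms_def)

section \<open>Definable sets in the monster model\<close>

locale monster_ring = interpreted_ring S X L M C k
 for S :: "'a list ring" (structure) and X and L :: "('f, 'r) language" and M C :: "('f, 'r, 'a) fo_struct" and k +
 fixes \<kappa> :: "'k rel"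
 assumes monster: "monster_model L \<kappa> M C"

lemma infinite_formulas: "inj (%n. Eq (Var 0) (Var n))" by (rule injI) simp

text \<open>There are infinitely many equations between variables, so \<open>\<kappa>\<close> is
uncountable.\<close>

lemma monster_big_cardinal:
 assumes "monster_model L \<kappa> M C"
 shows "big_cardinal \<kappa>" and "|{\<phi>. wf_form L \<phi>}| <o \<kappa>"
proof -
 let ?W = "{\<phi>. wf_form L \<phi>}"
 show W: "|?W| <o \<kappa>"
  using assms ordLeq_ordLess_trans[OF ordLeq_csum1[OF card_of_Card_order]] by (auto simp: monster_model_def)
 have "|UNIV :: nat set| \<le>o |?W|"
  by (rule card_of_ordLeqI[OF infinite_formulas]) simp
 then show "big_cardinal \<kappa>"
  using assms W by unfold_locales (auto simp: monster_model_def intro: ordLeq_ordLess_trans)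
qed

sublocale monster_ring \<subseteq> big_cardinal \<kappa> by (rule monster_big_cardinal[OF monster])

context monster_ring
begin

lemma C_struct: "is_structure L C" and sat_C: "saturated L \<kappa> C" and hom_C: "strongly_homogeneous L \<kappa> C"
 using monster by (auto simp: monster_model_def elem_substructure_def)

lemma univ_ex: "EX u. u \<in> univ C" using C_struct by (auto simp: is_structure_def)

definition fset :: "('f, 'r) fo_form => 'a list => 'a list set" where
 "fset \<phi> ps = {x \<in> TC. holds C \<phi> (x @ ps)}"

definition fdef :: "'a set => 'a list set => bool" where
 "fdef B D \<longleftrightarrow> (EX \<phi> ps. (\<phi>, ps) \<in> formulas_over L B k \<and> D = fset \<phi> ps)"

lemma formulas_overI: "wf_form L \<phi> ==> fv \<phi> \<subseteq> {..<n + length ps} ==> set ps \<subseteq> B ==> (\<phi>, ps) \<in> formulas_over L B n"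
 by (simp add: formulas_over_def formulas_def)

lemma formulas_overD: "(\<phi>, ps) \<in> formulas_over L B n ==> wf_form L \<phi>"
 "(\<phi>, ps) \<in> formulas_over L B n ==> fv \<phi> \<subseteq> {..<n + length ps}"
 "(\<phi>, ps) \<in> formulas_over L B n ==> set ps \<subseteq> B"
 "(\<phi>, ps) \<in> formulas_over L B n ==> \<phi> \<in> formulas L (n + length ps)"
 by (auto simp: formulas_over_def formulas_def)

lemma fdef_mono: "fdef A D ==> A \<subseteq> B ==> fdef B D"
 unfolding fdef_def formulas_over_def by blast

lemma fdef_TC: "fdef B D ==> D \<subseteq> TC" by (auto simp: fdef_def fset_def)

lemma fdef_compl: "fdef B D ==> fdef B (TC - D)"
proof -
 assume "fdef B D"
 then obtain \<phi> ps where p: "(\<phi>, ps) \<in> formulas_over L B k" "D = fset \<phi> ps" by (auto simp: fdef_def)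
 have "(Neg \<phi>, ps) \<in> formulas_over L B k" using formulas_overD[OF p(1)] by (intro formulas_overI) auto
 moreover have "TC - D = fset (Neg \<phi>) ps" by (auto simp: p(2) fset_def holds_def)
 ultimately show ?thesis unfolding fdef_def by blast
qed

lemma fdef_Int:
 assumes "fdef B D" "fdef B E" shows "fdef B (D \<inter> E)"
proof -
 obtain \<phi> ps where p: "(\<phi>, ps) \<in> formulas_over L B k" "D = fset \<phi> ps" using assms(1) by (auto simp: fdef_def)
 obtain \<psi> qs where q: "(\<psi>, qs) \<in> formulas_over L B k" "E = fset \<psi> qs" using assms(2) by (auto simp: fdef_def)
 let ?f = "%i. if i < k then i else i + length ps"
 let ?\<chi> = "Conj \<phi> (rename ?f \<psi>)"
 have "fv ?\<chi> \<subseteq> {..<k + length (ps @ qs)}"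
  using formulas_overD(2)[OF p(1)] formulas_overD(2)[OF q(1)] by (auto simp: fv_rename subset_iff)
 then have "(?\<chi>, ps @ qs) \<in> formulas_over L B k"
  using formulas_overD[OF p(1)] formulas_overD[OF q(1)] by (intro formulas_overI) (auto simp: wf_rename)
 moreover have "fset ?\<chi> (ps @ qs) = D \<inter> E"
 proof -
  have "sat C (%i. (x @ ps @ qs) ! i) \<phi> = sat C (%i. (x @ ps) ! i) \<phi>"
   "sat C (%i. (x @ ps @ qs) ! ?f i) \<psi> = sat C (%i. (x @ qs) ! i) \<psi>" if "x \<in> TC" for x
  proof -
   have l: "length x = k" using that by (simp add: tuples_def)
   show "sat C (%i. (x @ ps @ qs) ! i) \<phi> = sat C (%i. (x @ ps) ! i) \<phi>"
   proof (rule sat_cong)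
    fix i assume "i \<in> fv \<phi>"
    then have "i < length (x @ ps)" using formulas_overD(2)[OF p(1)] l by auto
    then show "(x @ ps @ qs) ! i = (x @ ps) ! i" using nth_append[of "x @ ps" qs i] by simp
   qed
   show "sat C (%i. (x @ ps @ qs) ! ?f i) \<psi> = sat C (%i. (x @ qs) ! i) \<psi>"
    by (rule sat_cong) (use l in \<open>auto simp: nth_append\<close>)
  qed
  then show ?thesis by (auto simp: fset_def holds_def p(2) q(2) sat_rename)
 qed
 ultimately show ?thesis unfolding fdef_def by metis
qed

lemma fdef_Diff: "fdef B D ==> fdef B E ==> fdef B (D - E)"
proof -
 assume D: "fdef B D" and E: "fdef B E"
 have "D - E = D \<inter> (TC - E)" using fdef_TC[OF D] by blast
 then show ?thesis using fdef_Int[OF D fdef_compl[OF E]] by simp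
qed

lemma ilay_formula: "EX \<phi>. (\<phi>, []) \<in> formulas_over L B k \<and> ilay n = fset \<phi> []"
proof -
 obtain \<phi> where "\<phi> \<in> formulas L k" "ilay n = defined_set C k \<phi>" using lay_def_ex[of n] by blast
 then show ?thesis by (intro exI[of _ \<phi>]) (auto simp: formulas_over_def fset_def defined_set_def)
qed

lemma fdef_ilay: "fdef B (ilay n)" using ilay_formula unfolding fdef_def by blast

lemma fdef_small: "|B| <o \<kappa> ==> |{D. fdef B D}| <o \<kappa>"
proof -
 assume B: "|B| <o \<kappa>"
 have "|{\<phi>. wf_form L \<phi>} \<times> lists B| <o \<kappa>" by (rule kTimes[OF monster_big_cardinal(2)[OF monster] kLists[OF B]])
 then have "|formulas_over L B k| <o \<kappa>"
  by (rule kSubset) (auto simp: formulas_over_def formulas_def)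
 then have "|(%(\<phi>, ps). fset \<phi> ps) ` formulas_over L B k| <o \<kappa>" by (rule kImage)
 moreover have "{D. fdef B D} = (%(\<phi>, ps). fset \<phi> ps) ` formulas_over L B k"
  by (force simp: fdef_def image_iff)
 ultimately show ?thesis by simp
qed

lemma TC_append: "x \<in> TC ==> set ps \<subseteq> univ C ==> x @ ps \<in> tuples (univ C) (k + length ps)"
 by (auto simp: tuples_def)

lemma map_TC: "\<sigma> \<in> automorphisms L C B ==> x \<in> TC ==> map \<sigma> x \<in> TC"
 using aut_univ by (fastforce simp: tuples_def)

lemma aut_fset:
 assumes s: "\<sigma> \<in> automorphisms L C A" and p: "(\<phi>, ps) \<in> formulas_over L (univ C) k" and x: "x \<in> fset \<phi> ps"
 shows "map \<sigma> x \<in> fset \<phi> (map \<sigma> ps)"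
proof -
 have xT: "x \<in> TC" using x by (simp add: fset_def)
 have "holds C \<phi> (map \<sigma> (x @ ps)) = holds C \<phi> (x @ ps)"
  by (rule aut_holds[OF C_struct s formulas_overD(4)[OF p] TC_append[OF xT formulas_overD(3)[OF p]]])
 then show ?thesis using x map_TC[OF s xT] by (simp add: fset_def)
qed

lemma aut_fdef:
 assumes s: "\<sigma> \<in> automorphisms L C B" and B: "B \<subseteq> univ C" and D: "fdef B D" and x: "x \<in> D"
 shows "map \<sigma> x \<in> D"
proof -
 obtain \<phi> ps where p: "(\<phi>, ps) \<in> formulas_over L B k" "D = fset \<phi> ps" using D by (auto simp: fdef_def)
 have "(\<phi>, ps) \<in> formulas_over L (univ C) k" using p(1) B by (auto simp: formulas_over_def)
 moreover have "map \<sigma> ps = ps"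
  using formulas_overD(3)[OF p(1)] s by (auto simp: automorphisms_def intro!: map_idI)
 ultimately show ?thesis using aut_fset[OF s _ x[unfolded p(2)]] p(2) by simp
qed

lemma aut_ilay: "\<sigma> \<in> automorphisms L C B ==> x \<in> ilay n ==> map \<sigma> x \<in> ilay n"
 using aut_fdef[of \<sigma> "{}" "ilay n" x] fdef_ilay aut_mono[of "{}" B L C] by blast

lemma aut_iop:
 assumes s: "\<sigma> \<in> automorphisms L C B" and h: "isop h" and xy: "x \<in> carrier IR" "y \<in> carrier IR"
 shows "map \<sigma> (iop h x y) = iop h (map \<sigma> x) (map \<sigma> y)"
proof -
 obtain n where n: "x \<in> ilay n" "y \<in> ilay n" using two_layers[OF xy] by blast
 note t = n[THEN ilay_TC]
 have z: "x @ y @ iop h x y \<in> ig h n" by (rule iop_graph[OF h n])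
 obtain \<phi> where p: "\<phi> \<in> formulas L (3 * k)" "ig h n = defined_set C (3 * k) \<phi>"
  using graph_def_ex[of "op_graph h (lay n)" n] h by (auto simp: isop_def)
 have zt: "x @ y @ iop h x y \<in> tuples (univ C) (3 * k)" using z by (simp add: p(2) defined_set_def)
 then have "map \<sigma> (x @ y @ iop h x y) \<in> tuples (univ C) (3 * k)"
  using aut_univ[OF s] by (auto simp: tuples_def)
 then have "map \<sigma> (x @ y @ iop h x y) \<in> ig h n"
  using z aut_holds[OF C_struct s p(1) zt] by (simp add: p(2) defined_set_def)
 then have "map \<sigma> x @ map \<sigma> y @ map \<sigma> (iop h x y) \<in> ig h n" by simp
 from iop_eqI[OF h map_TC[OF s t(1)] map_TC[OF s t(2)] this] show ?thesis by simp
qed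

lemma aut_image_fdef:
 assumes s: "\<sigma> \<in> automorphisms L C B" and B: "B \<subseteq> univ C" and D: "fdef (univ C) D"
 shows "fdef (univ C) (map \<sigma> ` D)"
proof -
 obtain \<phi> ps where p: "(\<phi>, ps) \<in> formulas_over L (univ C) k" "D = fset \<phi> ps" using D by (auto simp: fdef_def)
 obtain \<tau> where t: "\<tau> \<in> automorphisms L C B" "ALL a:univ C. \<tau> (\<sigma> a) = a \<and> \<sigma> (\<tau> a) = a"
  using aut_inv[OF C_struct B s] by blast
 have ps: "set ps \<subseteq> univ C" by (rule formulas_overD(3)[OF p(1)])
 have p': "(\<phi>, map \<sigma> ps) \<in> formulas_over L (univ C) k"
  using p(1) ps aut_univ[OF s] by (auto simp: formulas_over_def)
 have "map \<sigma> ` D = fset \<phi> (map \<sigma> ps)"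
 proof (intro equalityI subsetI)
  fix y assume "y \<in> map \<sigma> ` D"
  then show "y \<in> fset \<phi> (map \<sigma> ps)" using aut_fset[OF s p(1)] p(2) by auto
 next
  fix y assume y: "y \<in> fset \<phi> (map \<sigma> ps)"
  have "map \<tau> y \<in> fset \<phi> (map \<tau> (map \<sigma> ps))" by (rule aut_fset[OF t(1) p' y])
  moreover have "map \<tau> (map \<sigma> ps) = ps" using ps t(2) by (auto intro!: map_idI)
  ultimately have "map \<tau> y \<in> D" using p(2) by simp
  moreover have "y = map \<sigma> (map \<tau> y)" using y t(2) by (auto simp: fset_def tuples_def intro!: map_idI[symmetric])
  ultimately show "y \<in> map \<sigma> ` D" by (rule rev_image_eqI)
 qed
 then show ?thesis using p' unfolding fdef_def by blast
qed

section \<open>Saturation and homogeneity\<close>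

lemma fdef_compact:
 assumes F: "\<And>D. D \<in> \<F> ==> fdef (univ C) D" and small: "|\<F>| <o \<kappa>"
  and fip: "\<And>\<G>. \<G> \<subseteq> \<F> ==> finite \<G> ==> \<G> \<noteq> {} ==> \<Inter>\<G> \<noteq> {}" and ne: "\<F> \<noteq> {}"
 shows "\<Inter>\<F> \<noteq> {}"
proof -
 have "ALL D:\<F>. EX q. q \<in> formulas_over L (univ C) k \<and> D = fset (fst q) (snd q)"
  using F by (fastforce simp: fdef_def)
 from bchoice[OF this] obtain q where q: "ALL D:\<F>. q D \<in> formulas_over L (univ C) k \<and> D = fset (fst (q D)) (snd (q D))" ..
 let ?B = "\<Union>D\<in>\<F>. set (snd (q D))"
 have BC: "?B \<subseteq> univ C" using q by (fastforce simp: formulas_over_def)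
 have Bs: "|?B| <o \<kappa>"
 proof -
  let ?g = "%(D, i). snd (q D) ! i"
  have "?B \<subseteq> ?g ` (\<F> \<times> UNIV)"
  proof
   fix b assume "b \<in> ?B"
   then obtain D i where "D \<in> \<F>" "b = snd (q D) ! i" by (auto simp: in_set_conv_nth)
   then show "b \<in> ?g ` (\<F> \<times> UNIV)" by (intro image_eqI[of _ _ "(D, i)"]) auto
  qed
  then show ?thesis using kSubset[OF kImage[OF kTimes[OF small nat_less]]] by blast
 qed
 have sub: "q ` \<F> \<subseteq> formulas_over L ?B k"
 proof
  fix p assume "p \<in> q ` \<F>"
  then obtain D where D: "D \<in> \<F>" "p = q D" ..
  then show "p \<in> formulas_over L ?B k" using q by (cases p) (force simp: formulas_over_def)
 qed
 have real: "realizations C k (q ` \<G>) = TC \<inter> \<Inter>\<G>" if "\<G> \<subseteq> \<F>" for \<G>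
 proof -
  have D: "x \<in> D \<longleftrightarrow> x \<in> TC \<and> holds C (fst (q D)) (x @ snd (q D))" if "D \<in> \<G>" for x D
  proof -
   have "D = fset (fst (q D)) (snd (q D))" using q that \<open>\<G> \<subseteq> \<F>\<close> by blast
   then have "x \<in> D \<longleftrightarrow> x \<in> fset (fst (q D)) (snd (q D))" by simp
   then show ?thesis by (simp add: fset_def)
  qed
  show ?thesis by (auto simp: realizations_def split_beta D)
 qed
 have "realizations C k (q ` \<F>) \<noteq> {}"
 proof (rule sat_C[unfolded saturated_def, rule_format, OF BC Bs sub])
  fix \<Psi> assume "\<Psi> \<subseteq> q ` \<F>" "finite \<Psi>"
  then obtain \<G> where G: "\<G> \<subseteq> \<F>" "finite \<G>" "\<Psi> = q ` \<G>" by (meson finite_subset_image)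
  show "realizations C k \<Psi> \<noteq> {}"
  proof (cases "\<G> = {}")
   case True
   obtain u where "u \<in> univ C" using univ_ex ..
   then have "replicate k u \<in> TC" by (auto simp: tuples_def)
   then show ?thesis using True G(3) by (auto simp: realizations_def)
  next
   case False
   then obtain D where D: "D \<in> \<G>" by blast
   have "\<Inter>\<G> \<subseteq> TC" using fdef_TC[OF F] D G(1) by blast
   then show ?thesis using real[OF G(1)] fip[OF G(1,2) False] G(3) by blast
  qed
 qed
 then show ?thesis using real[of \<F>] by blast
qed

text \<open>The map that fixes \<open>B\<close> and sends \<open>x\<close> to \<open>y\<close> is
well defined and elementary, because \<open>x\<close> and \<open>y\<close> satisfy the same
formulas over \<open>B\<close>; homogeneity extends it.\<close>

lemma same_type_conjugate:
 assumes x: "x \<in> TC" and y: "y \<in> TC" and B: "B \<subseteq> univ C" "|B| <o \<kappa>"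
  and type: "\<And>D. fdef B D ==> x \<in> D ==> y \<in> D"
 shows "EX \<sigma>:automorphisms L C B. map \<sigma> x = y"
proof -
 have len: "length x = k" "length y = k" using x y by (auto simp: tuples_def)
 have imp: "holds C \<phi> (y @ ps)" if "(\<phi>, ps) \<in> formulas_over L B k" "holds C \<phi> (x @ ps)" for \<phi> ps
 proof -
  have "fdef B (fset \<phi> ps)" using that(1) by (auto simp: fdef_def)
  from type[OF this] show ?thesis using that(2) x by (simp add: fset_def)
 qed
 have eq: "holds C \<phi> (x @ ps) = holds C \<phi> (y @ ps)" if p: "(\<phi>, ps) \<in> formulas_over L B k" for \<phi> ps
 proof -
  have "(Neg \<phi>, ps) \<in> formulas_over L B k" using formulas_overD[OF p] by (intro formulas_overI) auto
  from imp[OF this] imp[OF p] show ?thesis by (auto simp: holds_def)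
 qed
 have eq': "sat C (%i. (x @ ps) ! pos i) \<phi> = sat C (%i. (y @ ps) ! pos i) \<phi>"
  if "wf_form L \<phi>" "set ps \<subseteq> B" "\<And>i. i \<in> fv \<phi> ==> pos i < k + length ps" for \<phi> ps pos
 proof -
  have "(rename pos \<phi>, ps) \<in> formulas_over L B k"
   using that by (intro formulas_overI) (auto simp: wf_rename fv_rename)
  from eq[OF this] show ?thesis by (simp add: holds_def sat_rename)
 qed
 define idx where "idx b = (SOME i. i < k \<and> x ! i = b)" for b
 have idx: "idx b < k \<and> x ! idx b = b" if "b \<in> set x" for b
  unfolding idx_def by (rule someI_ex) (use that len in \<open>auto simp: in_set_conv_nth\<close>)
 define g where "g b = (if b \<in> B then b else y ! idx b)" for b
 have gx: "g (x ! i) = y ! i" if i: "i < k" for i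
 proof (cases "x ! i \<in> B")
  case True
  have "sat C (%j. (x @ [x ! i]) ! j) (Eq (Var i) (Var k)) = sat C (%j. (y @ [x ! i]) ! j) (Eq (Var i) (Var k))"
   by (rule eq'[where pos = "%j. j"]) (use True i in auto)
  then show ?thesis using True i len by (simp add: nth_append g_def)
 next
  case False
  have j: "idx (x ! i) < k \<and> x ! idx (x ! i) = x ! i" using idx[of "x ! i"] i len by simp
  have "sat C (%j. (x @ []) ! j) (Eq (Var i) (Var (idx (x ! i)))) = sat C (%j. (y @ []) ! j) (Eq (Var i) (Var (idx (x ! i))))"
   by (rule eq'[where pos = "%j. j"]) (use j i in auto)
  then show ?thesis using False j by (simp add: g_def)
 qed
 let ?B = "B \<union> set x"
 have BC: "?B \<subseteq> univ C" using B x by (auto simp: tuples_def)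
 have "partial_elementary L C ?B g"
  unfolding partial_elementary_def
 proof (intro conjI allI ballI)
  show "g ` ?B \<subseteq> univ C"
  proof
   fix z assume "z \<in> g ` ?B"
   then obtain b where b: "b \<in> ?B" "z = g b" by blast
   show "z \<in> univ C"
   proof (cases "b \<in> B")
    case False
    then have "idx b < k" using b idx by blast
    then have "y ! idx b \<in> set y" using len by simp
    then show ?thesis using b(2) False y by (auto simp: g_def tuples_def)
   qed (use b B in \<open>auto simp: g_def\<close>)
  qed
  fix n \<phi> ts assume \<phi>: "\<phi> \<in> formulas L n" and ts: "ts \<in> tuples ?B n"
  let ?ps = "filter (%b. b \<in> B) ts"
  have "EX p. p < k + length ?ps \<and> (x @ ?ps) ! p = ts ! j \<and> (y @ ?ps) ! p = g (ts ! j)" if j: "j < n" for j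
  proof (cases "ts ! j \<in> B")
   case True
   then have "ts ! j \<in> set ?ps" using ts j by (auto simp: tuples_def)
   then obtain l where "l < length ?ps" "?ps ! l = ts ! j" unfolding in_set_conv_nth by blast
   then show ?thesis using True len by (intro exI[of _ "k + l"]) (simp add: nth_append g_def)
  next
   case False
   have "ts ! j \<in> set ts" using ts j by (simp add: tuples_def)
   then have "ts ! j \<in> set x" using ts False by (auto simp: tuples_def)
   from idx[OF this] show ?thesis using False len by (intro exI[of _ "idx (ts ! j)"]) (simp add: nth_append g_def)
  qed
  then have "ALL j. EX p. j < n --> p < k + length ?ps \<and> (x @ ?ps) ! p = ts ! j \<and> (y @ ?ps) ! p = g (ts ! j)" by blast
  from choice[OF this] obtain pos where pos: "ALL j. j < n --> pos j < k + length ?ps \<and> (x @ ?ps) ! pos j = ts ! j \<and> (y @ ?ps) ! pos j = g (ts ! j)" ..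
  have fv: "j < n" if "j \<in> fv \<phi>" for j using \<phi> that by (auto simp: formulas_def)
  have "sat C (%j. ts ! j) \<phi> = sat C (%j. (x @ ?ps) ! pos j) \<phi>"
   by (rule sat_cong) (use pos fv in simp)
  also have "\<dots> = sat C (%j. (y @ ?ps) ! pos j) \<phi>"
   by (rule eq') (use \<phi> pos fv in \<open>auto simp: formulas_def\<close>)
  also have "\<dots> = sat C (%j. map g ts ! j) \<phi>"
   by (rule sat_cong) (use pos fv ts in \<open>simp add: tuples_def\<close>)
  finally show "holds C \<phi> ts = holds C \<phi> (map g ts)" by (simp add: holds_def)
 qed (rule BC)
 moreover have "|?B| <o \<kappa>" by (rule kUn[OF B(2) kFinite]) simp
 ultimately obtain \<sigma> where s: "\<sigma> \<in> automorphisms L C {}" "ALL b:?B. \<sigma> b = g b"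
  using hom_C unfolding strongly_homogeneous_def by blast
 have "\<sigma> \<in> automorphisms L C B" using s by (auto simp: automorphisms_def g_def)
 moreover have "map \<sigma> x = y" using s(2) gx len by (auto simp: list_eq_iff_nth_eq)
 ultimately show ?thesis by blast
qed

lemma orbit_family:
 assumes B: "B \<subseteq> univ C" "|B| <o \<kappa>" and x: "x \<in> carrier IR"
 shows "\<Inter>{D. fdef B D \<and> (EX n. D \<subseteq> ilay n) \<and> x \<in> D} = {map \<sigma> x | \<sigma>. \<sigma> \<in> automorphisms L C B}"
proof (intro equalityI subsetI)
 fix y assume y: "y \<in> \<Inter>{D. fdef B D \<and> (EX n. D \<subseteq> ilay n) \<and> x \<in> D}"
 obtain n where n: "x \<in> ilay n" using x carrier_IR by blast
 have yD: "y \<in> D" if "fdef B D" "x \<in> D" for D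
 proof -
  have "fdef B (D \<inter> ilay n)" "D \<inter> ilay n \<subseteq> ilay n" "x \<in> D \<inter> ilay n" using fdef_Int[OF that(1) fdef_ilay] that n by auto
  then show ?thesis using y by blast
 qed
 have "y \<in> TC" using yD[OF fdef_ilay n] ilay_TC by blast
 from same_type_conjugate[OF ilay_TC[OF n] this B yD]
 show "y \<in> {map \<sigma> x | \<sigma>. \<sigma> \<in> automorphisms L C B}" by auto
next
 fix y assume "y \<in> {map \<sigma> x | \<sigma>. \<sigma> \<in> automorphisms L C B}"
 then show "y \<in> \<Inter>{D. fdef B D \<and> (EX n. D \<subseteq> ilay n) \<and> x \<in> D}" using aut_fdef[OF _ B(1)] by blast
qed

end

context monster_ring
begin

interpretation CC: two_structures L C C k .

section \<open>Local definability in the interpreted ring\<close>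

text \<open>On the environments in layer \<open>N\<close>, \<open>P\<close> is given by a formula
with parameters \<open>c\<close>. The formula may depend on the layer, since the operations of the
ring are definable only on each layer separately.\<close>

definition formula_on :: "nat => ((nat => 'a list) => bool) => bool" where
 "formula_on N P \<longleftrightarrow>
  (EX Q c. CC.tdef Q Q \<and> c \<in> vals (univ C) \<and> (ALL e. bddenv ilay N e --> P e = Q e c))"

definition ldef :: "((nat => 'a list) => bool) set" where
 "ldef = {P. ALL N. formula_on N P}"

lemma ldefI: "(\<And>N. formula_on N P) ==> P \<in> ldef" by (simp add: ldef_def)

lemma formula_onI:
 "CC.tdef Q Q ==> c \<in> vals (univ C) ==> (\<And>e. bddenv ilay N e ==> P e = Q e c) ==> formula_on N P"
 unfolding formula_on_def by (intro exI[of _ Q] exI[of _ c]) simp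

lemma ldefE:
 assumes "P \<in> ldef"
 obtains Q c where "CC.tdef Q Q" "c \<in> vals (univ C)" "\<And>e. bddenv ilay N e ==> P e = Q e c"
proof -
 have "formula_on N P" using assms by (simp add: ldef_def)
 then show ?thesis using that unfolding formula_on_def by (elim exE conjE) blast
qed

lemma bddenv_TC: "bddenv ilay N e ==> e i \<in> TC" using ilay_TC by (auto simp: bddenv_def)

lemma bddenv_case: "bddenv ilay N e ==> x \<in> ilay N ==> bddenv ilay N (case_nat x e)"
 by (auto simp: bddenv_def split: nat.split)

lemma bddenv_le: "bddenv ilay m e ==> m \<le> n ==> bddenv ilay n e"
 using ilay_mono by (auto simp: bddenv_def)

lemma vals_C: "EX c. c \<in> vals (univ C)" using univ_ex by (auto simp: vals_def)

lemma CC_ilay: "CC.tdef (%e c. e i \<in> ilay n) (%e c. e i \<in> ilay n)"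
proof -
 obtain \<phi> where "\<phi> \<in> formulas L k" "ilay n = defined_set C k \<phi>" using lay_def_ex[of n] by blast
 then show ?thesis using CC.tdef_mem[of \<phi> i] by simp
qed

lemma CC_ig:
 assumes "isop h"
 shows "CC.tdef (%e c. e i @ e j @ e l \<in> ig h n) (%e c. e i @ e j @ e l \<in> ig h n)"
proof -
 obtain \<phi> where "\<phi> \<in> formulas L (3 * k)" "ig h n = defined_set C (3 * k) \<phi>"
  using graph_def_ex[of "op_graph h (lay n)" n] assms by (auto simp: isop_def)
 then show ?thesis using CC.tdef_mem3[of \<phi> i j l] by simp
qed

lemma ldef_not:
 assumes "P \<in> ldef" shows "(%e. \<not> P e) \<in> ldef"
proof (rule ldefI)
 fix N
 obtain Q c where Q: "CC.tdef Q Q" "c \<in> vals (univ C)" "\<And>e. bddenv ilay N e ==> P e = Q e c"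
  using assms by (rule ldefE) blast
 then show "formula_on N (%e. \<not> P e)" by (intro formula_onI[OF CC.tdef_not[OF Q(1)] Q(2)]) simp
qed

lemma ldef_conj:
 assumes "P \<in> ldef" "P' \<in> ldef" shows "(%e. P e \<and> P' e) \<in> ldef"
proof (rule ldefI)
 fix N
 obtain Q c where Q: "CC.tdef Q Q" "c \<in> vals (univ C)" "\<And>e. bddenv ilay N e ==> P e = Q e c"
  using assms(1) by (rule ldefE) blast
 obtain Q' c' where Q': "CC.tdef Q' Q'" "c' \<in> vals (univ C)" "\<And>e. bddenv ilay N e ==> P' e = Q' e c'"
  using assms(2) by (rule ldefE) blast
 let ?d = "%i. if even i then c (i div 2) else c' (i div 2)"
 let ?Q = "%e c. Q e (%i. c (2 * i)) \<and> Q' e (%i. c (2 * i + 1))"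
 have "CC.tdef ?Q ?Q"
  by (rule CC.tdef_conj) (rule CC.tdef_rename[where f = "%i. i", OF Q(1)] CC.tdef_rename[where f = "%i. i", OF Q'(1)])+
 moreover have "?d \<in> vals (univ C)" using Q(2) Q'(2) by (auto simp: vals_def)
 ultimately show "formula_on N (%e. P e \<and> P' e)"
  by (rule formula_onI) (simp add: Q(3) Q'(3))
qed

lemma ldef_ex:
 assumes "P \<in> ldef" shows "(%e. EX x:ilay n. P (case_nat x e)) \<in> ldef"
proof (rule ldefI)
 fix N
 obtain Q c where Q: "CC.tdef Q Q" "c \<in> vals (univ C)" "\<And>e. bddenv ilay (max n N) e ==> P e = Q e c"
  using assms by (rule ldefE) blast
 let ?Q = "%e c. EX x:TC. x \<in> ilay n \<and> Q (case_nat x e) c"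
 have "CC.tdef ?Q ?Q"
  using CC.tdef_exists[OF CC.tdef_conj[OF CC_ilay[of 0 n] Q(1)]] by simp
 moreover have "(EX x:ilay n. P (case_nat x e)) = ?Q e c" if e: "bddenv ilay N e" for e
 proof -
  have "P (case_nat x e) = Q (case_nat x e) c" if "x \<in> ilay n" for x
   using ilay_mono[of n "max n N" x] that by (intro Q(3) bddenv_case bddenv_le[OF e]) auto
  then show ?thesis using ilay_TC by blast
 qed
 ultimately show "formula_on N (%e. EX x:ilay n. P (case_nat x e))"
  using Q(2) by (intro formula_onI[of ?Q c])
qed

lemma ldef_ren:
 assumes "P \<in> ldef" shows "(%e. P (%i. e (f i))) \<in> ldef"
proof (rule ldefI)
 fix N
 obtain Q c where Q: "CC.tdef Q Q" "c \<in> vals (univ C)" "\<And>e. bddenv ilay N e ==> P e = Q e c"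
  using assms by (rule ldefE) blast
 let ?Q = "%e c. Q (%i. e (f i)) c"
 have "CC.tdef ?Q ?Q" using CC.tdef_rename[where f = f and g = "%i. i", OF Q(1)] by simp
 moreover have "P (%i. e (f i)) = ?Q e c" if "bddenv ilay N e" for e
  using that by (intro Q(3)) (auto simp: bddenv_def)
 ultimately show "formula_on N (%e. P (%i. e (f i)))" using Q(2) by (intro formula_onI[of ?Q c])
qed

lemma ldef_const:
 assumes x: "x \<in> carrier IR" and P: "P \<in> ldef" shows "(%e. P (case_nat x e)) \<in> ldef"
proof (rule ldefI)
 fix N
 obtain m where m: "x \<in> ilay m" using x carrier_IR by blast
 obtain Q c where Q: "CC.tdef Q Q" "c \<in> vals (univ C)" "\<And>e. bddenv ilay (max m N) e ==> P e = Q e c"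
  using P by (rule ldefE) blast
 let ?Q = "%e c. Q (case_nat (map c [0..<k]) e) (%i. c (i + k))"
 have xk: "length x = k" "set x \<subseteq> univ C" using ilay_TC[OF m] by (auto simp: tuples_def)
 have p: "map (prep x c) [0..<k] = x" "(%i. prep x c (i + k)) = c"
  using xk(1) by (auto simp: prep_def list_eq_iff_nth_eq)
 have "P (case_nat x e) = ?Q e (prep x c)" if e: "bddenv ilay N e" for e
  unfolding p using ilay_mono[of m "max m N" x] m by (intro Q(3) bddenv_case bddenv_le[OF e]) auto
 moreover have "prep x c \<in> vals (univ C)" using Q(2) xk(2) by (auto simp: vals_def prep_def)
 ultimately show "formula_on N (%e. P (case_nat x e))"
  using CC.tdef_param[OF Q(1)] by (intro formula_onI[of ?Q "prep x c"])
qed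

lemma ldef_op:
 assumes h: "isop h" and P: "P \<in> ldef" shows "(%e. P (case_nat (iop h (e i) (e j)) e)) \<in> ldef"
proof (rule ldefI)
 fix N
 obtain Q c where Q: "CC.tdef Q Q" "c \<in> vals (univ C)" "\<And>e. bddenv ilay (Suc N) e ==> P e = Q e c"
  using P by (rule ldefE) blast
 let ?Q = "%e c. EX z:TC. e i @ e j @ z \<in> ig h N \<and> Q (case_nat z e) c"
 have "CC.tdef ?Q ?Q"
  using CC.tdef_exists[OF CC.tdef_conj[OF CC_ig[OF h, of "Suc i" "Suc j" 0 N] Q(1)]] by simp
 moreover have "P (case_nat (iop h (e i) (e j)) e) = ?Q e c" if e: "bddenv ilay N e" for e
 proof -
  have ij: "e i \<in> ilay N" "e j \<in> ilay N" using e by (auto simp: bddenv_def)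
  note g = iop_graph[OF h ij]
  have "P (case_nat (iop h (e i) (e j)) e) = Q (case_nat (iop h (e i) (e j)) e) c"
   by (intro Q(3) bddenv_case bddenv_le[OF e] g(2)) simp
  also have "\<dots> = ?Q e c"
   using g(1) ilay_TC[OF g(2)] iop_eqI[OF h ilay_TC[OF ij(1)] ilay_TC[OF ij(2)]] by blast
  finally show ?thesis .
 qed
 ultimately show "formula_on N (%e. P (case_nat (iop h (e i) (e j)) e))"
  using Q(2) by (intro formula_onI[of ?Q c])
qed

lemma ldef_tdef: "CC.tdef (%e c. P e) (%e c. P e) ==> P \<in> ldef"
 using vals_C by (intro ldefI) (blast intro: formula_onI)

lemma CC_holds:
 assumes \<phi>: "\<phi> \<in> formulas L (k + m)"
 shows "CC.tdef (%e c. holds C \<phi> (e 0 @ map c [0..<m])) (%e c. holds C \<phi> (e 0 @ map c [0..<m]))"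
proof -
 let ?g = "%n. if n < k then vpos 0 n else cpos (n - k)"
 have v: "holds C \<phi> (e 0 @ map c [0..<m]) = sat C (val k e c) (rename ?g \<phi>)" if "e \<in> envs (univ C) k" for e c
  unfolding holds_def sat_rename
 proof (rule sat_cong)
  fix n assume "n \<in> fv \<phi>"
  then have n: "n < k + m" using \<phi> by (auto simp: formulas_def)
  have "length (e 0) = k" using that by (auto simp: envs_def tuples_def)
  then show "(e 0 @ map c [0..<m]) ! n = val k e c (?g n)"
   using n by (auto simp: nth_append val_vpos val_cpos)
 qed
 have "wf_form L (rename ?g \<phi>)" using \<phi> by (simp add: wf_rename formulas_def)
 then show ?thesis by (rule CC.tdefI) (use v in auto)
qed

lemma CC_fdef:
 assumes Q: "CC.tdef Q Q" and c: "c \<in> vals (univ C)"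
 shows "fdef (univ C) {x \<in> TC. Q (%_. x) c}"
 using Q
proof (rule CC.tdefE)
 fix \<phi> assume \<phi>: "wf_form L \<phi>" "\<And>e c. e \<in> envs (univ C) k ==> c \<in> vals (univ C) ==> Q e c = sat C (val k e c) \<phi>"
 let ?m = "Suc (fresh (fv \<phi>))" let ?ps = "map c [0..<?m]"
 let ?g = "%i. case prod_decode i of (0, j) => k + j | (Suc p, q) => if q < k then q else k"
 have j: "j < ?m" if "cpos j \<in> fv \<phi>" for j
  using fresh_gt[OF finite_fv that] le_prod_encode_2[of j 0] by simp
 have g: "?g i < k + ?m" if "i \<in> fv \<phi>" for i
 proof (cases "prod_decode i")
  case (Pair p q)
  then have i: "i = prod_encode (p, q)" by (metis prod_decode_inverse)
  show ?thesis using j[of q] that i by (cases p) auto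
 qed
 have "(rename ?g \<phi>, ?ps) \<in> formulas_over L (univ C) k"
  using \<phi>(1) g c by (intro formulas_overI) (auto simp: wf_rename fv_rename vals_def simp del: upt_Suc)
 moreover have "{x \<in> TC. Q (%_. x) c} = fset (rename ?g \<phi>) ?ps"
 proof -
  have "Q (%_. x) c = holds C (rename ?g \<phi>) (x @ ?ps)" if x: "x \<in> TC" for x
  proof -
   have len: "length x = k" using x by (simp add: tuples_def)
   have "Q (%_. x) c = sat C (val k (%_. x) c) \<phi>" using x c by (intro \<phi>(2)) (auto simp: envs_def)
   also have "\<dots> = sat C (%i. (x @ ?ps) ! ?g i) \<phi>"
   proof (rule sat_cong)
    fix i assume i: "i \<in> fv \<phi>"
    obtain p q where pq: "prod_decode i = (p, q)" by (cases "prod_decode i")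
    then have e: "i = prod_encode (p, q)" by (metis prod_decode_inverse)
    have "q < ?m" if "p = 0" using j[of q] i e that by simp
    then show "val k (%_. x) c i = (x @ ?ps) ! ?g i"
     using pq len by (cases p) (auto simp: val_def nth_append simp del: upt_Suc)
   qed
   finally show ?thesis by (simp add: holds_def sat_rename)
  qed
  then show ?thesis by (auto simp: fset_def)
 qed
 ultimately show ?thesis unfolding fdef_def by blast
qed

lemma bounded_definable_iff: "D \<in> bounded_definable ilay ldef \<longleftrightarrow> (EX n. D \<subseteq> ilay n) \<and> fdef (univ C) D"
proof (cases "EX n. D \<subseteq> ilay n")
 case True
 then obtain n where n: "D \<subseteq> ilay n" ..
 have "fdef (univ C) D" if "(%e. e 0 \<in> D) \<in> ldef"
  using that
 proof (rule ldefE[of _ n])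
  fix Q c assume Q: "CC.tdef Q Q" "c \<in> vals (univ C)" "\<And>e. bddenv ilay n e ==> (e 0 \<in> D) = Q e c"
  have "x \<in> D \<longleftrightarrow> x \<in> {x \<in> TC. Q (%_. x) c} \<inter> ilay n" for x
   using Q(3)[of "%_. x"] n ilay_TC[of x n] by (auto simp: bddenv_def)
  then have "D = {x \<in> TC. Q (%_. x) c} \<inter> ilay n" by blast
  then show ?thesis using fdef_Int[OF CC_fdef[OF Q(1,2)] fdef_ilay] by simp
 qed
 moreover have "(%e. e 0 \<in> D) \<in> ldef" if fD: "fdef (univ C) D"
 proof (rule ldefI)
  fix N
  obtain \<phi> ps where p: "(\<phi>, ps) \<in> formulas_over L (univ C) k" "D = fset \<phi> ps" using fD by (auto simp: fdef_def)
  obtain u where u: "u \<in> univ C" using univ_ex ..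
  define c where "c i = (if i < length ps then ps ! i else u)" for i
  have "c \<in> vals (univ C)" using u formulas_overD(3)[OF p(1)] by (auto simp: vals_def c_def)
  moreover have "map c [0..<length ps] = ps" by (rule nth_equalityI) (simp_all add: c_def)
  ultimately show "formula_on N (%e. e 0 \<in> D)"
   using bddenv_TC by (intro formula_onI[OF CC_holds[OF formulas_overD(4)[OF p(1)]]]) (auto simp: p(2) fset_def)
 qed
 ultimately show ?thesis using True by (auto simp: bounded_definable_def)
qed (auto simp: bounded_definable_def)

definition Aut :: "'a set => ('a list => 'a list) set" where
 "Aut A = map ` automorphisms L C A"

lemma image_fixed:
 assumes s: "\<sigma> \<in> automorphisms L C B" and B: "B \<subseteq> univ C" and DT: "D \<subseteq> TC"
  and D: "\<And>\<sigma> x. \<sigma> \<in> automorphisms L C B ==> x \<in> D ==> map \<sigma> x \<in> D"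
 shows "map \<sigma> ` D = D"
proof (intro equalityI subsetI)
 fix y assume "y \<in> map \<sigma> ` D" then show "y \<in> D" using D[OF s] by blast
next
 fix y assume y: "y \<in> D"
 obtain \<tau> where t: "\<tau> \<in> automorphisms L C B" "ALL a:univ C. \<tau> (\<sigma> a) = a \<and> \<sigma> (\<tau> a) = a"
  using aut_inv[OF C_struct B s] by blast
 have "y = map \<sigma> (map \<tau> y)" using y t(2) DT by (auto simp: tuples_def subset_iff intro!: map_idI[symmetric])
 then show "y \<in> map \<sigma> ` D" using D[OF t(1) y] by (rule image_eqI)
qed

definition family :: "'a set => 'a list set set" where
 "family B = {D. fdef B D \<and> (EX n. D \<subseteq> ilay n)}"

lemma family_orbits:
 assumes A: "A \<subseteq> univ C" "|A| <o \<kappa>" and P: "P \<subseteq> carrier IR" "|P| <o \<kappa>"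
 defines "B \<equiv> A \<union> \<Union>(set ` P)"
 shows "family B \<subseteq> bounded_definable ilay ldef \<and> |family B| <o \<kappa> \<and>
   range ilay \<subseteq> family B \<and> (ALL D:family B. ALL E:family B. D \<inter> E \<in> family B \<and> D - E \<in> family B) \<and>
   (ALL D:family B. ALL \<sigma>:Aut A. (ALL x:P. \<sigma> x = x) --> \<sigma> ` D = D) \<and>
   (ALL x:carrier IR. \<Inter>{D \<in> family B. x \<in> D} = {\<sigma> x | \<sigma>. \<sigma> \<in> Aut A \<and> (ALL y:P. \<sigma> y = y)})"
proof -
 have PT: "P \<subseteq> TC" using P(1) ilay_TC carrier_IR by blast
 then have BC: "B \<subseteq> univ C" using A(1) by (auto simp: B_def tuples_def)
 have "\<Union>(set ` P) \<subseteq> (%(x, i). x ! i) ` (P \<times> UNIV)"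
  by (force simp: in_set_conv_nth image_iff)
 then have "|\<Union>(set ` P)| <o \<kappa>" using kSubset[OF kImage[OF kTimes[OF P(2) nat_less]]] by blast
 then have Bs: "|B| <o \<kappa>" unfolding B_def by (rule kUn[OF A(2)])
 have aut: "\<sigma> \<in> automorphisms L C B \<longleftrightarrow> \<sigma> \<in> automorphisms L C A \<and> (ALL x:P. map \<sigma> x = x)" for \<sigma>
  by (auto simp: automorphisms_def B_def map_eq_conv[of \<sigma> _ "%x. x", simplified])
 have "{\<sigma> x | \<sigma>. \<sigma> \<in> Aut A \<and> (ALL y:P. \<sigma> y = y)} = {map \<sigma> x | \<sigma>. \<sigma> \<in> automorphisms L C B}" for x
  by (auto simp: aut Aut_def)
 moreover have "\<sigma> ` D = D" if sD: "D \<in> family B" "\<sigma> \<in> Aut A" "ALL x:P. \<sigma> x = x" for \<sigma> D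
 proof -
  obtain \<tau> where t: "\<sigma> = map \<tau>" "\<tau> \<in> automorphisms L C B" using sD(2,3) by (auto simp: aut Aut_def)
  have D: "fdef B D" using sD(1) by (simp add: family_def)
  show ?thesis unfolding t(1) by (rule image_fixed[OF t(2) BC fdef_TC[OF D] aut_fdef[OF _ BC D]])
 qed
 moreover have "\<Inter>{D \<in> family B. x \<in> D} = {map \<sigma> x | \<sigma>. \<sigma> \<in> automorphisms L C B}" if "x \<in> carrier IR" for x
  using orbit_family[OF BC Bs that] by (simp add: family_def conj_assoc)
 moreover have "|family B| <o \<kappa>" by (rule kSubset[OF fdef_small[OF Bs]]) (auto simp: family_def)
 moreover have "D \<inter> E \<in> family B" "D - E \<in> family B" if "D \<in> family B" "E \<in> family B" for D E
  using that fdef_Int fdef_Diff by (auto simp: family_def)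
 moreover have "family B \<subseteq> bounded_definable ilay ldef"
  using fdef_mono[OF _ BC] unfolding family_def bounded_definable_iff subset_iff by blast
 moreover have "range ilay \<subseteq> family B" using fdef_ilay by (auto simp: family_def)
 ultimately show ?thesis by simp
qed

theorem definable:
 assumes A: "A \<subseteq> univ C" "|A| <o \<kappa>"
 shows "definable_ring IR \<kappa> ilay ldef (Aut A)"
proof -
 interpret R: nonunital_ring IR by (rule interp_nonunital_ring)
 have neg: "\<ominus>\<^bsub>IR\<^esub> x \<in> ilay n" if x: "x \<in> ilay n" for x n
 proof -
  obtain y where y: "y \<in> ilay n" "y +\<^sub>i x = \<zero>" using izero(2)[OF x] by blast
  have c: "x \<in> carrier IR" "y \<in> carrier IR" using x y carrier_IR by blast+
  have "y \<oplus>\<^bsub>IR\<^esub> x = \<zero>\<^bsub>IR\<^esub>" using y(2) by (simp add: add_IR zero_IR)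
  from R.minus_equality[OF this c] show ?thesis using y(1) by simp
 qed
 show ?thesis
 proof (intro definable_ring.intro definable_ring_axioms.intro, unfold add_IR mult_IR zero_IR)
  show "nonunital_ring IR" by (rule interp_nonunital_ring)
  show "big_cardinal \<kappa>" by unfold_locales
  show "carrier IR = (\<Union>n. ilay n)" by (rule carrier_IR)
  show "EX F. finite F \<and> F \<subseteq> carrier IR \<and> (ALL x:ilay n. EX f:F. EX y:ilay 0. x = f +\<^sub>i y)" for n
   using icover[of n] by blast
  show "\<F> \<subseteq> bounded_definable ilay ldef ==> \<F> \<noteq> {} ==> |\<F>| <o \<kappa> ==>
   (\<And>\<G>. \<G> \<subseteq> \<F> ==> finite \<G> ==> \<G> \<noteq> {} ==> \<Inter>\<G> \<noteq> {}) ==> \<Inter>\<F> \<noteq> {}" for \<F>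
   by (rule fdef_compact) (auto simp: bounded_definable_iff subset_iff)
  show "id \<in> Aut A" using aut_id unfolding Aut_def by (intro image_eqI[of _ _ id]) auto
  show "\<sigma> \<circ> \<tau> \<in> Aut A" if st: "\<sigma> \<in> Aut A" "\<tau> \<in> Aut A" for \<sigma> \<tau>
  proof -
   obtain s t where st: "\<sigma> = map s" "s \<in> automorphisms L C A" "\<tau> = map t" "t \<in> automorphisms L C A"
    using st by (auto simp: Aut_def)
   have "\<sigma> \<circ> \<tau> = map (s \<circ> t)" by (simp add: st(1,3) fun_eq_iff)
   then show ?thesis using aut_comp[OF st(2,4)] by (simp add: Aut_def)
  qed
  show "EX \<tau>:Aut A. ALL x:carrier IR. \<tau> (\<sigma> x) = x \<and> \<sigma> (\<tau> x) = x" if sA: "\<sigma> \<in> Aut A" for \<sigma>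
  proof -
   obtain s where s: "\<sigma> = map s" "s \<in> automorphisms L C A" using sA by (auto simp: Aut_def)
   obtain t where t: "t \<in> automorphisms L C A" "ALL a:univ C. t (s a) = a \<and> s (t a) = a"
    using aut_inv[OF C_struct A(1) s(2)] by blast
   have "map t (map s x) = x \<and> map s (map t x) = x" if "x \<in> carrier IR" for x
   proof -
    have "x \<in> TC" using that ilay_TC carrier_IR by blast
    then have "set x \<subseteq> univ C" by (simp add: tuples_def)
    then show ?thesis using t(2) by (auto intro!: map_idI)
   qed
   then show ?thesis using s t(1) by (intro bexI[of _ "map t"]) (auto simp: Aut_def)
  qed
  show "\<sigma> x \<in> ilay n" if "\<sigma> \<in> Aut A" "x \<in> ilay n" for \<sigma> x n
   using that aut_ilay by (auto simp: Aut_def)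
  show "\<sigma> (x +\<^sub>i y) = \<sigma> x +\<^sub>i \<sigma> y" "\<sigma> (x *\<^sub>i y) = \<sigma> x *\<^sub>i \<sigma> y"
   if "\<sigma> \<in> Aut A" "x \<in> carrier IR" "y \<in> carrier IR" for \<sigma> x y
   using that aut_iop isop_add isop_mult by (auto simp: Aut_def)
  show "\<sigma> ` D \<in> bounded_definable ilay ldef" if sD: "\<sigma> \<in> Aut A" "D \<in> bounded_definable ilay ldef" for \<sigma> D
  proof -
   obtain s where s: "\<sigma> = map s" "s \<in> automorphisms L C A" using sD by (auto simp: Aut_def)
   obtain n where n: "D \<subseteq> ilay n" "fdef (univ C) D" using sD(2) by (auto simp: bounded_definable_iff)
   have "map s ` D \<subseteq> ilay n" using n(1) aut_ilay[OF s(2)] by blast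
   then show ?thesis using aut_image_fdef[OF s(2) A(1) n(2)] s(1) by (auto simp: bounded_definable_iff)
  qed
  show "\<exists>\<B>\<subseteq>bounded_definable ilay ldef. |\<B>| <o \<kappa> \<and> range ilay \<subseteq> \<B> \<and>
    (ALL B:\<B>. ALL C:\<B>. B \<inter> C \<in> \<B> \<and> B - C \<in> \<B>) \<and>
    (ALL B:\<B>. ALL \<sigma>:Aut A. (ALL x:P. \<sigma> x = x) --> \<sigma> ` B = B) \<and>
    (ALL x:carrier IR. \<Inter>{B \<in> \<B>. x \<in> B} = {\<sigma> x | \<sigma>. \<sigma> \<in> Aut A \<and> (ALL y:P. \<sigma> y = y)})"
   if "P \<subseteq> carrier IR" "|P| <o \<kappa>" for P
   by (rule exI[where x = "family (A \<union> \<Union>(set ` P))"], rule family_orbits[OF A that])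
  show "P \<in> ldef" if loc: "\<And>N. EX Q:ldef. ALL e. bddenv ilay N e --> P e = Q e" for P
  proof (rule ldefI)
   fix N
   obtain Q where Q: "Q \<in> ldef" "ALL e. bddenv ilay N e --> P e = Q e" using loc[of N] ..
   obtain Q' c where Q': "CC.tdef Q' Q'" "c \<in> vals (univ C)" "\<And>e. bddenv ilay N e ==> Q e = Q' e c"
    using Q(1) by (rule ldefE) blast
   show "formula_on N P" by (rule formula_onI[OF Q'(1,2)]) (simp add: Q(2) Q')
  qed
  show "(%e. e 0 \<in> ilay n) \<in> ldef" for n by (rule ldef_tdef[OF CC_ilay])
  show "(%e. e 0 = e 1) \<in> ldef" by (rule ldef_tdef[OF CC.tdef_eq])
  show "ilay n \<subseteq> ilay (Suc n)" for n using ilay_Suc by blast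
 qed ((rule zero_ilay neg iop_facts ldef_not ldef_conj ldef_ex ldef_ren ldef_const
    ldef_op[OF isop_add] ldef_op[OF isop_mult]; assumption)+)
qed

end

section \<open>The connected components\<close>

locale monster_over = monster_ring S X L M C k \<kappa>
 for S :: "'a list ring" (structure) and X and L :: "('f, 'r) language" and M C :: "('f, 'r, 'a) fo_struct" and k
  and \<kappa> :: "'k rel" +
 fixes A assumes A_univ: "A \<subseteq> univ C" and A_small: "|A| <o \<kappa>"
begin

interpretation dr: definable_ring IR \<kappa> ilay ldef "Aut A" by (rule definable[OF A_univ A_small])

lemma carrier_TC: "x \<in> carrier IR ==> x \<in> TC" using ilay_TC carrier_IR by blast

lemma ginv_invariant: "dr.ginv (Aut A) D \<longleftrightarrow> invariant L C A D"
 by (auto simp: dr.ginv_def invariant_def Aut_def)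

lemma family_isBB: "dr.isBB {} (family A)"
 unfolding dr.isBB_def dr.ginv_def dr.fixg_def
 using family_orbits[OF A_univ A_small, of "{}"] kFinite[of "{}"] by (simp add: image_subset_iff)

text \<open>Otherwise saturation realises the defining type outside all layers.\<close>

lemma type_definable_bounded:
 assumes \<Phi>: "\<Phi> \<subseteq> formulas_over L A k" and D: "realizations C k \<Phi> \<subseteq> carrier IR"
 shows "EX n. realizations C k \<Phi> \<subseteq> ilay n"
proof (rule ccontr)
 assume no: "\<not> ?thesis"
 have "ALL n. EX \<phi>. (\<phi>, []) \<in> formulas_over L A k \<and> ilay n = fset \<phi> []"
 proof
  fix n
  obtain \<phi> where "\<phi> \<in> formulas L k" "ilay n = defined_set C k \<phi>" using lay_def_ex[of n] by blast
  then show "EX \<phi>. (\<phi>, []) \<in> formulas_over L A k \<and> ilay n = fset \<phi> []"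
   by (intro exI[of _ \<phi>]) (auto simp: formulas_over_def fset_def defined_set_def)
 qed
 from choice[OF this] obtain \<phi> where \<phi>: "ALL n. (\<phi> n, []) \<in> formulas_over L A k \<and> ilay n = fset (\<phi> n) []" ..
 let ?q = "%n. (Neg (\<phi> n), [] :: 'a list)"
 have q: "?q n \<in> formulas_over L A k" for n
 proof -
  have "(\<phi> n, []) \<in> formulas_over L A k" using \<phi> by blast
  then show ?thesis by (simp add: formulas_over_def formulas_def)
 qed
 have out: "x \<notin> ilay n \<longleftrightarrow> holds C (Neg (\<phi> n)) (x @ [])" if "x \<in> TC" for x n
 proof -
  have "x \<in> ilay n \<longleftrightarrow> x \<in> fset (\<phi> n) []" using \<phi> by simp
  then show ?thesis using that by (simp add: fset_def holds_def)
 qed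
 have "realizations C k (\<Phi> \<union> range ?q) \<noteq> {}"
 proof (rule sat_C[unfolded saturated_def, rule_format, OF A_univ A_small])
  show "\<Phi> \<union> range ?q \<subseteq> formulas_over L A k" using \<Phi> q by blast
  fix \<Psi> assume P: "\<Psi> \<subseteq> \<Phi> \<union> range ?q" "finite \<Psi>"
  have "\<Psi> - \<Phi> \<subseteq> range ?q" "finite (\<Psi> - \<Phi>)" using P by auto
  from finite_subset_image[OF this(2,1)] obtain N where N: "finite N" "\<Psi> - \<Phi> = ?q ` N" by blast
  obtain m where m: "ALL n:N. n \<le> m" using N(1) finite_nat_set_iff_bounded_le by blast
  obtain x where x: "x \<in> realizations C k \<Phi>" "x \<notin> ilay m" using no by blast
  have xT: "x \<in> TC" using x(1) by (simp add: realizations_def)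
  have "x \<notin> ilay n" if "n \<in> N" for n using ilay_mono[of n m x] m that x(2) by blast
  then have "ALL n:N. holds C (Neg (\<phi> n)) (x @ [])" using out[OF xT] by blast
  then have "ALL (\<psi>, ps):\<Psi> - \<Phi>. holds C \<psi> (x @ ps)" unfolding N(2) by simp
  then have "x \<in> realizations C k \<Psi>" using x(1) by (auto simp: realizations_def)
  then show "realizations C k \<Psi> \<noteq> {}" by blast
 qed
 then obtain x where x: "x \<in> realizations C k (\<Phi> \<union> range ?q)" by blast
 then have all: "ALL (\<psi>, ps):\<Phi> \<union> range ?q. holds C \<psi> (x @ ps)" unfolding realizations_def by blast
 have "ALL n. holds C (Neg (\<phi> n)) (x @ [])"
 proof
  fix n
  have "?q n \<in> \<Phi> \<union> range ?q" by blast
  from bspec[OF all this] show "holds C (Neg (\<phi> n)) (x @ [])" by simp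
 qed
 moreover have "x \<in> realizations C k \<Phi>" "x \<in> TC" using x by (auto simp: realizations_def)
 ultimately show False using D out carrier_IR by blast
qed

lemma type_definable_TD:
 assumes D: "type_definable L C A k D" "D \<subseteq> carrier IR"
 shows "dr.TD D" and "dr.ginv (Aut A) D"
proof -
 obtain \<Phi> where F: "\<Phi> \<subseteq> formulas_over L A k" "D = realizations C k \<Phi>" using D(1) by (auto simp: type_definable_def)
 obtain n where n: "D \<subseteq> ilay n" using type_definable_bounded[OF F(1)] D(2) F(2) by auto
 have DT: "D \<subseteq> TC" using D(2) carrier_TC by blast
 let ?f = "%(\<phi>, ps). fset \<phi> ps"
 have eq: "x \<in> D \<longleftrightarrow> x \<in> TC \<and> (ALL q:\<Phi>. x \<in> ?f q)" for x
  by (auto simp: F(2) realizations_def fset_def)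
 have fA: "fdef A (?f q)" if "q \<in> \<Phi>" for q using that F(1) unfolding fdef_def by (cases q) auto
 let ?\<F> = "insert (ilay n) ((%q. ?f q \<inter> ilay n) ` \<Phi>)"
 have fam: "?\<F> \<subseteq> family A" unfolding family_def using fdef_Int[OF fA fdef_ilay] fdef_ilay by auto
 have B: "family A \<subseteq> bounded_definable ilay ldef" "|family A| <o \<kappa>" using family_isBB by (auto simp: dr.isBB_def)
 have "D = \<Inter>?\<F>" using eq n ilay_TC by auto
 then show "dr.TD D" unfolding dr.TD_def
  by (intro exI[of _ ?\<F>] conjI kSubset[OF B(2) fam]) (use fam B(1) in blast)+
 show "dr.ginv (Aut A) D"
 proof (rule dr.ginvI[OF dr.autg_Aut D(2)])
  fix \<sigma> x assume "\<sigma> \<in> Aut A" and x: "x \<in> D"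
  then obtain s where s: "s \<in> automorphisms L C A" "\<sigma> = map s" by (auto simp: Aut_def)
  have "map s x \<in> ?f q" if "q \<in> \<Phi>" for q using aut_fdef[OF s(1) A_univ fA[OF that]] x eq that by blast
  moreover have "map s x \<in> TC" using map_TC[OF s(1)] x DT by blast
  ultimately show "\<sigma> x \<in> D" using eq s(2) by blast
 qed
qed

text \<open>An invariant type-definable set is defined over \<open>A\<close>: it is the
intersection of the sets definable over \<open>A\<close> that contain it.\<close>

lemma TD_type_definable:
 assumes D: "dr.TD D" "dr.ginv (Aut A) D"
 shows "type_definable L C A k D"
proof -
 have "D = \<Inter>{B \<in> family A. D \<subseteq> B}"
  by (rule dr.BB_inv_TD[OF family_isBB _ D(1)]) (use D(2) dr.fixg_empty in auto)
 note eq = this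
 let ?\<Phi> = "{q \<in> formulas_over L A k. D \<subseteq> (case q of (\<phi>, ps) => fset \<phi> ps)}"
 have DT: "D \<subseteq> TC" using dr.TD_carrier[OF D(1)] carrier_TC by blast
 have "D = realizations C k ?\<Phi>"
 proof (intro equalityI subsetI)
  fix x assume "x \<in> D"
  then show "x \<in> realizations C k ?\<Phi>" using DT by (force simp: realizations_def fset_def)
 next
  fix x assume x: "x \<in> realizations C k ?\<Phi>"
  have "x \<in> B" if B: "B \<in> family A" "D \<subseteq> B" for B
  proof -
   obtain \<phi> ps where "(\<phi>, ps) \<in> formulas_over L A k" "B = fset \<phi> ps" using B(1) unfolding family_def fdef_def by blast
   then show ?thesis using x B(2) by (auto simp: realizations_def fset_def)
  qed
  then show "x \<in> D" using eq by blast
 qed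
 then show ?thesis unfolding type_definable_def by (intro exI[of _ ?\<Phi>]) auto
qed

lemma bounded_index_bidx: "bounded_index \<kappa> IR H \<longleftrightarrow> dr.bidx H" by (simp add: bounded_index_def dr.bidx_def)

lemma subgroup_asub: "subgroup H (add_monoid IR) \<longleftrightarrow> dr.asub H" by (simp add: dr.asub_def)

theorem add_comp00_ccomp: "add_comp00 L \<kappa> C A k IR = dr.ccomp"
 unfolding add_comp00_def subgroup_asub bounded_index_bidx
proof (rule Least_equality)
 show "dr.asub dr.ccomp \<and> type_definable L C A k dr.ccomp \<and> dr.bidx dr.ccomp"
  using TD_type_definable[OF dr.cc_TD[OF dr.ccomp_cc] dr.ccomp_inv] dr.ccomp_asub dr.cc_bidx[OF dr.ccomp_cc] by blast
 fix H assume H: "dr.asub H \<and> type_definable L C A k H \<and> dr.bidx H"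
 then have T: "dr.TD H" "dr.ginv (Aut A) H" using type_definable_TD dr.asub_carrier by blast+
 then have "dr.cc H" using H dr.bidx_coc by (simp add: dr.cc_def)
 then show "dr.ccomp \<le> H" using dr.ccomp_least T(2) by blast
qed

lemma two_sided_ideal_iff: "two_sided_ideal IR I \<longleftrightarrow>
 dr.asub I \<and> (ALL r:carrier IR. ALL x:I. r \<otimes>\<^bsub>IR\<^esub> x \<in> I \<and> x \<otimes>\<^bsub>IR\<^esub> r \<in> I)"
 unfolding two_sided_ideal_def subgroup_asub set_mult_def by blast

lemma cideal_two_sided: "two_sided_ideal IR dr.cideal"
 using dr.cideal_asub dr.cideal_left dr.cideal_right by (simp add: two_sided_ideal_iff)

lemma cideal_least_ideal:
 assumes "two_sided_ideal IR I" "invariant L C A I" "bounded_index \<kappa> IR I"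
 shows "dr.cideal \<subseteq> I"
 using assms unfolding two_sided_ideal_iff ginv_invariant[symmetric] bounded_index_bidx
 by (intro dr.cideal_least) auto

theorem ring_comp000_cideal: "ring_comp000 L \<kappa> C A IR = dr.cideal"
 unfolding ring_comp000_def
proof (rule Least_equality)
 show "two_sided_ideal IR dr.cideal \<and> invariant L C A dr.cideal \<and> bounded_index \<kappa> IR dr.cideal"
  using cideal_two_sided dr.cideal_inv dr.cideal_bidx by (simp add: ginv_invariant bounded_index_bidx)
qed (use cideal_least_ideal in blast)

lemma sum_product_iff:
 fixes H :: "'a list set"
 shows "H <+>\<^bsub>IR\<^esub> (Y <#>\<^bsub>IR\<^esub> H) = {x. EX h:H. EX r:Y. EX k:H. x = h \<oplus>\<^bsub>IR\<^esub> r \<otimes>\<^bsub>IR\<^esub> k}"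
 by (auto simp: set_add_def' set_mult_def)

theorem sum_product_cideal: "dr.ccomp <+>\<^bsub>IR\<^esub> (carrier IR <#>\<^bsub>IR\<^esub> dr.ccomp) = dr.cideal"
 unfolding sum_product_iff dr.cideal_def by blast

theorem fixed_case:
 assumes dcl: "ALL r:gr. set r \<subseteq> dcl L C A"
 shows "ring_comp00_exists L \<kappa> C A k IR" and "ring_comp00 L \<kappa> C A k IR = dr.cideal"
  and "dr.cideal = dr.ccomp <+>\<^bsub>IR\<^esub> (ilay 0 <#>\<^bsub>IR\<^esub> dr.ccomp)"
proof -
 have fixed: "\<sigma> r = r" if r: "r \<in> gr" and sA: "\<sigma> \<in> Aut A" for \<sigma> r
 proof -
  obtain s where s: "s \<in> automorphisms L C A" "\<sigma> = map s" using sA by (auto simp: Aut_def)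
  have "s a = a" if "a \<in> set r" for a using dcl r that s(1) by (auto simp: dcl_def)
  then show ?thesis unfolding s(2) by (rule map_idI)
 qed
 have cov: "\<exists>F\<subseteq>carrier IR. (ALL f:F. ALL \<sigma>:Aut A. \<sigma> f = f) \<and> (ALL x:ilay n. EX f:F. EX y:ilay 0. x = f \<oplus>\<^bsub>IR\<^esub> y)" for n
 proof -
  obtain F where F: "F \<subseteq> gr" "F \<subseteq> carrier IR" "ALL x:ilay n. EX f:F. EX y:ilay 0. x = f +\<^sub>i y" using icover[of n] by blast
  have "ALL f:F. ALL \<sigma>:Aut A. \<sigma> f = f" using F(1) fixed by blast
  then show ?thesis using F(2,3) unfolding add_IR by (intro exI[of _ F] conjI)
 qed
 show "dr.cideal = dr.ccomp <+>\<^bsub>IR\<^esub> (ilay 0 <#>\<^bsub>IR\<^esub> dr.ccomp)"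
  unfolding sum_product_iff by (rule dr.cideal_fixed(1)[OF cov])
 have "type_definable L C A k dr.cideal"
  by (rule TD_type_definable[OF dr.cideal_fixed(2)[OF cov] dr.cideal_inv])
 then have b: "bounded_td_ideal L \<kappa> C A k IR dr.cideal"
  using cideal_two_sided dr.cideal_bidx by (simp add: bounded_td_ideal_def bounded_index_bidx)
 have least: "dr.cideal \<subseteq> J" if J: "bounded_td_ideal L \<kappa> C A k IR J" for J
 proof (rule cideal_least_ideal)
  show "two_sided_ideal IR J" "bounded_index \<kappa> IR J" using J by (simp_all add: bounded_td_ideal_def)
  then have "J \<subseteq> carrier IR" by (simp add: two_sided_ideal_iff dr.asub_carrier)
  then show "invariant L C A J" using type_definable_TD(2) J by (simp add: bounded_td_ideal_def ginv_invariant)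
 qed
 show "ring_comp00_exists L \<kappa> C A k IR" unfolding ring_comp00_exists_def using b least by blast
 show "ring_comp00 L \<kappa> C A k IR = dr.cideal" unfolding ring_comp00_def by (rule Least_equality) (rule b, rule least)
qed

theorem interpreted_ring_components:
 "add_comp00 L \<kappa> C A k IR <+>\<^bsub>IR\<^esub> (carrier IR <#>\<^bsub>IR\<^esub> add_comp00 L \<kappa> C A k IR) = ring_comp000 L \<kappa> C A IR \<and>
 ((ALL r:gr. set r \<subseteq> dcl L C A) -->
  ring_comp00_exists L \<kappa> C A k IR \<and>
  ring_comp00 L \<kappa> C A k IR = ring_comp000 L \<kappa> C A IR \<and>
  ring_comp000 L \<kappa> C A IR =
   add_comp00 L \<kappa> C A k IR <+>\<^bsub>IR\<^esub> (interp L M C k X <#>\<^bsub>IR\<^esub> add_comp00 L \<kappa> C A k IR))"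
 unfolding add_comp00_ccomp ring_comp000_cideal
 using sum_product_cideal fixed_case by simp

end

theorem theorem4p1:
  fixes L :: "('f, 'r) language"
    and \<kappa> :: "'k rel"
    and M C :: "('f, 'r, 'a) fo_struct"
    and k :: nat
    and S :: "'a list ring"
    and X :: "'a list set"
    and A :: "'a set"
  assumes "monster_model L \<kappa> M C"
    and "nonunital_ring S"
    and "approximate_subring S X"
    and "zero_definable_in L M k S X"
    and "A \<subseteq> univ C" and "|A| <o \<kappa>"
  shows
    "let R = generated_subring S X;
         Rbar = interp_ring L M C k S X;
         Xbar = interp L M C k X;
         H = add_comp00 L \<kappa> C A k Rbar
     in H <+>\<^bsub>Rbar\<^esub> (carrier Rbar <#>\<^bsub>Rbar\<^esub> H) = ring_comp000 L \<kappa> C A Rbar \<and>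
        ((\<forall>r\<in>R. set r \<subseteq> dcl L C A) \<longrightarrow>
           ring_comp00_exists L \<kappa> C A k Rbar \<and>
           ring_comp00 L \<kappa> C A k Rbar = ring_comp000 L \<kappa> C A Rbar \<and>
           ring_comp000 L \<kappa> C A Rbar = H <+>\<^bsub>Rbar\<^esub> (Xbar <#>\<^bsub>Rbar\<^esub> H))"
proof -
  have "elem_substructure L M C" using assms(1) by (simp add: monster_model_def)
  then have "monster_over S X L M C k \<kappa> A"
    using assms
    by (intro monster_over.intro monster_ring.intro interpreted_ring.intro approx_subring.intro
      approx_subring_axioms.intro interpreted_ring_axioms.intro monster_ring_axioms.intro monster_over_axioms.intro)
  from monster_over.interpreted_ring_components[OF this] show ?thesis unfolding Let_def .
qed

end
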